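(* Let $\mathfrak{g}$ be an $n$-Filippov algebra (with $n>2$) of dimension at least $n$ over a field $\mathfrak{K}$ of characteristic different from $2$. Then there exists a spectral sequence converging to ${}_{n}H^{rel}_{*}(\mathfrak{g})$ with $$E^2_{r,s}\cong {}_{n}HL_s(\mathfrak{g};\mathfrak{K})\otimes {}_{n}HD_r(\mathfrak{g}),\qquad r\geq 0,\ s\geq 0.$$
   Context: Tensor products are over $\mathfrak{K}$. A Leibniz $n$-algebra is a $\mathfrak{K}$-vector space $\mathfrak{g}$ with an $n$-linear operation $[-,\ldots,-]:\mathfrak{g}^{\otimes n}\to\mathfrak{g}$ satisfying $$[[x_1,\ldots,x_n],y_1,\ldots,y_{n-1}]=\sum_{i=1}^n[x_1,\ldots,x_{i-1},[x_i,y_1,\ldots,y_{n-1}],x_{i+1},\ldots,x_n].$$ It is an $n$-Filippov algebra if moreover the operation is anti-symmetric in each pair of variables (equivalently, vanishes whenever two arguments are equal). A Leibniz algebra is a Leibniz $2$-algebra. For an $n$-Filippov algebra $\mathfrak{g}$, $D_n(\mathfrak{g})=\mathfrak{g}^{\otimes(n-1)}$ is a Leibniz algebra with bracket $$[a_1\otimes\cdots\otimes a_{n-1},\,b_1\otimes\cdots\otimes b_{n-1}]=\sum_{i=1}^{n-1}a_1\otimes\cdots\otimes[a_i,b_1,\ldots,b_{n-1}]\otimes\cdots\otimes a_{n-1},$$ and $L_n(\mathfrak{g})=\mathfrak{g}^{\wedge(n-1)}$ is a Leibniz algebra with bracket given by the same formula with $\wedge$ in place of $\otimes$. A co-representation of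 a Leibniz algebra $\mathfrak{h}$ is a $\mathfrak{K}$-module $M$ with two actions $[-,-]:\mathfrak{h}\times M\to M$ (left) and $[-,-]:M\times\mathfrak{h}\to M$ (right) such that $[[x,y],m]=[x,[y,m]]-[y,[x,m]]$, $[y,[m,x]]=[[y,m],x]-[m,[x,y]]$ and $[[m,x],y]=[m,[x,y]]-[[y,m],x]$ for $x,y\in\mathfrak{h}$, $m\in M$. It is anti-symmetric when $[m,x]=0$ for all $x\in\mathfrak{h}$, $m\in M$. For a Leibniz algebra $\mathfrak{h}$ and a co-representation $A$ of $\mathfrak{h}$, $CL_*(\mathfrak{h},A)$ is the complex with $CL_k(\mathfrak{h},A)=A\otimes\mathfrak{h}^{\otimes k}$ ($k\ge 0$) and Loday boundary map $$d(v\otimes h_1\otimes\cdots\otimes h_k)=\sum_{1\le j\le k}(-1)^j[v,h_j]\otimes h_1\otimes\cdots\widehat{h_j}\cdots\otimes h_k+\sum_{1\le i<j\le k}(-1)^{j+1}v\otimes h_1\otimes\cdots\otimes h_{i-1}\otimes[h_i,h_j]\otimes\cdots\widehat{h_j}\cdots\otimes h_k;$$ its homology is $HL_*(\mathfrak{h};A)$. Co-representations used: $\mathfrak{g}$ over $D_n(\mathfrak{g})$, with left action $(x_1\otimes\cdots\otimes x_{n-1},x)\mapsto-[x,x_1,\ldots,x_{n-1}]$ and right action $(x,x_1\otimes\cdots\otimes x_{n-1})\mapsto[x,x_1,\ldots,x_{n-1}]$; $D_n(\mathfrak{g})$ as an anti-symmetric co-representation over $L_n(\mathfrak{g})$, with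 trivial right action and left action $$(a_1\wedge\cdots\wedge a_{n-1},\,b_1\otimes\cdots\otimes b_{n-1})\mapsto-\sum_{i=1}^{n-1}b_1\otimes\cdots\otimes[b_i,a_1,\ldots,a_{n-1}]\otimes\cdots\otimes b_{n-1}.$$ ${}_{n}CL_*(\mathfrak{g}):=CL_*(D_n(\mathfrak{g}),\mathfrak{g})$, and ${}_{n}HL_*(\mathfrak{g};\mathfrak{K})$ is its homology. ${}_{n}C^{rel}_*(\mathfrak{g})$ is the subcomplex of ${}_{n}CL_*(\mathfrak{g})$ given by ${}_{n}C^{rel}_k(\mathfrak{g}):=\ker[\mathfrak{g}\otimes D_n(\mathfrak{g})^{\otimes(k+1)}\to\mathfrak{g}\otimes L_n(\mathfrak{g})^{\otimes(k+1)}]$, $k\ge0$, the kernel of the canonical projection. Its homology is ${}_{n}H^{rel}_*(\mathfrak{g})$. For $k\ge0$ let $\pi_2^k:D_n(\mathfrak{g})\otimes L_n(\mathfrak{g})^{\otimes k}\to L_n(\mathfrak{g})^{\otimes(k+1)}$ be the canonical projection. ${}_{n}DR_*(\mathfrak{g})$ is the subcomplex of $CL_*(L_n(\mathfrak{g}),D_n(\mathfrak{g}))$ given by ${}_{n}DR_k(\mathfrak{g}):=\ker(\pi_2^{k+1})$. Its homology is ${}_{n}HD_*(\mathfrak{g})$.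
   Formalization: In the Loday boundary, [v,h_j] is taken as the left action [h_j,v], since with the right action d²(v⊗h_1⊗h_2)=2[v,[h_1,h_2]] is not 0; and nDR_k is ker(π_2^k) instead of ker(π_2^{k+1}), since with the latter the claim fails for the zero bracket. *)

theory Defs
  imports "HOL-Algebra.Module" "HOL-Algebra.AbelCoset"
begin

section \<open>Linear algebra over a field, in the language of HOL-Algebra modules\<close>

text \<open>
  Vector spaces over a field \<open>K\<close> are HOL-Algebra modules. The fields \<open>mult\<close> and \<open>one\<close> that
  the module record inherits from rings play no role.
\<close>

definition mod_hom ::
  "('k, 'r) ring_scheme \<Rightarrow> ('k, 'a, 'x) module_scheme \<Rightarrow> ('k, 'b, 'y) module_scheme \<Rightarrow> ('a \<Rightarrow> 'b) set"
  where "mod_hom K M N =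
    {f \<in> carrier M \<rightarrow> carrier N.
       (\<forall>x\<in>carrier M. \<forall>y\<in>carrier M. f (x \<oplus>\<^bsub>M\<^esub> y) = f x \<oplus>\<^bsub>N\<^esub> f y) \<and>
       (\<forall>c\<in>carrier K. \<forall>x\<in>carrier M. f (c \<odot>\<^bsub>M\<^esub> x) = c \<odot>\<^bsub>N\<^esub> f x)}"

definition mod_isomorphic ::
  "('k, 'r) ring_scheme \<Rightarrow> ('k, 'a, 'x) module_scheme \<Rightarrow> ('k, 'b, 'y) module_scheme \<Rightarrow> bool"
  where "mod_isomorphic K M N \<longleftrightarrow> (\<exists>f\<in>mod_hom K M N. bij_betw f (carrier M) (carrier N))"

definition quot_module :: "('k, 'a, 'x) module_scheme \<Rightarrow> 'a set \<Rightarrow> ('k, 'a set) module"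
  where "quot_module M N =
    \<lparr>carrier = a_rcosets\<^bsub>M\<^esub> N, mult = undefined, one = undefined,
     zero = N, add = (<+>\<^bsub>M\<^esub>), smult = (\<lambda>c X. \<Union>x\<in>X. N +>\<^bsub>M\<^esub> (c \<odot>\<^bsub>M\<^esub> x))\<rparr>"

definition mod_span :: "('k, 'r) ring_scheme \<Rightarrow> ('k, 'a, 'x) module_scheme \<Rightarrow> 'a set \<Rightarrow> 'a set"
  where "mod_span K M S = \<Inter>{N. submodule N K M \<and> S \<subseteq> N}"

definition tuples :: "('a, 'x) partial_object_scheme \<Rightarrow> nat \<Rightarrow> 'a list set"
  where "tuples M k = {xs. length xs = k \<and> set xs \<subseteq> carrier M}"

definition dim_at_least :: "('k, 'r) ring_scheme \<Rightarrow> ('k, 'a, 'x) module_scheme \<Rightarrow> nat \<Rightarrow> bool"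
  where "dim_at_least K M m \<longleftrightarrow>
    (\<exists>xs\<in>tuples M m. \<forall>c\<in>{..<m} \<rightarrow> carrier K.
       (\<Oplus>\<^bsub>M\<^esub>i\<in>{..<m}. c i \<odot>\<^bsub>M\<^esub> (xs ! i)) = \<zero>\<^bsub>M\<^esub> \<longrightarrow> (\<forall>i<m. c i = \<zero>\<^bsub>K\<^esub>))"

subsection \<open>Vector spaces given by generators and relations\<close>

definition free_module :: "('k, 'r) ring_scheme \<Rightarrow> 'x set \<Rightarrow> ('k, 'x \<Rightarrow> 'k) module"
  where "free_module K X =
    \<lparr>carrier = {f. (\<forall>x\<in>X. f x \<in> carrier K) \<and> (\<forall>x. x \<notin> X \<longrightarrow> f x = \<zero>\<^bsub>K\<^esub>) \<and> finite {x. f x \<noteq> \<zero>\<^bsub>K\<^esub>}},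
     mult = undefined, one = undefined,
     zero = (\<lambda>x. \<zero>\<^bsub>K\<^esub>), add = (\<lambda>f g x. f x \<oplus>\<^bsub>K\<^esub> g x), smult = (\<lambda>c f x. c \<otimes>\<^bsub>K\<^esub> f x)\<rparr>"

definition gen :: "('k, 'r) ring_scheme \<Rightarrow> 'x \<Rightarrow> 'x \<Rightarrow> 'k"
  where "gen K x = (\<lambda>y. if y = x then \<one>\<^bsub>K\<^esub> else \<zero>\<^bsub>K\<^esub>)"

definition presented :: "('k, 'r) ring_scheme \<Rightarrow> 'x set \<Rightarrow> ('x \<Rightarrow> 'k) set \<Rightarrow> ('k, ('x \<Rightarrow> 'k) set) module"
  where "presented K X S = quot_module (free_module K X) (mod_span K (free_module K X) S)"

definition gen_class :: "('k, 'r) ring_scheme \<Rightarrow> 'x set \<Rightarrow> ('x \<Rightarrow> 'k) set \<Rightarrow> 'x \<Rightarrow> ('x \<Rightarrow> 'k) set"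
  where "gen_class K X S x = mod_span K (free_module K X) S +>\<^bsub>free_module K X\<^esub> gen K x"

text \<open>
  The linear map from a presented space to \<open>N\<close> that sends the class of each generator \<open>x\<close> to
  \<open>\<phi> x\<close>. It is used only for \<open>\<phi>\<close> compatible with the relations, and then the choice of the
  representative does not matter.
\<close>

definition induced_map ::
  "('k, 'r) ring_scheme \<Rightarrow> ('k, 'b, 'y) module_scheme \<Rightarrow> ('x \<Rightarrow> 'b) \<Rightarrow> ('x \<Rightarrow> 'k) set \<Rightarrow> 'b"
  where "induced_map K N \<phi> C =
    (let f = (SOME f. f \<in> C) in \<Oplus>\<^bsub>N\<^esub>x\<in>{x. f x \<noteq> \<zero>\<^bsub>K\<^esub>}. f x \<odot>\<^bsub>N\<^esub> \<phi> x)"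

text \<open>
  The relations saying that the generator \<open>\<iota> a\<close> depends linearly on the vector \<open>a\<close> of \<open>M\<close>;
  \<open>F\<close> is the free module on all generators.
\<close>

definition linear_rels ::
  "('k, 'r) ring_scheme \<Rightarrow> ('k, 'x \<Rightarrow> 'k) module \<Rightarrow> ('k, 'a, 'm) module_scheme \<Rightarrow> ('a \<Rightarrow> 'x) \<Rightarrow> ('x \<Rightarrow> 'k) set"
  where "linear_rels K F M \<iota> =
    {gen K (\<iota> (a \<oplus>\<^bsub>M\<^esub> b)) \<ominus>\<^bsub>F\<^esub> (gen K (\<iota> a) \<oplus>\<^bsub>F\<^esub> gen K (\<iota> b)) | a b. a \<in> carrier M \<and> b \<in> carrier M} \<union>
    {gen K (\<iota> (c \<odot>\<^bsub>M\<^esub> a)) \<ominus>\<^bsub>F\<^esub> (c \<odot>\<^bsub>F\<^esub> gen K (\<iota> a)) | c a. c \<in> carrier K \<and> a \<in> carrier M}"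

subsection \<open>Tensor products and exterior powers\<close>

definition tensor ::
  "('k, 'r) ring_scheme \<Rightarrow> ('k, 'a, 'x) module_scheme \<Rightarrow> ('k, 'b, 'y) module_scheme \<Rightarrow> ('k, ('a \<times> 'b \<Rightarrow> 'k) set) module"
  where "tensor K M N =
    (let X = carrier M \<times> carrier N; F = free_module K X in
     presented K X
       ((\<Union>y\<in>carrier N. linear_rels K F M (\<lambda>x. (x, y))) \<union>
        (\<Union>x\<in>carrier M. linear_rels K F N (\<lambda>y. (x, y)))))"

definition tensor_power_rels ::
  "('k, 'r) ring_scheme \<Rightarrow> ('k, 'a, 'x) module_scheme \<Rightarrow> nat \<Rightarrow> ('a list \<Rightarrow> 'k) set"
  where "tensor_power_rels K M k =
    (\<Union>xs\<in>tuples M k. \<Union>i\<in>{..<k}. linear_rels K (free_module K (tuples M k)) M (\<lambda>a. xs[i := a]))"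

definition tensor_power ::
  "('k, 'r) ring_scheme \<Rightarrow> ('k, 'a, 'x) module_scheme \<Rightarrow> nat \<Rightarrow> ('k, ('a list \<Rightarrow> 'k) set) module"
  where "tensor_power K M k = presented K (tuples M k) (tensor_power_rels K M k)"

definition tensors ::
  "('k, 'r) ring_scheme \<Rightarrow> ('k, 'a, 'x) module_scheme \<Rightarrow> nat \<Rightarrow> 'a list \<Rightarrow> ('a list \<Rightarrow> 'k) set"
  where "tensors K M k = gen_class K (tuples M k) (tensor_power_rels K M k)"

definition ext_power_rels ::
  "('k, 'r) ring_scheme \<Rightarrow> ('k, 'a, 'x) module_scheme \<Rightarrow> nat \<Rightarrow> ('a list \<Rightarrow> 'k) set"
  where "ext_power_rels K M k =
    tensor_power_rels K M k \<union> {gen K xs | xs i j. xs \<in> tuples M k \<and> i < j \<and> j < k \<and> xs ! i = xs ! j}"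

definition ext_power ::
  "('k, 'r) ring_scheme \<Rightarrow> ('k, 'a, 'x) module_scheme \<Rightarrow> nat \<Rightarrow> ('k, ('a list \<Rightarrow> 'k) set) module"
  where "ext_power K M k = presented K (tuples M k) (ext_power_rels K M k)"

definition wedges ::
  "('k, 'r) ring_scheme \<Rightarrow> ('k, 'a, 'x) module_scheme \<Rightarrow> nat \<Rightarrow> 'a list \<Rightarrow> ('a list \<Rightarrow> 'k) set"
  where "wedges K M k = gen_class K (tuples M k) (ext_power_rels K M k)"

text \<open>
  \<open>A \<otimes> H\<^sup>\<otimes>\<^sup>k\<close>, built in one step as a \<open>(k+1)\<close>-fold tensor product: the generator
  \<open>(v, [h\<^sub>1, \<dots>, h\<^sub>k])\<close> stands for \<open>v \<otimes> h\<^sub>1 \<otimes> \<dots> \<otimes> h\<^sub>k\<close>.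
\<close>

definition mixed_gens ::
  "('a, 'x) partial_object_scheme \<Rightarrow> ('h, 'y) partial_object_scheme \<Rightarrow> nat \<Rightarrow> ('a \<times> 'h list) set"
  where "mixed_gens A H k = carrier A \<times> tuples H k"

definition mixed_rels ::
  "('k, 'r) ring_scheme \<Rightarrow> ('k, 'a, 'x) module_scheme \<Rightarrow> ('k, 'h, 'y) module_scheme \<Rightarrow> nat \<Rightarrow>
   ('a \<times> 'h list \<Rightarrow> 'k) set"
  where "mixed_rels K A H k =
    (let F = free_module K (mixed_gens A H k) in
     (\<Union>hs\<in>tuples H k. linear_rels K F A (\<lambda>v. (v, hs))) \<union>
     (\<Union>v\<in>carrier A. \<Union>hs\<in>tuples H k. \<Union>i\<in>{..<k}. linear_rels K F H (\<lambda>h. (v, hs[i := h]))))"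

definition mixed_tensor ::
  "('k, 'r) ring_scheme \<Rightarrow> ('k, 'a, 'x) module_scheme \<Rightarrow> ('k, 'h, 'y) module_scheme \<Rightarrow> nat \<Rightarrow>
   ('k, ('a \<times> 'h list \<Rightarrow> 'k) set) module"
  where "mixed_tensor K A H k = presented K (mixed_gens A H k) (mixed_rels K A H k)"

definition mixed_tensors ::
  "('k, 'r) ring_scheme \<Rightarrow> ('k, 'a, 'x) module_scheme \<Rightarrow> ('k, 'h, 'y) module_scheme \<Rightarrow> nat \<Rightarrow>
   'a \<times> 'h list \<Rightarrow> ('a \<times> 'h list \<Rightarrow> 'k) set"
  where "mixed_tensors K A H k = gen_class K (mixed_gens A H k) (mixed_rels K A H k)"


section \<open>Leibniz n-algebras and co-representations\<close>

record ('k, 'a) nalg = "('k, 'a) module" +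
  bracket :: "'a list \<Rightarrow> 'a"

locale leibniz_n_algebra = module K \<gg> for K (structure) and \<gg> (structure) and n :: nat +
  assumes bracket_closed: "xs \<in> tuples \<gg> n \<Longrightarrow> bracket \<gg> xs \<in> carrier \<gg>"
    and bracket_add: "\<lbrakk>xs \<in> tuples \<gg> n; i < n; a \<in> carrier \<gg>; b \<in> carrier \<gg>\<rbrakk> \<Longrightarrow>
      bracket \<gg> (xs[i := a \<oplus>\<^bsub>\<gg>\<^esub> b]) = bracket \<gg> (xs[i := a]) \<oplus>\<^bsub>\<gg>\<^esub> bracket \<gg> (xs[i := b])"
    and bracket_smult: "\<lbrakk>xs \<in> tuples \<gg> n; i < n; c \<in> carrier K; a \<in> carrier \<gg>\<rbrakk> \<Longrightarrow>
      bracket \<gg> (xs[i := c \<odot>\<^bsub>\<gg>\<^esub> a]) = c \<odot>\<^bsub>\<gg>\<^esub> bracket \<gg> (xs[i := a])"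
    and leibniz_identity: "\<lbrakk>xs \<in> tuples \<gg> n; ys \<in> tuples \<gg> (n - 1)\<rbrakk> \<Longrightarrow>
      bracket \<gg> (bracket \<gg> xs # ys) =
        (\<Oplus>\<^bsub>\<gg>\<^esub>i\<in>{..<n}. bracket \<gg> (xs[i := bracket \<gg> ((xs ! i) # ys)]))"

locale filippov_algebra = leibniz_n_algebra +
  assumes antisym: "\<lbrakk>xs \<in> tuples \<gg> n; i < j; j < n\<rbrakk> \<Longrightarrow>
      bracket \<gg> (xs[i := xs ! j, j := xs ! i]) = \<ominus>\<^bsub>\<gg>\<^esub> bracket \<gg> xs"

text \<open>A Leibniz algebra is a Leibniz 2-algebra; its bracket is \<open>bracket H [x, y]\<close>.\<close>

record ('k, 'a, 'h) corep = "('k, 'a) module" +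
  lact :: "'h \<Rightarrow> 'a \<Rightarrow> 'a"
  ract :: "'a \<Rightarrow> 'h \<Rightarrow> 'a"

locale corepresentation = H: leibniz_n_algebra K H 2 + A: module K A
  for K (structure) and H (structure) and A (structure) +
  assumes lact_closed: "\<lbrakk>x \<in> carrier H; m \<in> carrier A\<rbrakk> \<Longrightarrow> lact A x m \<in> carrier A"
    and ract_closed: "\<lbrakk>x \<in> carrier H; m \<in> carrier A\<rbrakk> \<Longrightarrow> ract A m x \<in> carrier A"
    and lact_linear: "x \<in> carrier H \<Longrightarrow> lact A x \<in> mod_hom K A A"
      "m \<in> carrier A \<Longrightarrow> (\<lambda>x. lact A x m) \<in> mod_hom K H A"
    and ract_linear: "m \<in> carrier A \<Longrightarrow> ract A m \<in> mod_hom K H A"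
      "x \<in> carrier H \<Longrightarrow> (\<lambda>m. ract A m x) \<in> mod_hom K A A"
    and corep1: "\<lbrakk>x \<in> carrier H; y \<in> carrier H; m \<in> carrier A\<rbrakk> \<Longrightarrow>
      lact A (bracket H [x, y]) m = lact A x (lact A y m) \<ominus>\<^bsub>A\<^esub> lact A y (lact A x m)"
    and corep2: "\<lbrakk>x \<in> carrier H; y \<in> carrier H; m \<in> carrier A\<rbrakk> \<Longrightarrow>
      lact A y (ract A m x) = ract A (lact A y m) x \<ominus>\<^bsub>A\<^esub> ract A m (bracket H [x, y])"
    and corep3: "\<lbrakk>x \<in> carrier H; y \<in> carrier H; m \<in> carrier A\<rbrakk> \<Longrightarrow>
      ract A (ract A m x) y = ract A m (bracket H [x, y]) \<ominus>\<^bsub>A\<^esub> ract A (lact A y m) x"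

definition with_bracket :: "('k, 'a, 'x) module_scheme \<Rightarrow> ('a list \<Rightarrow> 'a) \<Rightarrow> ('k, 'a) nalg"
  where "with_bracket M b =
    \<lparr>carrier = carrier M, mult = mult M, one = one M, zero = zero M, add = add M, smult = smult M,
     bracket = b\<rparr>"

definition with_actions ::
  "('k, 'a, 'x) module_scheme \<Rightarrow> ('h \<Rightarrow> 'a \<Rightarrow> 'a) \<Rightarrow> ('a \<Rightarrow> 'h \<Rightarrow> 'a) \<Rightarrow> ('k, 'a, 'h) corep"
  where "with_actions M l r =
    \<lparr>carrier = carrier M, mult = mult M, one = one M, zero = zero M, add = add M, smult = smult M,
     lact = l, ract = r\<rparr>"

subsection \<open>The Leibniz algebras of an n-Filippov algebra\<close>

text \<open>
  The bilinear map sending \<open>\<tau> [a\<^sub>1, \<dots>, a\<^sub>n\<^sub>-\<^sub>1]\<close> and a product of \<open>b\<^sub>1, \<dots>, b\<^sub>n\<^sub>-\<^sub>1\<close> to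
  \<open>\<Sum>\<^sub>i \<tau> [a\<^sub>1, \<dots>, [a\<^sub>i, b\<^sub>1, \<dots>, b\<^sub>n\<^sub>-\<^sub>1], \<dots>, a\<^sub>n\<^sub>-\<^sub>1]\<close>. The first argument lies in \<open>P\<close>, where
  \<open>\<tau>\<close> is the tensor or the wedge product; the second lies in a tensor or an exterior power.
\<close>

definition derivation_action ::
  "('k, 'r) ring_scheme \<Rightarrow> nat \<Rightarrow> ('k, 'a, 'x) nalg_scheme \<Rightarrow> ('k, ('a list \<Rightarrow> 'k) set) module \<Rightarrow>
   ('a list \<Rightarrow> ('a list \<Rightarrow> 'k) set) \<Rightarrow> ('a list \<Rightarrow> 'k) set \<Rightarrow> ('a list \<Rightarrow> 'k) set \<Rightarrow> ('a list \<Rightarrow> 'k) set"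
  where "derivation_action K n \<gg> P \<tau> X Y =
    induced_map K P (\<lambda>bs. induced_map K P
      (\<lambda>as. \<Oplus>\<^bsub>P\<^esub>i\<in>{..<n - 1}. \<tau> (as[i := bracket \<gg> ((as ! i) # bs)])) X) Y"

definition D_alg ::
  "('k, 'r) ring_scheme \<Rightarrow> nat \<Rightarrow> ('k, 'a, 'x) nalg_scheme \<Rightarrow> ('k, ('a list \<Rightarrow> 'k) set) nalg"
  where "D_alg K n \<gg> =
    (let P = tensor_power K \<gg> (n - 1) in
     with_bracket P
       (\<lambda>zs. derivation_action K n \<gg> P (tensors K \<gg> (n - 1)) (zs ! 0) (zs ! 1)))"

definition L_alg ::
  "('k, 'r) ring_scheme \<Rightarrow> nat \<Rightarrow> ('k, 'a, 'x) nalg_scheme \<Rightarrow> ('k, ('a list \<Rightarrow> 'k) set) nalg"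
  where "L_alg K n \<gg> =
    (let P = ext_power K \<gg> (n - 1) in
     with_bracket P
       (\<lambda>zs. derivation_action K n \<gg> P (wedges K \<gg> (n - 1)) (zs ! 0) (zs ! 1)))"

definition D_to_L ::
  "('k, 'r) ring_scheme \<Rightarrow> nat \<Rightarrow> ('k, 'a, 'x) nalg_scheme \<Rightarrow> ('a list \<Rightarrow> 'k) set \<Rightarrow> ('a list \<Rightarrow> 'k) set"
  where "D_to_L K n \<gg> = induced_map K (L_alg K n \<gg>) (wedges K \<gg> (n - 1))"

definition g_corep ::
  "('k, 'r) ring_scheme \<Rightarrow> ('k, 'a, 'x) nalg_scheme \<Rightarrow> ('k, 'a, ('a list \<Rightarrow> 'k) set) corep"
  where "g_corep K \<gg> =
    (let right = (\<lambda>x. induced_map K \<gg> (\<lambda>xs. bracket \<gg> (x # xs))) in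
     with_actions \<gg> (\<lambda>Y x. \<ominus>\<^bsub>\<gg>\<^esub> right x Y) right)"

definition D_corep ::
  "('k, 'r) ring_scheme \<Rightarrow> nat \<Rightarrow> ('k, 'a, 'x) nalg_scheme \<Rightarrow>
   ('k, ('a list \<Rightarrow> 'k) set, ('a list \<Rightarrow> 'k) set) corep"
  where "D_corep K n \<gg> =
    (let P = tensor_power K \<gg> (n - 1) in
     with_actions P
       (\<lambda>Y X. \<ominus>\<^bsub>P\<^esub> derivation_action K n \<gg> P (tensors K \<gg> (n - 1)) X Y)
       (\<lambda>X Y. \<zero>\<^bsub>P\<^esub>))"


section \<open>Complexes and homology\<close>

text \<open>Complexes are concentrated in degrees \<open>k \<ge> 0\<close>, with \<open>d k\<close> leaving degree \<open>k\<close>; \<open>d 0\<close> is ignored.\<close>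

definition cycles :: "(nat \<Rightarrow> ('k, 'a, 'x) module_scheme) \<Rightarrow> (nat \<Rightarrow> 'a \<Rightarrow> 'a) \<Rightarrow> nat \<Rightarrow> 'a set"
  where "cycles C d k = {c \<in> carrier (C k). k = 0 \<or> d k c = \<zero>\<^bsub>C (k - 1)\<^esub>}"

definition homology ::
  "(nat \<Rightarrow> ('k, 'a, 'x) module_scheme) \<Rightarrow> (nat \<Rightarrow> 'a \<Rightarrow> 'a) \<Rightarrow> nat \<Rightarrow> ('k, 'a set) module"
  where "homology C d k =
    quot_module ((C k)\<lparr>carrier := cycles C d k\<rparr>) (d (Suc k) ` carrier (C (Suc k)))"

definition sgn_in :: "('k, 'r) ring_scheme \<Rightarrow> nat \<Rightarrow> 'k"
  where "sgn_in K j = (\<ominus>\<^bsub>K\<^esub> \<one>\<^bsub>K\<^esub>) [^]\<^bsub>K\<^esub> j"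

definition del :: "nat \<Rightarrow> 'a list \<Rightarrow> 'a list"
  where "del j xs = take j xs @ drop (Suc j) xs"

text \<open>
  The Loday boundary on \<open>A \<otimes> H\<^sup>\<otimes>\<^sup>k\<close> for \<open>k \<ge> 1\<close>,
  \[ v \otimes h_1 \otimes \cdots \otimes h_k \mapsto
     \sum_j (-1)^j [h_j, v] \otimes h_1 \otimes \cdots \widehat{h_j} \cdots \otimes h_k
     + \sum_{i<j} (-1)^{j+1} v \otimes h_1 \otimes \cdots \otimes [h_i, h_j] \otimes
       \cdots \widehat{h_j} \cdots \otimes h_k, \]
  with positions counted from 0 below, which shifts the signs by one. The coefficient terms use
  the left action. With these signs the square vanishes by the first co-representation axiom. With
  the right action instead it does not vanish: for \<open>\<gg>\<close> over \<open>D\<^sub>n(\<gg>)\<close> it would send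
  \<open>v \<otimes> h\<^sub>1 \<otimes> h\<^sub>2\<close> to \<open>2 [v, [h\<^sub>1, h\<^sub>2]]\<close>.
\<close>

definition loday_boundary ::
  "('k, 'r) ring_scheme \<Rightarrow> ('k, 'h, 'y) nalg_scheme \<Rightarrow> ('k, 'a, 'h, 'x) corep_scheme \<Rightarrow> nat \<Rightarrow>
   ('a \<times> 'h list \<Rightarrow> 'k) set \<Rightarrow> ('a \<times> 'h list \<Rightarrow> 'k) set"
  where "loday_boundary K H A k =
    (let T = mixed_tensor K A H (k - 1); t = mixed_tensors K A H (k - 1) in
     induced_map K T (\<lambda>(v, hs).
       (\<Oplus>\<^bsub>T\<^esub>j\<in>{..<k}. sgn_in K (j + 1) \<odot>\<^bsub>T\<^esub> t (lact A (hs ! j) v, del j hs)) \<oplus>\<^bsub>T\<^esub>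
       (\<Oplus>\<^bsub>T\<^esub>j\<in>{..<k}. \<Oplus>\<^bsub>T\<^esub>i\<in>{..<j}.
          sgn_in K j \<odot>\<^bsub>T\<^esub> t (v, del j (hs[i := bracket H [hs ! i, hs ! j]])))))"

abbreviation CL ::
  "('k, 'r) ring_scheme \<Rightarrow> ('k, 'h, 'y) nalg_scheme \<Rightarrow> ('k, 'a, 'h, 'x) corep_scheme \<Rightarrow> nat \<Rightarrow>
   ('k, ('a \<times> 'h list \<Rightarrow> 'k) set) module"
  where "CL K H A k \<equiv> mixed_tensor K A H k"

definition HL ::
  "('k, 'r) ring_scheme \<Rightarrow> ('k, 'h, 'y) nalg_scheme \<Rightarrow> ('k, 'a, 'h, 'x) corep_scheme \<Rightarrow> nat \<Rightarrow>
   ('k, ('a \<times> 'h list \<Rightarrow> 'k) set set) module"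
  where "HL K H A = homology (CL K H A) (loday_boundary K H A)"

text \<open>\<open>\<^sub>nHL\<^sub>*(\<gg>; K)\<close>\<close>

definition nHL ::
  "('k, 'r) ring_scheme \<Rightarrow> nat \<Rightarrow> ('k, 'a, 'x) nalg_scheme \<Rightarrow> nat \<Rightarrow>
   ('k, ('a \<times> ('a list \<Rightarrow> 'k) set list \<Rightarrow> 'k) set set) module"
  where "nHL K n \<gg> = HL K (D_alg K n \<gg>) (g_corep K \<gg>)"

subsection \<open>The relative complex\<close>

definition proj_gD ::
  "('k, 'r) ring_scheme \<Rightarrow> nat \<Rightarrow> ('k, 'a, 'x) nalg_scheme \<Rightarrow> nat \<Rightarrow>
   ('a \<times> ('a list \<Rightarrow> 'k) set list \<Rightarrow> 'k) set \<Rightarrow> ('a \<times> ('a list \<Rightarrow> 'k) set list \<Rightarrow> 'k) set"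
  where "proj_gD K n \<gg> m =
    induced_map K (mixed_tensor K \<gg> (L_alg K n \<gg>) m)
      (\<lambda>(x, hs). mixed_tensors K \<gg> (L_alg K n \<gg>) m (x, map (D_to_L K n \<gg>) hs))"

text \<open>Degree \<open>k\<close> of the relative complex sits inside degree \<open>k + 1\<close> of \<open>CL\<^sub>*(D\<^sub>n(\<gg>), \<gg>)\<close>.\<close>

definition C_rel ::
  "('k, 'r) ring_scheme \<Rightarrow> nat \<Rightarrow> ('k, 'a, 'x) nalg_scheme \<Rightarrow> nat \<Rightarrow>
   ('k, ('a \<times> ('a list \<Rightarrow> 'k) set list \<Rightarrow> 'k) set) module"
  where "C_rel K n \<gg> k =
    (let C = CL K (D_alg K n \<gg>) (g_corep K \<gg>) (k + 1) in
     C\<lparr>carrier := {c \<in> carrier C. proj_gD K n \<gg> (k + 1) c = \<zero>\<^bsub>mixed_tensor K \<gg> (L_alg K n \<gg>) (k + 1)\<^esub>}\<rparr>)"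

definition H_rel ::
  "('k, 'r) ring_scheme \<Rightarrow> nat \<Rightarrow> ('k, 'a, 'x) nalg_scheme \<Rightarrow> nat \<Rightarrow>
   ('k, ('a \<times> ('a list \<Rightarrow> 'k) set list \<Rightarrow> 'k) set set) module"
  where "H_rel K n \<gg> =
    homology (C_rel K n \<gg>) (\<lambda>k. loday_boundary K (D_alg K n \<gg>) (g_corep K \<gg>) (k + 1))"

subsection \<open>The complex DR\<close>

definition pi2 ::
  "('k, 'r) ring_scheme \<Rightarrow> nat \<Rightarrow> ('k, 'a, 'x) nalg_scheme \<Rightarrow> nat \<Rightarrow>
   (('a list \<Rightarrow> 'k) set \<times> ('a list \<Rightarrow> 'k) set list \<Rightarrow> 'k) set \<Rightarrow> (('a list \<Rightarrow> 'k) set list \<Rightarrow> 'k) set"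
  where "pi2 K n \<gg> k =
    induced_map K (tensor_power K (L_alg K n \<gg>) (k + 1))
      (\<lambda>(X, hs). tensors K (L_alg K n \<gg>) (k + 1) (D_to_L K n \<gg> X # hs))"

text \<open>
  Degree \<open>k\<close> is the kernel of \<open>D\<^sub>n(\<gg>) \<otimes> L\<^sub>n(\<gg>)\<^sup>\<otimes>\<^sup>k \<rightarrow> L\<^sub>n(\<gg>)\<^sup>\<otimes>\<^sup>(\<^sup>k\<^sup>+\<^sup>1\<^sup>)\<close>, the part of the
  kernel that lies in degree \<open>k\<close> of \<open>CL\<^sub>*(L\<^sub>n(\<gg>), D\<^sub>n(\<gg>))\<close>. Unlike for \<open>n = 2\<close>, it is nonzero
  in degree 0 for \<open>n > 2\<close>, so the complex must start there.
\<close>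

definition DR ::
  "('k, 'r) ring_scheme \<Rightarrow> nat \<Rightarrow> ('k, 'a, 'x) nalg_scheme \<Rightarrow> nat \<Rightarrow>
   ('k, (('a list \<Rightarrow> 'k) set \<times> ('a list \<Rightarrow> 'k) set list \<Rightarrow> 'k) set) module"
  where "DR K n \<gg> k =
    (let C = CL K (L_alg K n \<gg>) (D_corep K n \<gg>) k in
     C\<lparr>carrier := {c \<in> carrier C. pi2 K n \<gg> k c = \<zero>\<^bsub>tensor_power K (L_alg K n \<gg>) (k + 1)\<^esub>}\<rparr>)"

definition HD ::
  "('k, 'r) ring_scheme \<Rightarrow> nat \<Rightarrow> ('k, 'a, 'x) nalg_scheme \<Rightarrow> nat \<Rightarrow>
   ('k, (('a list \<Rightarrow> 'k) set \<times> ('a list \<Rightarrow> 'k) set list \<Rightarrow> 'k) set set) module"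
  where "HD K n \<gg> = homology (DR K n \<gg>) (loday_boundary K (L_alg K n \<gg>) (D_corep K n \<gg>))"


section \<open>Spectral sequences\<close>

text \<open>
  First-quadrant homological spectral sequences \<open>E\<^sup>r\<^sub>p\<^sub>q\<close>, \<open>r \<ge> 2\<close>, with differentials
  \<open>d r p q\<close> from \<open>E\<^sup>r\<^sub>p\<^sub>q\<close> to \<open>E\<^sup>r\<close> at \<open>(p - r, q + r - 1)\<close>.
\<close>

locale spectral_sequence =
  fixes K :: "('k, 'r) ring_scheme"
    and E :: "nat \<Rightarrow> int \<Rightarrow> int \<Rightarrow> ('k, 'a) module"
    and d :: "nat \<Rightarrow> int \<Rightarrow> int \<Rightarrow> 'a \<Rightarrow> 'a"
  assumes page_module: "2 \<le> r \<Longrightarrow> module K (E r p q)"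
    and first_quadrant: "\<lbrakk>2 \<le> r; p < 0 \<or> q < 0\<rbrakk> \<Longrightarrow> carrier (E r p q) = {\<zero>\<^bsub>E r p q\<^esub>}"
    and differential_hom:
      "2 \<le> r \<Longrightarrow> d r p q \<in> mod_hom K (E r p q) (E r (p - int r) (q + int r - 1))"
    and differential_square: "\<lbrakk>2 \<le> r; x \<in> carrier (E r p q)\<rbrakk> \<Longrightarrow>
      d r (p - int r) (q + int r - 1) (d r p q x) =
        \<zero>\<^bsub>E r (p - 2 * int r) (q + 2 * int r - 2)\<^esub>"
    and next_page: "2 \<le> r \<Longrightarrow>
      mod_isomorphic K
        (quot_module
          ((E r p q)\<lparr>carrier := {x \<in> carrier (E r p q). d r p q x = \<zero>\<^bsub>E r (p - int r) (q + int r - 1)\<^esub>}\<rparr>)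
          (d r (p + int r) (q - int r + 1) ` carrier (E r (p + int r) (q - int r + 1))))
        (E (Suc r) p q)"

text \<open>
  Convergence to \<open>H\<^sub>*\<close>: each \<open>H\<^sub>m\<close> carries an increasing filtration with \<open>F\<^sub>-\<^sub>1 = 0\<close>,
  \<open>F\<^sub>m = H\<^sub>m\<close> and \<open>F\<^sub>p / F\<^sub>p\<^sub>-\<^sub>1\<close> isomorphic to \<open>E\<^sup>\<infinity>\<close> at \<open>(p, m - p)\<close>. In the first
  quadrant \<open>E\<^sup>\<infinity>\<^sub>p\<^sub>q\<close> is the common value of \<open>E\<^sup>r\<^sub>p\<^sub>q\<close> for \<open>r > max p (q + 1)\<close>.
\<close>

definition ss_converges ::
  "('k, 'r) ring_scheme \<Rightarrow> (nat \<Rightarrow> int \<Rightarrow> int \<Rightarrow> ('k, 'a) module) \<Rightarrow> (nat \<Rightarrow> ('k, 'b) module) \<Rightarrow> bool"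
  where "ss_converges K E H \<longleftrightarrow>
    (\<exists>F :: nat \<Rightarrow> int \<Rightarrow> 'b set. \<forall>m.
       (\<forall>p. submodule (F m p) K (H m)) \<and>
       (\<forall>p. F m (p - 1) \<subseteq> F m p) \<and>
       (\<forall>p<0. F m p = {\<zero>\<^bsub>H m\<^esub>}) \<and>
       (\<forall>p\<ge>int m. F m p = carrier (H m)) \<and>
       (\<forall>p r. 0 \<le> p \<and> p \<le> int m \<and> int r > max p (int m - p + 1) \<longrightarrow>
          mod_isomorphic K (quot_module ((H m)\<lparr>carrier := F m p\<rparr>) (F m (p - 1))) (E r p (int m - p))))"

end

theory Submission
  imports Defs
begin

text \<open>
  Filter \<open>\<gg> \<otimes> D\<^sub>n(\<gg>)\<^sup>\<otimes>\<^sup>k\<close> by the kernels of the projections that replace the last \<open>p + 1\<close> factors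
  \<open>D\<^sub>n(\<gg>)\<close> by \<open>L\<^sub>n(\<gg>)\<close>. This is a filtration by subcomplexes because the kernel of \<open>D\<^sub>n(\<gg>) \<rightarrow> L\<^sub>n(\<gg>)\<close> is an ideal
  that acts trivially from the right, and the relative complex is its top step in each degree. In filtration
  degree \<open>p\<close> the associated graded complex is the head complex \<open>\<gg> \<otimes> D\<^sub>n(\<gg>)\<^sup>\<otimes>\<^sup>q\<close> tensored with \<open>DR\<^sub>p\<close>, where the
  first tail factor plays the role of the coefficients. The tail acts on the homology of the head, but this
  action is trivial: the action of \<open>h\<close> on a cycle \<open>z\<close> is up to sign the boundary of \<open>z \<otimes> h\<close>. Hence the
  differential of the first page is that of the tails, and over a field splittings of the head and the tail
  complexes onto their homology identify the second page.
\<close>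

section \<open>Linear maps\<close>

text \<open>A linear section \<open>\<sigma>\<close> of the projection \<open>\<pi>\<close> turns it
  into an idempotent \<open>e\<close> of \<open>D\<close>, so that every filtration step is the
  kernel of an operator \<open>P k j\<close> on one fixed space. As \<open>\<sigma>\<close> is only
  linear, \<open>e\<close> is not known to respect brackets; what survives is that its kernel is an
  ideal, and compatibility with an operator f takes the one-sided form P f P = P f. The first page
  is never formed. One linear map \<open>\<Theta>\<close> from the cycles of the second page to the
  tensor product of the two homologies is shown to be onto, with exactly the relations of that page
  as kernel. The obstacle is that tail factors act on the head. If the head is a cycle, these terms
  add up to a head boundary (d \<otimes> 1) (Y x), and \<open>Y\<close> lowers the filtration by one
  step; subtracting Y x therefore repairs representatives without changing their value under
  \<open>\<Theta>\<close>. Characteristic different from 2 enters through one implication, from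
  antisymmetry to vanishing on equal arguments, by which the bracket descends to exterior
  powers.\<close>

lemma mod_hom_closed: "f \<in> mod_hom K M N \<Longrightarrow> x \<in> carrier M \<Longrightarrow> f x \<in> carrier N"
  by (auto simp: mod_hom_def)

lemma mod_hom_add:
  "f \<in> mod_hom K M N \<Longrightarrow> x \<in> carrier M \<Longrightarrow> y \<in> carrier M \<Longrightarrow> f (x \<oplus>\<^bsub>M\<^esub> y) = f x \<oplus>\<^bsub>N\<^esub> f y"
  by (auto simp: mod_hom_def)

lemma mod_hom_smult:
  "f \<in> mod_hom K M N \<Longrightarrow> c \<in> carrier K \<Longrightarrow> x \<in> carrier M \<Longrightarrow> f (c \<odot>\<^bsub>M\<^esub> x) = c \<odot>\<^bsub>N\<^esub> f x"
  by (auto simp: mod_hom_def)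

lemma mod_homI:
  assumes "\<And>x. x \<in> carrier M \<Longrightarrow> f x \<in> carrier N"
    and "\<And>x y. \<lbrakk>x \<in> carrier M; y \<in> carrier M\<rbrakk> \<Longrightarrow> f (x \<oplus>\<^bsub>M\<^esub> y) = f x \<oplus>\<^bsub>N\<^esub> f y"
    and "\<And>c x. \<lbrakk>c \<in> carrier K; x \<in> carrier M\<rbrakk> \<Longrightarrow> f (c \<odot>\<^bsub>M\<^esub> x) = c \<odot>\<^bsub>N\<^esub> f x"
  shows "f \<in> mod_hom K M N"
  using assms by (auto simp: mod_hom_def)

lemma mod_hom_zero:
  assumes "module K M" "module K N" "f \<in> mod_hom K M N"
  shows "f \<zero>\<^bsub>M\<^esub> = \<zero>\<^bsub>N\<^esub>"
proof -
  interpret M: module K M by fact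
  interpret N: module K N by fact
  have "f \<zero>\<^bsub>M\<^esub> = f (\<zero>\<^bsub>K\<^esub> \<odot>\<^bsub>M\<^esub> \<zero>\<^bsub>M\<^esub>)" by simp
  also have "\<dots> = \<zero>\<^bsub>K\<^esub> \<odot>\<^bsub>N\<^esub> f \<zero>\<^bsub>M\<^esub>"
    by (rule mod_hom_smult[OF assms(3)]) auto
  finally show ?thesis using mod_hom_closed[OF assms(3), of "\<zero>\<^bsub>M\<^esub>"] by simp
qed

lemma mod_hom_neg:
  assumes "module K M" "module K N" "f \<in> mod_hom K M N" "x \<in> carrier M"
  shows "f (\<ominus>\<^bsub>M\<^esub> x) = \<ominus>\<^bsub>N\<^esub> f x"
proof -
  interpret M: module K M by fact
  interpret N: module K N by fact
  have "f (\<ominus>\<^bsub>M\<^esub> x) = f (\<ominus>\<^bsub>K\<^esub> \<one>\<^bsub>K\<^esub> \<odot>\<^bsub>M\<^esub> x)"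
    using assms(4) by (simp add: M.smult_l_minus)
  also have "\<dots> = \<ominus>\<^bsub>K\<^esub> \<one>\<^bsub>K\<^esub> \<odot>\<^bsub>N\<^esub> f x"
    using assms by (intro mod_hom_smult) auto
  finally show ?thesis using mod_hom_closed[OF assms(3,4)] by (simp add: N.smult_l_minus)
qed

lemma mod_hom_minus:
  assumes "module K M" "module K N" "f \<in> mod_hom K M N" "x \<in> carrier M" "y \<in> carrier M"
  shows "f (x \<ominus>\<^bsub>M\<^esub> y) = f x \<ominus>\<^bsub>N\<^esub> f y"
proof -
  interpret M: module K M by fact
  show ?thesis unfolding a_minus_def
    using assms mod_hom_neg[OF assms(1-3,5)] by (simp add: mod_hom_add[OF assms(3)])
qed

lemma mod_hom_finsum:
  assumes "module K M" "module K N" "f \<in> mod_hom K M N" "g \<in> I \<rightarrow> carrier M"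
  shows "f (\<Oplus>\<^bsub>M\<^esub>i\<in>I. g i) = (\<Oplus>\<^bsub>N\<^esub>i\<in>I. f (g i))"
proof -
  interpret M: module K M by fact
  interpret N: module K N by fact
  show ?thesis
  proof (cases "finite I")
    case True
    then show ?thesis using assms(4)
    proof (induction I)
      case empty
      then show ?case using mod_hom_zero[OF assms(1-3)] by simp
    next
      case (insert x F)
      then have "g \<in> F \<rightarrow> carrier M" "g x \<in> carrier M" by auto
      then show ?case using insert mod_hom_closed[OF assms(3)]
        by (simp add: Pi_iff mod_hom_add[OF assms(3)])
    qed
  next
    case False
    then show ?thesis
      using mod_hom_zero[OF assms(1-3)] by simp
  qed
qed

lemma mod_hom_comp:
  "g \<in> mod_hom K N P \<Longrightarrow> f \<in> mod_hom K M N \<Longrightarrow> (\<lambda>x. g (f x)) \<in> mod_hom K M P"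
  by (auto simp: mod_hom_def Pi_iff)

lemma mod_hom_id: "(\<lambda>x. x) \<in> mod_hom K M M"
  by (auto simp: mod_hom_def)

lemma mod_hom_zerof: "module K N \<Longrightarrow> (\<lambda>x. \<zero>\<^bsub>N\<^esub>) \<in> mod_hom K M N"
proof -
  assume "module K N"
  then interpret N: module K N .
  show ?thesis by (auto simp: mod_hom_def)
qed

lemma mod_hom_addf:
  assumes "module K N" "f \<in> mod_hom K M N" "g \<in> mod_hom K M N"
  shows "(\<lambda>x. f x \<oplus>\<^bsub>N\<^esub> g x) \<in> mod_hom K M N"
proof -
  interpret N: module K N by fact
  show ?thesis using assms(2,3) by (auto simp: mod_hom_def Pi_iff N.smult_r_distr N.a_ac)
qed

lemma mod_hom_smultf:
  assumes "module K N" "f \<in> mod_hom K M N" "c \<in> carrier K"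
  shows "(\<lambda>x. c \<odot>\<^bsub>N\<^esub> f x) \<in> mod_hom K M N"
proof -
  interpret N: module K N by fact
  have *: "c \<odot>\<^bsub>N\<^esub> (a \<odot>\<^bsub>N\<^esub> y) = a \<odot>\<^bsub>N\<^esub> (c \<odot>\<^bsub>N\<^esub> y)" if "a \<in> carrier K" "y \<in> carrier N" for a y
    using that assms(3) by (simp flip: N.smult_assoc1 add: N.R.m_comm)
  show ?thesis using assms(2,3) by (auto simp: mod_hom_def Pi_iff N.smult_r_distr *)
qed

lemma mod_hom_negf:
  assumes "module K N" "f \<in> mod_hom K M N"
  shows "(\<lambda>x. \<ominus>\<^bsub>N\<^esub> f x) \<in> mod_hom K M N"
proof -
  interpret N: module K N by fact
  show ?thesis using assms(2)
    by (auto simp: mod_hom_def Pi_iff N.minus_add N.a_ac N.smult_r_minus)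
qed

lemma mod_hom_minusf:
  assumes "module K N" "f \<in> mod_hom K M N" "g \<in> mod_hom K M N"
  shows "(\<lambda>x. f x \<ominus>\<^bsub>N\<^esub> g x) \<in> mod_hom K M N"
  unfolding a_minus_def by (intro mod_hom_addf mod_hom_negf assms)

lemma mod_hom_cong:
  assumes "module K M" "f \<in> mod_hom K M N" "\<And>x. x \<in> carrier M \<Longrightarrow> g x = f x"
  shows "g \<in> mod_hom K M N"
proof -
  interpret M: module K M by fact
  show ?thesis using assms(2,3) by (auto simp: mod_hom_def Pi_iff)
qed

lemma mod_hom_finsumf:
  assumes "module K M" "module K N" "\<And>i. i \<in> I \<Longrightarrow> f i \<in> mod_hom K M N"
  shows "(\<lambda>x. \<Oplus>\<^bsub>N\<^esub>i\<in>I. f i x) \<in> mod_hom K M N"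
proof -
  interpret N: module K N by fact
  show ?thesis
  proof (cases "finite I")
    case True
    then show ?thesis using assms(3)
    proof (induction I)
      case empty
      show ?case using mod_hom_zerof[OF assms(2)] by simp
    next
      case (insert j F)
      have "(\<lambda>x. f j x \<oplus>\<^bsub>N\<^esub> (\<Oplus>\<^bsub>N\<^esub>i\<in>F. f i x)) \<in> mod_hom K M N"
        using insert by (intro mod_hom_addf assms(2)) auto
      moreover have "(\<Oplus>\<^bsub>N\<^esub>i\<in>insert j F. f i x) = f j x \<oplus>\<^bsub>N\<^esub> (\<Oplus>\<^bsub>N\<^esub>i\<in>F. f i x)"
        if "x \<in> carrier M" for x
        using insert that by (subst N.finsum_insert) (auto intro: mod_hom_closed)
      ultimately show ?case by (rule mod_hom_cong[OF assms(1)])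
    qed
  next
    case False
    then show ?thesis using mod_hom_zerof[OF assms(2)] by simp
  qed
qed

section \<open>Submodules and quotients\<close>

lemma (in abelian_group) minus_eq_zero_iff:
  assumes "x \<in> carrier G" "y \<in> carrier G"
  shows "x \<ominus> y = \<zero> \<longleftrightarrow> x = y"
  using assms by (metis a_minus_def add.inv_closed add.inv_inv minus_equality r_neg)

text \<open>\<open>Q\<close> is not assumed to be a group or a module: every axiom is pulled back
  along the surjection \<open>f\<close>. Coset maps use this for quotient modules, the identity map
  for records that differ only in their extra fields.\<close>

lemma module_image:
  assumes "module K M"
    and "f ` carrier M = carrier Q"
    and "\<And>x y. \<lbrakk>x \<in> carrier M; y \<in> carrier M\<rbrakk> \<Longrightarrow> f (x \<oplus>\<^bsub>M\<^esub> y) = f x \<oplus>\<^bsub>Q\<^esub> f y"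
    and "\<And>c x. \<lbrakk>c \<in> carrier K; x \<in> carrier M\<rbrakk> \<Longrightarrow> f (c \<odot>\<^bsub>M\<^esub> x) = c \<odot>\<^bsub>Q\<^esub> f x"
    and "f \<zero>\<^bsub>M\<^esub> = \<zero>\<^bsub>Q\<^esub>"
  shows "module K Q"
proof -
  interpret M: module K M by fact
  have ex: "\<exists>a\<in>carrier M. f a = x" if "x \<in> carrier Q" for x
    using that assms(2) by (metis imageE)
  note eqs = assms(3,4)[symmetric] assms(5)[symmetric]
  have cl: "f a \<in> carrier Q" if "a \<in> carrier M" for a
    using that assms(2) by auto
  show ?thesis
  proof (rule moduleI)
    show "cring K" by (rule M.R.is_cring)
    show "abelian_group Q"
    proof (rule abelian_groupI)
      show "\<exists>y\<in>carrier Q. y \<oplus>\<^bsub>Q\<^esub> x = \<zero>\<^bsub>Q\<^esub>" if "x \<in> carrier Q" for x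
      proof -
        obtain a where "a \<in> carrier M" "f a = x" using ex[OF \<open>x \<in> carrier Q\<close>] by blast
        then have "f (\<ominus>\<^bsub>M\<^esub> a) \<oplus>\<^bsub>Q\<^esub> x = \<zero>\<^bsub>Q\<^esub>" "f (\<ominus>\<^bsub>M\<^esub> a) \<in> carrier Q"
          by (auto simp: M.l_neg cl eqs)
        then show ?thesis by blast
      qed
    qed (auto dest!: ex simp: eqs cl M.a_ac)
  qed (auto dest!: ex simp: eqs cl M.smult_l_distr M.smult_r_distr M.smult_assoc1)
qed

lemma submodule_abelian_subgroup:
  assumes "module K M" "submodule N K M"
  shows "abelian_subgroup N M"
proof -
  interpret M: module K M by fact
  interpret N: submodule N K M by fact
  show ?thesis
    by (rule abelian_subgroupI3) (auto intro!: additive_subgroupI N.subgroup_axioms M.abelian_group_axioms)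
qed

lemma quot_module_simps [simp]:
  "carrier (quot_module M N) = a_rcosets\<^bsub>M\<^esub> N"
  "zero (quot_module M N) = N"
  "add (quot_module M N) = (<+>\<^bsub>M\<^esub>)"
  "smult (quot_module M N) = (\<lambda>c X. \<Union>x\<in>X. N +>\<^bsub>M\<^esub> (c \<odot>\<^bsub>M\<^esub> x))"
  by (simp_all add: quot_module_def)

lemma coset_eq_iff:
  assumes "module K M" "submodule N K M" "x \<in> carrier M" "y \<in> carrier M"
  shows "N +>\<^bsub>M\<^esub> x = N +>\<^bsub>M\<^esub> y \<longleftrightarrow> x \<ominus>\<^bsub>M\<^esub> y \<in> N"
proof -
  interpret M: module K M by fact
  interpret S: abelian_subgroup N M using submodule_abelian_subgroup[OF assms(1,2)] .
  show ?thesis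
    using S.a_rcos_module[OF assms(4,3)] assms(3,4)
      M.a_repr_independence[OF _ assms(4) S.a_subgroup, of x] S.a_rcos_self[OF assms(3)]
    by (auto simp: a_minus_def)
qed

lemma coset_zero_iff:
  assumes "module K M" "submodule N K M" "x \<in> carrier M"
  shows "N +>\<^bsub>M\<^esub> x = N \<longleftrightarrow> x \<in> N"
proof -
  interpret M: module K M by fact
  interpret S: abelian_subgroup N M using submodule_abelian_subgroup[OF assms(1,2)] .
  show ?thesis using assms(3)
    using M.a_coset_join1[OF _ assms(3) S.a_subgroup] M.a_coset_join2[OF assms(3) S.a_subgroup] by blast
qed

lemma coset_add:
  assumes "module K M" "submodule N K M" "x \<in> carrier M" "y \<in> carrier M"
  shows "N +>\<^bsub>M\<^esub> (x \<oplus>\<^bsub>M\<^esub> y) = (N +>\<^bsub>M\<^esub> x) <+>\<^bsub>M\<^esub> (N +>\<^bsub>M\<^esub> y)"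
proof -
  interpret S: abelian_subgroup N M using submodule_abelian_subgroup[OF assms(1,2)] .
  show ?thesis using S.a_rcos_sum assms by simp
qed

text \<open>The scalar multiplication of \<open>quot_module\<close> is a union over representatives.
  All representatives of a coset yield the same coset here, so the union has only one distinct
  member.\<close>

lemma coset_smult:
  assumes "module K M" "submodule N K M" "c \<in> carrier K" "x \<in> carrier M"
  shows "N +>\<^bsub>M\<^esub> (c \<odot>\<^bsub>M\<^esub> x) = (\<Union>y\<in>N +>\<^bsub>M\<^esub> x. N +>\<^bsub>M\<^esub> (c \<odot>\<^bsub>M\<^esub> y))"
proof -
  interpret M: module K M by fact
  interpret N: submodule N K M by fact
  interpret S: abelian_subgroup N M using submodule_abelian_subgroup[OF assms(1,2)] .
  have *: "N +>\<^bsub>M\<^esub> (c \<odot>\<^bsub>M\<^esub> y) = N +>\<^bsub>M\<^esub> (c \<odot>\<^bsub>M\<^esub> x)" if y: "y \<in> N +>\<^bsub>M\<^esub> x" for y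
  proof -
    have yc: "y \<in> carrier M" using y assms(4) S.a_elemrcos_carrier by blast
    have "N +>\<^bsub>M\<^esub> y = N +>\<^bsub>M\<^esub> x"
      using M.a_repr_independence[OF y assms(4) S.a_subgroup] by simp
    then have "y \<ominus>\<^bsub>M\<^esub> x \<in> N" using coset_eq_iff[OF assms(1,2) yc assms(4)] by simp
    then have "c \<odot>\<^bsub>M\<^esub> (y \<ominus>\<^bsub>M\<^esub> x) \<in> N" using assms(3) by auto
    moreover have "c \<odot>\<^bsub>M\<^esub> (y \<ominus>\<^bsub>M\<^esub> x) = c \<odot>\<^bsub>M\<^esub> y \<ominus>\<^bsub>M\<^esub> c \<odot>\<^bsub>M\<^esub> x"
      unfolding a_minus_def using yc assms(3,4) by (simp add: M.smult_r_distr M.smult_r_minus)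
    ultimately show ?thesis using coset_eq_iff[OF assms(1,2)] yc assms(3,4) by simp
  qed
  have "x \<in> N +>\<^bsub>M\<^esub> x" using S.a_rcos_self assms(4) by simp
  then show ?thesis using * by blast
qed

lemma coset_image: "(\<lambda>x. N +>\<^bsub>M\<^esub> x) ` carrier M = carrier (quot_module M N)"
  by (auto simp: A_RCOSETS_def')

lemma coset_mem: "x \<in> carrier M \<Longrightarrow> N +>\<^bsub>M\<^esub> x \<in> carrier (quot_module M N)"
  using imageI[of x "carrier M" "\<lambda>x. N +>\<^bsub>M\<^esub> x"] unfolding coset_image .

lemma quot_module_is_module:
  assumes "module K M" "submodule N K M"
  shows "module K (quot_module M N)"
proof -
  interpret M: module K M by fact
  interpret N: submodule N K M by fact
  have "\<zero>\<^bsub>M\<^esub> \<in> N" using N.one_closed by simp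
  then show ?thesis
    using coset_smult[OF assms] coset_zero_iff[OF assms M.zero_closed]
    by (intro module_image[OF assms(1) coset_image]) (simp_all add: coset_add[OF assms])
qed

lemma coset_hom:
  assumes "module K M" "submodule N K M"
  shows "(\<lambda>x. N +>\<^bsub>M\<^esub> x) \<in> mod_hom K M (quot_module M N)"
  using coset_smult[OF assms] by (intro mod_homI coset_mem) (simp_all add: coset_add[OF assms])

lemma quot_module_cases:
  assumes "X \<in> carrier (quot_module M N)"
  obtains x where "x \<in> carrier M" "X = N +>\<^bsub>M\<^esub> x"
  using assms coset_image by (metis imageE)

lemma kernel_submodule:
  assumes "module K M" "module K N" "f \<in> mod_hom K M N"
  shows "submodule {x \<in> carrier M. f x = \<zero>\<^bsub>N\<^esub>} K M"
proof -
  interpret M: module K M by fact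
  interpret N: module K N by fact
  show ?thesis
    by (rule M.submoduleI)
      (auto simp: mod_hom_zero[OF assms] mod_hom_neg[OF assms] mod_hom_add[OF assms(3)] mod_hom_smult[OF assms(3)])
qed

lemma image_submodule:
  assumes "module K M" "module K N" "f \<in> mod_hom K M N"
  shows "submodule (f ` carrier M) K N"
proof -
  interpret M: module K M by fact
  interpret N: module K N by fact
  note h = mod_hom_zero[OF assms,symmetric] mod_hom_neg[OF assms,symmetric] mod_hom_add[OF assms(3),symmetric] mod_hom_smult[OF assms(3),symmetric]
  show ?thesis
    by (rule N.submoduleI) (auto simp: h intro!: imageI mod_hom_closed[OF assms(3)])
qed

text \<open>Sending \<open>f x\<close> to \<open>g x\<close> is well defined and injective because
  the kernels agree. The next-page isomorphism, convergence and the second page are all obtained in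
  this form, with a common space of representatives as \<open>M\<close>, so that no map between
  iterated quotients has to be built.\<close>

lemma mod_isomorphicI_surj:
  assumes "module K M" "module K A" "module K B"
    and f: "f \<in> mod_hom K M A" "f ` carrier M = carrier A"
    and g: "g \<in> mod_hom K M B" "g ` carrier M = carrier B"
    and ker: "\<And>x. x \<in> carrier M \<Longrightarrow> f x = \<zero>\<^bsub>A\<^esub> \<longleftrightarrow> g x = \<zero>\<^bsub>B\<^esub>"
  shows "mod_isomorphic K A B"
proof -
  interpret M: module K M by fact
  interpret A: module K A by fact
  interpret B: module K B by fact
  define h where "h = (\<lambda>a. g (SOME x. x \<in> carrier M \<and> f x = a))"
  have eq: "f x = f y \<longleftrightarrow> g x = g y" if "x \<in> carrier M" "y \<in> carrier M" for x y
  proof -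
    have "f x = f y \<longleftrightarrow> f (x \<ominus>\<^bsub>M\<^esub> y) = \<zero>\<^bsub>A\<^esub>"
      using that mod_hom_closed[OF f(1)] by (simp add: mod_hom_minus[OF assms(1,2) f(1)] A.minus_eq_zero_iff)
    also have "\<dots> \<longleftrightarrow> g (x \<ominus>\<^bsub>M\<^esub> y) = \<zero>\<^bsub>B\<^esub>" using ker that by simp
    also have "\<dots> \<longleftrightarrow> g x = g y"
      using that mod_hom_closed[OF g(1)] by (simp add: mod_hom_minus[OF assms(1,3) g(1)] B.minus_eq_zero_iff)
    finally show ?thesis .
  qed
  have hf: "h (f x) = g x" if "x \<in> carrier M" for x
  proof -
    have "\<exists>z. z \<in> carrier M \<and> f z = f x" using that by blast
    from someI_ex[OF this] show ?thesis unfolding h_def using eq that by blast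
  qed
  have ex: "\<exists>x\<in>carrier M. f x = a" if "a \<in> carrier A" for a using that f(2) by (metis imageE)
  have "h \<in> mod_hom K A B"
    by (rule mod_homI)
      (auto dest!: ex simp: hf mod_hom_closed[OF g(1)] mod_hom_add[OF g(1)] mod_hom_smult[OF g(1)]
        simp flip: mod_hom_add[OF f(1)] mod_hom_smult[OF f(1)])
  moreover have "bij_betw h (carrier A) (carrier B)"
  proof (rule bij_betw_imageI)
    show "inj_on h (carrier A)" by (rule inj_onI) (auto dest!: ex simp: hf eq)
    have "h ` carrier A = (\<lambda>x. h (f x)) ` carrier M" by (simp flip: f(2) add: image_image)
    then show "h ` carrier A = carrier B" using hf by (simp flip: g(2))
  qed
  ultimately show ?thesis unfolding mod_isomorphic_def by blast
qed

lemma submodule_restrict: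
  assumes "module K M" "submodule C K M" "submodule N K M" "N \<subseteq> C"
  shows "submodule N K (M\<lparr>carrier := C\<rparr>)"
proof -
  interpret M: module K M by fact
  interpret C: module K "M\<lparr>carrier := C\<rparr>" by (rule submodule.submodule_is_module) fact+
  interpret N: submodule N K M by fact
  interpret N': module K "M\<lparr>carrier := N\<rparr>" by (rule submodule.submodule_is_module) fact+
  show ?thesis
    by (rule C.module_incl_imp_submodule) (use assms(4) N'.module_axioms in simp_all)
qed

lemma coset_restrict [simp]: "N +>\<^bsub>M\<lparr>carrier := C\<rparr>\<^esub> x = N +>\<^bsub>M\<^esub> x"
  by (simp add: a_r_coset_def')

lemma submodule_inter:
  assumes "module K M" "submodule A K M" "submodule B K M"
  shows "submodule (A \<inter> B) K M"
proof -
  interpret M: module K M by fact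
  note A = M.submoduleE[OF assms(2)] and B = M.submoduleE[OF assms(3)]
  interpret A: submodule A K M by fact
  interpret B: submodule B K M by fact
  show ?thesis using A B A.one_closed B.one_closed by (intro M.submoduleI) auto
qed

lemma submodule_sum:
  assumes "module K M" "submodule A K M" "submodule B K M"
  shows "submodule (A <+>\<^bsub>M\<^esub> B) K M"
proof -
  interpret M: module K M by fact
  interpret A: submodule A K M by fact
  interpret B: submodule B K M by fact
  note A = M.submoduleE[OF assms(2)] and B = M.submoduleE[OF assms(3)]
  note cl = A.mem_carrier[simplified] B.mem_carrier[simplified]
  show ?thesis
  proof (rule M.submoduleI)
    show "A <+>\<^bsub>M\<^esub> B \<subseteq> carrier M" using cl by (auto simp: set_add_def')
    show "\<zero>\<^bsub>M\<^esub> \<in> A <+>\<^bsub>M\<^esub> B"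
      using A.one_closed B.one_closed M.l_zero[OF M.zero_closed] by (force simp: set_add_def')
    show "\<ominus>\<^bsub>M\<^esub> x \<in> A <+>\<^bsub>M\<^esub> B" if "x \<in> A <+>\<^bsub>M\<^esub> B" for x
    proof -
      obtain a b where ab: "a \<in> A" "b \<in> B" "x = a \<oplus>\<^bsub>M\<^esub> b" using \<open>x \<in> A <+>\<^bsub>M\<^esub> B\<close> by (auto simp: set_add_def')
      then have "\<ominus>\<^bsub>M\<^esub> x = \<ominus>\<^bsub>M\<^esub> a \<oplus>\<^bsub>M\<^esub> \<ominus>\<^bsub>M\<^esub> b" using cl by (simp add: M.minus_add)
      then show ?thesis using A(3)[OF ab(1)] B(3)[OF ab(2)] by (auto simp: set_add_def')
    qed
    show "x \<oplus>\<^bsub>M\<^esub> y \<in> A <+>\<^bsub>M\<^esub> B" if xy: "x \<in> A <+>\<^bsub>M\<^esub> B" "y \<in> A <+>\<^bsub>M\<^esub> B" for x y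
    proof -
      obtain a b where ab: "a \<in> A" "b \<in> B" "x = a \<oplus>\<^bsub>M\<^esub> b" using xy(1) by (auto simp: set_add_def')
      obtain a' b' where ab': "a' \<in> A" "b' \<in> B" "y = a' \<oplus>\<^bsub>M\<^esub> b'" using xy(2) by (auto simp: set_add_def')
      have "x \<oplus>\<^bsub>M\<^esub> y = (a \<oplus>\<^bsub>M\<^esub> a') \<oplus>\<^bsub>M\<^esub> (b \<oplus>\<^bsub>M\<^esub> b')" using ab ab' cl by (simp add: M.a_ac)
      then show ?thesis using A(5)[OF ab(1) ab'(1)] B(5)[OF ab(2) ab'(2)] by (auto simp: set_add_def')
    qed
    show "c \<odot>\<^bsub>M\<^esub> x \<in> A <+>\<^bsub>M\<^esub> B" if c: "c \<in> carrier K" and x: "x \<in> A <+>\<^bsub>M\<^esub> B" for c x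
    proof -
      obtain a b where ab: "a \<in> A" "b \<in> B" "x = a \<oplus>\<^bsub>M\<^esub> b" using x by (auto simp: set_add_def')
      then have "c \<odot>\<^bsub>M\<^esub> x = c \<odot>\<^bsub>M\<^esub> a \<oplus>\<^bsub>M\<^esub> c \<odot>\<^bsub>M\<^esub> b" using cl c by (simp add: M.smult_r_distr)
      then show ?thesis using A(4)[OF c ab(1)] B(4)[OF c ab(2)] by (auto simp: set_add_def')
    qed
  qed
qed

lemma preimage_submodule:
  assumes "module K M" "module K N" "f \<in> mod_hom K M N" "submodule S K N"
  shows "submodule {x \<in> carrier M. f x \<in> S} K M"
proof -
  interpret M: module K M by fact
  interpret N: module K N by fact
  interpret S: submodule S K N by fact
  note S = N.submoduleE[OF assms(4)]
  show ?thesis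
    using S S.one_closed
    by (intro M.submoduleI) (auto simp: mod_hom_zero[OF assms(1-3)] mod_hom_neg[OF assms(1-3)] mod_hom_add[OF assms(3)] mod_hom_smult[OF assms(3)])
qed

lemma submodule_image:
  assumes "module K M" "module K N" "f \<in> mod_hom K M N" "submodule S K M"
  shows "submodule (f ` S) K N"
proof -
  interpret M: module K M by fact
  have "S \<subseteq> carrier M" by (rule M.submoduleE[OF assms(4)])
  then have "f \<in> mod_hom K (M\<lparr>carrier := S\<rparr>) N" using assms(3) by (auto simp: mod_hom_def subset_iff)
  from image_submodule[OF submodule.submodule_is_module[OF assms(4,1)] assms(2) this] show ?thesis by simp
qed

lemma zero_submodule: "module K M \<Longrightarrow> submodule {\<zero>\<^bsub>M\<^esub>} K M"
proof -
  assume "module K M"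
  then interpret M: module K M .
  show ?thesis by (rule M.submoduleI) auto
qed

lemma quot_module_trivial:
  assumes "module K M" "submodule N K M" "carrier M \<subseteq> N"
  shows "carrier (quot_module M N) = {\<zero>\<^bsub>quot_module M N\<^esub>}"
proof -
  interpret Q: module K "quot_module M N" by (rule quot_module_is_module[OF assms(1,2)])
  have "X = N" if "X \<in> carrier (quot_module M N)" for X
    using that assms(3) coset_zero_iff[OF assms(1,2)] by (elim quot_module_cases) blast
  then show ?thesis using Q.zero_closed by auto
qed

lemma (in abelian_group) minus_minus_add:
  "\<lbrakk>x \<in> carrier G; y \<in> carrier G\<rbrakk> \<Longrightarrow> y \<oplus> (x \<ominus> y) = x" "\<lbrakk>x \<in> carrier G; y \<in> carrier G\<rbrakk> \<Longrightarrow> (x \<ominus> y) \<oplus> y = x"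
  "\<lbrakk>x \<in> carrier G; y \<in> carrier G\<rbrakk> \<Longrightarrow> (x \<oplus> y) \<ominus> y = x" "\<lbrakk>x \<in> carrier G; y \<in> carrier G\<rbrakk> \<Longrightarrow> (x \<oplus> y) \<ominus> x = y"
  by (simp_all add: a_minus_def a_ac l_neg r_neg r_neg1 r_neg2) (simp add: a_lcomm[of x y] r_neg)

lemma (in abelian_group) minus_zero_right: "x \<in> carrier G \<Longrightarrow> x \<ominus> \<zero> = x"
  using minus_minus_add(3)[of x \<zero>] by simp

lemma mod_hom_restrict:
  "f \<in> mod_hom K M N \<Longrightarrow> A \<subseteq> carrier M \<Longrightarrow> (\<And>x. x \<in> A \<Longrightarrow> f x \<in> B) \<Longrightarrow>
    f \<in> mod_hom K (M\<lparr>carrier := A\<rparr>) (N\<lparr>carrier := B\<rparr>)"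
  by (auto simp: mod_hom_def subset_iff)

lemma mod_hom_restrict_dom:
  "f \<in> mod_hom K M N \<Longrightarrow> A \<subseteq> carrier M \<Longrightarrow> f \<in> mod_hom K (M\<lparr>carrier := A\<rparr>) N"
  by (auto simp: mod_hom_def subset_iff)

lemma mod_hom_restrict_cod:
  "f \<in> mod_hom K M N \<Longrightarrow> (\<And>x. x \<in> carrier M \<Longrightarrow> f x \<in> B) \<Longrightarrow> f \<in> mod_hom K M (N\<lparr>carrier := B\<rparr>)"
  by (auto simp: mod_hom_def)

section \<open>Generators and relations\<close>

lemma free_module_simps [simp]:
  "zero (free_module K X) = (\<lambda>x. \<zero>\<^bsub>K\<^esub>)"
  "add (free_module K X) = (\<lambda>f g x. f x \<oplus>\<^bsub>K\<^esub> g x)"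
  "smult (free_module K X) = (\<lambda>c f x. c \<otimes>\<^bsub>K\<^esub> f x)"
  by (simp_all add: free_module_def)

lemma free_module_carrier:
  assumes "cring K"
  shows "f \<in> carrier (free_module K X) \<longleftrightarrow>
    (\<forall>x. f x \<in> carrier K) \<and> {x. f x \<noteq> \<zero>\<^bsub>K\<^esub>} \<subseteq> X \<and> finite {x. f x \<noteq> \<zero>\<^bsub>K\<^esub>}"
proof -
  interpret cring K by fact
  show ?thesis by (auto simp: free_module_def)
qed

lemma free_module_is_module:
  assumes "cring K"
  shows "module K (free_module K X)"
proof -
  interpret cring K by fact
  note c = free_module_carrier[OF assms]
  show ?thesis
  proof (rule moduleI)
    show "abelian_group (free_module K X)"
    proof (rule abelian_groupI)
      show "f \<oplus>\<^bsub>free_module K X\<^esub> g \<in> carrier (free_module K X)"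
        if "f \<in> carrier (free_module K X)" "g \<in> carrier (free_module K X)" for f g
      proof -
        have "{x. f x \<oplus>\<^bsub>K\<^esub> g x \<noteq> \<zero>\<^bsub>K\<^esub>} \<subseteq> {x. f x \<noteq> \<zero>\<^bsub>K\<^esub>} \<union> {x. g x \<noteq> \<zero>\<^bsub>K\<^esub>}" by auto
        then show ?thesis using that by (auto simp: c intro: finite_subset)
      qed
      show "\<exists>g\<in>carrier (free_module K X). g \<oplus>\<^bsub>free_module K X\<^esub> f = \<zero>\<^bsub>free_module K X\<^esub>"
        if "f \<in> carrier (free_module K X)" for f
      proof
        have "{x. \<ominus>\<^bsub>K\<^esub> f x \<noteq> \<zero>\<^bsub>K\<^esub>} \<subseteq> {x. f x \<noteq> \<zero>\<^bsub>K\<^esub>}" by auto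
        then show "(\<lambda>x. \<ominus>\<^bsub>K\<^esub> f x) \<in> carrier (free_module K X)"
          using that by (auto simp: c intro: finite_subset)
        show "(\<lambda>x. \<ominus>\<^bsub>K\<^esub> f x) \<oplus>\<^bsub>free_module K X\<^esub> f = \<zero>\<^bsub>free_module K X\<^esub>"
          using that by (auto simp: c l_neg)
      qed
    qed (auto simp: c a_ac)
    show "a \<odot>\<^bsub>free_module K X\<^esub> f \<in> carrier (free_module K X)"
      if "a \<in> carrier K" "f \<in> carrier (free_module K X)" for a f
    proof -
      have "{x. a \<otimes>\<^bsub>K\<^esub> f x \<noteq> \<zero>\<^bsub>K\<^esub>} \<subseteq> {x. f x \<noteq> \<zero>\<^bsub>K\<^esub>}" using that by auto
      then show ?thesis using that by (auto simp: c intro: finite_subset)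
    qed
  qed (auto simp: c l_distr r_distr m_assoc assms)
qed

lemma gen_closed:
  assumes "cring K" "x \<in> X"
  shows "gen K x \<in> carrier (free_module K X)"
proof -
  interpret cring K by fact
  have "{y. gen K x y \<noteq> \<zero>\<^bsub>K\<^esub>} \<subseteq> {x}" by (auto simp: gen_def)
  then show ?thesis using assms(2) finite_subset[of _ "{x}"]
    by (auto simp: free_module_carrier[OF assms(1)] gen_def)
qed

text \<open>\<open>induced_map\<close> is this sum for a chosen representative. Separating the two
  allows linearity to be proved on the free module, where no choice is involved.\<close>

definition lin_ext :: "('k, 'r) ring_scheme \<Rightarrow> ('k, 'b, 'y) module_scheme \<Rightarrow> ('x \<Rightarrow> 'b) \<Rightarrow> ('x \<Rightarrow> 'k) \<Rightarrow> 'b"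
  where "lin_ext K N \<phi> f = (\<Oplus>\<^bsub>N\<^esub>x\<in>{x. f x \<noteq> \<zero>\<^bsub>K\<^esub>}. f x \<odot>\<^bsub>N\<^esub> \<phi> x)"

lemma lin_ext_superset:
  assumes "module K N" "\<And>x. x \<in> S \<Longrightarrow> \<phi> x \<in> carrier N" "\<And>x. f x \<in> carrier K"
    "finite S" "{x. f x \<noteq> \<zero>\<^bsub>K\<^esub>} \<subseteq> S"
  shows "lin_ext K N \<phi> f = (\<Oplus>\<^bsub>N\<^esub>x\<in>S. f x \<odot>\<^bsub>N\<^esub> \<phi> x)"
proof -
  interpret N: module K N by fact
  show ?thesis unfolding lin_ext_def
    using assms by (intro N.add.finprod_mono_neutral_cong_left) (auto simp: Pi_iff)
qed

lemma lin_ext_hom: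
  assumes "module K N" "\<And>x. x \<in> X \<Longrightarrow> \<phi> x \<in> carrier N"
  shows "lin_ext K N \<phi> \<in> mod_hom K (free_module K X) N"
proof -
  interpret N: module K N by fact
  note c = free_module_carrier[OF N.R.is_cring]
  show ?thesis
  proof (rule mod_homI)
    show "lin_ext K N \<phi> f \<in> carrier N" if "f \<in> carrier (free_module K X)" for f
      unfolding lin_ext_def using that assms(2) by (intro N.finsum_closed) (auto simp: c)
  next
    fix f g assume f: "f \<in> carrier (free_module K X)" and g: "g \<in> carrier (free_module K X)"
    let ?S = "{x. f x \<noteq> \<zero>\<^bsub>K\<^esub>} \<union> {x. g x \<noteq> \<zero>\<^bsub>K\<^esub>}"
    have S: "finite ?S" "?S \<subseteq> X" using f g by (auto simp: c)
    have "lin_ext K N \<phi> f = (\<Oplus>\<^bsub>N\<^esub>x\<in>?S. f x \<odot>\<^bsub>N\<^esub> \<phi> x)" "lin_ext K N \<phi> g = (\<Oplus>\<^bsub>N\<^esub>x\<in>?S. g x \<odot>\<^bsub>N\<^esub> \<phi> x)"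
      "lin_ext K N \<phi> (\<lambda>x. f x \<oplus>\<^bsub>K\<^esub> g x) = (\<Oplus>\<^bsub>N\<^esub>x\<in>?S. (f x \<oplus>\<^bsub>K\<^esub> g x) \<odot>\<^bsub>N\<^esub> \<phi> x)"
      using f g S assms by (auto intro!: lin_ext_superset simp: c)
    moreover have "(\<Oplus>\<^bsub>N\<^esub>x\<in>?S. (f x \<oplus>\<^bsub>K\<^esub> g x) \<odot>\<^bsub>N\<^esub> \<phi> x) =
        (\<Oplus>\<^bsub>N\<^esub>x\<in>?S. f x \<odot>\<^bsub>N\<^esub> \<phi> x \<oplus>\<^bsub>N\<^esub> g x \<odot>\<^bsub>N\<^esub> \<phi> x)"
      using f g S assms(2) by (intro N.finsum_cong') (auto simp: c N.smult_l_distr)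
    moreover have "\<dots> = (\<Oplus>\<^bsub>N\<^esub>x\<in>?S. f x \<odot>\<^bsub>N\<^esub> \<phi> x) \<oplus>\<^bsub>N\<^esub> (\<Oplus>\<^bsub>N\<^esub>x\<in>?S. g x \<odot>\<^bsub>N\<^esub> \<phi> x)"
      using f g S assms(2) by (intro N.finsum_addf) (auto simp: c)
    ultimately show "lin_ext K N \<phi> (f \<oplus>\<^bsub>free_module K X\<^esub> g) = lin_ext K N \<phi> f \<oplus>\<^bsub>N\<^esub> lin_ext K N \<phi> g"
      by simp
  next
    fix a f assume a: "a \<in> carrier K" and f: "f \<in> carrier (free_module K X)"
    let ?S = "{x. f x \<noteq> \<zero>\<^bsub>K\<^esub>}"
    have S: "finite ?S" "?S \<subseteq> X" using f by (auto simp: c)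
    have "lin_ext K N \<phi> (\<lambda>x. a \<otimes>\<^bsub>K\<^esub> f x) = (\<Oplus>\<^bsub>N\<^esub>x\<in>?S. (a \<otimes>\<^bsub>K\<^esub> f x) \<odot>\<^bsub>N\<^esub> \<phi> x)"
      using f S assms a by (intro lin_ext_superset) (auto simp: c)
    also have "\<dots> = (\<Oplus>\<^bsub>N\<^esub>x\<in>?S. a \<odot>\<^bsub>N\<^esub> (f x \<odot>\<^bsub>N\<^esub> \<phi> x))"
      using f S assms(2) a by (intro N.finsum_cong') (auto simp: c N.smult_assoc1)
    also have "\<dots> = a \<odot>\<^bsub>N\<^esub> lin_ext K N \<phi> f"
      unfolding lin_ext_def using f S assms(2) a by (intro N.finsum_smult_ldistr[symmetric]) (auto simp: c)
    finally show "lin_ext K N \<phi> (a \<odot>\<^bsub>free_module K X\<^esub> f) = a \<odot>\<^bsub>N\<^esub> lin_ext K N \<phi> f"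
      by simp
  qed
qed

lemma lin_ext_gen:
  assumes "module K N" "\<phi> x \<in> carrier N" "\<one>\<^bsub>K\<^esub> \<noteq> \<zero>\<^bsub>K\<^esub>"
  shows "lin_ext K N \<phi> (gen K x) = \<phi> x"
proof -
  interpret N: module K N by fact
  have "{y. gen K x y \<noteq> \<zero>\<^bsub>K\<^esub>} = {x}" using assms(3) by (auto simp: gen_def)
  then show ?thesis using assms(2) unfolding lin_ext_def by (simp add: gen_def)
qed

lemma free_module_hom_eq:
  assumes "module K N" "f \<in> mod_hom K (free_module K X) N" "\<phi> \<in> carrier (free_module K X)"
  shows "f \<phi> = lin_ext K N (\<lambda>x. f (gen K x)) \<phi>"
proof -
  interpret N: module K N by fact
  note c = free_module_carrier[OF N.R.is_cring]
  interpret F: module K "free_module K X" by (rule free_module_is_module[OF N.R.is_cring])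
  let ?F = "free_module K X"
  have *: "(\<Oplus>\<^bsub>?F\<^esub>x\<in>S. \<phi> x \<odot>\<^bsub>?F\<^esub> gen K x) = (\<lambda>x. if x \<in> S then \<phi> x else \<zero>\<^bsub>K\<^esub>)"
    if "finite S" "S \<subseteq> X" "\<forall>x. \<phi> x \<in> carrier K" for S
    using that
  proof (induction S)
    case empty
    show ?case using F.finsum_empty by simp
  next
    case (insert a S)
    have cl: "\<phi> x \<odot>\<^bsub>?F\<^esub> gen K x \<in> carrier ?F" if "x \<in> X" for x
      by (rule F.smult_closed) (use insert.prems that gen_closed[OF N.R.is_cring] in auto)
    show ?case
    proof (subst F.finsum_insert[OF insert.hyps])
      show "(\<lambda>x. \<phi> x \<odot>\<^bsub>?F\<^esub> gen K x) \<in> S \<rightarrow> carrier ?F" "\<phi> a \<odot>\<^bsub>?F\<^esub> gen K a \<in> carrier ?F"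
        using cl insert.prems by blast+
      have "(\<Oplus>\<^bsub>?F\<^esub>x\<in>S. \<phi> x \<odot>\<^bsub>?F\<^esub> gen K x) = (\<lambda>x. if x \<in> S then \<phi> x else \<zero>\<^bsub>K\<^esub>)"
        using insert by blast
      then show "\<phi> a \<odot>\<^bsub>?F\<^esub> gen K a \<oplus>\<^bsub>?F\<^esub> (\<Oplus>\<^bsub>?F\<^esub>x\<in>S. \<phi> x \<odot>\<^bsub>?F\<^esub> gen K x) =
          (\<lambda>x. if x \<in> insert a S then \<phi> x else \<zero>\<^bsub>K\<^esub>)"
        using insert.hyps(2) insert.prems(2) by (auto simp: gen_def fun_eq_iff)
    qed
  qed
  let ?S = "{x. \<phi> x \<noteq> \<zero>\<^bsub>K\<^esub>}"
  have S: "finite ?S" "?S \<subseteq> X" "\<forall>x. \<phi> x \<in> carrier K" using assms(3) by (auto simp: c)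
  have cl: "\<phi> x \<odot>\<^bsub>?F\<^esub> gen K x \<in> carrier ?F" if "x \<in> X" for x
    by (rule F.smult_closed) (use S that gen_closed[OF N.R.is_cring] in auto)
  have "\<phi> = (\<Oplus>\<^bsub>?F\<^esub>x\<in>?S. \<phi> x \<odot>\<^bsub>?F\<^esub> gen K x)" using *[OF S] by (auto simp: fun_eq_iff)
  then have "f \<phi> = f (\<Oplus>\<^bsub>?F\<^esub>x\<in>?S. \<phi> x \<odot>\<^bsub>?F\<^esub> gen K x)" by simp
  also have "\<dots> = (\<Oplus>\<^bsub>N\<^esub>x\<in>?S. f (\<phi> x \<odot>\<^bsub>?F\<^esub> gen K x))"
  proof (rule mod_hom_finsum[OF F.module_axioms N.module_axioms assms(2)])
    show "(\<lambda>x. \<phi> x \<odot>\<^bsub>?F\<^esub> gen K x) \<in> ?S \<rightarrow> carrier ?F"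
      by (rule Pi_I, rule cl, rule subsetD[OF S(2)])
  qed
  also have "\<dots> = lin_ext K N (\<lambda>x. f (gen K x)) \<phi>"
    unfolding lin_ext_def
  proof (rule N.finsum_cong')
    fix x assume x: "x \<in> ?S"
    then have g: "gen K x \<in> carrier ?F" by (intro gen_closed[OF N.R.is_cring] subsetD[OF S(2)])
    show "f (\<phi> x \<odot>\<^bsub>?F\<^esub> gen K x) = \<phi> x \<odot>\<^bsub>N\<^esub> f (gen K x)"
      by (rule mod_hom_smult[OF assms(2) _ g]) (simp add: S(3))
  next
    have "gen K x \<in> carrier ?F" if "x \<in> ?S" for x
      using that by (intro gen_closed[OF N.R.is_cring] subsetD[OF S(2)])
    then show "(\<lambda>x. \<phi> x \<odot>\<^bsub>N\<^esub> f (gen K x)) \<in> ?S \<rightarrow> carrier N"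
      using S(3) mod_hom_closed[OF assms(2)] by (intro Pi_I N.smult_closed) auto
  qed simp
  finally show ?thesis .
qed

lemma lin_ext_cong:
  assumes "module K N" "\<And>x. x \<in> X \<Longrightarrow> \<phi> x = \<psi> x" "\<And>x. x \<in> X \<Longrightarrow> \<psi> x \<in> carrier N"
    and "f \<in> carrier (free_module K X)"
  shows "lin_ext K N \<phi> f = lin_ext K N \<psi> f"
proof -
  interpret N: module K N by fact
  have "{x. f x \<noteq> \<zero>\<^bsub>K\<^esub>} \<subseteq> X" "\<And>x. f x \<in> carrier K"
    using assms(4) by (auto simp: free_module_carrier[OF N.R.is_cring])
  then show ?thesis unfolding lin_ext_def
    using assms(2,3) by (intro N.finsum_cong') auto
qed

lemma mod_span_submodule:
  assumes "module K M" "S \<subseteq> carrier M"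
  shows "submodule (mod_span K M S) K M"
proof -
  interpret M: module K M by fact
  have 1: "carrier M \<in> {N. submodule N K M \<and> S \<subseteq> N}" using M.carrier_is_submodule assms(2) by blast
  show ?thesis unfolding mod_span_def
  proof (rule M.submoduleI)
    show "\<zero>\<^bsub>M\<^esub> \<in> \<Inter>{N. submodule N K M \<and> S \<subseteq> N}"
      using subgroup.one_closed[OF submodule.axioms(1)] by fastforce
    show "\<Inter>{N. submodule N K M \<and> S \<subseteq> N} \<subseteq> carrier M" using 1 by blast
  qed (auto dest: M.submoduleE(3-5))
qed

lemma mod_span_superset: "S \<subseteq> mod_span K M S"
  by (auto simp: mod_span_def)

lemma mod_span_minimal: "submodule N K M \<Longrightarrow> S \<subseteq> N \<Longrightarrow> mod_span K M S \<subseteq> N"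
  by (auto simp: mod_span_def)

context
  fixes K :: "('k, 'r) ring_scheme" and X :: "'x set" and S :: "('x \<Rightarrow> 'k) set"
  assumes K: "field K" and S: "S \<subseteq> carrier (free_module K X)"
begin

interpretation K: field K by (rule K)

lemma presented_is_module: "module K (presented K X S)"
  unfolding presented_def
  by (intro quot_module_is_module free_module_is_module mod_span_submodule S K.is_cring)

lemma gen_class_closed: "x \<in> X \<Longrightarrow> gen_class K X S x \<in> carrier (presented K X S)"
  unfolding presented_def gen_class_def by (intro coset_mem gen_closed K.is_cring)

lemma coset_presented_hom:
  "(\<lambda>f. mod_span K (free_module K X) S +>\<^bsub>free_module K X\<^esub> f) \<in> mod_hom K (free_module K X) (presented K X S)"
  unfolding presented_def by (intro coset_hom free_module_is_module mod_span_submodule S K.is_cring)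

lemma presented_hom_eq:
  assumes "module K N" "f \<in> mod_hom K (presented K X S) N" "g \<in> mod_hom K (presented K X S) N"
    and "\<And>x. x \<in> X \<Longrightarrow> f (gen_class K X S x) = g (gen_class K X S x)"
    and "C \<in> carrier (presented K X S)"
  shows "f C = g C"
proof -
  obtain c where c: "c \<in> carrier (free_module K X)" "C = mod_span K (free_module K X) S +>\<^bsub>free_module K X\<^esub> c"
    using assms(5) unfolding presented_def by (rule quot_module_cases)
  have "h C = lin_ext K N (\<lambda>x. h (gen_class K X S x)) c" if "h \<in> mod_hom K (presented K X S) N" for h
    using free_module_hom_eq[OF assms(1) mod_hom_comp[OF that coset_presented_hom] c(1)]
    by (simp add: c(2) gen_class_def)
  moreover have "lin_ext K N (\<lambda>x. f (gen_class K X S x)) c = lin_ext K N (\<lambda>x. g (gen_class K X S x)) c"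
    using assms(4) c(1) mod_hom_closed[OF assms(3) gen_class_closed]
    by (intro lin_ext_cong[OF assms(1)]) auto
  ultimately show ?thesis using assms(2,3) by metis
qed

text \<open>The kernel of the linear extension is a submodule containing the relations, hence their
  span. The extension is therefore constant on a coset, and the representative chosen by
  \<open>induced_map\<close> is immaterial.\<close>

lemma induced_map_coset:
  assumes "module K N" "\<And>x. x \<in> X \<Longrightarrow> \<phi> x \<in> carrier N" "\<And>s. s \<in> S \<Longrightarrow> lin_ext K N \<phi> s = \<zero>\<^bsub>N\<^esub>"
    and "c \<in> carrier (free_module K X)"
  shows "induced_map K N \<phi> (mod_span K (free_module K X) S +>\<^bsub>free_module K X\<^esub> c) = lin_ext K N \<phi> c"
proof -
  let ?F = "free_module K X"
  let ?R = "mod_span K ?F S"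
  let ?k = "{f \<in> carrier ?F. lin_ext K N \<phi> f = \<zero>\<^bsub>N\<^esub>}"
  interpret N: module K N by fact
  have F: "module K ?F" by (rule free_module_is_module[OF K.is_cring])
  interpret F: module K ?F by (rule F)
  have R: "submodule ?R K ?F" by (rule mod_span_submodule[OF F S])
  interpret R: abelian_subgroup ?R ?F by (rule submodule_abelian_subgroup[OF F R])
  have h: "lin_ext K N \<phi> \<in> mod_hom K ?F N" by (rule lin_ext_hom) fact+
  have "submodule ?k K ?F" by (rule kernel_submodule[OF F assms(1) h])
  then have sub: "?R \<subseteq> ?k" by (rule mod_span_minimal) (use S assms(3) in auto)
  have eq: "lin_ext K N \<phi> f = lin_ext K N \<phi> c" if f: "f \<in> ?R +>\<^bsub>?F\<^esub> c" for f
  proof -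
    have fc: "f \<in> carrier ?F" by (rule R.a_elemrcos_carrier[OF assms(4) f])
    have "f \<ominus>\<^bsub>?F\<^esub> c \<in> ?R"
      using R.a_rcos_module[OF assms(4) fc] f by (simp add: a_minus_def)
    then have "lin_ext K N \<phi> (f \<ominus>\<^bsub>?F\<^esub> c) = \<zero>\<^bsub>N\<^esub>" using sub by blast
    then show ?thesis
      using mod_hom_minus[OF F assms(1) h fc assms(4)] mod_hom_closed[OF h] fc assms(4)
      by (simp add: N.minus_eq_zero_iff)
  qed
  have "c \<in> ?R +>\<^bsub>?F\<^esub> c" by (rule R.a_rcos_self[OF assms(4)])
  then have "(SOME f. f \<in> ?R +>\<^bsub>?F\<^esub> c) \<in> ?R +>\<^bsub>?F\<^esub> c" by (rule someI[where P = "\<lambda>f. f \<in> _"])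
  from eq[OF this] show ?thesis by (simp add: induced_map_def lin_ext_def Let_def)
qed

lemma presented_lift:
  assumes "module K N" "\<And>x. x \<in> X \<Longrightarrow> \<phi> x \<in> carrier N" "\<And>s. s \<in> S \<Longrightarrow> lin_ext K N \<phi> s = \<zero>\<^bsub>N\<^esub>"
  shows "induced_map K N \<phi> \<in> mod_hom K (presented K X S) N"
    and "\<And>x. x \<in> X \<Longrightarrow> induced_map K N \<phi> (gen_class K X S x) = \<phi> x"
proof -
  let ?F = "free_module K X"
  let ?q = "\<lambda>f. mod_span K ?F S +>\<^bsub>?F\<^esub> f"
  interpret F: module K ?F by (rule free_module_is_module[OF K.is_cring])
  have im: "induced_map K N \<phi> (?q c) = lin_ext K N \<phi> c" if "c \<in> carrier ?F" for c
    using that assms by (intro induced_map_coset) auto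
  have h: "lin_ext K N \<phi> \<in> mod_hom K ?F N" using assms by (intro lin_ext_hom) auto
  have ex: "\<exists>c\<in>carrier ?F. C = ?q c" if "C \<in> carrier (presented K X S)" for C
    using that unfolding presented_def by (metis quot_module_cases)
  show "induced_map K N \<phi> \<in> mod_hom K (presented K X S) N"
  proof (rule mod_homI)
    show "induced_map K N \<phi> C \<in> carrier N" if C: "C \<in> carrier (presented K X S)" for C
      using ex[OF C] mod_hom_closed[OF h] by (auto simp: im)
    show "induced_map K N \<phi> (C \<oplus>\<^bsub>presented K X S\<^esub> C') = induced_map K N \<phi> C \<oplus>\<^bsub>N\<^esub> induced_map K N \<phi> C'"
      if C: "C \<in> carrier (presented K X S)" "C' \<in> carrier (presented K X S)" for C C'
    proof -
      obtain c c' where c: "c \<in> carrier ?F" "C = ?q c" "c' \<in> carrier ?F" "C' = ?q c'"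
        using ex C by meson
      have "C \<oplus>\<^bsub>presented K X S\<^esub> C' = ?q (c \<oplus>\<^bsub>?F\<^esub> c')"
        using mod_hom_add[OF coset_presented_hom c(1,3)] c(2,4) by simp
      then show ?thesis using c im mod_hom_add[OF h c(1,3)] F.a_closed[OF c(1,3)] by metis
    qed
    show "induced_map K N \<phi> (a \<odot>\<^bsub>presented K X S\<^esub> C) = a \<odot>\<^bsub>N\<^esub> induced_map K N \<phi> C"
      if a: "a \<in> carrier K" and C: "C \<in> carrier (presented K X S)" for a C
    proof -
      obtain c where c: "c \<in> carrier ?F" "C = ?q c" using ex C by meson
      have "a \<odot>\<^bsub>presented K X S\<^esub> C = ?q (a \<odot>\<^bsub>?F\<^esub> c)"
        using mod_hom_smult[OF coset_presented_hom a c(1)] c(2) by simp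
      then show ?thesis using c im mod_hom_smult[OF h a c(1)] F.smult_closed[OF a c(1)] by metis
    qed
  qed
  show "induced_map K N \<phi> (gen_class K X S x) = \<phi> x" if "x \<in> X" for x
    using im[OF gen_closed[OF K.is_cring that]] lin_ext_gen[where \<phi> = \<phi>, OF assms(1) assms(2)[OF that] K.one_not_zero]
    by (simp add: gen_class_def)
qed

text \<open>If \<open>\<phi>\<close> comes from a linear map on the quotient, it respects the
  relations automatically. An explicit formula can thus be recognized as a map constructed
  otherwise, without checking its multilinearity; the Loday boundary and the derivation action are
  treated this way.\<close>

lemma induced_map_hom_eq:
  assumes "module K N" "g \<in> mod_hom K (presented K X S) N"
    and "\<And>x. x \<in> X \<Longrightarrow> \<phi> x = g (gen_class K X S x)" and "C \<in> carrier (presented K X S)"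
  shows "induced_map K N \<phi> C = g C"
proof -
  let ?F = "free_module K X"
  let ?q = "\<lambda>f. mod_span K ?F S +>\<^bsub>?F\<^esub> f"
  interpret N: module K N by fact
  have F: "module K ?F" by (rule free_module_is_module[OF K.is_cring])
  have gq: "(\<lambda>f. g (?q f)) \<in> mod_hom K ?F N" by (rule mod_hom_comp[OF assms(2) coset_presented_hom])
  have \<phi>: "\<phi> x \<in> carrier N" if "x \<in> X" for x
    using assms(3)[OF that] mod_hom_closed[OF assms(2) gen_class_closed[OF that]] by simp
  have eq: "lin_ext K N \<phi> f = g (?q f)" if "f \<in> carrier ?F" for f
    unfolding free_module_hom_eq[OF assms(1) gq that]
    using assms(3) \<phi> that by (intro lin_ext_cong[OF assms(1)]) (auto simp: gen_class_def)
  have "lin_ext K N \<phi> s = \<zero>\<^bsub>N\<^esub>" if s: "s \<in> S" for s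
  proof -
    have "?q s = \<zero>\<^bsub>presented K X S\<^esub>"
      using s S mod_span_superset[of S K ?F] coset_zero_iff[OF F mod_span_submodule[OF F S], of s]
      by (auto simp: presented_def)
    then show ?thesis
      using eq s S mod_hom_zero[OF presented_is_module assms(1,2)] by auto
  qed
  then have hom: "induced_map K N \<phi> \<in> mod_hom K (presented K X S) N"
    "\<And>x. x \<in> X \<Longrightarrow> induced_map K N \<phi> (gen_class K X S x) = \<phi> x"
    using presented_lift[where \<phi> = \<phi> and N = N] assms(1) \<phi> by auto
  show ?thesis
    by (rule presented_hom_eq[OF assms(1) hom(1) assms(2) _ assms(4)]) (use hom(2) assms(3) in auto)
qed

lemma gen_class_linear:
  assumes "module K M" "linear_rels K (free_module K X) M \<iota> \<subseteq> S" "\<And>a. a \<in> carrier M \<Longrightarrow> \<iota> a \<in> X"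
  shows "(\<lambda>a. gen_class K X S (\<iota> a)) \<in> mod_hom K M (presented K X S)"
proof -
  let ?F = "free_module K X"
  let ?R = "mod_span K ?F S"
  interpret M: module K M by fact
  have F: "module K ?F" by (rule free_module_is_module[OF K.is_cring])
  interpret F: module K ?F by (rule F)
  have R: "submodule ?R K ?F" by (rule mod_span_submodule[OF F S])
  have g: "gen K (\<iota> a) \<in> carrier ?F" if "a \<in> carrier M" for a
    by (rule gen_closed[OF K.is_cring assms(3)[OF that]])
  have rel: "linear_rels K ?F M \<iota> \<subseteq> ?R" using assms(2) mod_span_superset by fast
  show ?thesis
  proof (rule mod_homI)
    show "gen_class K X S (\<iota> a) \<in> carrier (presented K X S)" if "a \<in> carrier M" for a
      by (rule gen_class_closed[OF assms(3)[OF that]])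
    show "gen_class K X S (\<iota> (a \<oplus>\<^bsub>M\<^esub> b)) = gen_class K X S (\<iota> a) \<oplus>\<^bsub>presented K X S\<^esub> gen_class K X S (\<iota> b)"
      if a: "a \<in> carrier M" and b: "b \<in> carrier M" for a b
    proof -
      have "gen K (\<iota> (a \<oplus>\<^bsub>M\<^esub> b)) \<ominus>\<^bsub>?F\<^esub> (gen K (\<iota> a) \<oplus>\<^bsub>?F\<^esub> gen K (\<iota> b)) \<in> ?R"
        using rel a b unfolding linear_rels_def by blast
      then have "?R +>\<^bsub>?F\<^esub> gen K (\<iota> (a \<oplus>\<^bsub>M\<^esub> b)) = ?R +>\<^bsub>?F\<^esub> (gen K (\<iota> a) \<oplus>\<^bsub>?F\<^esub> gen K (\<iota> b))"
        using coset_eq_iff[OF F R] g a b by (metis F.a_closed M.a_closed)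
      then show ?thesis
        unfolding gen_class_def using mod_hom_add[OF coset_presented_hom g[OF a] g[OF b]] by metis
    qed
    show "gen_class K X S (\<iota> (c \<odot>\<^bsub>M\<^esub> a)) = c \<odot>\<^bsub>presented K X S\<^esub> gen_class K X S (\<iota> a)"
      if c: "c \<in> carrier K" and a: "a \<in> carrier M" for c a
    proof -
      have "gen K (\<iota> (c \<odot>\<^bsub>M\<^esub> a)) \<ominus>\<^bsub>?F\<^esub> (c \<odot>\<^bsub>?F\<^esub> gen K (\<iota> a)) \<in> ?R"
        using rel a c unfolding linear_rels_def by blast
      then have "?R +>\<^bsub>?F\<^esub> gen K (\<iota> (c \<odot>\<^bsub>M\<^esub> a)) = ?R +>\<^bsub>?F\<^esub> (c \<odot>\<^bsub>?F\<^esub> gen K (\<iota> a))"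
        using coset_eq_iff[OF F R] g a c by (metis F.smult_closed M.smult_closed)
      then show ?thesis
        unfolding gen_class_def using mod_hom_smult[OF coset_presented_hom c g[OF a]] by metis
    qed
  qed
qed

lemma gen_class_rel:
  assumes "x \<in> X" "gen K x \<in> S"
  shows "gen_class K X S x = \<zero>\<^bsub>presented K X S\<^esub>"
proof -
  have F: "module K (free_module K X)" by (rule free_module_is_module[OF K.is_cring])
  show ?thesis
    using coset_zero_iff[OF F mod_span_submodule[OF F S], of "gen K x"] gen_closed[OF K.is_cring assms(1)]
      assms(2) mod_span_superset[of S K "free_module K X"]
    by (auto simp: gen_class_def presented_def)
qed

end

lemma linear_rels_closed:
  assumes "field K" "module K M" "\<And>a. a \<in> carrier M \<Longrightarrow> \<iota> a \<in> X"
  shows "linear_rels K (free_module K X) M \<iota> \<subseteq> carrier (free_module K X)"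
proof -
  interpret K: field K by fact
  interpret M: module K M by fact
  interpret F: module K "free_module K X" by (rule free_module_is_module[OF K.is_cring])
  have "gen K (\<iota> a) \<in> carrier (free_module K X)" if "a \<in> carrier M" for a
    by (rule gen_closed[OF K.is_cring assms(3)[OF that]])
  then show ?thesis unfolding linear_rels_def
    by (auto intro!: F.minus_closed F.a_closed F.smult_closed simp del: free_module_simps)
qed

lemma lin_ext_linear_rels:
  assumes "field K" "module K M" "module K N" "\<And>a. a \<in> carrier M \<Longrightarrow> \<iota> a \<in> X"
    and "\<And>x. x \<in> X \<Longrightarrow> \<phi> x \<in> carrier N" "(\<lambda>a. \<phi> (\<iota> a)) \<in> mod_hom K M N"
    and "s \<in> linear_rels K (free_module K X) M \<iota>"
  shows "lin_ext K N \<phi> s = \<zero>\<^bsub>N\<^esub>"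
proof -
  let ?F = "free_module K X"
  interpret K: field K by fact
  interpret M: module K M by fact
  interpret N: module K N by fact
  have F: "module K ?F" by (rule free_module_is_module[OF K.is_cring])
  interpret F: module K ?F by (rule F)
  have h: "lin_ext K N \<phi> \<in> mod_hom K ?F N" by (rule lin_ext_hom) fact+
  have g: "gen K (\<iota> a) \<in> carrier ?F" if "a \<in> carrier M" for a
    by (rule gen_closed[OF K.is_cring assms(4)[OF that]])
  have e: "lin_ext K N \<phi> (gen K (\<iota> a)) = \<phi> (\<iota> a)" if "a \<in> carrier M" for a
    by (rule lin_ext_gen[where \<phi> = \<phi>, OF assms(3) assms(5)[OF assms(4)[OF that]] K.one_not_zero])
  have cl: "\<phi> (\<iota> a) \<in> carrier N" if "a \<in> carrier M" for a using that assms(4,5) by blast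
  from assms(7) consider
    a b where "a \<in> carrier M" "b \<in> carrier M"
      "s = gen K (\<iota> (a \<oplus>\<^bsub>M\<^esub> b)) \<ominus>\<^bsub>?F\<^esub> (gen K (\<iota> a) \<oplus>\<^bsub>?F\<^esub> gen K (\<iota> b))" |
    c a where "c \<in> carrier K" "a \<in> carrier M" "s = gen K (\<iota> (c \<odot>\<^bsub>M\<^esub> a)) \<ominus>\<^bsub>?F\<^esub> (c \<odot>\<^bsub>?F\<^esub> gen K (\<iota> a))"
    unfolding linear_rels_def by blast
  then show ?thesis
  proof cases
    case 1
    then have "lin_ext K N \<phi> s = \<phi> (\<iota> (a \<oplus>\<^bsub>M\<^esub> b)) \<ominus>\<^bsub>N\<^esub> (\<phi> (\<iota> a) \<oplus>\<^bsub>N\<^esub> \<phi> (\<iota> b))"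
      using mod_hom_minus[OF F assms(3) h g F.a_closed[OF g g]] mod_hom_add[OF h g g] e
      by (metis M.a_closed)
    then show ?thesis using mod_hom_add[OF assms(6)] 1 cl by (simp add: N.minus_eq_zero_iff)
  next
    case 2
    then have "lin_ext K N \<phi> s = \<phi> (\<iota> (c \<odot>\<^bsub>M\<^esub> a)) \<ominus>\<^bsub>N\<^esub> (c \<odot>\<^bsub>N\<^esub> \<phi> (\<iota> a))"
      using mod_hom_minus[OF F assms(3) h g F.smult_closed[OF _ g]] mod_hom_smult[OF h _ g] e
      by (metis M.smult_closed)
    then show ?thesis using mod_hom_smult[OF assms(6)] 2 cl by (simp add: N.minus_eq_zero_iff)
  qed
qed

section \<open>Splittings over a field\<close>

text \<open>The graph of a linear map on a subspace of \<open>B\<close>, single-valued because zero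
  is related to zero alone. A graph is used rather than a function so that Zorn's lemma applies to
  inclusion and chains have unions.\<close>

definition partial_section ::
  "('k, 'r) ring_scheme \<Rightarrow> ('k, 'a, 'x) module_scheme \<Rightarrow> ('k, 'b, 'y) module_scheme \<Rightarrow> ('a \<Rightarrow> 'b) \<Rightarrow> ('b \<times> 'a) set \<Rightarrow> bool"
  where "partial_section K A B f G \<longleftrightarrow>
    G \<subseteq> carrier B \<times> carrier A \<and> (\<zero>\<^bsub>B\<^esub>, \<zero>\<^bsub>A\<^esub>) \<in> G \<and>
    (\<forall>b a b' a'. (b, a) \<in> G \<longrightarrow> (b', a') \<in> G \<longrightarrow> (b \<oplus>\<^bsub>B\<^esub> b', a \<oplus>\<^bsub>A\<^esub> a') \<in> G) \<and>
    (\<forall>c b a. c \<in> carrier K \<longrightarrow> (b, a) \<in> G \<longrightarrow> (c \<odot>\<^bsub>B\<^esub> b, c \<odot>\<^bsub>A\<^esub> a) \<in> G) \<and>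
    (\<forall>a. (\<zero>\<^bsub>B\<^esub>, a) \<in> G \<longrightarrow> a = \<zero>\<^bsub>A\<^esub>) \<and>
    (\<forall>b a. (b, a) \<in> G \<longrightarrow> b \<in> f ` carrier A \<longrightarrow> f a = b)"

lemma partial_sectionD:
  assumes "partial_section K A B f G"
  shows "\<And>b a. (b, a) \<in> G \<Longrightarrow> b \<in> carrier B \<and> a \<in> carrier A"
    and "(\<zero>\<^bsub>B\<^esub>, \<zero>\<^bsub>A\<^esub>) \<in> G"
    and "\<And>b a b' a'. (b, a) \<in> G \<Longrightarrow> (b', a') \<in> G \<Longrightarrow> (b \<oplus>\<^bsub>B\<^esub> b', a \<oplus>\<^bsub>A\<^esub> a') \<in> G"
    and "\<And>c b a. c \<in> carrier K \<Longrightarrow> (b, a) \<in> G \<Longrightarrow> (c \<odot>\<^bsub>B\<^esub> b, c \<odot>\<^bsub>A\<^esub> a) \<in> G"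
    and "\<And>a. (\<zero>\<^bsub>B\<^esub>, a) \<in> G \<Longrightarrow> a = \<zero>\<^bsub>A\<^esub>"
    and "\<And>b a. (b, a) \<in> G \<Longrightarrow> b \<in> f ` carrier A \<Longrightarrow> f a = b"
proof -
  note G = assms[unfolded partial_section_def, THEN conjunct1] assms[unfolded partial_section_def, THEN conjunct2]
  note G2 = G(2)[THEN conjunct2]
  note G3 = G2[THEN conjunct2]
  note G4 = G3[THEN conjunct2]
  show "\<And>b a. (b, a) \<in> G \<Longrightarrow> b \<in> carrier B \<and> a \<in> carrier A" using G(1) by fast
  show "(\<zero>\<^bsub>B\<^esub>, \<zero>\<^bsub>A\<^esub>) \<in> G" by (rule G(2)[THEN conjunct1])
  show "\<And>b a b' a'. (b, a) \<in> G \<Longrightarrow> (b', a') \<in> G \<Longrightarrow> (b \<oplus>\<^bsub>B\<^esub> b', a \<oplus>\<^bsub>A\<^esub> a') \<in> G"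
    by (rule G2[THEN conjunct1, rule_format])
  show "\<And>c b a. c \<in> carrier K \<Longrightarrow> (b, a) \<in> G \<Longrightarrow> (c \<odot>\<^bsub>B\<^esub> b, c \<odot>\<^bsub>A\<^esub> a) \<in> G"
    by (rule G3[THEN conjunct1, rule_format])
  show "\<And>a. (\<zero>\<^bsub>B\<^esub>, a) \<in> G \<Longrightarrow> a = \<zero>\<^bsub>A\<^esub>" by (rule G4[THEN conjunct1, rule_format])
  show "\<And>b a. (b, a) \<in> G \<Longrightarrow> b \<in> f ` carrier A \<Longrightarrow> f a = b" by (rule G4[THEN conjunct2, rule_format])
qed

text \<open>The enlarged graph is \<open>G\<close> plus the line through \<open>(b0, a0)\<close>. It
  stays single-valued: a relation between \<open>b0\<close> and the old domain with nonzero
  coefficient \<open>c\<close> could be divided by \<open>c\<close>, which would put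
  \<open>b0\<close> into that domain.\<close>

lemma partial_section_extend:
  assumes "field K" "module K A" "module K B"
    and G: "partial_section K A B f G"
    and b0: "b0 \<in> carrier B" "b0 \<notin> Domain G" and a0: "a0 \<in> carrier A"
    and sec: "\<And>c b a. \<lbrakk>c \<in> carrier K; (b, a) \<in> G; c \<odot>\<^bsub>B\<^esub> b0 \<oplus>\<^bsub>B\<^esub> b \<in> f ` carrier A\<rbrakk>
      \<Longrightarrow> f (c \<odot>\<^bsub>A\<^esub> a0 \<oplus>\<^bsub>A\<^esub> a) = c \<odot>\<^bsub>B\<^esub> b0 \<oplus>\<^bsub>B\<^esub> b"
  shows "\<exists>G'. partial_section K A B f G' \<and> G \<subseteq> G' \<and> b0 \<in> Domain G'"
proof -
  interpret K: field K by fact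
  interpret A: module K A by fact
  interpret B: module K B by fact
  note cl = partial_sectionD(1)[OF G] and z = partial_sectionD(2)[OF G] and ad = partial_sectionD(3)[OF G]
    and sm = partial_sectionD(4)[OF G] and sv = partial_sectionD(5)[OF G]
  let ?G = "{(c \<odot>\<^bsub>B\<^esub> b0 \<oplus>\<^bsub>B\<^esub> b, c \<odot>\<^bsub>A\<^esub> a0 \<oplus>\<^bsub>A\<^esub> a) | c b a. c \<in> carrier K \<and> (b, a) \<in> G}"
  have sub: "G \<subseteq> ?G"
  proof clarify
    fix b a assume "(b, a) \<in> G"
    then show "\<exists>c b' a'. (b, a) = (c \<odot>\<^bsub>B\<^esub> b0 \<oplus>\<^bsub>B\<^esub> b', c \<odot>\<^bsub>A\<^esub> a0 \<oplus>\<^bsub>A\<^esub> a') \<and> c \<in> carrier K \<and> (b', a') \<in> G"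
      using cl b0(1) a0 by (intro exI[of _ "\<zero>\<^bsub>K\<^esub>"] exI[of _ b] exI[of _ a]) auto
  qed
  have dom: "b0 \<in> Domain ?G"
    by (rule DomainI[of _ "\<one>\<^bsub>K\<^esub> \<odot>\<^bsub>A\<^esub> a0 \<oplus>\<^bsub>A\<^esub> \<zero>\<^bsub>A\<^esub>"]) (use z b0(1) in \<open>auto intro!: exI[of _ "\<one>\<^bsub>K\<^esub>"] exI[of _ "\<zero>\<^bsub>B\<^esub>"]\<close>)
  have sv': "c \<odot>\<^bsub>A\<^esub> a0 \<oplus>\<^bsub>A\<^esub> a = \<zero>\<^bsub>A\<^esub>"
    if c: "c \<in> carrier K" and ba: "(b, a) \<in> G" and e: "c \<odot>\<^bsub>B\<^esub> b0 \<oplus>\<^bsub>B\<^esub> b = \<zero>\<^bsub>B\<^esub>" for c b a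
  proof (cases "c = \<zero>\<^bsub>K\<^esub>")
    case True
    then have "b = \<zero>\<^bsub>B\<^esub>" using e b0 cl[OF ba] by simp
    then show ?thesis using sv ba True a0 cl[OF ba] by auto
  next
    case False
    then have u: "c \<in> Units K" using c K.field_Units by simp
    let ?d = "\<ominus>\<^bsub>K\<^esub> (inv\<^bsub>K\<^esub> c)"
    have d: "?d \<in> carrier K" "inv\<^bsub>K\<^esub> c \<in> carrier K" using u by auto
    have "c \<odot>\<^bsub>B\<^esub> b0 = \<ominus>\<^bsub>B\<^esub> b" using e b0(1) c cl[OF ba] B.minus_equality by (metis B.smult_closed)
    then have "inv\<^bsub>K\<^esub> c \<odot>\<^bsub>B\<^esub> (c \<odot>\<^bsub>B\<^esub> b0) = ?d \<odot>\<^bsub>B\<^esub> b"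
      using d cl[OF ba] by (simp add: B.smult_r_minus B.smult_l_minus)
    then have "b0 = ?d \<odot>\<^bsub>B\<^esub> b" using d c b0(1) u by (simp flip: B.smult_assoc1)
    then have "b0 \<in> Domain G" using sm[OF d(1) ba] by blast
    then show ?thesis using b0(2) by blast
  qed
  have "partial_section K A B f ?G"
    unfolding partial_section_def
  proof (intro conjI allI impI)
    show "?G \<subseteq> carrier B \<times> carrier A" using cl a0 b0(1) by auto
    show "(\<zero>\<^bsub>B\<^esub>, \<zero>\<^bsub>A\<^esub>) \<in> ?G" using sub z by blast
    show "(b \<oplus>\<^bsub>B\<^esub> b', a \<oplus>\<^bsub>A\<^esub> a') \<in> ?G" if "(b, a) \<in> ?G" "(b', a') \<in> ?G" for b a b' a'
    proof -
      obtain c x y c' x' y' where e: "b = c \<odot>\<^bsub>B\<^esub> b0 \<oplus>\<^bsub>B\<^esub> x" "a = c \<odot>\<^bsub>A\<^esub> a0 \<oplus>\<^bsub>A\<^esub> y" "c \<in> carrier K" "(x, y) \<in> G"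
        "b' = c' \<odot>\<^bsub>B\<^esub> b0 \<oplus>\<^bsub>B\<^esub> x'" "a' = c' \<odot>\<^bsub>A\<^esub> a0 \<oplus>\<^bsub>A\<^esub> y'" "c' \<in> carrier K" "(x', y') \<in> G"
        using \<open>(b, a) \<in> ?G\<close> \<open>(b', a') \<in> ?G\<close> by auto
      have "b \<oplus>\<^bsub>B\<^esub> b' = (c \<oplus>\<^bsub>K\<^esub> c') \<odot>\<^bsub>B\<^esub> b0 \<oplus>\<^bsub>B\<^esub> (x \<oplus>\<^bsub>B\<^esub> x')"
        "a \<oplus>\<^bsub>A\<^esub> a' = (c \<oplus>\<^bsub>K\<^esub> c') \<odot>\<^bsub>A\<^esub> a0 \<oplus>\<^bsub>A\<^esub> (y \<oplus>\<^bsub>A\<^esub> y')"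
        using e cl[OF e(4)] cl[OF e(8)] a0 b0(1) by (simp_all add: B.smult_l_distr A.smult_l_distr A.a_ac B.a_ac)
      then show ?thesis using ad[OF e(4,8)] K.a_closed[OF e(3,7)] by blast
    qed
    show "(c \<odot>\<^bsub>B\<^esub> b, c \<odot>\<^bsub>A\<^esub> a) \<in> ?G" if c: "c \<in> carrier K" and ba: "(b, a) \<in> ?G" for c b a
    proof -
      obtain c' x' y' where e: "b = c' \<odot>\<^bsub>B\<^esub> b0 \<oplus>\<^bsub>B\<^esub> x'" "a = c' \<odot>\<^bsub>A\<^esub> a0 \<oplus>\<^bsub>A\<^esub> y'" "c' \<in> carrier K" "(x', y') \<in> G"
        using ba by auto
      have "c \<odot>\<^bsub>B\<^esub> b = (c \<otimes>\<^bsub>K\<^esub> c') \<odot>\<^bsub>B\<^esub> b0 \<oplus>\<^bsub>B\<^esub> (c \<odot>\<^bsub>B\<^esub> x')"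
        "c \<odot>\<^bsub>A\<^esub> a = (c \<otimes>\<^bsub>K\<^esub> c') \<odot>\<^bsub>A\<^esub> a0 \<oplus>\<^bsub>A\<^esub> (c \<odot>\<^bsub>A\<^esub> y')"
        using e cl[OF e(4)] a0 b0(1) c by (simp_all add: B.smult_r_distr A.smult_r_distr A.smult_assoc1 B.smult_assoc1)
      then show ?thesis using sm[OF c e(4)] K.m_closed[OF c e(3)] by blast
    qed
    show "a = \<zero>\<^bsub>A\<^esub>" if "(\<zero>\<^bsub>B\<^esub>, a) \<in> ?G" for a
      using that sv' by force
    show "f a = b" if "(b, a) \<in> ?G" "b \<in> f ` carrier A" for b a
      using that sec by blast
  qed
  then show ?thesis using sub dom by blast
qed

text \<open>A maximal partial section is total, because a missing vector can always be adjoined. For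
  an arbitrary \<open>f\<close>, surjective or not, this supplies the sections of quotient maps as
  well as both homotopies of the splittings below.\<close>

lemma generalized_inverse:
  assumes "field K" "module K A" "module K B" "f \<in> mod_hom K A B"
  obtains s where "s \<in> mod_hom K B A" "\<And>x. x \<in> carrier A \<Longrightarrow> f (s (f x)) = f x"
proof -
  interpret K: field K by fact
  interpret A: module K A by fact
  interpret B: module K B by fact
  let ?P = "Collect (partial_section K A B f)"
  have "partial_section K A B f {(\<zero>\<^bsub>B\<^esub>, \<zero>\<^bsub>A\<^esub>)}"
    unfolding partial_section_def using mod_hom_zero[OF assms(2-4)] by auto
  then have "?P \<noteq> {}" by blast
  moreover have "\<Union>C \<in> ?P" if ne: "C \<noteq> {}" and chain: "subset.chain ?P C" for C
  proof -
    have C: "\<And>G. G \<in> C \<Longrightarrow> partial_section K A B f G"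
      and ch: "\<And>G G'. G \<in> C \<Longrightarrow> G' \<in> C \<Longrightarrow> G \<subseteq> G' \<or> G' \<subseteq> G"
      using chain unfolding subset.chain_def by auto
    obtain G0 where "G0 \<in> C" using ne by blast
    then have z: "(\<zero>\<^bsub>B\<^esub>, \<zero>\<^bsub>A\<^esub>) \<in> \<Union>C" using C unfolding partial_section_def by blast
    have ad: "(b \<oplus>\<^bsub>B\<^esub> b', a \<oplus>\<^bsub>A\<^esub> a') \<in> \<Union>C" if ba: "(b, a) \<in> \<Union>C" "(b', a') \<in> \<Union>C" for b a b' a'
    proof -
      obtain G G' where "G \<in> C" "(b, a) \<in> G" "G' \<in> C" "(b', a') \<in> G'" using ba by blast
      then obtain H where "H \<in> C" "(b, a) \<in> H" "(b', a') \<in> H" using ch by blast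
      then show ?thesis using C unfolding partial_section_def by blast
    qed
    show ?thesis unfolding mem_Collect_eq partial_section_def
    proof (intro conjI allI impI)
      show "\<Union>C \<subseteq> carrier B \<times> carrier A" using C unfolding partial_section_def by blast
      show "(c \<odot>\<^bsub>B\<^esub> b, c \<odot>\<^bsub>A\<^esub> a) \<in> \<Union>C" if "c \<in> carrier K" "(b, a) \<in> \<Union>C" for c b a
        using that C unfolding partial_section_def by blast
      show "a = \<zero>\<^bsub>A\<^esub>" if "(\<zero>\<^bsub>B\<^esub>, a) \<in> \<Union>C" for a
        using that C unfolding partial_section_def by blast
      show "f a = b" if "(b, a) \<in> \<Union>C" "b \<in> f ` carrier A" for b a
        using that C unfolding partial_section_def by blast
    qed (use z ad in blast)+
  qed
  ultimately obtain G where G: "partial_section K A B f G"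
    and mx: "\<And>G'. partial_section K A B f G' \<Longrightarrow> G \<subseteq> G' \<Longrightarrow> G' = G"
    using subset_Zorn_nonempty[of ?P] by auto
  note cl = partial_sectionD(1)[OF G] and ad = partial_sectionD(3)[OF G] and sm = partial_sectionD(4)[OF G]
    and sv = partial_sectionD(5)[OF G] and sec = partial_sectionD(6)[OF G]
  have neg: "(\<ominus>\<^bsub>B\<^esub> b, \<ominus>\<^bsub>A\<^esub> a) \<in> G" if "(b, a) \<in> G" for b a
    using sm[of "\<ominus>\<^bsub>K\<^esub> \<one>\<^bsub>K\<^esub>" b a] that cl[OF that] by (simp add: A.smult_l_minus B.smult_l_minus)
  have im: "submodule (f ` carrier A) K B" by (rule image_submodule[OF assms(2-4)])
  note im = B.submoduleE[OF im]
  have total: "b \<in> Domain G" if b: "b \<in> carrier B" for b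
  proof (rule ccontr)
    assume nd: "b \<notin> Domain G"
    show False
    proof (cases "\<exists>u\<in>Domain G. b \<oplus>\<^bsub>B\<^esub> u \<in> f ` carrier A")
      \<comment> \<open>A translate of \<open>b\<close> by a domain element lies in the image.
        Adjoining the translate together with a preimage keeps the section property, and the
        translate lies outside the domain just as \<open>b\<close> does.\<close>
      case True
      then obtain u w a0 where u: "(u, w) \<in> G" and a0: "a0 \<in> carrier A" "f a0 = b \<oplus>\<^bsub>B\<^esub> u"
        by (auto simp: image_iff)
      have uB: "u \<in> carrier B" using cl[OF u] by simp
      have "b \<oplus>\<^bsub>B\<^esub> u \<notin> Domain G"
      proof
        assume "b \<oplus>\<^bsub>B\<^esub> u \<in> Domain G"
        then obtain x where "(b \<oplus>\<^bsub>B\<^esub> u, x) \<in> G" by blast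
        from ad[OF this neg[OF u]] have "((b \<oplus>\<^bsub>B\<^esub> u) \<oplus>\<^bsub>B\<^esub> \<ominus>\<^bsub>B\<^esub> u, x \<oplus>\<^bsub>A\<^esub> \<ominus>\<^bsub>A\<^esub> w) \<in> G" .
        moreover have "(b \<oplus>\<^bsub>B\<^esub> u) \<oplus>\<^bsub>B\<^esub> \<ominus>\<^bsub>B\<^esub> u = b" using b uB by (simp add: B.a_assoc B.r_neg)
        ultimately show False using nd by auto
      qed
      moreover have "f (c \<odot>\<^bsub>A\<^esub> a0 \<oplus>\<^bsub>A\<^esub> a) = c \<odot>\<^bsub>B\<^esub> (b \<oplus>\<^bsub>B\<^esub> u) \<oplus>\<^bsub>B\<^esub> b'"
        if c: "c \<in> carrier K" and ba: "(b', a) \<in> G" and i: "c \<odot>\<^bsub>B\<^esub> (b \<oplus>\<^bsub>B\<^esub> u) \<oplus>\<^bsub>B\<^esub> b' \<in> f ` carrier A" for c b' a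
      proof -
        let ?x = "c \<odot>\<^bsub>B\<^esub> (b \<oplus>\<^bsub>B\<^esub> u)"
        have x: "?x \<in> f ` carrier A" using im(4)[OF c imageI[of a0 "carrier A" f]] a0 by simp
        have xc: "?x \<in> carrier B" using b uB c by simp
        have "\<ominus>\<^bsub>B\<^esub> ?x \<oplus>\<^bsub>B\<^esub> (?x \<oplus>\<^bsub>B\<^esub> b') \<in> f ` carrier A" using im(5)[OF im(3)[OF x] i] .
        moreover have "\<ominus>\<^bsub>B\<^esub> ?x \<oplus>\<^bsub>B\<^esub> (?x \<oplus>\<^bsub>B\<^esub> b') = b'" using xc cl[OF ba] by (simp add: B.r_neg1)
        ultimately have "f a = b'" using sec[OF ba] by simp
        then show ?thesis using a0 c cl[OF ba] by (simp add: mod_hom_add[OF assms(4)] mod_hom_smult[OF assms(4)])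
      qed
      ultimately obtain G' where "partial_section K A B f G'" "G \<subseteq> G'" "b \<oplus>\<^bsub>B\<^esub> u \<in> Domain G'"
        using partial_section_extend[OF assms(1-3) G, of "b \<oplus>\<^bsub>B\<^esub> u" a0] b uB a0(1) by auto
      then show False using mx \<open>b \<oplus>\<^bsub>B\<^esub> u \<notin> Domain G\<close> by blast
    next
      \<comment> \<open>No translate lies in the image. Dividing by \<open>c\<close> shows that a
        combination of \<open>b\<close> with coefficient \<open>c\<close> and a domain element can
        lie in the image only for \<open>c = 0\<close>, so \<open>b\<close> may be sent to
        zero.\<close>
      case False
      have "f (c \<odot>\<^bsub>A\<^esub> \<zero>\<^bsub>A\<^esub> \<oplus>\<^bsub>A\<^esub> a) = c \<odot>\<^bsub>B\<^esub> b \<oplus>\<^bsub>B\<^esub> b'"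
        if c: "c \<in> carrier K" and ba: "(b', a) \<in> G" and i: "c \<odot>\<^bsub>B\<^esub> b \<oplus>\<^bsub>B\<^esub> b' \<in> f ` carrier A" for c b' a
      proof (cases "c = \<zero>\<^bsub>K\<^esub>")
        case True
        then show ?thesis using sec[OF ba] i b cl[OF ba] by simp
      next
        case nz: False
        then have u: "c \<in> Units K" using c K.field_Units by simp
        have "inv\<^bsub>K\<^esub> c \<odot>\<^bsub>B\<^esub> (c \<odot>\<^bsub>B\<^esub> b \<oplus>\<^bsub>B\<^esub> b') \<in> f ` carrier A" using im(4) i u by blast
        moreover have "inv\<^bsub>K\<^esub> c \<odot>\<^bsub>B\<^esub> (c \<odot>\<^bsub>B\<^esub> b \<oplus>\<^bsub>B\<^esub> b') = b \<oplus>\<^bsub>B\<^esub> inv\<^bsub>K\<^esub> c \<odot>\<^bsub>B\<^esub> b'"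
          using u c b cl[OF ba] by (simp add: B.smult_r_distr flip: B.smult_assoc1)
        moreover have "inv\<^bsub>K\<^esub> c \<odot>\<^bsub>B\<^esub> b' \<in> Domain G" using sm[OF _ ba, of "inv\<^bsub>K\<^esub> c"] u by blast
        ultimately show ?thesis using False by auto
      qed
      then obtain G' where "partial_section K A B f G'" "G \<subseteq> G'" "b \<in> Domain G'"
        using partial_section_extend[OF assms(1-3) G b nd A.zero_closed] by auto
      then show False using mx nd by blast
    qed
  qed
  have uniq: "a = a'" if "(b, a) \<in> G" "(b, a') \<in> G" for b a a'
  proof -
    have "(b \<oplus>\<^bsub>B\<^esub> \<ominus>\<^bsub>B\<^esub> b, a \<oplus>\<^bsub>A\<^esub> \<ominus>\<^bsub>A\<^esub> a') \<in> G" using ad[OF that(1) neg[OF that(2)]] .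
    then have "a \<ominus>\<^bsub>A\<^esub> a' = \<zero>\<^bsub>A\<^esub>" using sv cl[OF that(1)] by (simp add: B.r_neg a_minus_def)
    then show ?thesis using A.minus_eq_zero_iff cl that by metis
  qed
  define s where "s = (\<lambda>b. THE a. (b, a) \<in> G)"
  have s: "s b = a" if "(b, a) \<in> G" for b a
    unfolding s_def by (rule the_equality) (use that uniq in auto)
  have sG: "(b, s b) \<in> G" if "b \<in> carrier B" for b
    using total[OF that] s by (auto simp: Domain_iff)
  have "s \<in> mod_hom K B A"
    by (rule mod_homI) (auto intro: cl[OF sG, THEN conjunct2] s[OF ad[OF sG sG]] s[OF sm[OF _ sG]])
  moreover have "f (s (f x)) = f x" if "x \<in> carrier A" for x
    by (rule sec[OF sG[OF mod_hom_closed[OF assms(4) that]] imageI[OF that]])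
  ultimately show thesis using that by blast
qed

lemma surjection_section:
  assumes "field K" "module K A" "module K B" "f \<in> mod_hom K A B" "f ` carrier A = carrier B"
  obtains s where "s \<in> mod_hom K B A" "\<And>b. b \<in> carrier B \<Longrightarrow> f (s b) = b"
proof -
  obtain s where s: "s \<in> mod_hom K B A" "\<And>x. x \<in> carrier A \<Longrightarrow> f (s (f x)) = f x"
    using generalized_inverse[OF assms(1-4)] by blast
  have "f (s b) = b" if "b \<in> carrier B" for b
  proof -
    from that obtain x where "x \<in> carrier A" "b = f x" using assms(5) by (metis imageE)
    then show ?thesis using s(2) by simp
  qed
  with s(1) show thesis by (rule that)
qed

text \<open>\<open>s\<close> and \<open>s'\<close> are the two parts of a contracting homotopy on a complement of the embedded homology.\<close>

lemma hodge_decomposition: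
  assumes "field K" "module K A" "module K B" "module K C"
    and f: "f \<in> mod_hom K A B" and g: "g \<in> mod_hom K B C"
    and gf: "\<And>x. x \<in> carrier A \<Longrightarrow> g (f x) = \<zero>\<^bsub>C\<^esub>"
  defines "Z \<equiv> {x \<in> carrier B. g x = \<zero>\<^bsub>C\<^esub>}"
  defines "H \<equiv> quot_module (B\<lparr>carrier := Z\<rparr>) (f ` carrier A)"
  obtains \<rho> \<tau> s s' where "module K H" "\<rho> \<in> mod_hom K B H" "\<tau> \<in> mod_hom K H B" "s \<in> mod_hom K B A" "s' \<in> mod_hom K C B"
    "\<And>x. x \<in> carrier B \<Longrightarrow> x = \<tau> (\<rho> x) \<oplus>\<^bsub>B\<^esub> f (s x) \<oplus>\<^bsub>B\<^esub> s' (g x)"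
    "\<And>x. x \<in> carrier A \<Longrightarrow> \<rho> (f x) = \<zero>\<^bsub>H\<^esub>" "\<And>a. a \<in> carrier H \<Longrightarrow> \<rho> (\<tau> a) = a"
    "\<And>a. a \<in> carrier H \<Longrightarrow> g (\<tau> a) = \<zero>\<^bsub>C\<^esub>"
proof -
  interpret A: module K A by fact
  interpret B: module K B by fact
  interpret C: module K C by fact
  let ?Z = "B\<lparr>carrier := Z\<rparr>"
  have Z: "submodule Z K B" unfolding Z_def by (rule kernel_submodule[OF assms(3,4) g])
  have Zm: "module K ?Z" by (rule submodule.submodule_is_module[OF Z assms(3)])
  have I: "submodule (f ` carrier A) K B" by (rule image_submodule[OF assms(2,3) f])
  have IZ: "f ` carrier A \<subseteq> Z" using gf mod_hom_closed[OF f] by (auto simp: Z_def)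
  have I': "submodule (f ` carrier A) K ?Z" by (rule submodule_restrict[OF assms(3) Z I IZ])
  have Hm: "module K H" unfolding H_def by (rule quot_module_is_module[OF Zm I'])
  interpret Z: module K ?Z by (rule Zm)
  interpret H: module K H by (rule Hm)
  let ?q = "\<lambda>x. f ` carrier A +>\<^bsub>?Z\<^esub> x"
  have q: "?q \<in> mod_hom K ?Z H" unfolding H_def by (rule coset_hom[OF Zm I'])
  have qs: "?q ` carrier ?Z = carrier H" unfolding H_def by (rule coset_image)
  obtain \<tau> where \<tau>: "\<tau> \<in> mod_hom K H ?Z" "\<And>a. a \<in> carrier H \<Longrightarrow> ?q (\<tau> a) = a"
    using surjection_section[OF assms(1) Zm Hm q qs] by blast
  obtain s0 where s0: "s0 \<in> mod_hom K B A" "\<And>x. x \<in> carrier A \<Longrightarrow> f (s0 (f x)) = f x"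
    using generalized_inverse[OF assms(1,2,3) f] by blast
  obtain s' where s': "s' \<in> mod_hom K C B" "\<And>x. x \<in> carrier B \<Longrightarrow> g (s' (g x)) = g x"
    using generalized_inverse[OF assms(1,3,4) g] by blast
  have ZB: "x \<in> carrier B" if "x \<in> Z" for x using that by (simp add: Z_def)
  have \<tau>B: "\<tau> \<in> mod_hom K H B" using \<tau>(1) ZB by (auto simp: mod_hom_def Pi_iff)
  have \<tau>Z: "\<tau> a \<in> Z" if "a \<in> carrier H" for a using mod_hom_closed[OF \<tau>(1) that] by simp
  \<comment> \<open>Subtracting \<open>s' (g x)\<close> projects onto the kernel of
    \<open>g\<close>, where the quotient map and its section \<open>\<tau>\<close> then separate
    homology from boundaries.\<close>
  define z where "z = (\<lambda>x. x \<ominus>\<^bsub>B\<^esub> s' (g x))"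
  have zB: "z \<in> mod_hom K B B" unfolding z_def
    by (intro mod_hom_minusf assms mod_hom_id mod_hom_comp[OF s'(1) g])
  have gz: "g (z x) = \<zero>\<^bsub>C\<^esub>" if "x \<in> carrier B" for x
    unfolding z_def using that s'(2)[OF that] mod_hom_closed[OF g] mod_hom_closed[OF s'(1)]
    by (simp add: mod_hom_minus[OF assms(3,4) g] C.minus_eq_zero_iff)
  have zZ: "z x \<in> Z" if "x \<in> carrier B" for x using gz that mod_hom_closed[OF zB] by (simp add: Z_def)
  have zZ': "z \<in> mod_hom K B ?Z" using zB zZ by (auto simp: mod_hom_def)
  define \<rho> where "\<rho> = (\<lambda>x. ?q (z x))"
  have \<rho>: "\<rho> \<in> mod_hom K B H" unfolding \<rho>_def by (rule mod_hom_comp[OF q zZ'])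
  \<comment> \<open>The cycle \<open>z x\<close> and the chosen representative of its class differ
    by a boundary, and on boundaries \<open>s0\<close> inverts \<open>f\<close>.\<close>
  define s where "s = (\<lambda>x. s0 (z x \<ominus>\<^bsub>B\<^esub> \<tau> (\<rho> x)))"
  have s: "s \<in> mod_hom K B A" unfolding s_def
    by (intro mod_hom_comp[OF s0(1)] mod_hom_minusf assms zB mod_hom_comp[OF \<tau>B \<rho>])
  have zz: "z x = x" if "x \<in> Z" for x
    unfolding z_def using that mod_hom_zero[OF assms(4,3) s'(1)] by (simp add: Z_def a_minus_def)
  have fs: "f (s x) = z x \<ominus>\<^bsub>B\<^esub> \<tau> (\<rho> x)" if x: "x \<in> carrier B" for x
  proof -
    let ?y = "\<tau> (\<rho> x)"
    have y: "?y \<in> Z" "z x \<in> Z" using \<tau>Z zZ x mod_hom_closed[OF \<rho>] by auto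
    have "?q (z x) = ?q ?y" using \<tau>(2)[of "\<rho> x"] mod_hom_closed[OF \<rho> x] by (simp add: \<rho>_def)
    then have "z x \<ominus>\<^bsub>B\<^esub> ?y \<in> f ` carrier A"
      using coset_eq_iff[OF assms(3) I ZB[OF y(2)] ZB[OF y(1)]] by simp
    then show ?thesis using s0(2) unfolding s_def by auto
  qed
  show thesis
  proof (rule that[OF Hm \<rho> \<tau>B s s'(1)])
    fix x assume x: "x \<in> carrier B"
    have cl: "\<tau> (\<rho> x) \<in> carrier B" "s' (g x) \<in> carrier B" "z x \<in> carrier B"
      using x mod_hom_closed[OF \<rho>] mod_hom_closed[OF \<tau>B] mod_hom_closed[OF g] mod_hom_closed[OF s'(1)] mod_hom_closed[OF zB] by auto
    have "\<tau> (\<rho> x) \<oplus>\<^bsub>B\<^esub> f (s x) = z x" using cl fs[OF x] by (simp add: a_minus_def B.a_ac B.r_neg1 B.r_neg2 B.r_neg)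
    moreover have "z x \<oplus>\<^bsub>B\<^esub> s' (g x) = x" using cl x by (simp add: z_def a_minus_def B.a_assoc B.l_neg)
    ultimately show "x = \<tau> (\<rho> x) \<oplus>\<^bsub>B\<^esub> f (s x) \<oplus>\<^bsub>B\<^esub> s' (g x)" by simp
  next
    fix x assume x: "x \<in> carrier A"
    then have "f x \<in> Z" using IZ by auto
    then show "\<rho> (f x) = \<zero>\<^bsub>H\<^esub>"
      using coset_zero_iff[OF Zm I', of "f x"] x zz by (simp add: \<rho>_def H_def)
  next
    fix a assume a: "a \<in> carrier H"
    show "\<rho> (\<tau> a) = a" using zz[OF \<tau>Z[OF a]] \<tau>(2)[OF a] by (simp add: \<rho>_def)
    show "g (\<tau> a) = \<zero>\<^bsub>C\<^esub>" using \<tau>Z[OF a] by (simp add: Z_def)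
  qed
qed

text \<open>Two differentials occur because \<open>d'\<close>, which defines the homology, is only
  known to agree with \<open>d\<close> on the modules and in positive degrees. Setting
  \<open>d 0\<close> to zero makes its kernel all of \<open>M 0\<close>, which is the convention of
  \<open>cycles\<close> in degree 0.\<close>

lemma homology_splitting:
  fixes M :: "nat \<Rightarrow> ('k, 'a, 'x) module_scheme"
  assumes K: "field K" and M: "\<And>k. module K (M k)" and d: "\<And>k. d k \<in> mod_hom K (M k) (M (k - 1))"
    and d0: "\<And>x. d 0 x = \<zero>\<^bsub>M 0\<^esub>"
    and d_d: "\<And>k x. x \<in> carrier (M (Suc (Suc k))) \<Longrightarrow> d (Suc k) (d (Suc (Suc k)) x) = \<zero>\<^bsub>M k\<^esub>"
    and d': "\<And>k x. x \<in> carrier (M (Suc k)) \<Longrightarrow> d' (Suc k) x = d (Suc k) x"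
  obtains \<rho> \<tau> s s' where "module K (homology M d' q)" "\<rho> \<in> mod_hom K (M q) (homology M d' q)"
    "\<tau> \<in> mod_hom K (homology M d' q) (M q)" "s \<in> mod_hom K (M q) (M (Suc q))" "s' \<in> mod_hom K (M (q - 1)) (M q)"
    "\<And>x. x \<in> carrier (M q) \<Longrightarrow> x = \<tau> (\<rho> x) \<oplus>\<^bsub>M q\<^esub> d (Suc q) (s x) \<oplus>\<^bsub>M q\<^esub> s' (d q x)"
    "\<And>x. x \<in> carrier (M (Suc q)) \<Longrightarrow> \<rho> (d (Suc q) x) = \<zero>\<^bsub>homology M d' q\<^esub>"
    "\<And>a. a \<in> carrier (homology M d' q) \<Longrightarrow> \<rho> (\<tau> a) = a"
    "\<And>a. a \<in> carrier (homology M d' q) \<Longrightarrow> d q (\<tau> a) = \<zero>\<^bsub>M (q - 1)\<^esub>"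
proof -
  have "cycles M d' q = {x \<in> carrier (M q). d q x = \<zero>\<^bsub>M (q - 1)\<^esub>}"
    by (cases q) (auto simp: cycles_def d0 d')
  moreover have "d' (Suc q) ` carrier (M (Suc q)) = d (Suc q) ` carrier (M (Suc q))"
    by (rule image_cong) (simp_all add: d')
  ultimately have H: "homology M d' q =
      quot_module ((M q)\<lparr>carrier := {x \<in> carrier (M q). d q x = \<zero>\<^bsub>M (q - 1)\<^esub>}\<rparr>) (d (Suc q) ` carrier (M (Suc q)))"
    by (simp add: homology_def)
  have f: "d (Suc q) \<in> mod_hom K (M (Suc q)) (M q)" using d[of "Suc q"] by simp
  have gf: "d q (d (Suc q) x) = \<zero>\<^bsub>M (q - 1)\<^esub>" if "x \<in> carrier (M (Suc q))" for x
    using that by (cases q) (simp_all add: d0 d_d)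
  show thesis
    by (rule hodge_decomposition[OF K M M M f d gf]) (simp, rule that[unfolded H])
qed

section \<open>The spectral sequence of a filtered complex\<close>

locale filtered_complex =
  fixes K :: "('k, 'r) ring_scheme" and V :: "int \<Rightarrow> ('k, 'c) module"
    and d :: "int \<Rightarrow> 'c \<Rightarrow> 'c" and F :: "int \<Rightarrow> int \<Rightarrow> 'c set"
  assumes V_module: "module K (V m)"
    and d_hom: "d m \<in> mod_hom K (V m) (V (m - 1))"
    and d_d: "x \<in> carrier (V m) \<Longrightarrow> d (m - 1) (d m x) = \<zero>\<^bsub>V (m - 2)\<^esub>"
    and F_submodule: "submodule (F p m) K (V m)"
    and F_mono: "F (p - 1) m \<subseteq> F p m"
    and F_low: "p < 0 \<Longrightarrow> F p m = {\<zero>\<^bsub>V m\<^esub>}"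
    and F_high: "m \<le> p \<Longrightarrow> F p m = carrier (V m)"
    and F_d: "x \<in> F p m \<Longrightarrow> d m x \<in> F p (m - 1)"
begin

sublocale V: module K "V m" for m by (rule V_module)

definition Z :: "nat \<Rightarrow> int \<Rightarrow> int \<Rightarrow> 'c set"
  where "Z r p m = {x \<in> F p m. d m x \<in> F (p - int r) (m - 1)}"

text \<open>The relations of the page \<open>r = s + 1\<close>.\<close>

definition B :: "nat \<Rightarrow> int \<Rightarrow> int \<Rightarrow> 'c set"
  where "B s p m = Z s (p - 1) m <+>\<^bsub>V m\<^esub> d (m + 1) ` Z s (p + int s) (m + 1)"

text \<open>Page \<open>s\<close> here is page \<open>s + 1\<close> of the spectral sequence, and
  \<open>m\<close> is the total degree. The shift keeps natural-number subtraction out of the page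
  index.\<close>

definition page :: "nat \<Rightarrow> int \<Rightarrow> int \<Rightarrow> ('k, 'c set) module"
  where "page s p m = quot_module ((V m)\<lparr>carrier := Z (Suc s) p m\<rparr>) (B s p m)"

definition E :: "nat \<Rightarrow> int \<Rightarrow> int \<Rightarrow> ('k, 'c set) module"
  where "E r p q = page (r - 1) p (p + q)"

text \<open>The class of \<open>d\<close> applied to an arbitrary representative; \<open>d_B\<close>
  makes it independent of the choice.\<close>

definition \<delta> :: "nat \<Rightarrow> int \<Rightarrow> int \<Rightarrow> 'c set \<Rightarrow> 'c set"
  where "\<delta> s p m X = B s (p - int s - 1) (m - 1) +>\<^bsub>V (m - 1)\<^esub> d m (SOME x. x \<in> X)"

definition dE :: "nat \<Rightarrow> int \<Rightarrow> int \<Rightarrow> 'c set \<Rightarrow> 'c set"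
  where "dE r p q = \<delta> (r - 1) p (p + q)"

lemma F_carrier: "x \<in> F p m \<Longrightarrow> x \<in> carrier (V m)"
  using V.submoduleE(1)[OF F_submodule] by blast

lemma d_closed: "x \<in> carrier (V m) \<Longrightarrow> d m x \<in> carrier (V (m - 1))"
  by (rule mod_hom_closed[OF d_hom])

lemma d_hom': "d (m + 1) \<in> mod_hom K (V (m + 1)) (V m)"
  using d_hom[of "m + 1"] by simp

lemma d_closed': "x \<in> carrier (V (m + 1)) \<Longrightarrow> d (m + 1) x \<in> carrier (V m)"
  by (rule mod_hom_closed[OF d_hom'])

lemma d_d': "x \<in> carrier (V (m + 1)) \<Longrightarrow> d m (d (m + 1) x) = \<zero>\<^bsub>V (m - 1)\<^esub>"
  using d_d[of x "m + 1"] by (simp add: diff_add_eq)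

lemma F_zero: "\<zero>\<^bsub>V m\<^esub> \<in> F p m"
  using subgroup.one_closed[OF submodule.axioms(1)[OF F_submodule]] by simp

lemma F_add: "x \<in> F p m \<Longrightarrow> y \<in> F p m \<Longrightarrow> x \<oplus>\<^bsub>V m\<^esub> y \<in> F p m"
  using V.submoduleE(5)[OF F_submodule] by blast

lemma F_minus: "x \<in> F p m \<Longrightarrow> y \<in> F p m \<Longrightarrow> x \<ominus>\<^bsub>V m\<^esub> y \<in> F p m"
  using V.submoduleE(3,5)[OF F_submodule] by (simp add: a_minus_def)

lemma F_mono': "p \<le> p' \<Longrightarrow> F p m \<subseteq> F p' m"
proof (induction rule: int_ge_induct)
  case (step i)
  then show ?case using F_mono[of "i + 1" m] by auto
qed simp

lemma Z_submodule: "submodule (Z r p m) K (V m)"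
proof -
  have "Z r p m = F p m \<inter> {x \<in> carrier (V m). d m x \<in> F (p - int r) (m - 1)}"
    using F_carrier by (auto simp: Z_def)
  then show ?thesis
    using submodule_inter[OF V_module F_submodule preimage_submodule[OF V_module V_module d_hom F_submodule]] by simp
qed

lemma Z_carrier: "x \<in> Z r p m \<Longrightarrow> x \<in> carrier (V m)"
  by (auto simp: Z_def F_carrier)

lemma Z_zero: "\<zero>\<^bsub>V m\<^esub> \<in> Z r p m"
  using subgroup.one_closed[OF submodule.axioms(1)[OF Z_submodule]] by simp

lemma mem_B: "x \<in> B s p m \<longleftrightarrow> (\<exists>w\<in>Z s (p - 1) m. \<exists>v\<in>Z s (p + int s) (m + 1). x = w \<oplus>\<^bsub>V m\<^esub> d (m + 1) v)"
  by (auto simp: B_def set_add_def')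

lemma B_submodule: "submodule (B s p m) K (V m)"
  unfolding B_def
  by (intro submodule_sum V_module Z_submodule submodule_image[OF V_module V_module d_hom'])

lemma Z_step: "Z s (p - 1) m \<subseteq> Z (Suc s) p m"
  using F_mono by (auto simp: Z_def algebra_simps)

lemma d_Z: "v \<in> Z s (p + int s) (m + 1) \<Longrightarrow> d (m + 1) v \<in> Z r p m"
  using d_d'[of v m] F_zero by (auto simp: Z_def F_carrier)

lemma B_sub_Z: "B s p m \<subseteq> Z (Suc s) p m"
proof
  fix x assume "x \<in> B s p m"
  then obtain w v where "w \<in> Z s (p - 1) m" "v \<in> Z s (p + int s) (m + 1)" "x = w \<oplus>\<^bsub>V m\<^esub> d (m + 1) v"
    by (auto simp: mem_B)
  then show "x \<in> Z (Suc s) p m"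
    using Z_step d_Z V.submoduleE(5)[OF Z_submodule] by blast
qed

lemma Z_module: "module K ((V m)\<lparr>carrier := Z r p m\<rparr>)"
  by (rule submodule.submodule_is_module[OF Z_submodule V_module])

lemma B_submodule_Z: "submodule (B s p m) K ((V m)\<lparr>carrier := Z (Suc s) p m\<rparr>)"
  by (rule submodule_restrict[OF V_module Z_submodule B_submodule B_sub_Z])

lemma page_module: "module K (page s p m)"
  unfolding page_def by (rule quot_module_is_module[OF Z_module B_submodule_Z])

abbreviation cls :: "nat \<Rightarrow> int \<Rightarrow> int \<Rightarrow> 'c \<Rightarrow> 'c set"
  where "cls s p m x \<equiv> B s p m +>\<^bsub>V m\<^esub> x"

lemma cls_hom: "cls s p m \<in> mod_hom K ((V m)\<lparr>carrier := Z (Suc s) p m\<rparr>) (page s p m)"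
  using coset_hom[OF Z_module B_submodule_Z] by (simp add: page_def)

lemma cls_image: "cls s p m ` Z (Suc s) p m = carrier (page s p m)"
  using coset_image[where N = "B s p m" and M = "(V m)\<lparr>carrier := Z (Suc s) p m\<rparr>"] by (simp add: page_def)

lemma page_zero: "\<zero>\<^bsub>page s p m\<^esub> = B s p m"
  by (simp add: page_def)

lemma cls_zero_iff: "x \<in> carrier (V m) \<Longrightarrow> cls s p m x = B s p m \<longleftrightarrow> x \<in> B s p m"
  by (rule coset_zero_iff[OF V_module B_submodule])

lemma cls_eq_iff: "x \<in> carrier (V m) \<Longrightarrow> y \<in> carrier (V m) \<Longrightarrow> cls s p m x = cls s p m y \<longleftrightarrow> x \<ominus>\<^bsub>V m\<^esub> y \<in> B s p m"
  by (rule coset_eq_iff[OF V_module B_submodule])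

lemma Z_B: "x \<in> Z s (p - 1) m \<Longrightarrow> x \<in> B s p m"
  unfolding mem_B using Z_zero[of "m + 1"] mod_hom_zero[OF V_module V_module d_hom', of m] Z_carrier
  by (rule_tac bexI[of _ x], rule_tac bexI[of _ "\<zero>\<^bsub>V (m + 1)\<^esub>"]) auto

text \<open>Of a relation w + d v only d w survives, and this is again a relation: \<open>w\<close>
  has filtration p - 1 = (p - s - 1) + s, which is exactly what the second summand of
  \<open>B s (p - int s - 1) (m - 1)\<close> admits.\<close>

lemma d_B: "x \<in> B s p m \<Longrightarrow> d m x \<in> B s (p - int s - 1) (m - 1)"
proof -
  assume "x \<in> B s p m"
  then obtain w v where wv: "w \<in> Z s (p - 1) m" "v \<in> Z s (p + int s) (m + 1)" "x = w \<oplus>\<^bsub>V m\<^esub> d (m + 1) v"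
    by (auto simp: mem_B)
  have "d m x = d m w \<oplus>\<^bsub>V (m - 1)\<^esub> d m (d (m + 1) v)"
    using wv Z_carrier d_closed' by (simp add: mod_hom_add[OF d_hom])
  also have "\<dots> = \<zero>\<^bsub>V (m - 1)\<^esub> \<oplus>\<^bsub>V (m - 1)\<^esub> d (m - 1 + 1) w"
    using wv Z_carrier d_d' d_closed by simp
  finally show ?thesis unfolding mem_B using wv(1) Z_zero by fastforce
qed

lemma \<delta>_cls:
  assumes "x \<in> Z (Suc s) p m"
  shows "\<delta> s p m (cls s p m x) = cls s (p - int s - 1) (m - 1) (d m x)"
proof -
  interpret S: abelian_subgroup "B s p m" "V m" by (rule submodule_abelian_subgroup[OF V_module B_submodule])
  have x: "x \<in> carrier (V m)" using assms Z_carrier by blast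
  define y where "y = (SOME y. y \<in> cls s p m x)"
  have y: "y \<in> cls s p m x" unfolding y_def using S.a_rcos_self[OF x] by (rule someI[where P = "\<lambda>y. y \<in> _"])
  have yc: "y \<in> carrier (V m)" by (rule S.a_elemrcos_carrier[OF x y])
  have "y \<ominus>\<^bsub>V m\<^esub> x \<in> B s p m" using S.a_rcos_module[OF x yc] y by (simp add: a_minus_def)
  from d_B[OF this] have "d m y \<ominus>\<^bsub>V (m - 1)\<^esub> d m x \<in> B s (p - int s - 1) (m - 1)"
    by (simp add: mod_hom_minus[OF V_module V_module d_hom yc x])
  then show ?thesis unfolding \<delta>_def y_def[symmetric] using cls_eq_iff d_closed x yc by simp
qed

lemma d_Z_page: "x \<in> Z (Suc s) p m \<Longrightarrow> d m x \<in> Z r (p - int s - 1) (m - 1)"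
  using d_Z[of x s "p - int s - 1" "m - 1" r] d_d[of x m] F_zero[of "m - 2"]
  by (auto simp: Z_def F_carrier algebra_simps)

lemma \<delta>_hom: "\<delta> s p m \<in> mod_hom K (page s p m) (page s (p - int s - 1) (m - 1))"
proof -
  let ?Z = "(V m)\<lparr>carrier := Z (Suc s) p m\<rparr>"
  let ?Z' = "(V (m - 1))\<lparr>carrier := Z (Suc s) (p - int s - 1) (m - 1)\<rparr>"
  let ?c = "\<lambda>x. cls s (p - int s - 1) (m - 1) (d m x)"
  interpret Z: module K ?Z by (rule Z_module)
  have "d m \<in> mod_hom K ?Z ?Z'"
    by (rule mod_hom_restrict[OF d_hom]) (use Z_carrier d_Z_page in auto)
  from mod_hom_comp[OF cls_hom this]
  have h: "?c \<in> mod_hom K ?Z (page s (p - int s - 1) (m - 1))" .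
  have ex: "\<exists>x\<in>carrier ?Z. X = cls s p m x" if "X \<in> carrier (page s p m)" for X
    using that unfolding cls_image[symmetric] by auto
  have \<delta>: "\<delta> s p m (cls s p m x) = ?c x" if "x \<in> carrier ?Z" for x using \<delta>_cls that by simp
  show ?thesis
  proof (rule mod_homI)
    fix X assume "X \<in> carrier (page s p m)"
    then show "\<delta> s p m X \<in> carrier (page s (p - int s - 1) (m - 1))"
      using ex \<delta> mod_hom_closed[OF h] by metis
  next
    fix X Y assume "X \<in> carrier (page s p m)" "Y \<in> carrier (page s p m)"
    then obtain x y where xy: "x \<in> carrier ?Z" "y \<in> carrier ?Z" "X = cls s p m x" "Y = cls s p m y" using ex by meson
    then show "\<delta> s p m (X \<oplus>\<^bsub>page s p m\<^esub> Y) = \<delta> s p m X \<oplus>\<^bsub>page s (p - int s - 1) (m - 1)\<^esub> \<delta> s p m Y"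
      using \<delta> mod_hom_add[OF h] mod_hom_add[OF cls_hom] Z.a_closed by metis
  next
    fix c X assume "c \<in> carrier K" "X \<in> carrier (page s p m)"
    then show "\<delta> s p m (c \<odot>\<^bsub>page s p m\<^esub> X) = c \<odot>\<^bsub>page s (p - int s - 1) (m - 1)\<^esub> \<delta> s p m X"
      using \<delta> ex mod_hom_smult[OF h] mod_hom_smult[OF cls_hom] Z.smult_closed by metis
  qed
qed

text \<open>Vanishing of the differential gives d x = w + d v, where \<open>v\<close> is itself a
  relation. Replacing \<open>x\<close> by x - v keeps the class and leaves the boundary
  \<open>w\<close>, which lies one filtration step lower than was known for d x.\<close>

lemma \<delta>_kernel:
  assumes "X \<in> carrier (page s p m)" "\<delta> s p m X = B s (p - int s - 1) (m - 1)"
  obtains x where "x \<in> Z (Suc (Suc s)) p m" "X = cls s p m x"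
proof -
  obtain x where x: "x \<in> Z (Suc s) p m" "X = cls s p m x" using assms(1) cls_image by (metis imageE)
  have xc: "x \<in> carrier (V m)" using x Z_carrier by blast
  have "d m x \<in> B s (p - int s - 1) (m - 1)"
    using assms(2) \<delta>_cls[OF x(1)] x(2) cls_zero_iff d_closed[OF xc] by simp
  then obtain w v where wv: "w \<in> Z s (p - int s - 1 - 1) (m - 1)" "v \<in> Z s (p - 1) m"
    "d m x = w \<oplus>\<^bsub>V (m - 1)\<^esub> d m v"
    by (auto simp: mem_B)
  have c: "v \<in> carrier (V m)" "w \<in> carrier (V (m - 1))" using wv Z_carrier by blast+
  have "d m (x \<ominus>\<^bsub>V m\<^esub> v) = w"
    using c xc wv(3) d_closed by (simp add: mod_hom_minus[OF V_module V_module d_hom] V.minus_minus_add)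
  moreover have "x \<ominus>\<^bsub>V m\<^esub> v \<in> F p m"
    using x wv(2) F_mono by (intro F_minus) (auto simp: Z_def)
  ultimately have "x \<ominus>\<^bsub>V m\<^esub> v \<in> Z (Suc (Suc s)) p m"
    using wv(1) by (auto simp: Z_def algebra_simps)
  moreover have "v \<in> B s p m"
    by (rule Z_B[OF wv(2)])
  then have "x \<ominus>\<^bsub>V m\<^esub> (x \<ominus>\<^bsub>V m\<^esub> v) \<in> B s p m"
    using xc c by (simp add: a_minus_def V.minus_add V.r_neg1 V.r_neg2 flip: V.a_assoc) (simp add: V.r_neg)
  then have "X = cls s p m (x \<ominus>\<^bsub>V m\<^esub> v)" using x(2) cls_eq_iff xc c by simp
  ultimately show thesis by (rule that)
qed

lemma Z_Suc: "Z (Suc r) p m \<subseteq> Z r p m"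
  using F_mono'[of "p - int (Suc r)" "p - int r"] by (auto simp: Z_def)

text \<open>Both conditions write \<open>x\<close> as a lower term plus a boundary and differ in
  what is asked of the two parts. In the reverse direction the two boundaries merge into that of y +
  v, and d w = d x shows that \<open>w\<close> meets the stronger condition.\<close>

lemma B_Suc_iff:
  assumes "x \<in> Z (Suc (Suc s)) p m"
  shows "x \<in> B (Suc s) p m \<longleftrightarrow> (\<exists>y\<in>Z (Suc s) (p + int s + 1) (m + 1). x \<ominus>\<^bsub>V m\<^esub> d (m + 1) y \<in> B s p m)"
proof
  have xc: "x \<in> carrier (V m)" using assms Z_carrier by blast
  assume "x \<in> B (Suc s) p m"
  then obtain w v where wv: "w \<in> Z (Suc s) (p - 1) m" "v \<in> Z (Suc s) (p + int s + 1) (m + 1)" "x = w \<oplus>\<^bsub>V m\<^esub> d (m + 1) v"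
    by (auto simp: mem_B algebra_simps)
  have c: "w \<in> carrier (V m)" "d (m + 1) v \<in> carrier (V m)" using wv Z_carrier d_closed' by blast+
  have "w \<in> B s p m" using Z_B wv(1) Z_Suc by blast
  then have "x \<ominus>\<^bsub>V m\<^esub> d (m + 1) v \<in> B s p m" using wv(3) c by (simp add: V.minus_minus_add)
  then show "\<exists>y\<in>Z (Suc s) (p + int s + 1) (m + 1). x \<ominus>\<^bsub>V m\<^esub> d (m + 1) y \<in> B s p m" using wv(2) by blast
next
  have xc: "x \<in> carrier (V m)" using assms Z_carrier by blast
  assume "\<exists>y\<in>Z (Suc s) (p + int s + 1) (m + 1). x \<ominus>\<^bsub>V m\<^esub> d (m + 1) y \<in> B s p m"
  then obtain y w v where y: "y \<in> Z (Suc s) (p + int s + 1) (m + 1)" and w: "w \<in> Z s (p - 1) m"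
    and v: "v \<in> Z s (p + int s) (m + 1)" and e: "x \<ominus>\<^bsub>V m\<^esub> d (m + 1) y = w \<oplus>\<^bsub>V m\<^esub> d (m + 1) v"
    by (auto simp: mem_B)
  have c: "y \<in> carrier (V (m + 1))" "v \<in> carrier (V (m + 1))" "w \<in> carrier (V m)"
    using y v w Z_carrier by blast+
  note dc = d_closed'[OF c(1)] d_closed'[OF c(2)]
  let ?u = "y \<oplus>\<^bsub>V (m + 1)\<^esub> v"
  have du: "d (m + 1) ?u = d (m + 1) y \<oplus>\<^bsub>V m\<^esub> d (m + 1) v" using c by (simp add: mod_hom_add[OF d_hom'])
  have "v \<in> F (p + int s + 1) (m + 1)" using v F_mono'[of "p + int s" "p + int s + 1"] by (auto simp: Z_def)
  then have u: "?u \<in> Z (Suc s) (p + int s + 1) (m + 1)"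
    using y v F_add by (auto simp: Z_def du)
  have x: "x = w \<oplus>\<^bsub>V m\<^esub> d (m + 1) ?u"
  proof -
    have "x = (x \<ominus>\<^bsub>V m\<^esub> d (m + 1) y) \<oplus>\<^bsub>V m\<^esub> d (m + 1) y" using xc dc by (simp add: V.minus_minus_add)
    also have "\<dots> = w \<oplus>\<^bsub>V m\<^esub> d (m + 1) ?u" unfolding e du using c dc by (simp add: V.a_ac)
    finally show ?thesis .
  qed
  have "d m x = d m w \<oplus>\<^bsub>V (m - 1)\<^esub> d m (d (m + 1) ?u)"
    unfolding x using c d_closed'[of ?u m] by (simp add: mod_hom_add[OF d_hom])
  also have "\<dots> = d m w" using d_d'[of ?u m] c d_closed by simp
  finally have "w \<in> Z (Suc s) (p - 1) m" using assms w by (auto simp: Z_def algebra_simps)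
  then show "x \<in> B (Suc s) p m" unfolding mem_B using u x by (auto simp: algebra_simps)
qed

text \<open>Both sides are images of \<open>Z (Suc (Suc s)) p m\<close>: by
  \<open>\<delta>_kernel\<close> every class in the kernel of the differential has a representative
  there, and by \<open>B_Suc_iff\<close> the two maps have the same kernel.\<close>

lemma next_page_iso:
  "mod_isomorphic K
     (quot_module ((page s p m)\<lparr>carrier := {X \<in> carrier (page s p m). \<delta> s p m X = \<zero>\<^bsub>page s (p - int s - 1) (m - 1)\<^esub>}\<rparr>)
       (\<delta> s (p + int s + 1) (m + 1) ` carrier (page s (p + int s + 1) (m + 1))))
     (page (Suc s) p m)"
proof -
  let ?M = "(V m)\<lparr>carrier := Z (Suc (Suc s)) p m\<rparr>"
  let ?k = "{X \<in> carrier (page s p m). \<delta> s p m X = \<zero>\<^bsub>page s (p - int s - 1) (m - 1)\<^esub>}"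
  let ?i = "\<delta> s (p + int s + 1) (m + 1) ` carrier (page s (p + int s + 1) (m + 1))"
  let ?k' = "(page s p m)\<lparr>carrier := ?k\<rparr>"
  have k: "submodule ?k K (page s p m)" by (rule kernel_submodule[OF page_module page_module \<delta>_hom])
  have km: "module K ?k'" by (rule submodule.submodule_is_module[OF k page_module])
  have dh: "\<delta> s (p + int s + 1) (m + 1) \<in> mod_hom K (page s (p + int s + 1) (m + 1)) (page s p m)"
    using \<delta>_hom[of s "p + int s + 1" "m + 1"] by simp
  have i: "submodule ?i K (page s p m)" by (rule image_submodule[OF page_module page_module dh])
  have \<delta>c: "\<delta> s (p + int s + 1) (m + 1) (cls s (p + int s + 1) (m + 1) y) = cls s p m (d (m + 1) y)"
    if "y \<in> Z (Suc s) (p + int s + 1) (m + 1)" for y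
    using \<delta>_cls[OF that] by simp
  have ik: "?i \<subseteq> ?k"
  proof
    fix X assume X: "X \<in> ?i"
    then obtain Y where Y: "Y \<in> carrier (page s (p + int s + 1) (m + 1))" "X = \<delta> s (p + int s + 1) (m + 1) Y"
      by blast
    then obtain y where "y \<in> Z (Suc s) (p + int s + 1) (m + 1)" "Y = cls s (p + int s + 1) (m + 1) y"
      unfolding cls_image[symmetric] by blast
    then have y: "y \<in> Z (Suc s) (p + int s + 1) (m + 1)" "X = cls s p m (d (m + 1) y)"
      using \<delta>c Y(2) by simp_all
    have "X \<in> carrier (page s p m)" using X mod_hom_closed[OF dh] by blast
    moreover have "\<delta> s p m X = \<zero>\<^bsub>page s (p - int s - 1) (m - 1)\<^esub>"
    proof -
      have "d (m + 1) y \<in> Z (Suc s) p m" using d_Z_page[OF y(1), of "Suc s"] by simp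
      from \<delta>_cls[OF this] show ?thesis
        using y(2) d_d'[OF Z_carrier[OF y(1)]] cls_zero_iff[of "\<zero>\<^bsub>V (m - 1)\<^esub>" "m - 1"] page_zero
          subgroup.one_closed[OF submodule.axioms(1)[OF B_submodule]] by simp
    qed
    ultimately show "X \<in> ?k" by blast
  qed
  have i': "submodule ?i K ?k'" by (rule submodule_restrict[OF page_module k i ik])
  let ?g = "\<lambda>x. ?i +>\<^bsub>?k'\<^esub> cls s p m x"
  have Mk: "cls s p m x \<in> ?k" if "x \<in> Z (Suc (Suc s)) p m" for x
  proof -
    have x: "x \<in> Z (Suc s) p m" using that Z_Suc by blast
    have "d m x \<in> Z s (p - int s - 1 - 1) (m - 1)"
      using that d_d[of x m] F_zero[of "m - 2"] by (auto simp: Z_def algebra_simps F_carrier)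
    then have "d m x \<in> B s (p - int s - 1) (m - 1)"
      by (rule Z_B)
    then have "\<delta> s p m (cls s p m x) = B s (p - int s - 1) (m - 1)"
      using \<delta>_cls[OF x] cls_zero_iff Z_carrier d_closed that by metis
    moreover have "cls s p m x \<in> carrier (page s p m)" using cls_image x by blast
    ultimately show ?thesis by (simp add: page_zero)
  qed
  have g0: "cls s p m \<in> mod_hom K ?M (page s p m)"
    using mod_hom_restrict_dom[OF cls_hom[where s = s and p = p and m = m], of "Z (Suc (Suc s)) p m"] Z_Suc by simp
  have g1: "cls s p m \<in> mod_hom K ?M ?k'"
    by (rule mod_hom_restrict_cod[OF g0]) (use Mk in simp)
  have g: "?g \<in> mod_hom K ?M (quot_module ?k' ?i)" by (rule mod_hom_comp[OF coset_hom[OF km i'] g1])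
  have kim: "?k = cls s p m ` Z (Suc (Suc s)) p m"
  proof
    show "?k \<subseteq> cls s p m ` Z (Suc (Suc s)) p m"
    proof
      fix X assume "X \<in> ?k"
      then obtain x where "x \<in> Z (Suc (Suc s)) p m" "X = cls s p m x"
        by (auto simp: page_zero elim: \<delta>_kernel)
      then show "X \<in> cls s p m ` Z (Suc (Suc s)) p m" by blast
    qed
  qed (use Mk in blast)
  have gi: "?g ` carrier ?M = carrier (quot_module ?k' ?i)"
  proof -
    have "?g ` carrier ?M = (\<lambda>X. ?i +>\<^bsub>?k'\<^esub> X) ` carrier ?k'" using kim by (simp add: image_image)
    then show ?thesis using coset_image by metis
  qed
  have f: "cls (Suc s) p m \<in> mod_hom K ?M (page (Suc s) p m)" by (rule cls_hom)
  have fi: "cls (Suc s) p m ` carrier ?M = carrier (page (Suc s) p m)" using cls_image by simp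
  have ker: "?g x = \<zero>\<^bsub>quot_module ?k' ?i\<^esub> \<longleftrightarrow> cls (Suc s) p m x = \<zero>\<^bsub>page (Suc s) p m\<^esub>" if x: "x \<in> carrier ?M" for x
  proof -
    have x': "x \<in> Z (Suc (Suc s)) p m" using x by simp
    have xc: "x \<in> carrier (V m)" using x' Z_carrier by blast
    have "?g x = \<zero>\<^bsub>quot_module ?k' ?i\<^esub> \<longleftrightarrow> cls s p m x \<in> ?i"
      using coset_zero_iff[OF km i'] Mk[OF x'] by simp
    also have "\<dots> \<longleftrightarrow> (\<exists>y\<in>Z (Suc s) (p + int s + 1) (m + 1). x \<ominus>\<^bsub>V m\<^esub> d (m + 1) y \<in> B s p m)"
    proof -
      have "?i = (\<lambda>y. cls s p m (d (m + 1) y)) ` Z (Suc s) (p + int s + 1) (m + 1)"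
        unfolding cls_image[symmetric] image_image using \<delta>c by (intro image_cong) auto
      then show ?thesis using cls_eq_iff[OF xc] d_closed' Z_carrier by (auto simp: image_iff)
    qed
    also have "\<dots> \<longleftrightarrow> x \<in> B (Suc s) p m" using B_Suc_iff[OF x'] by simp
    also have "\<dots> \<longleftrightarrow> cls (Suc s) p m x = \<zero>\<^bsub>page (Suc s) p m\<^esub>" using cls_zero_iff[OF xc] page_zero by simp
    finally show ?thesis .
  qed
  show ?thesis
    by (rule mod_isomorphicI_surj[OF Z_module quot_module_is_module[OF km i'] page_module g gi f fi ker])
qed

text \<open>For \<open>p < 0\<close> the filtration is zero, and for \<open>m < p\<close>, which
  means q < 0, it is already exhausted at p - 1. Either way every element of
  \<open>Z (Suc s) p m\<close> lies in \<open>Z s (p - 1) m\<close>, which consists of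
  relations.\<close>

lemma page_trivial:
  assumes "p < 0 \<or> m < p"
  shows "carrier (page s p m) = {\<zero>\<^bsub>page s p m\<^esub>}"
proof -
  have "Z (Suc s) p m \<subseteq> B s p m"
  proof
    fix x assume x: "x \<in> Z (Suc s) p m"
    have "x \<in> Z s (p - 1) m"
    proof (cases "p < 0")
      case True
      then have "x = \<zero>\<^bsub>V m\<^esub>" using x F_low by (simp add: Z_def)
      then show ?thesis using Z_zero by simp
    next
      case False
      then have "F (p - 1) m = carrier (V m)" using assms by (intro F_high) auto
      moreover have e: "p - int (Suc s) = p - 1 - int s" by simp
      ultimately show ?thesis using x F_carrier unfolding Z_def e by blast
    qed
    then show "x \<in> B s p m" by (rule Z_B)
  qed
  then show ?thesis unfolding page_def by (intro quot_module_trivial[OF Z_module B_submodule_Z]) simp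
qed

lemma is_spectral_sequence: "spectral_sequence K E dE"
proof (rule spectral_sequence.intro)
  fix r :: nat and p q :: int assume r: "2 \<le> r"
  then obtain s where s: "r = Suc s" by (metis Suc_le_D One_nat_def numeral_2_eq_2)
  have e1: "p - int r + (q + int r - 1) = p + q - 1" "p + int r + (q - int r + 1) = p + q + 1"
    "p - int r = p - int s - 1" "p + int r = p + int s + 1" using s by auto
  show "module K (E r p q)" unfolding E_def by (rule page_module)
  show "carrier (E r p q) = {\<zero>\<^bsub>E r p q\<^esub>}" if "p < 0 \<or> q < 0"
    unfolding E_def by (rule page_trivial) (use that in auto)
  show dh: "dE r p q \<in> mod_hom K (E r p q) (E r (p - int r) (q + int r - 1))"
    unfolding dE_def E_def e1(1,2) unfolding e1(3,4) using \<delta>_hom[of s p "p + q"] s by simp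
  show "mod_isomorphic K (quot_module (E r p q\<lparr>carrier := {x \<in> carrier (E r p q). dE r p q x = \<zero>\<^bsub>E r (p - int r) (q + int r - 1)\<^esub>}\<rparr>)
        (dE r (p + int r) (q - int r + 1) ` carrier (E r (p + int r) (q - int r + 1)))) (E (Suc r) p q)"
    unfolding dE_def E_def e1(1,2) unfolding e1(3,4) using next_page_iso[of s p "p + q"] s by simp
  show "dE r (p - int r) (q + int r - 1) (dE r p q x) = \<zero>\<^bsub>E r (p - 2 * int r) (q + 2 * int r - 2)\<^esub>"
    if x: "x \<in> carrier (E r p q)" for x
  proof -
    have e2: "p - 2 * int r = p - int s - 1 - int s - 1" "p - 2 * int r + (q + 2 * int r - 2) = p + q - 1 - 1"
      using s by auto
    obtain y where y: "y \<in> Z (Suc s) p (p + q)" "x = cls s p (p + q) y"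
      using x cls_image s unfolding E_def by (metis diff_Suc_1 imageE)
    have yc: "y \<in> carrier (V (p + q))" using y Z_carrier by blast
    have "\<delta> s (p - int s - 1) (p + q - 1) (\<delta> s p (p + q) x) = cls s (p - int s - 1 - int s - 1) (p + q - 1 - 1) (d (p + q - 1) (d (p + q) y))"
      using \<delta>_cls[OF y(1)] \<delta>_cls[OF d_Z_page[OF y(1)]] y(2) by simp
    also have "\<dots> = B s (p - int s - 1 - int s - 1) (p + q - 1 - 1)"
      using d_d[OF yc] cls_zero_iff[of "\<zero>\<^bsub>V (p + q - 1 - 1)\<^esub>" "p + q - 1 - 1"]
        subgroup.one_closed[OF submodule.axioms(1)[OF B_submodule]] by (simp add: diff_diff_eq)
    finally show ?thesis unfolding dE_def E_def e1(1,2) e2(2) unfolding e1(3,4) e2(1) using s page_zero by simp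
  qed
qed

section \<open>Convergence to the homology of the filtered complex\<close>

definition zyc :: "int \<Rightarrow> 'c set"
  where "zyc m = {x \<in> carrier (V m). d m x = \<zero>\<^bsub>V (m - 1)\<^esub>}"

definition hom_V :: "int \<Rightarrow> ('k, 'c set) module"
  where "hom_V m = quot_module ((V m)\<lparr>carrier := zyc m\<rparr>) (d (m + 1) ` carrier (V (m + 1)))"

definition FH :: "int \<Rightarrow> int \<Rightarrow> 'c set set"
  where "FH m p = (\<lambda>x. (d (m + 1) ` carrier (V (m + 1))) +>\<^bsub>V m\<^esub> x) ` (F p m \<inter> zyc m)"

lemma convergence:
  shows "submodule (FH m p) K (hom_V m)" "FH m (p - 1) \<subseteq> FH m p"
    "p < 0 \<Longrightarrow> FH m p = {\<zero>\<^bsub>hom_V m\<^esub>}" "m \<le> p \<Longrightarrow> FH m p = carrier (hom_V m)"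
    "\<lbrakk>0 \<le> p; p \<le> m; int r > max p (m - p + 1)\<rbrakk> \<Longrightarrow>
      mod_isomorphic K (quot_module ((hom_V m)\<lparr>carrier := FH m p\<rparr>) (FH m (p - 1))) (E r p (m - p))"
proof -
  let ?I = "d (m + 1) ` carrier (V (m + 1))"
  let ?Z = "(V m)\<lparr>carrier := zyc m\<rparr>"
  let ?q = "\<lambda>x. ?I +>\<^bsub>V m\<^esub> x"
  have Z: "submodule (zyc m) K (V m)" unfolding zyc_def by (rule kernel_submodule[OF V_module V_module d_hom])
  have Zm: "module K ?Z" by (rule submodule.submodule_is_module[OF Z V_module])
  have I: "submodule ?I K (V m)" by (rule image_submodule[OF V_module V_module d_hom'])
  have IZ: "?I \<subseteq> zyc m" using d_d' d_closed' by (auto simp: zyc_def)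
  have I': "submodule ?I K ?Z" by (rule submodule_restrict[OF V_module Z I IZ])
  have Hm: "module K (hom_V m)" unfolding hom_V_def by (rule quot_module_is_module[OF Zm I'])
  have q: "?q \<in> mod_hom K ?Z (hom_V m)" unfolding hom_V_def using coset_hom[OF Zm I'] by simp
  have qi: "?q ` zyc m = carrier (hom_V m)"
    unfolding hom_V_def using coset_image[where N = ?I and M = ?Z] by simp
  have FZ: "submodule (F p m \<inter> zyc m) K ?Z" for p
    by (rule submodule_restrict[OF V_module Z submodule_inter[OF V_module F_submodule Z]]) blast
  have FZV: "submodule (F p m \<inter> zyc m) K (V m)" for p by (rule submodule_inter[OF V_module F_submodule Z])
  show S: "submodule (FH m p) K (hom_V m)" for p unfolding FH_def by (rule submodule_image[OF Zm Hm q FZ])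
  show sub: "FH m (p - 1) \<subseteq> FH m p" for p unfolding FH_def using F_mono by blast
  have zI: "\<zero>\<^bsub>V m\<^esub> \<in> ?I" using subgroup.one_closed[OF submodule.axioms(1)[OF I]] by simp
  show "FH m p = {\<zero>\<^bsub>hom_V m\<^esub>}" if "p < 0"
  proof -
    have "F p m \<inter> zyc m = {\<zero>\<^bsub>V m\<^esub>}" using F_low[OF that] zI IZ by auto
    then show ?thesis unfolding FH_def using coset_zero_iff[OF V_module I, of "\<zero>\<^bsub>V m\<^esub>"] zI by (simp add: hom_V_def)
  qed
  show "FH m p = carrier (hom_V m)" if "m \<le> p"
  proof -
    have "F p m \<inter> zyc m = zyc m" using F_high[OF that] by (auto simp: zyc_def)
    then show ?thesis unfolding FH_def using qi by simp
  qed
  show "mod_isomorphic K (quot_module ((hom_V m)\<lparr>carrier := FH m p\<rparr>) (FH m (p - 1))) (E r p (m - p))"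
    if p: "0 \<le> p" "p \<le> m" and r: "int r > max p (m - p + 1)"
  proof -
    obtain s where s: "r = Suc s" using r p by (cases r) auto
    let ?M = "(V m)\<lparr>carrier := F p m \<inter> zyc m\<rparr>"
    let ?H = "(hom_V m)\<lparr>carrier := FH m p\<rparr>"
    \<comment> \<open>Since r > p, the index p - r is negative and the condition on the boundary
      says that it vanishes; the same index occurs for \<open>Z s (p - 1) m\<close>. Since r > m - p
      + 1, step p + s of the filtration is the whole space in degree m + 1, so there only the
      condition on the boundary remains.\<close>
    have ZF: "Z (Suc s) p m = F p m \<inter> zyc m"
      using F_low[of "p - int (Suc s)"] r s F_carrier by (auto simp: Z_def zyc_def)
    have ZF1: "Z s (p - 1) m = F (p - 1) m \<inter> zyc m"
      using F_low[of "p - 1 - int s"] r s F_carrier by (auto simp: Z_def zyc_def)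
    have ZF2: "Z s (p + int s) (m + 1) = {y \<in> carrier (V (m + 1)). d (m + 1) y \<in> F p m}"
      using F_high[of "m + 1" "p + int s"] r s by (auto simp: Z_def)
    have Mm: "module K ?M" by (rule submodule.submodule_is_module[OF FZV V_module])
    have HF: "module K ?H" by (rule submodule.submodule_is_module[OF S Hm])
    have HS: "submodule (FH m (p - 1)) K ?H" by (rule submodule_restrict[OF Hm S S sub])
    let ?g = "\<lambda>x. FH m (p - 1) +>\<^bsub>?H\<^esub> ?q x"
    have "?q \<in> mod_hom K (?Z\<lparr>carrier := F p m \<inter> zyc m\<rparr>) ?H"
      by (rule mod_hom_restrict[OF q]) (auto simp: FH_def)
    then have "?q \<in> mod_hom K ?M ?H" by simp
    from mod_hom_comp[OF coset_hom[OF HF HS] this]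
    have g: "?g \<in> mod_hom K ?M (quot_module ?H (FH m (p - 1)))" .
    have gi: "?g ` carrier ?M = carrier (quot_module ?H (FH m (p - 1)))"
    proof -
      have "?g ` carrier ?M = (\<lambda>X. FH m (p - 1) +>\<^bsub>?H\<^esub> X) ` carrier ?H" by (simp add: image_image FH_def)
      then show ?thesis using coset_image by metis
    qed
    have f: "cls s p m \<in> mod_hom K ?M (page s p m)" using cls_hom[where s = s and p = p and m = m] ZF by simp
    have fi: "cls s p m ` carrier ?M = carrier (page s p m)" using cls_image[where s = s and p = p and m = m] ZF by simp
    have ker: "?g x = \<zero>\<^bsub>quot_module ?H (FH m (p - 1))\<^esub> \<longleftrightarrow> cls s p m x = \<zero>\<^bsub>page s p m\<^esub>" if x: "x \<in> carrier ?M" for x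
    proof -
      have xc: "x \<in> carrier (V m)" and xF: "x \<in> F p m" "x \<in> zyc m" using x F_carrier by auto
      have qH: "?q x \<in> carrier ?H" using xF by (auto simp: FH_def)
      have "?g x = \<zero>\<^bsub>quot_module ?H (FH m (p - 1))\<^esub> \<longleftrightarrow> ?q x \<in> FH m (p - 1)"
        using coset_zero_iff[OF HF HS qH] by simp
      also have "\<dots> \<longleftrightarrow> (\<exists>y\<in>F (p - 1) m \<inter> zyc m. x \<ominus>\<^bsub>V m\<^esub> y \<in> ?I)"
      proof -
        have "?q x = ?q y \<longleftrightarrow> x \<ominus>\<^bsub>V m\<^esub> y \<in> ?I" if "y \<in> F (p - 1) m \<inter> zyc m" for y
          using coset_eq_iff[OF V_module I xc] F_carrier that by blast
        then show ?thesis unfolding FH_def by blast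
      qed
      also have "\<dots> \<longleftrightarrow> x \<in> B s p m"
      proof
        assume "\<exists>y\<in>F (p - 1) m \<inter> zyc m. x \<ominus>\<^bsub>V m\<^esub> y \<in> ?I"
        then obtain y v where y: "y \<in> F (p - 1) m \<inter> zyc m" and v: "v \<in> carrier (V (m + 1))" "x \<ominus>\<^bsub>V m\<^esub> y = d (m + 1) v"
          by auto
        have yc: "y \<in> carrier (V m)" "y \<in> F p m" using y F_carrier F_mono by blast+
        have "d (m + 1) v \<in> F p m" using v F_minus[OF xF(1) yc(2)] by simp
        moreover have "x = y \<oplus>\<^bsub>V m\<^esub> d (m + 1) v" using v(2) xc yc by (simp flip: v(2) add: V.minus_minus_add)
        ultimately show "x \<in> B s p m" unfolding mem_B ZF1 ZF2 using y v(1) by blast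
      next
        assume "x \<in> B s p m"
        then obtain w v where w: "w \<in> F (p - 1) m \<inter> zyc m" and v: "v \<in> carrier (V (m + 1))" "x = w \<oplus>\<^bsub>V m\<^esub> d (m + 1) v"
          unfolding mem_B ZF1 ZF2 by blast
        have "w \<in> carrier (V m)" using w F_carrier by blast
        then have "x \<ominus>\<^bsub>V m\<^esub> w = d (m + 1) v" using v d_closed' by (simp add: V.minus_minus_add)
        then show "\<exists>y\<in>F (p - 1) m \<inter> zyc m. x \<ominus>\<^bsub>V m\<^esub> y \<in> ?I" using w v(1) by blast
      qed
      also have "\<dots> \<longleftrightarrow> cls s p m x = \<zero>\<^bsub>page s p m\<^esub>" using cls_zero_iff[OF xc] page_zero by simp
      finally show ?thesis .
    qed
    have "mod_isomorphic K (quot_module ?H (FH m (p - 1))) (page s p m)"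
      by (rule mod_isomorphicI_surj[OF Mm quot_module_is_module[OF HF HS] page_module g gi f fi ker])
    then show ?thesis by (simp add: E_def s)
  qed
qed

end

section \<open>Tensor products\<close>

definition bilin ::
  "('k, 'r) ring_scheme \<Rightarrow> ('k, 'a, 'x) module_scheme \<Rightarrow> ('k, 'b, 'y) module_scheme \<Rightarrow> ('k, 'c, 'z) module_scheme \<Rightarrow> ('a \<Rightarrow> 'b \<Rightarrow> 'c) \<Rightarrow> bool"
  where "bilin K M N P \<beta> \<longleftrightarrow>
    (\<forall>y\<in>carrier N. (\<lambda>x. \<beta> x y) \<in> mod_hom K M P) \<and> (\<forall>x\<in>carrier M. \<beta> x \<in> mod_hom K N P)"

lemma bilinI:
  "(\<And>y. y \<in> carrier N \<Longrightarrow> (\<lambda>x. \<beta> x y) \<in> mod_hom K M P) \<Longrightarrow> (\<And>x. x \<in> carrier M \<Longrightarrow> \<beta> x \<in> mod_hom K N P) \<Longrightarrow>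
    bilin K M N P \<beta>"
  by (auto simp: bilin_def)

lemma bilinD:
  "bilin K M N P \<beta> \<Longrightarrow> y \<in> carrier N \<Longrightarrow> (\<lambda>x. \<beta> x y) \<in> mod_hom K M P"
  "bilin K M N P \<beta> \<Longrightarrow> x \<in> carrier M \<Longrightarrow> \<beta> x \<in> mod_hom K N P"
  by (auto simp: bilin_def)

lemma bilin_closed: "bilin K M N P \<beta> \<Longrightarrow> x \<in> carrier M \<Longrightarrow> y \<in> carrier N \<Longrightarrow> \<beta> x y \<in> carrier P"
  using mod_hom_closed[of "\<beta> x" K N P y] bilinD(2)[of K M N P \<beta> x] by simp

definition pure ::
  "('k, 'r) ring_scheme \<Rightarrow> ('k, 'a, 'x) module_scheme \<Rightarrow> ('k, 'b, 'y) module_scheme \<Rightarrow> 'a \<Rightarrow> 'b \<Rightarrow> ('a \<times> 'b \<Rightarrow> 'k) set"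
  where "pure K M N x y = gen_class K (carrier M \<times> carrier N)
     ((\<Union>y\<in>carrier N. linear_rels K (free_module K (carrier M \<times> carrier N)) M (\<lambda>x. (x, y))) \<union>
      (\<Union>x\<in>carrier M. linear_rels K (free_module K (carrier M \<times> carrier N)) N (\<lambda>y. (x, y)))) (x, y)"

context
  fixes K :: "('k, 'r) ring_scheme" and M :: "('k, 'a, 'x) module_scheme" and N :: "('k, 'b, 'y) module_scheme"
  assumes K: "field K" and M: "module K M" and N: "module K N"
begin

lemma tensor_rels_closed:
  "((\<Union>y\<in>carrier N. linear_rels K (free_module K (carrier M \<times> carrier N)) M (\<lambda>x. (x, y))) \<union>
      (\<Union>x\<in>carrier M. linear_rels K (free_module K (carrier M \<times> carrier N)) N (\<lambda>y. (x, y))))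
    \<subseteq> carrier (free_module K (carrier M \<times> carrier N))"
  by (intro Un_least UN_least linear_rels_closed[OF K] M N) auto

lemma tensor_is_module: "module K (tensor K M N)"
  unfolding tensor_def Let_def by (rule presented_is_module[OF K tensor_rels_closed])

lemma pure_bilin: "bilin K M N (tensor K M N) (pure K M N)"
proof (rule bilinI)
  fix y assume y: "y \<in> carrier N"
  show "(\<lambda>x. pure K M N x y) \<in> mod_hom K M (tensor K M N)"
    unfolding tensor_def Let_def pure_def
    using y by (intro gen_class_linear[OF K tensor_rels_closed M, where \<iota> = "\<lambda>x. (x, y)"]) auto
next
  fix x assume x: "x \<in> carrier M"
  show "pure K M N x \<in> mod_hom K N (tensor K M N)"
    unfolding tensor_def Let_def pure_def
    using x by (intro gen_class_linear[OF K tensor_rels_closed N, where \<iota> = "\<lambda>y. (x, y)"]) auto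
qed

lemma tensor_hom_eq:
  assumes "module K P" "f \<in> mod_hom K (tensor K M N) P" "g \<in> mod_hom K (tensor K M N) P"
    and "\<And>x y. x \<in> carrier M \<Longrightarrow> y \<in> carrier N \<Longrightarrow> f (pure K M N x y) = g (pure K M N x y)"
    and "z \<in> carrier (tensor K M N)"
  shows "f z = g z"
  using assms unfolding tensor_def Let_def pure_def
  by (intro presented_hom_eq[OF K tensor_rels_closed, where C = z and f = f and g = g and N = P]) auto

lemma tensor_lift:
  assumes "module K P" "bilin K M N P \<beta>"
  obtains f where "f \<in> mod_hom K (tensor K M N) P"
    "\<And>x y. x \<in> carrier M \<Longrightarrow> y \<in> carrier N \<Longrightarrow> f (pure K M N x y) = \<beta> x y"
proof -
  let ?X = "carrier M \<times> carrier N"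
  have \<phi>: "(case z of (x, y) \<Rightarrow> \<beta> x y) \<in> carrier P" if "z \<in> ?X" for z
    using that bilin_closed[OF assms(2)] by auto
  have 1: "lin_ext K P (\<lambda>(x, y). \<beta> x y) s = \<zero>\<^bsub>P\<^esub>"
    if "y \<in> carrier N" "s \<in> linear_rels K (free_module K ?X) M (\<lambda>x. (x, y))" for y s
    by (rule lin_ext_linear_rels[OF K M assms(1) _ \<phi> _ that(2)]) (use that(1) bilinD[OF assms(2)] in auto)
  have 2: "lin_ext K P (\<lambda>(x, y). \<beta> x y) s = \<zero>\<^bsub>P\<^esub>"
    if "x \<in> carrier M" "s \<in> linear_rels K (free_module K ?X) N (\<lambda>y. (x, y))" for x s
    by (rule lin_ext_linear_rels[OF K N assms(1) _ \<phi> _ that(2)]) (use that(1) bilinD[OF assms(2)] in auto)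
  note l = presented_lift[OF K tensor_rels_closed assms(1), where \<phi> = "\<lambda>(x, y). \<beta> x y"]
  show thesis
  proof (rule that)
    show "induced_map K P (\<lambda>(x, y). \<beta> x y) \<in> mod_hom K (tensor K M N) P"
      unfolding tensor_def Let_def by (rule l(1)) (use \<phi> 1 2 in auto)
    fix x y assume "x \<in> carrier M" "y \<in> carrier N"
    then show "induced_map K P (\<lambda>(x, y). \<beta> x y) (pure K M N x y) = \<beta> x y"
      unfolding pure_def by (subst l(2)) (use \<phi> 1 2 in auto)
  qed
qed

end

subsection \<open>The spaces \<open>A \<otimes> H\<^sup>\<otimes>\<^sup>k\<close>\<close>

lemma tuples_update: "hs \<in> tuples H k \<Longrightarrow> h \<in> carrier H \<Longrightarrow> hs[i := h] \<in> tuples H k"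
  unfolding tuples_def by (auto dest: set_update_subset_insert[THEN subsetD])

lemma tuples_snoc: "hs \<in> tuples H k \<Longrightarrow> h \<in> carrier H \<Longrightarrow> hs @ [h] \<in> tuples H (Suc k)"
  by (auto simp: tuples_def)

lemma tuples_butlast: "hs \<in> tuples H (Suc k) \<Longrightarrow> butlast hs \<in> tuples H k"
  unfolding tuples_def by (auto dest: in_set_butlastD)

lemma tuples_last: "hs \<in> tuples H (Suc k) \<Longrightarrow> last hs \<in> carrier H"
  unfolding tuples_def by (cases hs rule: rev_cases) auto

lemma tuples_0 [simp]: "hs \<in> tuples H 0 \<longleftrightarrow> hs = []"
  by (auto simp: tuples_def)

lemma tuples_length: "hs \<in> tuples H k \<Longrightarrow> length hs = k"
  by (simp add: tuples_def)

lemma tuples_snoc_cases: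
  assumes "hs \<in> tuples H (Suc k)"
  obtains hs' h where "hs' \<in> tuples H k" "h \<in> carrier H" "hs = hs' @ [h]"
proof -
  have "hs \<noteq> []" using assms by (auto simp: tuples_def)
  then have "hs = butlast hs @ [last hs]" by simp
  then show thesis using that tuples_butlast[OF assms] tuples_last[OF assms] by blast
qed

lemma tuples_nth: "hs \<in> tuples H k \<Longrightarrow> i < k \<Longrightarrow> hs ! i \<in> carrier H"
  by (auto simp: tuples_def)

lemma tuples_map: "hs \<in> tuples H k \<Longrightarrow> (\<And>h. h \<in> carrier H \<Longrightarrow> f h \<in> carrier H') \<Longrightarrow> map f hs \<in> tuples H' k"
  by (auto simp: tuples_def)

locale mixed = K: field K + H: module K H + A: module K A
  for K :: "('k, 'r) ring_scheme" and H :: "('k, 'h, 'y) module_scheme" and A :: "('k, 'a, 'x) module_scheme"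
begin

abbreviation T :: "nat \<Rightarrow> ('k, ('a \<times> 'h list \<Rightarrow> 'k) set) module"
  where "T k \<equiv> mixed_tensor K A H k"

abbreviation t :: "nat \<Rightarrow> 'a \<times> 'h list \<Rightarrow> ('a \<times> 'h list \<Rightarrow> 'k) set"
  where "t k \<equiv> mixed_tensors K A H k"

lemma mixed_rels_closed: "mixed_rels K A H k \<subseteq> carrier (free_module K (mixed_gens A H k))"
  unfolding mixed_rels_def Let_def
  by (intro Un_least UN_least linear_rels_closed[OF K.field_axioms] A.module_axioms H.module_axioms)
    (auto simp: mixed_gens_def tuples_update)

lemma T_module: "module K (T k)"
  unfolding mixed_tensor_def by (rule presented_is_module[OF K.field_axioms mixed_rels_closed])

sublocale T: module K "T k" for k by (rule T_module)

lemma t_closed: "v \<in> carrier A \<Longrightarrow> hs \<in> tuples H k \<Longrightarrow> t k (v, hs) \<in> carrier (T k)"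
  unfolding mixed_tensor_def mixed_tensors_def
  by (rule gen_class_closed[OF K.field_axioms mixed_rels_closed]) (simp add: mixed_gens_def)

lemma t_linear_coeff: "hs \<in> tuples H k \<Longrightarrow> (\<lambda>v. t k (v, hs)) \<in> mod_hom K A (T k)"
  unfolding mixed_tensor_def mixed_tensors_def
  by (rule gen_class_linear[OF K.field_axioms mixed_rels_closed A.module_axioms, where \<iota> = "\<lambda>v. (v, hs)"])
    (unfold mixed_gens_def mixed_rels_def Let_def, blast+)

lemma t_linear_nth:
  "v \<in> carrier A \<Longrightarrow> hs \<in> tuples H k \<Longrightarrow> i < k \<Longrightarrow> (\<lambda>h. t k (v, hs[i := h])) \<in> mod_hom K H (T k)"
  unfolding mixed_tensor_def mixed_tensors_def
  by (rule gen_class_linear[OF K.field_axioms mixed_rels_closed H.module_axioms, where \<iota> = "\<lambda>h. (v, hs[i := h])"])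
    (unfold mixed_gens_def mixed_rels_def Let_def, (blast | simp add: tuples_update)+)

lemma T_hom_eq:
  assumes "module K N" "f \<in> mod_hom K (T k) N" "g \<in> mod_hom K (T k) N"
    and "\<And>v hs. v \<in> carrier A \<Longrightarrow> hs \<in> tuples H k \<Longrightarrow> f (t k (v, hs)) = g (t k (v, hs))"
    and "y \<in> carrier (T k)"
  shows "f y = g y"
proof (rule presented_hom_eq[OF K.field_axioms mixed_rels_closed assms(1)])
  fix x assume "x \<in> mixed_gens A H k"
  then show "f (gen_class K (mixed_gens A H k) (mixed_rels K A H k) x) = g (gen_class K (mixed_gens A H k) (mixed_rels K A H k) x)"
    using assms(4) unfolding mixed_tensors_def mixed_gens_def by auto
qed (use assms in \<open>auto simp: mixed_tensor_def\<close>)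

lemma T_induced_map_eq:
  assumes "module K N" "g \<in> mod_hom K (T k) N"
    and "\<And>v hs. v \<in> carrier A \<Longrightarrow> hs \<in> tuples H k \<Longrightarrow> \<phi> (v, hs) = g (t k (v, hs))"
    and "y \<in> carrier (T k)"
  shows "induced_map K N \<phi> y = g y"
  using assms unfolding mixed_tensor_def mixed_tensors_def
  by (intro induced_map_hom_eq[OF K.field_axioms mixed_rels_closed]) (auto simp: mixed_gens_def)

lemma T_induced_map:
  assumes "module K N" "\<And>v hs. v \<in> carrier A \<Longrightarrow> hs \<in> tuples H k \<Longrightarrow> \<phi> (v, hs) \<in> carrier N"
    and "\<And>hs. hs \<in> tuples H k \<Longrightarrow> (\<lambda>v. \<phi> (v, hs)) \<in> mod_hom K A N"
    and "\<And>v hs i. v \<in> carrier A \<Longrightarrow> hs \<in> tuples H k \<Longrightarrow> i < k \<Longrightarrow> (\<lambda>h. \<phi> (v, hs[i := h])) \<in> mod_hom K H N"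
  shows "induced_map K N \<phi> \<in> mod_hom K (T k) N"
    and "\<And>v hs. v \<in> carrier A \<Longrightarrow> hs \<in> tuples H k \<Longrightarrow> induced_map K N \<phi> (t k (v, hs)) = \<phi> (v, hs)"
proof -
  let ?X = "mixed_gens A H k"
  have \<phi>: "\<phi> x \<in> carrier N" if "x \<in> ?X" for x using that assms(2) by (auto simp: mixed_gens_def)
  have 1: "lin_ext K N \<phi> s = \<zero>\<^bsub>N\<^esub>"
    if "hs \<in> tuples H k" "s \<in> linear_rels K (free_module K ?X) A (\<lambda>v. (v, hs))" for hs s
    by (rule lin_ext_linear_rels[OF K.field_axioms A.module_axioms assms(1) _ \<phi> _ that(2)])
      (use that(1) assms(3) in \<open>auto simp: mixed_gens_def\<close>)
  have 2: "lin_ext K N \<phi> s = \<zero>\<^bsub>N\<^esub>"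
    if "v \<in> carrier A" "hs \<in> tuples H k" "i < k" "s \<in> linear_rels K (free_module K ?X) H (\<lambda>h. (v, hs[i := h]))" for v hs i s
    by (rule lin_ext_linear_rels[OF K.field_axioms H.module_axioms assms(1) _ \<phi> _ that(4)])
      (use that(1-3) assms(4) in \<open>auto simp: mixed_gens_def tuples_update\<close>)
  have rel: "lin_ext K N \<phi> s = \<zero>\<^bsub>N\<^esub>" if "s \<in> mixed_rels K A H k" for s
    using that 1 2 unfolding mixed_rels_def Let_def by blast
  show "induced_map K N \<phi> \<in> mod_hom K (T k) N"
    unfolding mixed_tensor_def by (rule presented_lift(1)[OF K.field_axioms mixed_rels_closed assms(1) \<phi> rel])
  show "induced_map K N \<phi> (t k (v, hs)) = \<phi> (v, hs)" if "v \<in> carrier A" "hs \<in> tuples H k" for v hs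
    unfolding mixed_tensors_def
    by (rule presented_lift(2)[OF K.field_axioms mixed_rels_closed assms(1) \<phi> rel]) (use that in \<open>auto simp: mixed_gens_def\<close>)
qed

text \<open>Appending a factor on the right. Together with \<open>lift\<close> it exhibits
  \<open>T (Suc k)\<close> as the tensor product of \<open>T k\<close> and \<open>H\<close>, so that
  operators are defined and compared by recursion on the last factor instead of through list
  positions.\<close>

definition snoc :: "nat \<Rightarrow> ('a \<times> 'h list \<Rightarrow> 'k) set \<Rightarrow> 'h \<Rightarrow> ('a \<times> 'h list \<Rightarrow> 'k) set"
  where "snoc k y h = induced_map K (T (Suc k)) (\<lambda>(v, hs). t (Suc k) (v, hs @ [h])) y"

lemma snoc_linear1: "h \<in> carrier H \<Longrightarrow> (\<lambda>y. snoc k y h) \<in> mod_hom K (T k) (T (Suc k))"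
  and snoc_t: "h \<in> carrier H \<Longrightarrow> v \<in> carrier A \<Longrightarrow> hs \<in> tuples H k \<Longrightarrow> snoc k (t k (v, hs)) h = t (Suc k) (v, hs @ [h])"
proof -
  assume h: "h \<in> carrier H"
  let ?\<phi> = "\<lambda>(v, hs). t (Suc k) (v, hs @ [h])"
  have 1: "?\<phi> (v, hs) \<in> carrier (T (Suc k))" if "v \<in> carrier A" "hs \<in> tuples H k" for v hs
    using that h by (simp add: t_closed tuples_snoc)
  have 2: "(\<lambda>v. ?\<phi> (v, hs)) \<in> mod_hom K A (T (Suc k))" if "hs \<in> tuples H k" for hs
    using t_linear_coeff[OF tuples_snoc[OF that h]] by simp
  have 3: "(\<lambda>g. ?\<phi> (v, hs[i := g])) \<in> mod_hom K H (T (Suc k))"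
    if "v \<in> carrier A" "hs \<in> tuples H k" "i < k" for v hs i
    using t_linear_nth[OF that(1) tuples_snoc[OF that(2) h], of i] that(2,3) by (simp add: list_update_append tuples_length)
  show "(\<lambda>y. snoc k y h) \<in> mod_hom K (T k) (T (Suc k))"
    unfolding snoc_def by (rule T_induced_map(1)[where \<phi> = ?\<phi>, OF T_module 1 2 3])
  show "snoc k (t k (v, hs)) h = t (Suc k) (v, hs @ [h])" if "v \<in> carrier A" "hs \<in> tuples H k"
    using T_induced_map(2)[where \<phi> = ?\<phi> and k = k and v = v and hs = hs, OF T_module] 1 2 3 that by (simp add: snoc_def)
qed

lemma snoc_closed: "y \<in> carrier (T k) \<Longrightarrow> h \<in> carrier H \<Longrightarrow> snoc k y h \<in> carrier (T (Suc k))"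
  by (rule mod_hom_closed[OF snoc_linear1])

lemma t_linear_last:
  assumes "v \<in> carrier A" "hs \<in> tuples H k"
  shows "(\<lambda>h. t (Suc k) (v, hs @ [h])) \<in> mod_hom K H (T (Suc k))"
proof -
  have "(hs @ [\<zero>\<^bsub>H\<^esub>])[k := h] = hs @ [h]" for h
    using assms(2) by (simp add: list_update_append tuples_length)
  then show ?thesis using t_linear_nth[OF assms(1) tuples_snoc[OF assms(2) H.zero_closed], of k] by simp
qed

lemma snoc_linear2:
  assumes y: "y \<in> carrier (T k)"
  shows "snoc k y \<in> mod_hom K H (T (Suc k))"
proof (rule mod_homI)
  show "snoc k y h \<in> carrier (T (Suc k))" if "h \<in> carrier H" for h using that y by (rule snoc_closed[rotated])
next
  fix g h assume gh: "g \<in> carrier H" "h \<in> carrier H"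
  show "snoc k y (g \<oplus>\<^bsub>H\<^esub> h) = snoc k y g \<oplus>\<^bsub>T (Suc k)\<^esub> snoc k y h"
    by (rule T_hom_eq[OF T_module _ mod_hom_addf _ y])
      (use gh mod_hom_add[OF t_linear_last] in \<open>auto intro!: snoc_linear1 T_module simp: snoc_t\<close>)
next
  fix c h assume ch: "c \<in> carrier K" "h \<in> carrier H"
  show "snoc k y (c \<odot>\<^bsub>H\<^esub> h) = c \<odot>\<^bsub>T (Suc k)\<^esub> snoc k y h"
    by (rule T_hom_eq[OF T_module _ mod_hom_smultf _ y])
      (use ch mod_hom_smult[OF t_linear_last] in \<open>auto intro!: snoc_linear1 T_module simp: snoc_t\<close>)
qed

lemma snoc_bilin: "bilin K (T k) H (T (Suc k)) (snoc k)"
  by (intro bilinI snoc_linear1 snoc_linear2)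

lemma T_ext:
  assumes "module K N" "f \<in> mod_hom K (T (Suc k)) N" "g \<in> mod_hom K (T (Suc k)) N"
    and "\<And>y h. y \<in> carrier (T k) \<Longrightarrow> h \<in> carrier H \<Longrightarrow> f (snoc k y h) = g (snoc k y h)"
    and "x \<in> carrier (T (Suc k))"
  shows "f x = g x"
proof (rule T_hom_eq[OF assms(1-3) _ assms(5)])
  fix v hs assume v: "v \<in> carrier A" and "hs \<in> tuples H (Suc k)"
  then obtain hs' h where "hs' \<in> tuples H k" "h \<in> carrier H" "hs = hs' @ [h]" by (elim tuples_snoc_cases)
  then show "f (t (Suc k) (v, hs)) = g (t (Suc k) (v, hs))"
    using assms(4)[OF t_closed[OF v]] v by (metis snoc_t)
qed

definition lift :: "nat \<Rightarrow> ('k, 'n, 'z) module_scheme \<Rightarrow> (('a \<times> 'h list \<Rightarrow> 'k) set \<Rightarrow> 'h \<Rightarrow> 'n) \<Rightarrow> ('a \<times> 'h list \<Rightarrow> 'k) set \<Rightarrow> 'n"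
  where "lift k N \<beta> = induced_map K N (\<lambda>(v, hs). \<beta> (t k (v, butlast hs)) (last hs))"

lemma lift:
  assumes "module K N" "bilin K (T k) H N \<beta>"
  shows lift_hom: "lift k N \<beta> \<in> mod_hom K (T (Suc k)) N"
    and lift_snoc: "\<And>y h. y \<in> carrier (T k) \<Longrightarrow> h \<in> carrier H \<Longrightarrow> lift k N \<beta> (snoc k y h) = \<beta> y h"
proof -
  let ?\<phi> = "\<lambda>(v, hs). \<beta> (t k (v, butlast hs)) (last hs)"
  have 1: "?\<phi> (v, hs) \<in> carrier N" if "v \<in> carrier A" "hs \<in> tuples H (Suc k)" for v hs
    using that bilin_closed[OF assms(2)] by (simp add: t_closed tuples_butlast tuples_last)
  have 2: "(\<lambda>v. ?\<phi> (v, hs)) \<in> mod_hom K A N" if "hs \<in> tuples H (Suc k)" for hs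
    using mod_hom_comp[OF bilinD(1)[OF assms(2) tuples_last] t_linear_coeff[OF tuples_butlast], OF that that] by simp
  have 3: "(\<lambda>g. ?\<phi> (v, hs[i := g])) \<in> mod_hom K H N"
    if v: "v \<in> carrier A" and hs: "hs \<in> tuples H (Suc k)" and i: "i < Suc k" for v hs i
  proof (cases "i = k")
    case True
    have "hs \<noteq> []" using hs by (auto simp: tuples_def)
    then have "butlast (hs[i := g]) = butlast hs" "last (hs[i := g]) = g" for g
      using hs True by (auto simp: tuples_def butlast_list_update last_list_update)
    then show ?thesis using bilinD(2)[OF assms(2) t_closed[OF v tuples_butlast[OF hs]]] by simp
  next
    case False
    have "hs \<noteq> []" using hs by (auto simp: tuples_def)
    then have "butlast (hs[i := g]) = (butlast hs)[i := g]" "last (hs[i := g]) = last hs" for g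
      using hs False i by (auto simp: tuples_def butlast_list_update last_list_update)
    then show ?thesis
      using mod_hom_comp[OF bilinD(1)[OF assms(2) tuples_last[OF hs]] t_linear_nth[OF v tuples_butlast[OF hs]], of i] i False by simp
  qed
  show hom: "lift k N \<beta> \<in> mod_hom K (T (Suc k)) N"
    unfolding lift_def by (rule T_induced_map(1)[where \<phi> = ?\<phi>, OF assms(1) 1 2 3])
  show "lift k N \<beta> (snoc k y h) = \<beta> y h" if "y \<in> carrier (T k)" "h \<in> carrier H" for y h
  proof (rule T_hom_eq[OF assms(1) mod_hom_comp[OF hom snoc_linear1] bilinD(1)[OF assms(2)] _ that(1)])
    fix v hs assume vh: "v \<in> carrier A" "hs \<in> tuples H k"
    show "lift k N \<beta> (snoc k (t k (v, hs)) h) = \<beta> (t k (v, hs)) h"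
      using T_induced_map(2)[where \<phi> = ?\<phi> and k = "Suc k" and v = v and hs = "hs @ [h]", OF assms(1)]
        1 2 3 vh that(2) tuples_snoc[OF vh(2) that(2)] by (simp add: snoc_t lift_def)
  qed (use that in auto)
qed

text \<open>The identification of \<open>A\<close> with \<open>T 0\<close>, at which these
  recursions start.\<close>

definition emb :: "'a \<Rightarrow> ('a \<times> 'h list \<Rightarrow> 'k) set"
  where "emb v = t 0 (v, [])"

lemma emb_hom: "emb \<in> mod_hom K A (T 0)"
  unfolding emb_def using t_linear_coeff[of "[]" 0] by simp

lemma emb_closed: "v \<in> carrier A \<Longrightarrow> emb v \<in> carrier (T 0)"
  by (rule mod_hom_closed[OF emb_hom])

definition lift0 :: "('k, 'n, 'z) module_scheme \<Rightarrow> ('a \<Rightarrow> 'n) \<Rightarrow> ('a \<times> 'h list \<Rightarrow> 'k) set \<Rightarrow> 'n"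
  where "lift0 N f = induced_map K N (\<lambda>(v, hs). f v)"

lemma lift0:
  assumes "module K N" "f \<in> mod_hom K A N"
  shows lift0_hom: "lift0 N f \<in> mod_hom K (T 0) N"
    and lift0_emb: "\<And>v. v \<in> carrier A \<Longrightarrow> lift0 N f (emb v) = f v"
proof -
  note l = T_induced_map[where \<phi> = "\<lambda>(v, hs). f v" and k = 0, OF assms(1)]
  show "lift0 N f \<in> mod_hom K (T 0) N" unfolding lift0_def by (rule l(1)) (use mod_hom_closed[OF assms(2)] assms(2) in auto)
  show "lift0 N f (emb v) = f v" if "v \<in> carrier A" for v
    unfolding lift0_def emb_def by (subst l(2)) (use mod_hom_closed[OF assms(2)] assms(2) that in auto)
qed

lemma emb_cases:
  assumes "y \<in> carrier (T 0)"
  obtains v where "v \<in> carrier A" "y = emb v"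
proof -
  have f: "lift0 A (\<lambda>v. v) \<in> mod_hom K (T 0) A" by (rule lift0_hom[OF A.module_axioms mod_hom_id])
  have "emb (lift0 A (\<lambda>v. v) y) = y"
    by (rule T_hom_eq[OF T_module mod_hom_comp[OF emb_hom f] mod_hom_id _ assms])
      (use lift0_emb[OF A.module_axioms mod_hom_id] in \<open>auto simp: emb_def\<close>)
  then show thesis using that mod_hom_closed[OF f assms] by metis
qed

end

lemma bilin_precomp:
  assumes "bilin K M N P \<beta>" "f \<in> mod_hom K M' M" "g \<in> mod_hom K N' N"
  shows "bilin K M' N' P (\<lambda>x y. \<beta> (f x) (g y))"
  by (intro bilinI mod_hom_comp[OF bilinD(1)[OF assms(1)] assms(2)] mod_hom_comp[OF bilinD(2)[OF assms(1)] assms(3)]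
      mod_hom_closed[OF assms(2)] mod_hom_closed[OF assms(3)])

lemma bilin_precomp1:
  "bilin K M N P \<beta> \<Longrightarrow> f \<in> mod_hom K M' M \<Longrightarrow> bilin K M' N P (\<lambda>x y. \<beta> (f x) y)"
  by (rule bilin_precomp[OF _ _ mod_hom_id])

lemma bilin_precomp2:
  "bilin K M N P \<beta> \<Longrightarrow> g \<in> mod_hom K N' N \<Longrightarrow> bilin K M N' P (\<lambda>x y. \<beta> x (g y))"
  by (rule bilin_precomp[OF _ mod_hom_id])

lemma bilin_add:
  assumes "module K P" "bilin K M N P \<beta>" "bilin K M N P \<gamma>"
  shows "bilin K M N P (\<lambda>x y. \<beta> x y \<oplus>\<^bsub>P\<^esub> \<gamma> x y)"
  by (intro bilinI mod_hom_addf[OF assms(1)] bilinD[OF assms(2)] bilinD[OF assms(3)])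

lemma bilin_smult:
  assumes "module K P" "bilin K M N P \<beta>" "c \<in> carrier K"
  shows "bilin K M N P (\<lambda>x y. c \<odot>\<^bsub>P\<^esub> \<beta> x y)"
  by (intro bilinI mod_hom_smultf[OF assms(1)] bilinD[OF assms(2)] assms(3))

lemma bilin_zero: "module K P \<Longrightarrow> bilin K M N P (\<lambda>x y. \<zero>\<^bsub>P\<^esub>)"
  by (intro bilinI mod_hom_zerof)

section \<open>The Loday complex\<close>

lemma (in cring) sgn_in_closed [simp]: "sgn_in R j \<in> carrier R"
  by (simp add: sgn_in_def)

lemma (in cring) sgn_in_0 [simp]: "sgn_in R 0 = \<one>"
  by (simp add: sgn_in_def)

lemma (in cring) sgn_in_Suc: "sgn_in R (Suc j) = \<ominus> sgn_in R j"
  by (simp add: sgn_in_def r_minus)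

lemma (in cring) sgn_in_add: "sgn_in R (i + j) = sgn_in R i \<otimes> sgn_in R j"
  by (simp add: sgn_in_def nat_pow_mult)

locale coefficients = mixed K H A
  for K :: "('k, 'r) ring_scheme" and H :: "('k, 'h, 'y) nalg_scheme" and A :: "('k, 'a, 'h, 'x) corep_scheme" +
  assumes bracket_bilin: "bilin K H H H (\<lambda>x y. bracket H [x, y])"
    and lact_bilin: "bilin K H A A (lact A)"
begin

abbreviation br :: "'h \<Rightarrow> 'h \<Rightarrow> 'h" where "br x y \<equiv> bracket H [x, y]"

text \<open>The action that enters the boundary, with the sign that lets coefficient and bracket
  terms share one recursion. It comes from the left action and is not the field \<open>ract\<close>:
  for \<open>\<gg>\<close> over \<open>D_alg\<close> it is the bracket, and for
  \<open>D_corep\<close> it is the derivation action although \<open>ract\<close> is zero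
  there.\<close>

definition ra :: "'a \<Rightarrow> 'h \<Rightarrow> 'a" where "ra v h = \<ominus>\<^bsub>A\<^esub> lact A h v"

lemma br_closed [simp]: "x \<in> carrier H \<Longrightarrow> y \<in> carrier H \<Longrightarrow> br x y \<in> carrier H"
  using bilin_closed[OF bracket_bilin] .

lemma lact_closed [simp]: "h \<in> carrier H \<Longrightarrow> v \<in> carrier A \<Longrightarrow> lact A h v \<in> carrier A"
  using bilin_closed[OF lact_bilin] .

lemma ra_bilin: "bilin K A H A ra"
  unfolding ra_def
  by (intro bilinI mod_hom_negf A.module_axioms bilinD[OF lact_bilin])

lemma ra_closed [simp]: "v \<in> carrier A \<Longrightarrow> h \<in> carrier H \<Longrightarrow> ra v h \<in> carrier A"
  using bilin_closed[OF ra_bilin] .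

lemmas [simp] = snoc_closed emb_closed

lemma hom_snoc: "f \<in> mod_hom K M (T k) \<Longrightarrow> h \<in> carrier H \<Longrightarrow> (\<lambda>x. snoc k (f x) h) \<in> mod_hom K M (T (Suc k))"
  by (rule mod_hom_comp[OF snoc_linear1])

lemma snoc_add1: "\<lbrakk>x \<in> carrier (T k); y \<in> carrier (T k); h \<in> carrier H\<rbrakk> \<Longrightarrow>
    snoc k (x \<oplus>\<^bsub>T k\<^esub> y) h = snoc k x h \<oplus>\<^bsub>T (Suc k)\<^esub> snoc k y h"
  by (rule mod_hom_add[OF snoc_linear1])

lemma snoc_add2: "\<lbrakk>y \<in> carrier (T k); g \<in> carrier H; h \<in> carrier H\<rbrakk> \<Longrightarrow>
    snoc k y (g \<oplus>\<^bsub>H\<^esub> h) = snoc k y g \<oplus>\<^bsub>T (Suc k)\<^esub> snoc k y h"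
  by (rule mod_hom_add[OF snoc_linear2])

lemma snoc_smult1: "\<lbrakk>c \<in> carrier K; y \<in> carrier (T k); h \<in> carrier H\<rbrakk> \<Longrightarrow>
    snoc k (c \<odot>\<^bsub>T k\<^esub> y) h = c \<odot>\<^bsub>T (Suc k)\<^esub> snoc k y h"
  by (rule mod_hom_smult[OF snoc_linear1])

lemma snoc_zero1: "h \<in> carrier H \<Longrightarrow> snoc k \<zero>\<^bsub>T k\<^esub> h = \<zero>\<^bsub>T (Suc k)\<^esub>"
  by (rule mod_hom_zero[OF T_module T_module snoc_linear1])

text \<open>The diagonal right action of \<open>h\<close> on a chain: a sum over all places, with
  \<open>ra\<close> on the coefficient and the bracket with \<open>h\<close> on each factor.\<close>

primrec act :: "nat \<Rightarrow> 'h \<Rightarrow> ('a \<times> 'h list \<Rightarrow> 'k) set \<Rightarrow> ('a \<times> 'h list \<Rightarrow> 'k) set"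
  where "act 0 h = lift0 (T 0) (\<lambda>v. emb (ra v h))"
  | "act (Suc k) h = lift k (T (Suc k)) (\<lambda>y g. snoc k (act k h y) g \<oplus>\<^bsub>T (Suc k)\<^esub> snoc k y (br g h))"

declare act.simps [simp del]

lemma act_step_bilin:
  assumes "h \<in> carrier H" "act k h \<in> mod_hom K (T k) (T k)"
  shows "bilin K (T k) H (T (Suc k)) (\<lambda>y g. snoc k (act k h y) g \<oplus>\<^bsub>T (Suc k)\<^esub> snoc k y (br g h))"
  by (rule bilin_add[OF T_module bilin_precomp1[OF snoc_bilin assms(2)] bilin_precomp2[OF snoc_bilin]])
    (rule bilinD(1)[OF bracket_bilin assms(1)])

lemma act_hom: "h \<in> carrier H \<Longrightarrow> act k h \<in> mod_hom K (T k) (T k)"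
proof (induction k)
  case 0
  show ?case unfolding act.simps
    by (rule lift0_hom[OF T_module mod_hom_comp[OF emb_hom bilinD(1)[OF ra_bilin 0]]])
next
  case (Suc k)
  show ?case unfolding act.simps
    by (rule lift_hom[OF T_module act_step_bilin[OF Suc.prems Suc.IH[OF Suc.prems]]])
qed

lemma act_closed [simp]: "h \<in> carrier H \<Longrightarrow> y \<in> carrier (T k) \<Longrightarrow> act k h y \<in> carrier (T k)"
  by (rule mod_hom_closed[OF act_hom])

lemma hom_act: "f \<in> mod_hom K M (T k) \<Longrightarrow> h \<in> carrier H \<Longrightarrow> (\<lambda>x. act k h (f x)) \<in> mod_hom K M (T k)"
  by (rule mod_hom_comp[OF act_hom])

lemma act_emb: "h \<in> carrier H \<Longrightarrow> v \<in> carrier A \<Longrightarrow> act 0 h (emb v) = emb (ra v h)"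
  unfolding act.simps by (rule lift0_emb[OF T_module mod_hom_comp[OF emb_hom bilinD(1)[OF ra_bilin]]])

lemma act_snoc:
  "h \<in> carrier H \<Longrightarrow> y \<in> carrier (T k) \<Longrightarrow> g \<in> carrier H \<Longrightarrow>
    act (Suc k) h (snoc k y g) = snoc k (act k h y) g \<oplus>\<^bsub>T (Suc k)\<^esub> snoc k y (br g h)"
  unfolding act.simps by (rule lift_snoc[OF T_module act_step_bilin[OF _ act_hom]])

lemma act_add: "\<lbrakk>h \<in> carrier H; x \<in> carrier (T k); y \<in> carrier (T k)\<rbrakk> \<Longrightarrow>
    act k h (x \<oplus>\<^bsub>T k\<^esub> y) = act k h x \<oplus>\<^bsub>T k\<^esub> act k h y"
  by (rule mod_hom_add[OF act_hom])

lemma act_smult: "\<lbrakk>h \<in> carrier H; c \<in> carrier K; y \<in> carrier (T k)\<rbrakk> \<Longrightarrow>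
    act k h (c \<odot>\<^bsub>T k\<^esub> y) = c \<odot>\<^bsub>T k\<^esub> act k h y"
  by (rule mod_hom_smult[OF act_hom])

lemmas hom_intros = hom_snoc hom_act mod_hom_addf[OF T_module] mod_hom_smultf[OF T_module] mod_hom_id
  mod_hom_zerof[OF T_module] K.sgn_in_closed br_closed

text \<open>The recursion fixes \<open>h\<close>, so linearity in \<open>h\<close> needs an
  induction of its own. It is required for \<open>dd\<close>, where \<open>h\<close> is the appended
  factor and varies.\<close>

lemma act_linear:
  assumes y: "y \<in> carrier (T k)"
  shows "(\<lambda>h. act k h y) \<in> mod_hom K H (T k)"
  using y
proof (induction k arbitrary: y)
  case 0
  then obtain v where v: "v \<in> carrier A" "y = emb v" by (elim emb_cases)
  have "(\<lambda>h. emb (ra v h)) \<in> mod_hom K H (T 0)"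
    by (rule mod_hom_comp[OF emb_hom bilinD(2)[OF ra_bilin v(1)]])
  then show ?case by (rule mod_hom_cong[OF H.module_axioms]) (simp add: v act_emb)
next
  case (Suc k)
  have cm: "c \<odot>\<^bsub>T (Suc k)\<^esub> (a \<oplus>\<^bsub>T (Suc k)\<^esub> b) = c \<odot>\<^bsub>T (Suc k)\<^esub> a \<oplus>\<^bsub>T (Suc k)\<^esub> c \<odot>\<^bsub>T (Suc k)\<^esub> b"
    if "c \<in> carrier K" "a \<in> carrier (T (Suc k))" "b \<in> carrier (T (Suc k))" for a b c
    using that by (rule T.smult_r_distr)
  show ?case
  proof (rule mod_homI)
    show "act (Suc k) h y \<in> carrier (T (Suc k))" if "h \<in> carrier H" for h using that Suc.prems by simp
    show "act (Suc k) (g \<oplus>\<^bsub>H\<^esub> h) y = act (Suc k) g y \<oplus>\<^bsub>T (Suc k)\<^esub> act (Suc k) h y"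
      if gh: "g \<in> carrier H" "h \<in> carrier H" for g h
    proof (rule T_ext[where N = "T (Suc k)", OF T_module _ _ _ Suc.prems])
      fix y x assume y: "y \<in> carrier (T k)" and x: "x \<in> carrier H"
      show "act (Suc k) (g \<oplus>\<^bsub>H\<^esub> h) (snoc k y x) = act (Suc k) g (snoc k y x) \<oplus>\<^bsub>T (Suc k)\<^esub> act (Suc k) h (snoc k y x)"
        using gh x y
        by (simp add: act_snoc mod_hom_add[OF Suc.IH[OF y]] snoc_add1 mod_hom_add[OF bilinD(2)[OF bracket_bilin]] snoc_add2 T.a_ac)
    qed (intro hom_intros H.a_closed gh)+
    show "act (Suc k) (c \<odot>\<^bsub>H\<^esub> h) y = c \<odot>\<^bsub>T (Suc k)\<^esub> act (Suc k) h y"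
      if ch: "c \<in> carrier K" "h \<in> carrier H" for c h
    proof (rule T_ext[where N = "T (Suc k)", OF T_module _ _ _ Suc.prems])
      fix y x assume y: "y \<in> carrier (T k)" and x: "x \<in> carrier H"
      show "act (Suc k) (c \<odot>\<^bsub>H\<^esub> h) (snoc k y x) = c \<odot>\<^bsub>T (Suc k)\<^esub> act (Suc k) h (snoc k y x)"
        using ch x y
        by (simp add: act_snoc mod_hom_smult[OF Suc.IH[OF y]] snoc_smult1 mod_hom_smult[OF bilinD(2)[OF bracket_bilin]]
            mod_hom_smult[OF snoc_linear2] cm)
    qed (intro hom_intros H.smult_closed ch)+
  qed
qed

lemma act_t:
  assumes "h \<in> carrier H" "v \<in> carrier A" "hs \<in> tuples H k"
  shows "act k h (t k (v, hs)) = t k (ra v h, hs) \<oplus>\<^bsub>T k\<^esub> (\<Oplus>\<^bsub>T k\<^esub>i\<in>{..<k}. t k (v, hs[i := br (hs ! i) h]))"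
  using assms(3)
proof (induction k arbitrary: hs)
  case 0
  then show ?case using act_emb[OF assms(1,2)] t_closed[of "ra v h" "[]" 0] assms by (simp add: emb_def)
next
  case (Suc k)
  then obtain hs' g where hs: "hs' \<in> tuples H k" "g \<in> carrier H" "hs = hs' @ [g]" by (elim tuples_snoc_cases)
  have len: "length hs' = k" using hs(1) by (rule tuples_length)
  have cl: "t k (v, hs'[i := br (hs' ! i) h]) \<in> carrier (T k)" if "i < k" for i
    using that hs(1) assms by (intro t_closed tuples_update br_closed tuples_nth) auto
  have S: "(\<lambda>i. t (Suc k) (v, hs[i := br (hs ! i) h])) \<in> {..<k} \<rightarrow> carrier (T (Suc k))"
    using Suc.prems assms by (intro Pi_I t_closed tuples_update br_closed tuples_nth[of _ _ "Suc k"]) auto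
  have eq: "snoc k (t k (v, hs'[i := br (hs' ! i) h])) g = t (Suc k) (v, hs[i := br (hs ! i) h])" if "i < k" for i
    using that hs assms len by (subst snoc_t) (auto intro!: tuples_update br_closed tuples_nth simp: list_update_append nth_append)
  have "act (Suc k) h (t (Suc k) (v, hs)) = act (Suc k) h (snoc k (t k (v, hs')) g)"
    using hs assms by (simp add: snoc_t)
  also have "\<dots> = snoc k (act k h (t k (v, hs'))) g \<oplus>\<^bsub>T (Suc k)\<^esub> snoc k (t k (v, hs')) (br g h)"
    using hs assms by (intro act_snoc t_closed)
  also have "snoc k (t k (v, hs')) (br g h) = t (Suc k) (v, hs[k := br (hs ! k) h])"
    using hs assms len by (simp add: snoc_t list_update_append nth_append)
  also have "snoc k (act k h (t k (v, hs'))) g =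
      t (Suc k) (ra v h, hs) \<oplus>\<^bsub>T (Suc k)\<^esub> (\<Oplus>\<^bsub>T (Suc k)\<^esub>i\<in>{..<k}. snoc k (t k (v, hs'[i := br (hs' ! i) h])) g)"
    unfolding Suc.IH[OF hs(1)]
    by (subst snoc_add1)
      (use hs assms cl mod_hom_finsum[OF T_module T_module snoc_linear1[OF hs(2)], of "\<lambda>i. t k (v, hs'[i := br (hs' ! i) h])" "{..<k}" k]
        in \<open>auto simp: snoc_t t_closed intro!: T.finsum_closed\<close>)
  also have "(\<Oplus>\<^bsub>T (Suc k)\<^esub>i\<in>{..<k}. snoc k (t k (v, hs'[i := br (hs' ! i) h])) g) =
      (\<Oplus>\<^bsub>T (Suc k)\<^esub>i\<in>{..<k}. t (Suc k) (v, hs[i := br (hs ! i) h]))"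
    using S eq by (intro T.finsum_cong') auto
  finally have 1: "act (Suc k) h (t (Suc k) (v, hs)) = (t (Suc k) (ra v h, hs) \<oplus>\<^bsub>T (Suc k)\<^esub>
      (\<Oplus>\<^bsub>T (Suc k)\<^esub>i\<in>{..<k}. t (Suc k) (v, hs[i := br (hs ! i) h]))) \<oplus>\<^bsub>T (Suc k)\<^esub> t (Suc k) (v, hs[k := br (hs ! k) h])" .
  have kc: "t (Suc k) (v, hs[k := br (hs ! k) h]) \<in> carrier (T (Suc k))"
    using Suc.prems assms by (intro t_closed tuples_update br_closed tuples_nth[of _ _ "Suc k"]) auto
  have "(\<Oplus>\<^bsub>T (Suc k)\<^esub>i\<in>{..<Suc k}. t (Suc k) (v, hs[i := br (hs ! i) h])) =
      t (Suc k) (v, hs[k := br (hs ! k) h]) \<oplus>\<^bsub>T (Suc k)\<^esub> (\<Oplus>\<^bsub>T (Suc k)\<^esub>i\<in>{..<k}. t (Suc k) (v, hs[i := br (hs ! i) h]))"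
    unfolding lessThan_Suc using S kc by (subst T.finsum_insert) auto
  then show ?case unfolding 1 using S kc assms Suc.prems by (simp add: T.a_ac t_closed)
qed

text \<open>The Loday boundary through d (y \<otimes> h) = d y \<otimes> h + (-1)^k (y acted on by
  h): the terms deleting the last factor are exactly its diagonal action on what precedes it.
  Deleting factor k + 1 carries (-1)^(k+2) in front of brackets, and \<open>ra\<close> absorbs the
  opposite sign of the coefficient term. The case distinction drops d y in degree 0, where there is
  no lower degree.\<close>

primrec dd :: "nat \<Rightarrow> ('a \<times> 'h list \<Rightarrow> 'k) set \<Rightarrow> ('a \<times> 'h list \<Rightarrow> 'k) set"
  where "dd 0 = (\<lambda>y. \<zero>\<^bsub>T 0\<^esub>)"
  | "dd (Suc k) = lift k (T k) (\<lambda>y h. (case k of 0 \<Rightarrow> \<zero>\<^bsub>T k\<^esub> | Suc j \<Rightarrow> snoc j (dd k y) h) \<oplus>\<^bsub>T k\<^esub> sgn_in K k \<odot>\<^bsub>T k\<^esub> act k h y)"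

declare dd.simps [simp del]

definition dsn :: "nat \<Rightarrow> ('a \<times> 'h list \<Rightarrow> 'k) set \<Rightarrow> 'h \<Rightarrow> ('a \<times> 'h list \<Rightarrow> 'k) set"
  where "dsn k y h = (case k of 0 \<Rightarrow> \<zero>\<^bsub>T k\<^esub> | Suc j \<Rightarrow> snoc j (dd k y) h)"

lemma act_bilin': "bilin K (T k) H (T k) (\<lambda>y h. act k h y)"
  by (intro bilinI act_hom act_linear)

lemma dsn_bilin:
  assumes "\<And>j. k = Suc j \<Longrightarrow> dd k \<in> mod_hom K (T k) (T j)"
  shows "bilin K (T k) H (T k) (dsn k)"
proof (cases k)
  case 0
  then show ?thesis by (simp add: dsn_def[abs_def] bilin_zero[OF T_module])
next
  case (Suc j)
  then show ?thesis using bilin_precomp1[OF snoc_bilin assms[OF Suc]] by (simp add: dsn_def[abs_def])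
qed

lemma dd_hom_Suc: "dd (Suc k) \<in> mod_hom K (T (Suc k)) (T k)"
proof (induction k)
  case 0
  have "bilin K (T 0) H (T 0) (dsn 0)" by (rule dsn_bilin) simp
  from lift_hom[OF T_module bilin_add[OF T_module this bilin_smult[OF T_module act_bilin' K.sgn_in_closed]], of 0]
  show ?case by (simp add: dd.simps dsn_def)
next
  case (Suc k)
  have "bilin K (T (Suc k)) H (T (Suc k)) (dsn (Suc k))" by (rule dsn_bilin) (use Suc in simp)
  from lift_hom[OF T_module bilin_add[OF T_module this bilin_smult[OF T_module act_bilin' K.sgn_in_closed]], of "Suc k"]
  show ?case unfolding dd.simps(2)[of "Suc k"] by (simp add: dsn_def)
qed

lemma dsn_bilin': "bilin K (T k) H (T k) (dsn k)"
  by (rule dsn_bilin) (use dd_hom_Suc in simp)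

lemma dd_hom: "dd k \<in> mod_hom K (T k) (T (k - 1))"
  by (cases k) (simp_all add: dd_hom_Suc dd.simps(1) mod_hom_zerof[OF T_module])

lemma dd_closed [simp]: "y \<in> carrier (T (Suc k)) \<Longrightarrow> dd (Suc k) y \<in> carrier (T k)"
  by (rule mod_hom_closed[OF dd_hom_Suc])

lemma dsn_closed [simp]: "y \<in> carrier (T k) \<Longrightarrow> h \<in> carrier H \<Longrightarrow> dsn k y h \<in> carrier (T k)"
  using bilin_closed[OF dsn_bilin'] .

lemma dd_snoc: "y \<in> carrier (T k) \<Longrightarrow> h \<in> carrier H \<Longrightarrow>
    dd (Suc k) (snoc k y h) = dsn k y h \<oplus>\<^bsub>T k\<^esub> sgn_in K k \<odot>\<^bsub>T k\<^esub> act k h y"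
  unfolding dd.simps dsn_def[symmetric]
  by (rule lift_snoc[OF T_module bilin_add[OF T_module dsn_bilin' bilin_smult[OF T_module act_bilin' K.sgn_in_closed]]])

lemma dsn_0 [simp]: "dsn 0 y h = \<zero>\<^bsub>T 0\<^esub>"
  by (simp add: dsn_def)

lemma dsn_Suc [simp]: "dsn (Suc k) y h = snoc k (dd (Suc k) y) h"
  by (simp add: dsn_def)

lemma hom_dd: "f \<in> mod_hom K M (T (Suc k)) \<Longrightarrow> (\<lambda>x. dd (Suc k) (f x)) \<in> mod_hom K M (T k)"
  by (rule mod_hom_comp[OF dd_hom_Suc])

lemma dd_add: "\<lbrakk>x \<in> carrier (T (Suc k)); y \<in> carrier (T (Suc k))\<rbrakk> \<Longrightarrow>
    dd (Suc k) (x \<oplus>\<^bsub>T (Suc k)\<^esub> y) = dd (Suc k) x \<oplus>\<^bsub>T k\<^esub> dd (Suc k) y"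
  by (rule mod_hom_add[OF dd_hom_Suc])

lemma dd_smult: "\<lbrakk>c \<in> carrier K; y \<in> carrier (T (Suc k))\<rbrakk> \<Longrightarrow>
    dd (Suc k) (c \<odot>\<^bsub>T (Suc k)\<^esub> y) = c \<odot>\<^bsub>T k\<^esub> dd (Suc k) y"
  by (rule mod_hom_smult[OF dd_hom_Suc])

text \<open>Induction on the last factor: the summands with j = k come from the action term by
  \<open>act_t\<close>, all others from appending the last factor to the formula one degree
  below.\<close>

lemma dd_t:
  assumes "v \<in> carrier A" "hs \<in> tuples H (Suc k)"
  shows "dd (Suc k) (t (Suc k) (v, hs)) =
    (\<Oplus>\<^bsub>T k\<^esub>j\<in>{..<Suc k}. sgn_in K (j + 1) \<odot>\<^bsub>T k\<^esub> t k (lact A (hs ! j) v, del j hs)) \<oplus>\<^bsub>T k\<^esub>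
    (\<Oplus>\<^bsub>T k\<^esub>j\<in>{..<Suc k}. \<Oplus>\<^bsub>T k\<^esub>i\<in>{..<j}. sgn_in K j \<odot>\<^bsub>T k\<^esub> t k (v, del j (hs[i := br (hs ! i) (hs ! j)])))"
  using assms(2)
proof (induction k arbitrary: hs)
  let ?a = "\<lambda>k hs j. sgn_in K (j + 1) \<odot>\<^bsub>T k\<^esub> t k (lact A (hs ! j) v, del j hs)"
  let ?b = "\<lambda>k hs j i. sgn_in K j \<odot>\<^bsub>T k\<^esub> t k (v, del j (hs[i := br (hs ! i) (hs ! j)]))"
  have del: "del j xs \<in> tuples H k" if "xs \<in> tuples H (Suc k)" "j < Suc k" for j xs k
    using that unfolding del_def tuples_def by (auto dest: in_set_takeD in_set_dropD)
  have ac: "?a k hs j \<in> carrier (T k)" if "hs \<in> tuples H (Suc k)" "j < Suc k" for k hs j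
    using that assms(1) by (intro T.smult_closed K.sgn_in_closed t_closed lact_closed tuples_nth del) auto
  have bc: "?b k hs j i \<in> carrier (T k)" if "hs \<in> tuples H (Suc k)" "j < Suc k" "i < j" for k hs j i
    using that assms(1) by (intro T.smult_closed K.sgn_in_closed t_closed br_closed tuples_nth[of _ _ "Suc k"] del tuples_update) auto
  have last: "dd (Suc k) (t (Suc k) (v, hs' @ [h])) =
      dsn k (t k (v, hs')) h \<oplus>\<^bsub>T k\<^esub> (?a k (hs' @ [h]) k \<oplus>\<^bsub>T k\<^esub> (\<Oplus>\<^bsub>T k\<^esub>i\<in>{..<k}. ?b k (hs' @ [h]) k i))"
    if hs': "hs' \<in> tuples H k" and h: "h \<in> carrier H" for k hs' h
  proof -
    have len: "length hs' = k" using hs' by (rule tuples_length)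
    have cl: "t k (v, hs'[i := br (hs' ! i) h]) \<in> carrier (T k)" if "i < k" for i
      using that hs' h assms(1) by (intro t_closed tuples_update br_closed tuples_nth) auto
    have lc: "t k (lact A h v, hs') \<in> carrier (T k)" using hs' h assms(1) by (simp add: t_closed)
    have "dd (Suc k) (t (Suc k) (v, hs' @ [h])) = dsn k (t k (v, hs')) h \<oplus>\<^bsub>T k\<^esub> sgn_in K k \<odot>\<^bsub>T k\<^esub> act k h (t k (v, hs'))"
      using dd_snoc[OF t_closed[OF assms(1) hs'] h] hs' h assms(1) by (simp add: snoc_t)
    also have "sgn_in K k \<odot>\<^bsub>T k\<^esub> act k h (t k (v, hs')) =
        sgn_in K k \<odot>\<^bsub>T k\<^esub> t k (ra v h, hs') \<oplus>\<^bsub>T k\<^esub> (\<Oplus>\<^bsub>T k\<^esub>i\<in>{..<k}. sgn_in K k \<odot>\<^bsub>T k\<^esub> t k (v, hs'[i := br (hs' ! i) h]))"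
      using cl hs' h assms(1)
      by (subst T.finsum_smult_ldistr[symmetric]) (auto simp: act_t T.smult_r_distr t_closed)
    also have "t k (ra v h, hs') = \<ominus>\<^bsub>T k\<^esub> t k (lact A h v, hs')"
      unfolding ra_def using mod_hom_neg[OF A.module_axioms T_module t_linear_coeff[OF hs']] h assms(1) by simp
    also have "sgn_in K k \<odot>\<^bsub>T k\<^esub> \<ominus>\<^bsub>T k\<^esub> t k (lact A h v, hs') = ?a k (hs' @ [h]) k"
      using len lc by (simp add: del_def nth_append K.sgn_in_Suc T.smult_r_minus T.smult_l_minus)
    also have "(\<Oplus>\<^bsub>T k\<^esub>i\<in>{..<k}. sgn_in K k \<odot>\<^bsub>T k\<^esub> t k (v, hs'[i := br (hs' ! i) h])) = (\<Oplus>\<^bsub>T k\<^esub>i\<in>{..<k}. ?b k (hs' @ [h]) k i)"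
      using len bc[OF tuples_snoc[OF hs' h], of k]
      by (intro T.finsum_cong') (auto simp: del_def nth_append list_update_append)
    finally show ?thesis .
  qed
  have split: "(\<Oplus>\<^bsub>T k\<^esub>j\<in>{..<Suc k}. ?a k hs j) \<oplus>\<^bsub>T k\<^esub> (\<Oplus>\<^bsub>T k\<^esub>j\<in>{..<Suc k}. \<Oplus>\<^bsub>T k\<^esub>i\<in>{..<j}. ?b k hs j i) =
      ((\<Oplus>\<^bsub>T k\<^esub>j\<in>{..<k}. ?a k hs j) \<oplus>\<^bsub>T k\<^esub> (\<Oplus>\<^bsub>T k\<^esub>j\<in>{..<k}. \<Oplus>\<^bsub>T k\<^esub>i\<in>{..<j}. ?b k hs j i)) \<oplus>\<^bsub>T k\<^esub>
      (?a k hs k \<oplus>\<^bsub>T k\<^esub> (\<Oplus>\<^bsub>T k\<^esub>i\<in>{..<k}. ?b k hs k i))" if hs: "hs \<in> tuples H (Suc k)" for hs k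
  proof -
    have bi: "(\<Oplus>\<^bsub>T k\<^esub>i\<in>{..<j}. ?b k hs j i) \<in> carrier (T k)" if "j < Suc k" for j
      using bc[OF hs that] by (intro T.finsum_closed) auto
    have as: "(\<Oplus>\<^bsub>T k\<^esub>j\<in>{..<k}. ?a k hs j) \<in> carrier (T k)" using ac[OF hs] by (intro T.finsum_closed) auto
    have bs: "(\<Oplus>\<^bsub>T k\<^esub>j\<in>{..<k}. \<Oplus>\<^bsub>T k\<^esub>i\<in>{..<j}. ?b k hs j i) \<in> carrier (T k)" using bi by (intro T.finsum_closed) auto
    have "(\<Oplus>\<^bsub>T k\<^esub>j\<in>{..<Suc k}. ?a k hs j) = ?a k hs k \<oplus>\<^bsub>T k\<^esub> (\<Oplus>\<^bsub>T k\<^esub>j\<in>{..<k}. ?a k hs j)"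
      unfolding lessThan_Suc using ac[OF hs] by (subst T.finsum_insert) auto
    moreover have "(\<Oplus>\<^bsub>T k\<^esub>j\<in>{..<Suc k}. \<Oplus>\<^bsub>T k\<^esub>i\<in>{..<j}. ?b k hs j i) =
        (\<Oplus>\<^bsub>T k\<^esub>i\<in>{..<k}. ?b k hs k i) \<oplus>\<^bsub>T k\<^esub> (\<Oplus>\<^bsub>T k\<^esub>j\<in>{..<k}. \<Oplus>\<^bsub>T k\<^esub>i\<in>{..<j}. ?b k hs j i)"
      unfolding lessThan_Suc using bi by (subst T.finsum_insert) auto
    ultimately show ?thesis using as bs ac[OF hs, of k] bi[of k] by (simp add: T.a_ac del: T.finsum_closed)
  qed
  {
    case 0
    then obtain hs' h where hs: "hs' \<in> tuples H 0" "h \<in> carrier H" "hs = hs' @ [h]" by (elim tuples_snoc_cases)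
    show ?case unfolding split[OF 0] unfolding hs(3) last[OF hs(1,2)] using T.zero_closed by simp
  next
    case (Suc k)
    obtain hs' h where hs: "hs' \<in> tuples H (Suc k)" "h \<in> carrier H" "hs = hs' @ [h]"
      using tuples_snoc_cases[OF Suc.prems] by metis
    have len: "length hs' = Suc k" using hs(1) by (rule tuples_length)
    have sa: "snoc k (?a k hs' j) h = ?a (Suc k) hs j" if "j < Suc k" for j
      using that hs len assms(1) del[OF hs(1) that] tuples_nth[OF hs(1) that]
      by (simp add: snoc_smult1 snoc_t t_closed del_def nth_append)
    have sb: "snoc k (?b k hs' j i) h = ?b (Suc k) hs j i" if "j < Suc k" "i < j" for i j
    proof -
      have "hs'[i := br (hs' ! i) (hs' ! j)] \<in> tuples H (Suc k)"
        using that hs by (intro tuples_update br_closed tuples_nth[of _ _ "Suc k"]) auto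
      from del[OF this that(1)] show ?thesis
        using that hs len assms(1) by (simp add: snoc_smult1 snoc_t t_closed del_def nth_append list_update_append)
    qed
    have bi: "(\<Oplus>\<^bsub>T k\<^esub>i\<in>{..<j}. ?b k hs' j i) \<in> carrier (T k)" if "j < Suc k" for j
      using bc[OF hs(1) that] by (intro T.finsum_closed) auto
    have 1: "snoc k (\<Oplus>\<^bsub>T k\<^esub>j\<in>{..<Suc k}. ?a k hs' j) h = (\<Oplus>\<^bsub>T (Suc k)\<^esub>j\<in>{..<Suc k}. ?a (Suc k) hs j)"
      using ac[OF hs(1)] ac[OF Suc.prems] sa
      by (subst mod_hom_finsum[OF T_module T_module snoc_linear1[OF hs(2)]], simp add: Pi_iff, intro T.finsum_cong')
        (simp_all add: Pi_iff)
    have 2: "snoc k (\<Oplus>\<^bsub>T k\<^esub>i\<in>{..<j}. ?b k hs' j i) h = (\<Oplus>\<^bsub>T (Suc k)\<^esub>i\<in>{..<j}. ?b (Suc k) hs j i)" if "j < Suc k" for j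
      using bc[OF hs(1) that] bc[OF Suc.prems, of j] sb[OF that] that
      by (subst mod_hom_finsum[OF T_module T_module snoc_linear1[OF hs(2)]], simp add: Pi_iff, intro T.finsum_cong')
        (simp_all add: Pi_iff)
    have bi': "(\<Oplus>\<^bsub>T (Suc k)\<^esub>i\<in>{..<j}. ?b (Suc k) hs j i) \<in> carrier (T (Suc k))" if "j < Suc k" for j
      using bc[OF Suc.prems, of j] that by (intro T.finsum_closed) auto
    have 3: "snoc k (\<Oplus>\<^bsub>T k\<^esub>j\<in>{..<Suc k}. \<Oplus>\<^bsub>T k\<^esub>i\<in>{..<j}. ?b k hs' j i) h =
        (\<Oplus>\<^bsub>T (Suc k)\<^esub>j\<in>{..<Suc k}. \<Oplus>\<^bsub>T (Suc k)\<^esub>i\<in>{..<j}. ?b (Suc k) hs j i)"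
      using bi bi' 2
      by (subst mod_hom_finsum[OF T_module T_module snoc_linear1[OF hs(2)]], simp add: Pi_iff, intro T.finsum_cong')
        (simp_all add: Pi_iff)
    have as: "(\<Oplus>\<^bsub>T k\<^esub>j\<in>{..<Suc k}. ?a k hs' j) \<in> carrier (T k)" using ac[OF hs(1)] by (intro T.finsum_closed) auto
    have bs: "(\<Oplus>\<^bsub>T k\<^esub>j\<in>{..<Suc k}. \<Oplus>\<^bsub>T k\<^esub>i\<in>{..<j}. ?b k hs' j i) \<in> carrier (T k)" using bi by (intro T.finsum_closed) auto
    show ?case
      unfolding split[OF Suc.prems] 1[symmetric] 3[symmetric]
      unfolding snoc_add1[OF as bs hs(2), symmetric] Suc.IH[OF hs(1), symmetric]
      unfolding hs(3) last[OF hs(1,2)] by simp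
  }
qed

lemma loday_boundary_eq:
  assumes "y \<in> carrier (T k)"
  shows "loday_boundary K H A k y = dd k y"
proof -
  show ?thesis unfolding loday_boundary_def Let_def
  proof (rule T_induced_map_eq[OF T_module dd_hom _ assms])
    fix v hs assume vh: "v \<in> carrier A" "hs \<in> tuples H k"
    show "(case (v, hs) of (v, hs) \<Rightarrow>
        (\<Oplus>\<^bsub>T (k - 1)\<^esub>j\<in>{..<k}. sgn_in K (j + 1) \<odot>\<^bsub>T (k - 1)\<^esub> t (k - 1) (lact A (hs ! j) v, del j hs)) \<oplus>\<^bsub>T (k - 1)\<^esub>
        (\<Oplus>\<^bsub>T (k - 1)\<^esub>j\<in>{..<k}. \<Oplus>\<^bsub>T (k - 1)\<^esub>i\<in>{..<j}.
           sgn_in K j \<odot>\<^bsub>T (k - 1)\<^esub> t (k - 1) (v, del j (hs[i := br (hs ! i) (hs ! j)])))) = dd k (t k (v, hs))"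
    proof (cases k)
      case 0
      then show ?thesis by (simp add: dd.simps(1))
    next
      case (Suc j)
      then show ?thesis using dd_t[of v hs j] vh by simp
    qed
  qed
qed

end

locale leibniz_complex = coefficients +
  assumes leibniz: "\<lbrakk>x \<in> carrier H; y \<in> carrier H; z \<in> carrier H\<rbrakk> \<Longrightarrow>
      br (br x y) z = br (br x z) y \<oplus>\<^bsub>H\<^esub> br x (br y z)"
    and ra_ra: "\<lbrakk>v \<in> carrier A; x \<in> carrier H; y \<in> carrier H\<rbrakk> \<Longrightarrow>
      ra (ra v x) y = ra (ra v y) x \<oplus>\<^bsub>A\<^esub> ra v (br x y)"
begin

text \<open>On the coefficient this is \<open>ra_ra\<close>, on a single factor the Leibniz
  identity; the terms in which \<open>g\<close> and \<open>h\<close> act at different places occur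
  on both sides.\<close>

lemma act_act:
  assumes "g \<in> carrier H" "h \<in> carrier H" "y \<in> carrier (T k)"
  shows "act k h (act k g y) = act k g (act k h y) \<oplus>\<^bsub>T k\<^esub> act k (br g h) y"
  using assms(3)
proof (induction k arbitrary: y)
  case 0
  then obtain v where v: "v \<in> carrier A" "y = emb v" by (elim emb_cases)
  then show ?case using assms by (simp add: act_emb ra_ra[OF v(1) assms(1,2)] mod_hom_add[OF emb_hom])
next
  case (Suc k)
  show ?case
  proof (rule T_ext[where N = "T (Suc k)", OF T_module _ _ _ Suc.prems])
    fix y x assume y: "y \<in> carrier (T k)" and x: "x \<in> carrier H"
    then show "act (Suc k) h (act (Suc k) g (snoc k y x)) =
      act (Suc k) g (act (Suc k) h (snoc k y x)) \<oplus>\<^bsub>T (Suc k)\<^esub> act (Suc k) (br g h) (snoc k y x)"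
      using assms(1,2) by (simp add: act_snoc act_add Suc.IH[OF y] snoc_add1 leibniz[OF x assms(1,2)] snoc_add2 T.a_ac)
  qed (intro hom_intros assms)+
qed

text \<open>Each \<open>h\<close> acts by a chain map. The only discrepancy in the recursion is the
  commutator of two actions on \<open>y\<close>, which \<open>act_act\<close> matches with the term
  where \<open>h\<close> acts on the appended factor.\<close>

lemma dd_act:
  assumes h: "h \<in> carrier H" and y: "y \<in> carrier (T (Suc k))"
  shows "dd (Suc k) (act (Suc k) h y) = act k h (dd (Suc k) y)"
  using y
proof (induction k arbitrary: y)
  case 0
  show ?case
  proof (rule T_ext[where N = "T 0", OF T_module _ _ _ 0])
    fix y x assume "y \<in> carrier (T 0)" "x \<in> carrier H"
    then show "dd (Suc 0) (act (Suc 0) h (snoc 0 y x)) = act 0 h (dd (Suc 0) (snoc 0 y x))"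
      using h by (simp add: act_snoc dd_snoc dd_add act_act[of x h])
  qed (intro hom_intros hom_dd h)+
next
  case (Suc k)
  show ?case
  proof (rule T_ext[where N = "T (Suc k)", OF T_module _ _ _ Suc.prems])
    fix y x assume y: "y \<in> carrier (T (Suc k))" and x: "x \<in> carrier H"
    then show "dd (Suc (Suc k)) (act (Suc (Suc k)) h (snoc (Suc k) y x)) =
        act (Suc k) h (dd (Suc (Suc k)) (snoc (Suc k) y x))"
      using h by (simp add: act_snoc dd_snoc dd_add Suc.IH[OF y] act_add act_smult snoc_add1 act_act[of x h]
          T.smult_r_distr T.a_ac)
  qed (intro hom_intros hom_dd h)+
qed

text \<open>Expanding the recursion twice produces the action on d y twice, with consecutive signs,
  because the boundary commutes with the action. These cancel, and d (d y) vanishes by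
  induction.\<close>

lemma dd_dd:
  assumes "y \<in> carrier (T (Suc (Suc k)))"
  shows "dd (Suc k) (dd (Suc (Suc k)) y) = \<zero>\<^bsub>T k\<^esub>"
  using assms
proof (induction k arbitrary: y)
  case 0
  show ?case
  proof (rule T_ext[where N = "T 0", OF T_module _ _ _ 0])
    fix y x assume y: "y \<in> carrier (T (Suc 0))" and x: "x \<in> carrier H"
    then show "dd (Suc 0) (dd (Suc (Suc 0)) (snoc (Suc 0) y x)) = \<zero>\<^bsub>T 0\<^esub>"
      by (simp add: dd_snoc dd_add dd_act K.sgn_in_Suc T.smult_l_minus T.r_neg mod_hom_neg[OF T_module T_module dd_hom_Suc])
  qed (intro hom_intros hom_dd)+
next
  case (Suc k)
  show ?case
  proof (rule T_ext[where N = "T (Suc k)", OF T_module _ _ _ Suc.prems])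
    fix y x assume y: "y \<in> carrier (T (Suc (Suc k)))" and x: "x \<in> carrier H"
    then show "dd (Suc (Suc k)) (dd (Suc (Suc (Suc k))) (snoc (Suc (Suc k)) y x)) = \<zero>\<^bsub>T (Suc k)\<^esub>"
      by (simp add: dd_snoc dd_add dd_smult dd_act K.sgn_in_Suc T.smult_l_minus T.smult_r_minus T.r_neg T.l_neg Suc.IH snoc_zero1)
  qed (intro hom_intros hom_dd)+
qed

end

section \<open>The filtration operators\<close>

text \<open>\<open>e\<close> projects along an ideal that acts trivially from the right.\<close>

locale leibniz_ideal_complex = leibniz_complex K H A
  for K :: "('k, 'r) ring_scheme" and H :: "('k, 'h, 'y) nalg_scheme" and A :: "('k, 'a, 'h, 'x) corep_scheme" +
  fixes e :: "'h \<Rightarrow> 'h"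
  assumes e_hom: "e \<in> mod_hom K H H"
    and e_e: "x \<in> carrier H \<Longrightarrow> e (e x) = e x"
    and br_e: "\<lbrakk>x \<in> carrier H; y \<in> carrier H\<rbrakk> \<Longrightarrow> br x (e y) = br x y"
    and e_br: "\<lbrakk>x \<in> carrier H; y \<in> carrier H\<rbrakk> \<Longrightarrow> e (br (e x) y) = e (br x y)"
    and ra_e: "\<lbrakk>v \<in> carrier A; x \<in> carrier H\<rbrakk> \<Longrightarrow> ra v (e x) = ra v x"
begin

lemma e_closed [simp]: "x \<in> carrier H \<Longrightarrow> e x \<in> carrier H"
  by (rule mod_hom_closed[OF e_hom])

lemma act_e: "h \<in> carrier H \<Longrightarrow> y \<in> carrier (T k) \<Longrightarrow> act k (e h) y = act k h y"
proof (induction k arbitrary: y)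
  case 0
  then obtain v where v: "v \<in> carrier A" "y = emb v" by (elim emb_cases)
  then show ?case using 0 by (simp add: act_emb ra_e)
next
  case (Suc k)
  show ?case
  proof (rule T_ext[where N = "T (Suc k)", OF T_module _ _ _ Suc.prems(2)])
    fix y x assume "y \<in> carrier (T k)" "x \<in> carrier H"
    then show "act (Suc k) (e h) (snoc k y x) = act (Suc k) h (snoc k y x)"
      using Suc by (simp add: act_snoc br_e)
  qed (intro hom_intros e_closed Suc.prems)+
qed

text \<open>\<open>P k j\<close> applies \<open>e\<close> to the last \<open>j\<close> tensor factors.\<close>

fun P :: "nat \<Rightarrow> nat \<Rightarrow> ('a \<times> 'h list \<Rightarrow> 'k) set \<Rightarrow> ('a \<times> 'h list \<Rightarrow> 'k) set"
  where "P k 0 = (\<lambda>y. y)"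
  | "P 0 (Suc j) = (\<lambda>y. y)"
  | "P (Suc k) (Suc j) = lift k (T (Suc k)) (\<lambda>y h. snoc k (P k j y) (e h))"

declare P.simps(3) [simp del]

lemma P_hom: "P k j \<in> mod_hom K (T k) (T k)"
proof (induction k j rule: P.induct)
  case (3 k j)
  show ?case unfolding P.simps by (rule lift_hom[OF T_module bilin_precomp[OF snoc_bilin 3 e_hom]])
qed (simp_all add: mod_hom_id)

lemma P_closed [simp]: "y \<in> carrier (T k) \<Longrightarrow> P k j y \<in> carrier (T k)"
  by (rule mod_hom_closed[OF P_hom])

lemma P_snoc: "y \<in> carrier (T k) \<Longrightarrow> h \<in> carrier H \<Longrightarrow> P (Suc k) (Suc j) (snoc k y h) = snoc k (P k j y) (e h)"
  unfolding P.simps by (rule lift_snoc[OF T_module bilin_precomp[OF snoc_bilin P_hom e_hom]])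

lemma P_0 [simp]: "P 0 j = (\<lambda>y. y)"
  by (cases j) simp_all

lemma hom_P: "f \<in> mod_hom K M (T k) \<Longrightarrow> (\<lambda>x. P k j (f x)) \<in> mod_hom K M (T k)"
  by (rule mod_hom_comp[OF P_hom])

lemma P_add: "\<lbrakk>x \<in> carrier (T k); y \<in> carrier (T k)\<rbrakk> \<Longrightarrow> P k j (x \<oplus>\<^bsub>T k\<^esub> y) = P k j x \<oplus>\<^bsub>T k\<^esub> P k j y"
  by (rule mod_hom_add[OF P_hom])

lemma P_smult: "\<lbrakk>c \<in> carrier K; y \<in> carrier (T k)\<rbrakk> \<Longrightarrow> P k j (c \<odot>\<^bsub>T k\<^esub> y) = c \<odot>\<^bsub>T k\<^esub> P k j y"
  by (rule mod_hom_smult[OF P_hom])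

lemma P_zero: "P k j \<zero>\<^bsub>T k\<^esub> = \<zero>\<^bsub>T k\<^esub>"
  by (rule mod_hom_zero[OF T_module T_module P_hom])

lemma P_minus: "\<lbrakk>x \<in> carrier (T k); y \<in> carrier (T k)\<rbrakk> \<Longrightarrow> P k j (x \<ominus>\<^bsub>T k\<^esub> y) = P k j x \<ominus>\<^bsub>T k\<^esub> P k j y"
  by (rule mod_hom_minus[OF T_module T_module P_hom])

lemma P_P:
  assumes "i \<le> j" "x \<in> carrier (T k)"
  shows "P k j (P k i x) = P k j x"
  using assms
proof (induction k arbitrary: i j x)
  case (Suc k)
  show ?case
  proof (cases i)
    case (Suc i')
    then obtain j' where j: "j = Suc j'" "i' \<le> j'" using Suc.prems by (cases j) auto
    show ?thesis unfolding j Suc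
    proof (rule T_ext[where N = "T (Suc k)", OF T_module _ _ _ Suc.prems(2)])
      fix y h assume "y \<in> carrier (T k)" "h \<in> carrier H"
      then show "P (Suc k) (Suc j') (P (Suc k) (Suc i') (snoc k y h)) = P (Suc k) (Suc j') (snoc k y h)"
        using Suc.IH[OF j(2)] by (simp add: P_snoc e_e)
    qed (intro hom_P mod_hom_id)+
  qed simp
qed simp

lemma P_mono: "P k i x = \<zero>\<^bsub>T k\<^esub> \<Longrightarrow> i \<le> j \<Longrightarrow> x \<in> carrier (T k) \<Longrightarrow> P k j x = \<zero>\<^bsub>T k\<^esub>"
  using P_P[of i j x k] by (simp add: P_zero)

text \<open>\<open>e\<close> need not commute with brackets: its image need not be a subalgebra,
  only its kernel is an ideal. What holds is that projecting beforehand does not change the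
  projected result, so the kernel of \<open>P k j\<close> is stable under the action. Later
  statements with a projection both inside and outside have this shape for the same reason.\<close>

lemma P_act:
  assumes "h \<in> carrier H" "y \<in> carrier (T k)"
  shows "P k j (act k h (P k j y)) = P k j (act k h y)"
  using assms(2)
proof (induction k arbitrary: j y)
  case (Suc k)
  show ?case
  proof (cases j)
    case (Suc j')
    show ?thesis unfolding Suc
    proof (rule T_ext[where N = "T (Suc k)", OF T_module _ _ _ Suc.prems])
      fix y x assume "y \<in> carrier (T k)" "x \<in> carrier H"
      then show "P (Suc k) (Suc j') (act (Suc k) h (P (Suc k) (Suc j') (snoc k y x))) =
          P (Suc k) (Suc j') (act (Suc k) h (snoc k y x))"
        using Suc.IH assms(1) by (simp add: P_snoc act_snoc P_add e_e e_br P_P)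
    qed (intro hom_P hom_intros assms)+
  qed simp
qed simp

text \<open>Every factor is projected and the boundary deletes one of them, so one projection fewer
  remains outside. The deleted factor may be replaced by its projection because of
  \<open>act_e\<close>.\<close>

lemma P_dd_full:
  assumes "x \<in> carrier (T (Suc m))"
  shows "P m m (dd (Suc m) (P (Suc m) (Suc m) x)) = P m m (dd (Suc m) x)"
  using assms
proof (induction m arbitrary: x)
  case 0
  show ?case
  proof (rule T_ext[where N = "T 0", OF T_module _ _ _ 0])
    fix y h assume "y \<in> carrier (T 0)" "h \<in> carrier H"
    then show "P 0 0 (dd (Suc 0) (P (Suc 0) (Suc 0) (snoc 0 y h))) = P 0 0 (dd (Suc 0) (snoc 0 y h))"
      by (simp add: P_snoc dd_snoc act_e)
  qed (intro hom_P hom_dd hom_intros)+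
next
  case (Suc m)
  show ?case
  proof (rule T_ext[where N = "T (Suc m)", OF T_module _ _ _ Suc.prems])
    fix y h assume "y \<in> carrier (T (Suc m))" "h \<in> carrier H"
    then show "P (Suc m) (Suc m) (dd (Suc (Suc m)) (P (Suc (Suc m)) (Suc (Suc m)) (snoc (Suc m) y h))) =
        P (Suc m) (Suc m) (dd (Suc (Suc m)) (snoc (Suc m) y h))"
      by (simp add: P_snoc dd_snoc act_e P_add P_smult Suc.IH e_e P_act)
  qed (intro hom_P hom_dd hom_intros)+
qed

text \<open>\<open>ext f a b j\<close> is \<open>f \<otimes> 1\<close> on \<open>T a \<otimes> H\<^sup>\<otimes>\<^sup>j\<close>.\<close>

primrec ext :: "(('a \<times> 'h list \<Rightarrow> 'k) set \<Rightarrow> ('a \<times> 'h list \<Rightarrow> 'k) set) \<Rightarrow> nat \<Rightarrow> nat \<Rightarrow> nat \<Rightarrow>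
    ('a \<times> 'h list \<Rightarrow> 'k) set \<Rightarrow> ('a \<times> 'h list \<Rightarrow> 'k) set"
  where "ext f a b 0 = f"
  | "ext f a b (Suc j) = lift (a + j) (T (Suc (b + j))) (\<lambda>y h. snoc (b + j) (ext f a b j y) h)"

declare ext.simps(2) [simp del]

lemma ext_hom: "f \<in> mod_hom K (T a) (T b) \<Longrightarrow> ext f a b j \<in> mod_hom K (T (a + j)) (T (b + j))"
proof (induction j)
  case (Suc j)
  have "ext f a b (Suc j) \<in> mod_hom K (T (Suc (a + j))) (T (Suc (b + j)))"
    unfolding ext.simps by (rule lift_hom[OF T_module bilin_precomp1[OF snoc_bilin Suc.IH[OF Suc.prems]]])
  then show ?case by simp
qed simp

lemma ext_hom_Suc: "f \<in> mod_hom K (T a) (T b) \<Longrightarrow> ext f a b (Suc j) \<in> mod_hom K (T (Suc (a + j))) (T (Suc (b + j)))"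
  using ext_hom[of f a b "Suc j"] by simp

lemma ext_closed: "f \<in> mod_hom K (T a) (T b) \<Longrightarrow> y \<in> carrier (T (a + j)) \<Longrightarrow> ext f a b j y \<in> carrier (T (b + j))"
  by (rule mod_hom_closed[OF ext_hom])

lemma ext_snoc:
  "f \<in> mod_hom K (T a) (T b) \<Longrightarrow> y \<in> carrier (T (a + j)) \<Longrightarrow> h \<in> carrier H \<Longrightarrow>
    ext f a b (Suc j) (snoc (a + j) y h) = snoc (b + j) (ext f a b j y) h"
  unfolding ext.simps by (rule lift_snoc[OF T_module bilin_precomp1[OF snoc_bilin ext_hom]])

lemma hom_ext_Suc: "f \<in> mod_hom K (T a) (T b) \<Longrightarrow> g \<in> mod_hom K M (T (Suc (a + j))) \<Longrightarrow>
    (\<lambda>x. ext f a b (Suc j) (g x)) \<in> mod_hom K M (T (Suc (b + j)))"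
  by (rule mod_hom_comp[OF ext_hom_Suc])

lemma ext_comp:
  assumes f: "f \<in> mod_hom K (T a) (T b)" and g: "g \<in> mod_hom K (T b) (T c)" and "x \<in> carrier (T (a + j))"
  shows "ext g b c j (ext f a b j x) = ext (\<lambda>y. g (f y)) a c j x"
  using assms(3)
proof (induction j arbitrary: x)
  case (Suc j)
  have x: "x \<in> carrier (T (Suc (a + j)))" using Suc.prems by simp
  note gf = mod_hom_comp[OF g f]
  show ?case
  proof (rule T_ext[where N = "T (Suc (c + j))", OF T_module _ _ _ x])
    fix y h assume "y \<in> carrier (T (a + j))" "h \<in> carrier H"
    then show "ext g b c (Suc j) (ext f a b (Suc j) (snoc (a + j) y h)) = ext (\<lambda>y. g (f y)) a c (Suc j) (snoc (a + j) y h)"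
      using ext_closed[OF f] Suc.IH by (simp add: ext_snoc[OF f] ext_snoc[OF g] ext_snoc[OF gf])
  qed (intro hom_ext_Suc mod_hom_id f g gf)+
qed simp

lemma ext_cong:
  assumes f: "f \<in> mod_hom K (T a) (T b)" and g: "g \<in> mod_hom K (T a) (T b)" and "x \<in> carrier (T (a + j))"
    and eq: "\<And>y. y \<in> carrier (T a) \<Longrightarrow> f y = g y"
  shows "ext f a b j x = ext g a b j x"
  using assms(3)
proof (induction j arbitrary: x)
  case (Suc j)
  have x: "x \<in> carrier (T (Suc (a + j)))" using Suc.prems by simp
  show ?case
  proof (rule T_ext[where N = "T (Suc (b + j))", OF T_module _ _ _ x])
    fix y h assume "y \<in> carrier (T (a + j))" "h \<in> carrier H"
    then show "ext f a b (Suc j) (snoc (a + j) y h) = ext g a b (Suc j) (snoc (a + j) y h)"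
      using Suc.IH by (simp add: ext_snoc[OF f] ext_snoc[OF g])
  qed (intro hom_ext_Suc mod_hom_id f g)+
qed (simp add: eq)

lemma ext_add:
  assumes f: "f \<in> mod_hom K (T a) (T b)" and g: "g \<in> mod_hom K (T a) (T b)" and "x \<in> carrier (T (a + j))"
  shows "ext (\<lambda>y. f y \<oplus>\<^bsub>T b\<^esub> g y) a b j x = ext f a b j x \<oplus>\<^bsub>T (b + j)\<^esub> ext g a b j x"
  using assms(3)
proof (induction j arbitrary: x)
  case (Suc j)
  have x: "x \<in> carrier (T (Suc (a + j)))" using Suc.prems by simp
  note fg = mod_hom_addf[OF T_module f g]
  show ?case unfolding add_Suc_right
  proof (rule T_ext[where N = "T (Suc (b + j))", OF T_module _ _ _ x])
    fix y h assume "y \<in> carrier (T (a + j))" "h \<in> carrier H"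
    then show "ext (\<lambda>y. f y \<oplus>\<^bsub>T b\<^esub> g y) a b (Suc j) (snoc (a + j) y h) =
        ext f a b (Suc j) (snoc (a + j) y h) \<oplus>\<^bsub>T (Suc (b + j))\<^esub> ext g a b (Suc j) (snoc (a + j) y h)"
      using Suc.IH ext_closed[OF f] ext_closed[OF g] by (simp add: ext_snoc[OF f] ext_snoc[OF g] ext_snoc[OF fg] snoc_add1)
  qed (intro hom_ext_Suc mod_hom_addf[OF T_module] mod_hom_id f g fg)+
qed simp

lemma ext_id: "x \<in> carrier (T (a + j)) \<Longrightarrow> ext (\<lambda>y. y) a a j x = x"
proof (induction j arbitrary: x)
  case (Suc j)
  have x: "x \<in> carrier (T (Suc (a + j)))" using Suc.prems by simp
  show ?case
  proof (rule T_ext[where N = "T (Suc (a + j))", OF T_module _ _ _ x])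
    fix y h assume "y \<in> carrier (T (a + j))" "h \<in> carrier H"
    then show "ext (\<lambda>y. y) a a (Suc j) (snoc (a + j) y h) = snoc (a + j) y h"
      using Suc.IH by (simp add: ext_snoc[OF mod_hom_id])
  qed (intro hom_ext_Suc mod_hom_id)+
qed simp

lemma P_ext:
  assumes f: "f \<in> mod_hom K (T a) (T b)" and "i \<le> j" "x \<in> carrier (T (a + j))"
  shows "P (b + j) i (ext f a b j x) = ext f a b j (P (a + j) i x)"
  using assms(2,3)
proof (induction j arbitrary: i x)
  case (Suc j)
  have x: "x \<in> carrier (T (Suc (a + j)))" using Suc.prems by simp
  show ?case
  proof (cases i)
    case (Suc i')
    then have i: "i' \<le> j" using Suc.prems by simp
    show ?thesis unfolding add_Suc_right Suc
    proof (rule T_ext[where N = "T (Suc (b + j))", OF T_module _ _ _ x])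
      fix y h assume "y \<in> carrier (T (a + j))" "h \<in> carrier H"
      then show "P (Suc (b + j)) (Suc i') (ext f a b (Suc j) (snoc (a + j) y h)) =
          ext f a b (Suc j) (P (Suc (a + j)) (Suc i') (snoc (a + j) y h))"
        using Suc.IH[OF i] ext_closed[OF f] by (simp add: ext_snoc[OF f] P_snoc)
    qed (intro hom_ext_Suc hom_P mod_hom_id f)+
  qed simp
qed simp

text \<open>\<open>dt a j\<close> collects the terms of \<open>d\<close> on \<open>T (a + 1) \<otimes> H\<^sup>\<otimes>\<^sup>j\<close> that remove one of the last \<open>j\<close> factors.\<close>

primrec dt :: "nat \<Rightarrow> nat \<Rightarrow> ('a \<times> 'h list \<Rightarrow> 'k) set \<Rightarrow> ('a \<times> 'h list \<Rightarrow> 'k) set"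
  where "dt a 0 = (\<lambda>y. \<zero>\<^bsub>T a\<^esub>)"
  | "dt a (Suc j) = lift (Suc (a + j)) (T (Suc (a + j)))
      (\<lambda>y h. snoc (a + j) (dt a j y) h \<oplus>\<^bsub>T (Suc (a + j))\<^esub> sgn_in K (Suc (a + j)) \<odot>\<^bsub>T (Suc (a + j))\<^esub> act (Suc (a + j)) h y)"

declare dt.simps(2) [simp del]

lemma dt_hom: "dt a j \<in> mod_hom K (T (Suc (a + j))) (T (a + j))"
proof (induction j)
  case (Suc j)
  have "dt a (Suc j) \<in> mod_hom K (T (Suc (Suc (a + j)))) (T (Suc (a + j)))"
    unfolding dt.simps
    by (rule lift_hom[OF T_module bilin_add[OF T_module bilin_precomp1[OF snoc_bilin Suc] bilin_smult[OF T_module act_bilin' K.sgn_in_closed]]])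
  then show ?case by simp
qed (simp add: mod_hom_zerof[OF T_module])

lemma dt_hom_Suc: "dt a (Suc j) \<in> mod_hom K (T (Suc (Suc (a + j)))) (T (Suc (a + j)))"
  using dt_hom[of a "Suc j"] by simp

lemma dt_closed [simp]: "y \<in> carrier (T (Suc (a + j))) \<Longrightarrow> dt a j y \<in> carrier (T (a + j))"
  by (rule mod_hom_closed[OF dt_hom])

lemma dt_closed_Suc [simp]: "y \<in> carrier (T (Suc (Suc (a + j)))) \<Longrightarrow> dt a (Suc j) y \<in> carrier (T (Suc (a + j)))"
  by (rule mod_hom_closed[OF dt_hom_Suc])

lemma dt_snoc: "y \<in> carrier (T (Suc (a + j))) \<Longrightarrow> h \<in> carrier H \<Longrightarrow>
    dt a (Suc j) (snoc (Suc (a + j)) y h) =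
      snoc (a + j) (dt a j y) h \<oplus>\<^bsub>T (Suc (a + j))\<^esub> sgn_in K (Suc (a + j)) \<odot>\<^bsub>T (Suc (a + j))\<^esub> act (Suc (a + j)) h y"
  unfolding dt.simps
  by (rule lift_snoc[OF T_module bilin_add[OF T_module bilin_precomp1[OF snoc_bilin dt_hom] bilin_smult[OF T_module act_bilin' K.sgn_in_closed]]])

lemma hom_dt_Suc: "f \<in> mod_hom K M (T (Suc (Suc (a + j)))) \<Longrightarrow> (\<lambda>x. dt a (Suc j) (f x)) \<in> mod_hom K M (T (Suc (a + j)))"
  by (rule mod_hom_comp[OF dt_hom_Suc])

lemma dd_split:
  assumes "x \<in> carrier (T (Suc (a + j)))"
  shows "dd (Suc (a + j)) x = ext (dd (Suc a)) (Suc a) a j x \<oplus>\<^bsub>T (a + j)\<^esub> dt a j x"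
  using assms
proof (induction j arbitrary: x)
  case (Suc j)
  have x: "x \<in> carrier (T (Suc (Suc (a + j))))" using Suc.prems by simp
  have h: "ext (dd (Suc a)) (Suc a) a (Suc j) \<in> mod_hom K (T (Suc (Suc (a + j)))) (T (Suc (a + j)))"
    using ext_hom_Suc[OF dd_hom_Suc, of a j] by simp
  show ?case unfolding add_Suc_right
  proof (rule T_ext[where N = "T (Suc (a + j))", OF T_module _ _ _ x])
    fix y h assume y: "y \<in> carrier (T (Suc (a + j)))" and h: "h \<in> carrier H"
    have "ext (dd (Suc a)) (Suc a) a j y \<in> carrier (T (a + j))" using ext_closed[OF dd_hom_Suc, of y a j] y by simp
    then show "dd (Suc (Suc (a + j))) (snoc (Suc (a + j)) y h) =
        ext (dd (Suc a)) (Suc a) a (Suc j) (snoc (Suc (a + j)) y h) \<oplus>\<^bsub>T (Suc (a + j))\<^esub> dt a (Suc j) (snoc (Suc (a + j)) y h)"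
      using y h Suc.IH[OF y] ext_snoc[OF dd_hom_Suc, of y a j h]
      by (simp add: dd_snoc dt_snoc snoc_add1 T.a_assoc)
  qed (intro hom_dd mod_hom_id mod_hom_addf[OF T_module] dt_hom_Suc h)+
qed (simp add: dd_closed)

text \<open>These terms delete one of the last j + 1 factors, so a chain killed by projecting all of
  those goes to a chain killed by projecting the remaining \<open>j\<close>: the filtration drops by
  one step.\<close>

lemma P_dt:
  assumes "x \<in> carrier (T (Suc (Suc (a + j))))"
  shows "P (Suc (a + j)) j (dt a (Suc j) (P (Suc (Suc (a + j))) (Suc j) x)) = P (Suc (a + j)) j (dt a (Suc j) x)"
  using assms
proof (induction j arbitrary: x)
  case 0
  have x: "x \<in> carrier (T (Suc (Suc (a + 0))))" using 0 by simp
  show ?case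
  proof (rule T_ext[where N = "T (Suc (a + 0))", OF T_module _ _ _ x])
    fix y h assume "y \<in> carrier (T (Suc (a + 0)))" "h \<in> carrier H"
    then show "P (Suc (a + 0)) 0 (dt a (Suc 0) (P (Suc (Suc (a + 0))) (Suc 0) (snoc (Suc (a + 0)) y h))) =
        P (Suc (a + 0)) 0 (dt a (Suc 0) (snoc (Suc (a + 0)) y h))"
      using dt_snoc[of y a 0] by (simp add: P_snoc act_e snoc_zero1)
  qed (intro hom_P hom_dt_Suc mod_hom_id)+
next
  case (Suc j)
  have x: "x \<in> carrier (T (Suc (Suc (Suc (a + j)))))" using Suc.prems by simp
  show ?case unfolding add_Suc_right
  proof (rule T_ext[where N = "T (Suc (Suc (a + j)))", OF T_module _ _ _ x])
    fix y h assume y: "y \<in> carrier (T (Suc (Suc (a + j))))" and h: "h \<in> carrier H"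
    have s: "dt a (Suc (Suc j)) (snoc (Suc (Suc (a + j))) z g) = snoc (Suc (a + j)) (dt a (Suc j) z) g
        \<oplus>\<^bsub>T (Suc (Suc (a + j)))\<^esub> sgn_in K (Suc (Suc (a + j))) \<odot>\<^bsub>T (Suc (Suc (a + j)))\<^esub> act (Suc (Suc (a + j))) g z"
      if "z \<in> carrier (T (Suc (Suc (a + j))))" "g \<in> carrier H" for z g
      using dt_snoc[of z a "Suc j" g] that by simp
    show "P (Suc (Suc (a + j))) (Suc j) (dt a (Suc (Suc j)) (P (Suc (Suc (Suc (a + j)))) (Suc (Suc j)) (snoc (Suc (Suc (a + j))) y h))) =
        P (Suc (Suc (a + j))) (Suc j) (dt a (Suc (Suc j)) (snoc (Suc (Suc (a + j))) y h))"
      using y h Suc.IH[OF y] by (simp add: P_snoc s P_add P_smult act_e e_e P_act)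
  next
    have d: "dt a (Suc (Suc j)) \<in> mod_hom K (T (Suc (Suc (Suc (a + j))))) (T (Suc (Suc (a + j))))"
      using dt_hom_Suc[of a "Suc j"] by simp
    show "(\<lambda>x. P (Suc (Suc (a + j))) (Suc j) (dt a (Suc (Suc j)) (P (Suc (Suc (Suc (a + j)))) (Suc (Suc j)) x))) \<in> mod_hom K (T (Suc (Suc (Suc (a + j))))) (T (Suc (Suc (a + j))))"
      "(\<lambda>x. P (Suc (Suc (a + j))) (Suc j) (dt a (Suc (Suc j)) x)) \<in> mod_hom K (T (Suc (Suc (Suc (a + j))))) (T (Suc (Suc (a + j))))"
      by (intro hom_P mod_hom_comp[OF d] mod_hom_id)+
  qed
qed

text \<open>By \<open>P_dt\<close> the terms deleting a tail factor drop one filtration step. What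
  the associated graded complex keeps is the boundary of the head tensored with the identity. For j
  = 0 the chain \<open>w\<close> itself is zero.\<close>

lemma P_dd:
  assumes w: "w \<in> carrier (T (Suc (a + j)))" and "P (Suc (a + j)) j w = \<zero>\<^bsub>T (Suc (a + j))\<^esub>"
  shows "P (a + j) (j - 1) (dd (Suc (a + j)) w) = P (a + j) (j - 1) (ext (dd (Suc a)) (Suc a) a j w)"
proof (cases j)
  case 0
  then have "w = \<zero>\<^bsub>T (Suc a)\<^esub>" using assms by simp
  then show ?thesis using 0 by simp
next
  case (Suc i)
  have w': "w \<in> carrier (T (Suc (Suc (a + i))))" using w Suc by simp
  have "P (Suc (a + i)) i (dt a (Suc i) w) = \<zero>\<^bsub>T (Suc (a + i))\<^esub>"
    using P_dt[OF w'] assms(2) Suc mod_hom_zero[OF T_module T_module dt_hom_Suc[of a i]] by (simp add: P_zero)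
  moreover have "ext (dd (Suc a)) (Suc a) a j w \<in> carrier (T (a + j))" using ext_closed[OF dd_hom_Suc, of w a j] w by simp
  ultimately show ?thesis unfolding dd_split[OF w] using w' Suc by (simp add: P_add)
qed

text \<open>Up to a smaller kernel the boundary is that of the head, and d \<otimes> 1 commutes with
  projections of the tail. This gives stability of the filtration as long as some factor stays
  unprojected; the top step is left to \<open>P_dd_full\<close>.\<close>

lemma P_dd_mono:
  assumes "w \<in> carrier (T (Suc (a + Suc i)))" "P (Suc (a + Suc i)) (Suc i) w = \<zero>\<^bsub>T (Suc (a + Suc i))\<^esub>"
  shows "P (a + Suc i) (Suc i) (dd (Suc (a + Suc i)) w) = \<zero>\<^bsub>T (a + Suc i)\<^esub>"
proof -
  let ?x = "ext (dd (Suc a)) (Suc a) a (Suc i) w"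
  have x: "?x \<in> carrier (T (a + Suc i))" using ext_closed[OF dd_hom_Suc, of w a "Suc i"] assms(1) by simp
  have dw: "dd (Suc (a + Suc i)) w \<in> carrier (T (a + Suc i))" using assms(1) by (rule dd_closed)
  have "P (a + Suc i) i (dd (Suc (a + Suc i)) w) = P (a + Suc i) i ?x" using P_dd[OF assms] by simp
  then have "P (a + Suc i) (Suc i) (dd (Suc (a + Suc i)) w) = P (a + Suc i) (Suc i) ?x"
    using P_P[of i "Suc i" _ "a + Suc i"] x dw by (metis le_SucI order_refl)
  also have "\<dots> = ext (dd (Suc a)) (Suc a) a (Suc i) (P (Suc a + Suc i) (Suc i) w)"
    by (rule P_ext[OF dd_hom_Suc]) (use assms(1) in auto)
  also have "\<dots> = \<zero>\<^bsub>T (a + Suc i)\<^esub>"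
    using mod_hom_zero[OF T_module T_module ext_hom[OF dd_hom_Suc, of a "Suc i"]] assms(2) by simp
  finally show ?thesis .
qed

end

section \<open>Moving a tail factor next to the head\<close>

context leibniz_ideal_complex
begin

lemma ext_smult:
  assumes f: "f \<in> mod_hom K (T a) (T b)" and c: "c \<in> carrier K" and "x \<in> carrier (T (a + j))"
  shows "ext (\<lambda>y. c \<odot>\<^bsub>T b\<^esub> f y) a b j x = c \<odot>\<^bsub>T (b + j)\<^esub> ext f a b j x"
  using assms(3)
proof (induction j arbitrary: x)
  case (Suc j)
  have x: "x \<in> carrier (T (Suc (a + j)))" using Suc.prems by simp
  note cf = mod_hom_smultf[OF T_module f c]
  show ?case unfolding add_Suc_right
  proof (rule T_ext[where N = "T (Suc (b + j))", OF T_module _ _ _ x])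
    fix y h assume "y \<in> carrier (T (a + j))" "h \<in> carrier H"
    then show "ext (\<lambda>y. c \<odot>\<^bsub>T b\<^esub> f y) a b (Suc j) (snoc (a + j) y h) =
        c \<odot>\<^bsub>T (Suc (b + j))\<^esub> ext f a b (Suc j) (snoc (a + j) y h)"
      using Suc.IH ext_closed[OF f] c by (simp add: ext_snoc[OF f] ext_snoc[OF cf] snoc_smult1)
  qed (intro hom_ext_Suc mod_hom_smultf[OF T_module _ c] mod_hom_id f cf)+
qed simp

lemma ext_zero:
  assumes "\<And>y. y \<in> carrier (T a) \<Longrightarrow> f y = \<zero>\<^bsub>T b\<^esub>" "x \<in> carrier (T (a + j))"
  shows "ext f a b j x = \<zero>\<^bsub>T (b + j)\<^esub>"
proof -
  have f: "f \<in> mod_hom K (T a) (T b)"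
    by (rule mod_hom_cong[OF T_module mod_hom_zerof[OF T_module]]) (use assms in simp)
  have "ext f a b j x = ext (\<lambda>y. \<zero>\<^bsub>K\<^esub> \<odot>\<^bsub>T b\<^esub> f y) a b j x"
    by (rule ext_cong[OF f mod_hom_smultf[OF T_module f] assms(2)]) (use assms in auto)
  then show ?thesis using ext_smult[OF f K.zero_closed assms(2)] ext_closed[OF f assms(2)] by simp
qed

text \<open>The head operator may depend on a vector \<open>h\<close>, and linearity in
  \<open>h\<close> passes to f \<otimes> 1. In \<open>Y\<close> the head operator inserts the moved
  factor, which has to vary linearly.\<close>

lemma ext_linear_param:
  assumes "bilin K (T a) H (T b) \<gamma>" "y \<in> carrier (T (a + j))"
  shows "(\<lambda>h. ext (\<lambda>c. \<gamma> c h) a b j y) \<in> mod_hom K H (T (b + j))"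
proof (rule mod_homI)
  note l = bilinD(1)[OF assms(1)]
  show "ext (\<lambda>c. \<gamma> c h) a b j y \<in> carrier (T (b + j))" if "h \<in> carrier H" for h
    by (rule ext_closed[OF l[OF that] assms(2)])
  show "ext (\<lambda>c. \<gamma> c (g \<oplus>\<^bsub>H\<^esub> h)) a b j y = ext (\<lambda>c. \<gamma> c g) a b j y \<oplus>\<^bsub>T (b + j)\<^esub> ext (\<lambda>c. \<gamma> c h) a b j y"
    if gh: "g \<in> carrier H" "h \<in> carrier H" for g h
    unfolding ext_add[OF l[OF gh(1)] l[OF gh(2)] assms(2), symmetric]
    by (rule ext_cong[OF l mod_hom_addf[OF T_module l l] assms(2)])
      (use gh mod_hom_add[OF bilinD(2)[OF assms(1)]] in auto)
  show "ext (\<lambda>c. \<gamma> c (a' \<odot>\<^bsub>H\<^esub> h)) a b j y = a' \<odot>\<^bsub>T (b + j)\<^esub> ext (\<lambda>c. \<gamma> c h) a b j y"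
    if ch: "a' \<in> carrier K" "h \<in> carrier H" for a' h
    unfolding ext_smult[OF l[OF ch(2)] ch(1) assms(2), symmetric]
    by (rule ext_cong[OF l mod_hom_smultf[OF T_module l] assms(2)])
      (use ch mod_hom_smult[OF bilinD(2)[OF assms(1)]] in auto)
qed

lemma P_ext_Suc:
  "f \<in> mod_hom K (T a) (T b) \<Longrightarrow> i \<le> Suc j \<Longrightarrow> x \<in> carrier (T (Suc (a + j))) \<Longrightarrow>
    P (Suc (b + j)) i (ext f a b (Suc j) x) = ext f a b (Suc j) (P (Suc (a + j)) i x)"
  using P_ext[of f a b i "Suc j" x] by simp

abbreviation ins :: "nat \<Rightarrow> 'h \<Rightarrow> ('a \<times> 'h list \<Rightarrow> 'k) set \<Rightarrow> ('a \<times> 'h list \<Rightarrow> 'k) set"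
  where "ins q h \<equiv> (\<lambda>c. snoc q c (e h))"

lemma ins_bilin: "bilin K (T q) H (T (Suc q)) (\<lambda>c h. ins q h c)"
  by (rule bilin_precomp2[OF snoc_bilin e_hom])

lemma ins_hom: "h \<in> carrier H \<Longrightarrow> ins q h \<in> mod_hom K (T q) (T (Suc q))"
  by (rule bilinD(1)[OF ins_bilin])

text \<open>
  The action of \<open>h\<close> on a cycle \<open>z\<close> is, up to sign, the boundary of \<open>z \<otimes> h\<close>; moving every tail factor \<open>h\<^sub>j\<close>
  next to the head with sign \<open>(-1)\<^sup>j\<close> therefore accounts for all terms of the boundary in which the tail
  acts on the head. Since \<open>h\<close> and \<open>e h\<close> act in the same way, \<open>e h\<close> may be moved instead,
  which kills the moved factor when it lies in the ideal.
\<close>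

primrec Y :: "nat \<Rightarrow> nat \<Rightarrow> ('a \<times> 'h list \<Rightarrow> 'k) set \<Rightarrow> ('a \<times> 'h list \<Rightarrow> 'k) set"
  where "Y q 0 = (\<lambda>y. \<zero>\<^bsub>T q\<^esub>)"
  | "Y q (Suc j) = lift (q + j) (T (Suc (q + j)))
      (\<lambda>y h. snoc (q + j) (Y q j y) h \<oplus>\<^bsub>T (Suc (q + j))\<^esub> sgn_in K j \<odot>\<^bsub>T (Suc (q + j))\<^esub> ext (ins q h) q (Suc q) j y)"

declare Y.simps(2) [simp del]

lemma Y_step_bilin:
  assumes "Y q j \<in> mod_hom K (T (q + j)) (T (q + j))"
  shows "bilin K (T (q + j)) H (T (Suc (q + j)))
    (\<lambda>y h. snoc (q + j) (Y q j y) h \<oplus>\<^bsub>T (Suc (q + j))\<^esub> sgn_in K j \<odot>\<^bsub>T (Suc (q + j))\<^esub> ext (ins q h) q (Suc q) j y)"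
proof (rule bilin_add[OF T_module bilin_precomp1[OF snoc_bilin assms] bilin_smult[OF T_module _ K.sgn_in_closed]], rule bilinI)
  show "ext (ins q h) q (Suc q) j \<in> mod_hom K (T (q + j)) (T (Suc (q + j)))" if "h \<in> carrier H" for h
    using ext_hom[OF ins_hom[OF that], of q j] by simp
  show "(\<lambda>h. ext (ins q h) q (Suc q) j y) \<in> mod_hom K H (T (Suc (q + j)))" if "y \<in> carrier (T (q + j))" for y
    using ext_linear_param[OF ins_bilin that] by simp
qed

lemma Y_hom: "Y q j \<in> mod_hom K (T (q + j)) (T (q + j))"
proof (induction j)
  case (Suc j)
  have "Y q (Suc j) \<in> mod_hom K (T (Suc (q + j))) (T (Suc (q + j)))"
    unfolding Y.simps by (rule lift_hom[OF T_module Y_step_bilin[OF Suc]])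
  then show ?case by simp
qed (simp add: mod_hom_zerof[OF T_module])

lemma Y_hom_Suc: "Y q (Suc j) \<in> mod_hom K (T (Suc (q + j))) (T (Suc (q + j)))"
  using Y_hom[of q "Suc j"] by simp

lemma Y_closed_Suc [simp]: "y \<in> carrier (T (Suc (q + j))) \<Longrightarrow> Y q (Suc j) y \<in> carrier (T (Suc (q + j)))"
  by (rule mod_hom_closed[OF Y_hom_Suc])

lemma Y_snoc: "y \<in> carrier (T (q + j)) \<Longrightarrow> h \<in> carrier H \<Longrightarrow> Y q (Suc j) (snoc (q + j) y h) =
    snoc (q + j) (Y q j y) h \<oplus>\<^bsub>T (Suc (q + j))\<^esub> sgn_in K j \<odot>\<^bsub>T (Suc (q + j))\<^esub> ext (ins q h) q (Suc q) j y"
  unfolding Y.simps by (rule lift_snoc[OF T_module Y_step_bilin[OF Y_hom]])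

lemma hom_Y_Suc: "f \<in> mod_hom K M (T (Suc (q + j))) \<Longrightarrow> (\<lambda>x. Y q (Suc j) (f x)) \<in> mod_hom K M (T (Suc (q + j)))"
  by (rule mod_hom_comp[OF Y_hom_Suc])

lemma ext_ins_closed: "h \<in> carrier H \<Longrightarrow> y \<in> carrier (T (q + j)) \<Longrightarrow> ext (ins q h) q (Suc q) j y \<in> carrier (T (Suc (q + j)))"
  using ext_closed[OF ins_hom, of h y q j] by simp

text \<open>A moved factor leaves the tail and enters as \<open>e h\<close>, so it stays projected
  after the move, and the outer projection has to cover only the \<open>j\<close> factors left
  behind. Hence \<open>Y\<close> lowers the filtration by one step.\<close>

lemma P_Y':
  assumes "x \<in> carrier (T (Suc (q + j)))"
  shows "P (Suc (q + j)) j (Y q (Suc j) (P (Suc (q + j)) (Suc j) x)) = P (Suc (q + j)) j (Y q (Suc j) x)"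
  using assms
proof (induction j arbitrary: x)
  case 0
  have x: "x \<in> carrier (T (Suc (q + 0)))" using 0 by simp
  show ?case
  proof (rule T_ext[where N = "T (Suc (q + 0))", OF T_module _ _ _ x])
    fix y h assume "y \<in> carrier (T (q + 0))" "h \<in> carrier H"
    then show "P (Suc (q + 0)) 0 (Y q (Suc 0) (P (Suc (q + 0)) (Suc 0) (snoc (q + 0) y h))) =
        P (Suc (q + 0)) 0 (Y q (Suc 0) (snoc (q + 0) y h))"
      using Y_snoc[of y q 0] by (simp add: P_snoc e_e snoc_zero1)
  qed (intro hom_P hom_Y_Suc mod_hom_id)+
next
  case (Suc j)
  have x: "x \<in> carrier (T (Suc (Suc (q + j))))" using Suc.prems by simp
  show ?case unfolding add_Suc_right
  proof (rule T_ext[where N = "T (Suc (Suc (q + j)))", OF T_module _ _ _ x])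
    fix y h assume y: "y \<in> carrier (T (Suc (q + j)))" and h: "h \<in> carrier H"
    have s: "Y q (Suc (Suc j)) (snoc (Suc (q + j)) z g) = snoc (Suc (q + j)) (Y q (Suc j) z) g
        \<oplus>\<^bsub>T (Suc (Suc (q + j)))\<^esub> sgn_in K (Suc j) \<odot>\<^bsub>T (Suc (Suc (q + j)))\<^esub> ext (ins q g) q (Suc q) (Suc j) z"
      if "z \<in> carrier (T (Suc (q + j)))" "g \<in> carrier H" for z g
      using Y_snoc[of z q "Suc j" g] that by simp
    have ec: "ext (ins q g) q (Suc q) (Suc j) z \<in> carrier (T (Suc (Suc (q + j))))"
      if "z \<in> carrier (T (Suc (q + j)))" "g \<in> carrier H" for z g
      using ext_ins_closed[of g z q "Suc j"] that by simp
    have pe: "P (Suc (Suc (q + j))) (Suc j) (ext (ins q h) q (Suc q) (Suc j) z) = ext (ins q h) q (Suc q) (Suc j) (P (Suc (q + j)) (Suc j) z)"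
      if "z \<in> carrier (T (Suc (q + j)))" for z
      using P_ext_Suc[OF ins_hom[OF h, of q], of "Suc j" j z] that by simp
    show "P (Suc (Suc (q + j))) (Suc j) (Y q (Suc (Suc j)) (P (Suc (Suc (q + j))) (Suc (Suc j)) (snoc (Suc (q + j)) y h))) =
        P (Suc (Suc (q + j))) (Suc j) (Y q (Suc (Suc j)) (snoc (Suc (q + j)) y h))"
      using y h Suc.IH[OF y] ec[OF _ h] pe
      by (simp add: P_snoc s P_add P_smult e_e P_P)
  next
    have d: "Y q (Suc (Suc j)) \<in> mod_hom K (T (Suc (Suc (q + j)))) (T (Suc (Suc (q + j))))"
      using Y_hom_Suc[of q "Suc j"] by simp
    show "(\<lambda>x. P (Suc (Suc (q + j))) (Suc j) (Y q (Suc (Suc j)) (P (Suc (Suc (q + j))) (Suc (Suc j)) x))) \<in> mod_hom K (T (Suc (Suc (q + j)))) (T (Suc (Suc (q + j))))"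
      "(\<lambda>x. P (Suc (Suc (q + j))) (Suc j) (Y q (Suc (Suc j)) x)) \<in> mod_hom K (T (Suc (Suc (q + j)))) (T (Suc (Suc (q + j))))"
      by (intro hom_P mod_hom_comp[OF d] mod_hom_id)+
  qed
qed

lemma P_Y:
  "x \<in> carrier (T (Suc (q + j))) \<Longrightarrow> P (Suc (q + j)) (Suc j) x = \<zero>\<^bsub>T (Suc (q + j))\<^esub> \<Longrightarrow>
    P (Suc (q + j)) j (Y q (Suc j) x) = \<zero>\<^bsub>T (Suc (q + j))\<^esub>"
  using P_Y'[of x q j] mod_hom_zero[OF T_module T_module Y_hom_Suc[of q j]] by (simp add: P_zero)

end

section \<open>Maps of tensor products\<close>

definition tmap ::
  "('k, 'r) ring_scheme \<Rightarrow> ('k, 'b, 'u) module_scheme \<Rightarrow> ('k, 'l, 'w) module_scheme \<Rightarrow> ('a \<Rightarrow> 'b) \<Rightarrow> ('h \<Rightarrow> 'l) \<Rightarrow> nat \<Rightarrow>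
    ('a \<times> 'h list \<Rightarrow> 'k) set \<Rightarrow> ('b \<times> 'l list \<Rightarrow> 'k) set"
  where "tmap K B L f g k =
    induced_map K (mixed_tensor K B L k) (\<lambda>(v, hs). mixed_tensors K B L k (f v, map g hs))"

locale mixed_map = M: mixed K H A + N: mixed K L B
  for K :: "('k, 'r) ring_scheme" and H :: "('k, 'h, 'y) module_scheme" and A :: "('k, 'a, 'x) module_scheme"
    and L :: "('k, 'l, 'w) module_scheme" and B :: "('k, 'b, 'u) module_scheme" +
  fixes f :: "'a \<Rightarrow> 'b" and g :: "'h \<Rightarrow> 'l"
  assumes f: "f \<in> mod_hom K A B" and g: "g \<in> mod_hom K H L"
begin

lemma tmap_hom: "tmap K B L f g k \<in> mod_hom K (M.T k) (N.T k)"
  and tmap_t: "v \<in> carrier A \<Longrightarrow> hs \<in> tuples H k \<Longrightarrow> tmap K B L f g k (M.t k (v, hs)) = N.t k (f v, map g hs)"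
proof -
  let ?\<phi> = "\<lambda>(v, hs). N.t k (f v, map g hs)"
  have m: "map g hs \<in> tuples L k" if "hs \<in> tuples H k" for hs
    using that mod_hom_closed[OF g] by (rule tuples_map)
  have 1: "?\<phi> (v, hs) \<in> carrier (N.T k)" if "v \<in> carrier A" "hs \<in> tuples H k" for v hs
    using that m mod_hom_closed[OF f] by (simp add: N.t_closed)
  have 2: "(\<lambda>v. ?\<phi> (v, hs)) \<in> mod_hom K A (N.T k)" if "hs \<in> tuples H k" for hs
    using mod_hom_comp[OF N.t_linear_coeff[OF m[OF that]] f] by simp
  have 3: "(\<lambda>h. ?\<phi> (v, hs[i := h])) \<in> mod_hom K H (N.T k)" if "v \<in> carrier A" "hs \<in> tuples H k" "i < k" for v hs i
    using mod_hom_comp[OF N.t_linear_nth[OF mod_hom_closed[OF f that(1)] m[OF that(2)] that(3)] g] by (simp add: map_update)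
  show "tmap K B L f g k \<in> mod_hom K (M.T k) (N.T k)"
    unfolding tmap_def by (rule M.T_induced_map(1)[where \<phi> = ?\<phi>, OF N.T_module 1 2 3])
  show "tmap K B L f g k (M.t k (v, hs)) = N.t k (f v, map g hs)" if "v \<in> carrier A" "hs \<in> tuples H k"
    using M.T_induced_map(2)[where \<phi> = ?\<phi> and k = k and v = v and hs = hs, OF N.T_module] 1 2 3 that by (simp add: tmap_def)
qed

lemma tmap_closed: "x \<in> carrier (M.T k) \<Longrightarrow> tmap K B L f g k x \<in> carrier (N.T k)"
  by (rule mod_hom_closed[OF tmap_hom])

lemma tmap_emb: "v \<in> carrier A \<Longrightarrow> tmap K B L f g 0 (M.emb v) = N.emb (f v)"
  by (simp add: M.emb_def N.emb_def tmap_t)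

lemma tmap_snoc:
  assumes "y \<in> carrier (M.T k)" "h \<in> carrier H"
  shows "tmap K B L f g (Suc k) (M.snoc k y h) = N.snoc k (tmap K B L f g k y) (g h)"
proof (rule M.T_hom_eq[OF N.T_module _ _ _ assms(1)])
  note gh = mod_hom_closed[OF g assms(2)]
  show "(\<lambda>y. tmap K B L f g (Suc k) (M.snoc k y h)) \<in> mod_hom K (M.T k) (N.T (Suc k))"
    by (rule mod_hom_comp[OF tmap_hom M.snoc_linear1[OF assms(2)]])
  show "(\<lambda>y. N.snoc k (tmap K B L f g k y) (g h)) \<in> mod_hom K (M.T k) (N.T (Suc k))"
    by (rule mod_hom_comp[OF N.snoc_linear1[OF gh] tmap_hom])
  fix v hs assume v: "v \<in> carrier A" "hs \<in> tuples H k"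
  then show "tmap K B L f g (Suc k) (M.snoc k (M.t k (v, hs)) h) = N.snoc k (tmap K B L f g k (M.t k (v, hs))) (g h)"
    using assms(2) gh mod_hom_closed[OF f] tuples_map[OF v(2), of g L] mod_hom_closed[OF g]
    by (simp add: M.snoc_t N.snoc_t tmap_t tuples_snoc)
qed

end

section \<open>The adjoint co-representation and the tail complex\<close>

definition adj :: "('k, 'h, 'y) nalg_scheme \<Rightarrow> ('k, 'h, 'h) corep"
  where "adj H = with_actions H (\<lambda>y x. \<ominus>\<^bsub>H\<^esub> bracket H [x, y]) (\<lambda>x y. \<zero>\<^bsub>H\<^esub>)"

lemma adj_simps [simp]:
  "carrier (adj H) = carrier H" "add (adj H) = add H" "zero (adj H) = zero H" "smult (adj H) = smult H"
  "lact (adj H) = (\<lambda>y x. \<ominus>\<^bsub>H\<^esub> bracket H [x, y])"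
  by (simp_all add: adj_def with_actions_def)

lemma a_inv_adj [simp]: "\<ominus>\<^bsub>adj H\<^esub> x = \<ominus>\<^bsub>H\<^esub> x"
  by (simp add: a_inv_def m_inv_def)

lemma mod_hom_adj [simp]: "mod_hom K (adj H) N = mod_hom K H N" "mod_hom K M (adj H) = mod_hom K M H"
  by (simp_all add: mod_hom_def)

lemma adj_module: "module K H \<Longrightarrow> module K (adj H)"
  by (rule module_image[where f = "\<lambda>x. x"]) auto

locale adjoint_complex = leibniz_ideal_complex K H A e
  for K :: "('k, 'r) ring_scheme" and H :: "('k, 'h, 'y) nalg_scheme" and A :: "('k, 'a, 'h, 'x) corep_scheme" and e

text \<open>\<open>W.T p\<close> is the tensor power of \<open>H\<close> with p + 1 factors, the
  first one serving as coefficient under the adjoint action. Treating the tail as a Loday complex of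
  the same kind makes every operator of the head available for it; in particular \<open>W.P\<close>
  spares the first factor.\<close>

sublocale adjoint_complex \<subseteq> W: leibniz_ideal_complex K H "adj H" e
proof -
  interpret adj: module K "adj H" by (rule adj_module[OF H.module_axioms])
  have c: "coefficients K H (adj H)"
  proof (intro coefficients.intro coefficients_axioms.intro mixed.intro)
    show "bilin K H H H (\<lambda>x y. bracket H [x, y])" by (rule bracket_bilin)
    show "bilin K H (adj H) (adj H) (lact (adj H))"
      using bilinD[OF bracket_bilin] by (auto intro!: bilinI mod_hom_negf[OF H.module_axioms])
  qed (rule K.field_axioms H.module_axioms adj.module_axioms)+
  interpret c: coefficients K H "adj H" by (rule c)
  have ra: "c.ra v h = br v h" if "v \<in> carrier H" "h \<in> carrier H" for v h
    using that by (simp add: c.ra_def)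
  show "leibniz_ideal_complex K H (adj H) e"
    by (intro leibniz_ideal_complex.intro leibniz_complex.intro c leibniz_complex_axioms.intro leibniz_ideal_complex_axioms.intro)
      (auto simp: ra e_e br_e e_br intro: leibniz e_hom)
qed

context adjoint_complex
begin

lemma W_ra [simp]: "v \<in> carrier H \<Longrightarrow> h \<in> carrier H \<Longrightarrow> W.ra v h = br v h"
  by (simp add: W.ra_def)

lemmas [simp] = W.emb_closed[simplified]

text \<open>Concatenation of a head and a tail. The coefficient of the tail becomes an ordinary
  factor of the result, which accounts for the degree q + p + 1.\<close>

primrec cat :: "nat \<Rightarrow> nat \<Rightarrow> ('a \<times> 'h list \<Rightarrow> 'k) set \<Rightarrow> ('h \<times> 'h list \<Rightarrow> 'k) set \<Rightarrow> ('a \<times> 'h list \<Rightarrow> 'k) set"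
  where "cat q 0 c = W.lift0 (T (Suc q)) (snoc q c)"
  | "cat q (Suc p) c = W.lift p (T (Suc (Suc (q + p)))) (\<lambda>w h. snoc (Suc (q + p)) (cat q p c w) h)"

declare cat.simps [simp del]

lemma cat_hom: "c \<in> carrier (T q) \<Longrightarrow> cat q p c \<in> mod_hom K (W.T p) (T (Suc (q + p)))"
proof (induction p)
  case 0
  show ?case unfolding cat.simps using W.lift0_hom[OF T_module, of "snoc q c" "Suc q"] snoc_linear2[OF 0] by simp
next
  case (Suc p)
  have "cat q (Suc p) c \<in> mod_hom K (W.T (Suc p)) (T (Suc (Suc (q + p))))"
    unfolding cat.simps by (rule W.lift_hom[OF T_module bilin_precomp1[OF snoc_bilin Suc.IH[OF Suc.prems]]])
  then show ?case by simp
qed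

lemma cat_hom_Suc: "c \<in> carrier (T q) \<Longrightarrow> cat q (Suc p) c \<in> mod_hom K (W.T (Suc p)) (T (Suc (Suc (q + p))))"
  using cat_hom[of c q "Suc p"] by simp

lemma cat_emb: "c \<in> carrier (T q) \<Longrightarrow> x \<in> carrier H \<Longrightarrow> cat q 0 c (W.emb x) = snoc q c x"
  unfolding cat.simps using W.lift0_emb[OF T_module, of "snoc q c" "Suc q"] snoc_linear2 by simp

lemma cat_snoc: "c \<in> carrier (T q) \<Longrightarrow> w \<in> carrier (W.T p) \<Longrightarrow> h \<in> carrier H \<Longrightarrow>
    cat q (Suc p) c (W.snoc p w h) = snoc (Suc (q + p)) (cat q p c w) h"
  unfolding cat.simps by (rule W.lift_snoc[OF T_module bilin_precomp1[OF snoc_bilin cat_hom]])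

lemma cat_closed [simp]: "c \<in> carrier (T q) \<Longrightarrow> w \<in> carrier (W.T p) \<Longrightarrow> cat q p c w \<in> carrier (T (Suc (q + p)))"
  by (rule mod_hom_closed[OF cat_hom])

lemma hom_cat_Suc: "c \<in> carrier (T q) \<Longrightarrow> f \<in> mod_hom K M (W.T (Suc p)) \<Longrightarrow>
    (\<lambda>x. cat q (Suc p) c (f x)) \<in> mod_hom K M (T (Suc (Suc (q + p))))"
  by (rule mod_hom_comp[OF cat_hom_Suc])

lemma cat_linear1: "w \<in> carrier (W.T p) \<Longrightarrow> (\<lambda>c. cat q p c w) \<in> mod_hom K (T q) (T (Suc (q + p)))"
proof (induction p arbitrary: w)
  case 0
  then obtain x where x: "x \<in> carrier H" "w = W.emb x" by (auto elim: W.emb_cases)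
  have "(\<lambda>c. snoc q c x) \<in> mod_hom K (T q) (T (Suc q))" using x by (rule_tac snoc_linear1)
  then have "(\<lambda>c. cat q 0 c w) \<in> mod_hom K (T q) (T (Suc q))"
    by (rule mod_hom_cong[OF T_module]) (simp add: x cat_emb)
  then show ?case by simp
next
  case (Suc p)
  show ?case unfolding add_Suc_right
  proof (rule mod_homI)
    show "cat q (Suc p) c w \<in> carrier (T (Suc (Suc (q + p))))" if "c \<in> carrier (T q)" for c
      using cat_closed[OF that Suc.prems] by simp
    show "cat q (Suc p) (c \<oplus>\<^bsub>T q\<^esub> c') w = cat q (Suc p) c w \<oplus>\<^bsub>T (Suc (Suc (q + p)))\<^esub> cat q (Suc p) c' w"
      if c: "c \<in> carrier (T q)" "c' \<in> carrier (T q)" for c c'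
    proof (rule W.T_ext[where N = "T (Suc (Suc (q + p)))", OF T_module _ _ _ Suc.prems])
      fix y h assume y: "y \<in> carrier (W.T p)" and h: "h \<in> carrier H"
      then show "cat q (Suc p) (c \<oplus>\<^bsub>T q\<^esub> c') (W.snoc p y h) =
          cat q (Suc p) c (W.snoc p y h) \<oplus>\<^bsub>T (Suc (Suc (q + p)))\<^esub> cat q (Suc p) c' (W.snoc p y h)"
        using c mod_hom_add[OF Suc.IH[OF y]] by (simp add: cat_snoc snoc_add1)
    qed (intro hom_cat_Suc mod_hom_addf[OF T_module] mod_hom_id c T.a_closed)+
    show "cat q (Suc p) (a \<odot>\<^bsub>T q\<^esub> c) w = a \<odot>\<^bsub>T (Suc (Suc (q + p)))\<^esub> cat q (Suc p) c w"
      if c: "a \<in> carrier K" "c \<in> carrier (T q)" for a c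
    proof (rule W.T_ext[where N = "T (Suc (Suc (q + p)))", OF T_module _ _ _ Suc.prems])
      fix y h assume y: "y \<in> carrier (W.T p)" and h: "h \<in> carrier H"
      then show "cat q (Suc p) (a \<odot>\<^bsub>T q\<^esub> c) (W.snoc p y h) = a \<odot>\<^bsub>T (Suc (Suc (q + p)))\<^esub> cat q (Suc p) c (W.snoc p y h)"
        using c mod_hom_smult[OF Suc.IH[OF y]] by (simp add: cat_snoc snoc_smult1)
    qed (intro hom_cat_Suc mod_hom_smultf[OF T_module] mod_hom_id c T.smult_closed)+
  qed
qed

lemma cat_bilin: "bilin K (T q) (W.T p) (T (Suc (q + p))) (cat q p)"
  by (intro bilinI cat_linear1 cat_hom)

lemma cat_zero2: "c \<in> carrier (T q) \<Longrightarrow> cat q p c \<zero>\<^bsub>W.T p\<^esub> = \<zero>\<^bsub>T (Suc (q + p))\<^esub>"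
  by (rule mod_hom_zero[OF W.T_module T_module cat_hom])

lemma cat_smult1: "a \<in> carrier K \<Longrightarrow> c \<in> carrier (T q) \<Longrightarrow> w \<in> carrier (W.T p) \<Longrightarrow>
    cat q p (a \<odot>\<^bsub>T q\<^esub> c) w = a \<odot>\<^bsub>T (Suc (q + p))\<^esub> cat q p c w"
  by (rule mod_hom_smult[OF cat_linear1])

lemma C_ext:
  assumes "module K N" "f \<in> mod_hom K (T (Suc (q + p))) N" "g \<in> mod_hom K (T (Suc (q + p))) N"
    and "\<And>c w. c \<in> carrier (T q) \<Longrightarrow> w \<in> carrier (W.T p) \<Longrightarrow> f (cat q p c w) = g (cat q p c w)"
    and "x \<in> carrier (T (Suc (q + p)))"
  shows "f x = g x"
  using assms(2-)
proof (induction p arbitrary: f g x)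
  case 0
  show ?case
  proof (rule T_ext[OF assms(1), where k = q])
    fix y h assume "y \<in> carrier (T q)" "h \<in> carrier H"
    then show "f (snoc q y h) = g (snoc q y h)" using 0(3)[of y "W.emb h"] by (simp add: cat_emb)
  qed (use 0 in auto)
next
  case (Suc p)
  show ?case
  proof (rule T_ext[OF assms(1), where k = "Suc (q + p)"])
    fix y h assume y: "y \<in> carrier (T (Suc (q + p)))" and h: "h \<in> carrier H"
    show "f (snoc (Suc (q + p)) y h) = g (snoc (Suc (q + p)) y h)"
    proof (rule Suc.IH[of "\<lambda>y. f (snoc (Suc (q + p)) y h)" "\<lambda>y. g (snoc (Suc (q + p)) y h)", OF _ _ _ y])
      have "(\<lambda>y. snoc (Suc (q + p)) y h) \<in> mod_hom K (T (Suc (q + p))) (T (Suc (q + Suc p)))"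
        using snoc_linear1[OF h, of "Suc (q + p)"] by simp
      from mod_hom_comp[OF Suc.prems(1) this] mod_hom_comp[OF Suc.prems(2) this]
      show "(\<lambda>y. f (snoc (Suc (q + p)) y h)) \<in> mod_hom K (T (Suc (q + p))) N"
        "(\<lambda>y. g (snoc (Suc (q + p)) y h)) \<in> mod_hom K (T (Suc (q + p))) N" .
      fix c w assume "c \<in> carrier (T q)" "w \<in> carrier (W.T p)"
      then show "f (snoc (Suc (q + p)) (cat q p c w) h) = g (snoc (Suc (q + p)) (cat q p c w) h)"
        using Suc.prems(3)[of c "W.snoc p w h"] h by (simp add: cat_snoc)
    qed
  qed (use Suc.prems in auto)
qed

text \<open>With \<open>C_ext\<close> this makes \<open>T (Suc (q + p))\<close> the tensor product
  of head and tail. In the induction step the maps \<beta> c (w \<otimes> h) are lifted for each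
  \<open>h\<close> separately; uniqueness from \<open>C_ext\<close> then shows that the lifts depend
  linearly on \<open>h\<close>, as recursion on the last factor requires.\<close>

lemma C_lift_exists:
  assumes "module K N" "bilin K (T q) (W.T p) N \<beta>"
  shows "\<exists>f. f \<in> mod_hom K (T (Suc (q + p))) N \<and> (\<forall>c\<in>carrier (T q). \<forall>w\<in>carrier (W.T p). f (cat q p c w) = \<beta> c w)"
  using assms(2)
proof (induction p arbitrary: \<beta>)
  case 0
  have b: "bilin K (T q) H N (\<lambda>c x. \<beta> c (W.emb x))"
    using bilin_precomp2[OF 0 W.emb_hom] by (simp add: bilin_def)
  have "lift q N (\<lambda>c x. \<beta> c (W.emb x)) (cat q 0 c w) = \<beta> c w" if "c \<in> carrier (T q)" "w \<in> carrier (W.T 0)" for c w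
  proof -
    obtain x where "x \<in> carrier H" "w = W.emb x" using \<open>w \<in> carrier (W.T 0)\<close> by (auto elim: W.emb_cases)
    then show ?thesis using that by (simp add: cat_emb lift_snoc[OF assms(1) b])
  qed
  then show ?case using lift_hom[OF assms(1) b] by auto
next
  case (Suc p)
  have b: "bilin K (T q) (W.T p) N (\<lambda>c w. \<beta> c (W.snoc p w h))" if "h \<in> carrier H" for h
    by (rule bilin_precomp2[OF Suc.prems W.snoc_linear1[OF that]])
  obtain F where F: "\<And>h. h \<in> carrier H \<Longrightarrow> F h \<in> mod_hom K (T (Suc (q + p))) N"
    "\<And>h c w. \<lbrakk>h \<in> carrier H; c \<in> carrier (T q); w \<in> carrier (W.T p)\<rbrakk> \<Longrightarrow> F h (cat q p c w) = \<beta> c (W.snoc p w h)"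
    using Suc.IH[OF b] by metis
  have Fb: "bilin K (T (Suc (q + p))) H N (\<lambda>y h. F h y)"
  proof (rule bilinI)
    show "F h \<in> mod_hom K (T (Suc (q + p))) N" if "h \<in> carrier H" for h by (rule F(1)[OF that])
    fix y assume y: "y \<in> carrier (T (Suc (q + p)))"
    show "(\<lambda>h. F h y) \<in> mod_hom K H N"
    proof (rule mod_homI)
      show "F h y \<in> carrier N" if "h \<in> carrier H" for h by (rule mod_hom_closed[OF F(1)[OF that] y])
      show "F (g \<oplus>\<^bsub>H\<^esub> h) y = F g y \<oplus>\<^bsub>N\<^esub> F h y" if gh: "g \<in> carrier H" "h \<in> carrier H" for g h
      proof (rule C_ext[OF assms(1) _ _ _ y])
        fix c w assume "c \<in> carrier (T q)" "w \<in> carrier (W.T p)"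
        then show "F (g \<oplus>\<^bsub>H\<^esub> h) (cat q p c w) = F g (cat q p c w) \<oplus>\<^bsub>N\<^esub> F h (cat q p c w)"
          using gh mod_hom_add[OF bilinD(2)[OF Suc.prems]] by (simp add: F W.snoc_add2)
      qed (intro F mod_hom_addf[OF assms(1)] gh H.a_closed)+
      show "F (a \<odot>\<^bsub>H\<^esub> h) y = a \<odot>\<^bsub>N\<^esub> F h y" if ah: "a \<in> carrier K" "h \<in> carrier H" for a h
      proof (rule C_ext[OF assms(1) _ _ _ y])
        fix c w assume "c \<in> carrier (T q)" "w \<in> carrier (W.T p)"
        then show "F (a \<odot>\<^bsub>H\<^esub> h) (cat q p c w) = a \<odot>\<^bsub>N\<^esub> F h (cat q p c w)"
          using ah mod_hom_smult[OF bilinD(2)[OF Suc.prems]] by (simp add: F mod_hom_smult[OF W.snoc_linear2])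
      qed (intro F mod_hom_smultf[OF assms(1)] ah H.smult_closed)+
    qed
  qed
  let ?f = "lift (Suc (q + p)) N (\<lambda>y h. F h y)"
  have f: "?f \<in> mod_hom K (T (Suc (Suc (q + p)))) N" by (rule lift_hom[OF assms(1) Fb])
  have fs: "?f (snoc (Suc (q + p)) y h) = F h y" if "y \<in> carrier (T (Suc (q + p)))" "h \<in> carrier H" for y h
    by (rule lift_snoc[OF assms(1) Fb that])
  have "?f (cat q (Suc p) c w) = \<beta> c w" if c: "c \<in> carrier (T q)" and w: "w \<in> carrier (W.T (Suc p))" for c w
  proof (rule W.T_ext[OF assms(1) _ _ _ w])
    show "(\<lambda>w. ?f (cat q (Suc p) c w)) \<in> mod_hom K (W.T (Suc p)) N"
      by (rule mod_hom_comp[OF f cat_hom_Suc[OF c]])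
    show "\<beta> c \<in> mod_hom K (W.T (Suc p)) N" by (rule bilinD(2)[OF Suc.prems c])
    fix y h assume "y \<in> carrier (W.T p)" "h \<in> carrier H"
    then show "?f (cat q (Suc p) c (W.snoc p y h)) = \<beta> c (W.snoc p y h)"
      using c by (simp add: cat_snoc fs F)
  qed
  then show ?case using f by auto
qed

definition clift :: "nat \<Rightarrow> nat \<Rightarrow> ('k, 'n, 'z) module_scheme \<Rightarrow> (('a \<times> 'h list \<Rightarrow> 'k) set \<Rightarrow> ('h \<times> 'h list \<Rightarrow> 'k) set \<Rightarrow> 'n) \<Rightarrow>
    ('a \<times> 'h list \<Rightarrow> 'k) set \<Rightarrow> 'n"
  where "clift q p N \<beta> = (SOME f. f \<in> mod_hom K (T (Suc (q + p))) N \<and>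
    (\<forall>c\<in>carrier (T q). \<forall>w\<in>carrier (W.T p). f (cat q p c w) = \<beta> c w))"

lemma clift:
  assumes "module K N" "bilin K (T q) (W.T p) N \<beta>"
  shows clift_hom: "clift q p N \<beta> \<in> mod_hom K (T (Suc (q + p))) N"
    and clift_cat: "\<And>c w. c \<in> carrier (T q) \<Longrightarrow> w \<in> carrier (W.T p) \<Longrightarrow> clift q p N \<beta> (cat q p c w) = \<beta> c w"
  using someI_ex[OF C_lift_exists[OF assms]] unfolding clift_def by auto

text \<open>\<open>rt q p p' f\<close> is \<open>1 \<otimes> f\<close> on \<open>T q \<otimes> W p\<close>.\<close>

definition rt :: "nat \<Rightarrow> nat \<Rightarrow> nat \<Rightarrow> (('h \<times> 'h list \<Rightarrow> 'k) set \<Rightarrow> ('h \<times> 'h list \<Rightarrow> 'k) set) \<Rightarrow>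
    ('a \<times> 'h list \<Rightarrow> 'k) set \<Rightarrow> ('a \<times> 'h list \<Rightarrow> 'k) set"
  where "rt q p p' f = clift q p (T (Suc (q + p'))) (\<lambda>c w. cat q p' c (f w))"

lemma rt_hom: "f \<in> mod_hom K (W.T p) (W.T p') \<Longrightarrow> rt q p p' f \<in> mod_hom K (T (Suc (q + p))) (T (Suc (q + p')))"
  unfolding rt_def by (rule clift_hom[OF T_module bilin_precomp2[OF cat_bilin]])

lemma rt_cat: "f \<in> mod_hom K (W.T p) (W.T p') \<Longrightarrow> c \<in> carrier (T q) \<Longrightarrow> w \<in> carrier (W.T p) \<Longrightarrow>
    rt q p p' f (cat q p c w) = cat q p' c (f w)"
  unfolding rt_def by (rule clift_cat[OF T_module bilin_precomp2[OF cat_bilin]])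

text \<open>The diagonal action is a sum over places, and every place belongs either to the head or
  to the tail; the first tail factor is acted on by the bracket, which is the adjoint
  action.\<close>

lemma act_cat:
  assumes "h \<in> carrier H" "c \<in> carrier (T q)" "w \<in> carrier (W.T p)"
  shows "act (Suc (q + p)) h (cat q p c w) = cat q p (act q h c) w \<oplus>\<^bsub>T (Suc (q + p))\<^esub> cat q p c (W.act p h w)"
  using assms(3)
proof (induction p arbitrary: w)
  case 0
  then obtain x where x: "x \<in> carrier H" "w = W.emb x" by (auto elim: W.emb_cases)
  then show ?case using assms by (simp add: cat_emb act_snoc W.act_emb)
next
  case (Suc p)
  show ?case unfolding add_Suc_right
  proof (rule W.T_ext[where N = "T (Suc (Suc (q + p)))", OF T_module _ _ _ Suc.prems])
    fix y g assume y: "y \<in> carrier (W.T p)" and g: "g \<in> carrier H"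
    have ca: "cat q (Suc p) c (a \<oplus>\<^bsub>W.T (Suc p)\<^esub> b) = cat q (Suc p) c a \<oplus>\<^bsub>T (Suc (Suc (q + p)))\<^esub> cat q (Suc p) c b"
      if "a \<in> carrier (W.T (Suc p))" "b \<in> carrier (W.T (Suc p))" for a b
      using mod_hom_add[OF cat_hom_Suc[OF assms(2)] that] .
    show "act (Suc (Suc (q + p))) h (cat q (Suc p) c (W.snoc p y g)) =
        cat q (Suc p) (act q h c) (W.snoc p y g) \<oplus>\<^bsub>T (Suc (Suc (q + p)))\<^esub> cat q (Suc p) c (W.act (Suc p) h (W.snoc p y g))"
      using y g assms Suc.IH[OF y] by (simp add: cat_snoc act_snoc W.act_snoc snoc_add1 ca T.a_ac)
  qed (intro hom_act hom_cat_Suc mod_hom_addf[OF T_module] mod_hom_id W.act_hom act_closed assms)+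
qed

lemma P_cat:
  assumes "i \<le> p" "c \<in> carrier (T q)" "w \<in> carrier (W.T p)"
  shows "P (Suc (q + p)) i (cat q p c w) = cat q p c (W.P p i w)"
  using assms(1,3)
proof (induction p arbitrary: i w)
  case (Suc p)
  show ?case
  proof (cases i)
    case (Suc i')
    then have i: "i' \<le> p" using Suc.prems by simp
    show ?thesis unfolding add_Suc_right Suc
    proof (rule W.T_ext[where N = "T (Suc (Suc (q + p)))", OF T_module _ _ _ Suc.prems(2)])
      fix y h assume "y \<in> carrier (W.T p)" "h \<in> carrier H"
      then show "P (Suc (Suc (q + p))) (Suc i') (cat q (Suc p) c (W.snoc p y h)) = cat q (Suc p) c (W.P (Suc p) (Suc i') (W.snoc p y h))"
        using assms(2) Suc.IH[OF i] by (simp add: cat_snoc P_snoc W.P_snoc)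
    qed (intro hom_P hom_cat_Suc mod_hom_id W.P_hom assms(2))+
  qed simp
qed simp

lemma ext_cat:
  assumes f: "f \<in> mod_hom K (T a) (T b)" and "c \<in> carrier (T a)" "w \<in> carrier (W.T p)"
  shows "ext f a b (Suc p) (cat a p c w) = cat b p (f c) w"
  using assms(3)
proof (induction p arbitrary: w)
  case 0
  then obtain x where x: "x \<in> carrier H" "w = W.emb x" by (auto elim: W.emb_cases)
  then show ?case using assms(2) ext_snoc[OF f, of c 0 x] mod_hom_closed[OF f] by (simp add: cat_emb)
next
  case (Suc p)
  note fc = mod_hom_closed[OF f assms(2)]
  show ?case
  proof (rule W.T_ext[where N = "T (Suc (Suc (b + p)))", OF T_module _ _ _ Suc.prems])
    fix y h assume y: "y \<in> carrier (W.T p)" and h: "h \<in> carrier H"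
    then show "ext f a b (Suc (Suc p)) (cat a (Suc p) c (W.snoc p y h)) = cat b (Suc p) (f c) (W.snoc p y h)"
      using assms(2) fc Suc.IH[OF y] ext_snoc[OF f, of "cat a p c y" "Suc p" h] by (simp add: cat_snoc)
  next
    show "(\<lambda>w. ext f a b (Suc (Suc p)) (cat a (Suc p) c w)) \<in> mod_hom K (W.T (Suc p)) (T (Suc (Suc (b + p))))"
    proof (rule mod_hom_comp[OF _ cat_hom_Suc[OF assms(2)]])
      show "ext f a b (Suc (Suc p)) \<in> mod_hom K (T (Suc (Suc (a + p)))) (T (Suc (Suc (b + p))))"
        using ext_hom_Suc[OF f, of "Suc p"] by simp
    qed
    show "cat b (Suc p) (f c) \<in> mod_hom K (W.T (Suc p)) (T (Suc (Suc (b + p))))" by (rule cat_hom_Suc[OF fc])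
  qed
qed

text \<open>Projects all p + 1 tail factors, whereas \<open>W.P p p\<close> leaves the first one
  alone. In the application the image of \<open>W.P p p\<close> is a copy of the space of chains of
  \<open>L_alg\<close> with coefficients in \<open>D_corep\<close>, and the kernel of
  \<open>Pf\<close> inside it is a copy of \<open>DR\<close>.\<close>

definition Pf :: "nat \<Rightarrow> ('h \<times> 'h list \<Rightarrow> 'k) set \<Rightarrow> ('h \<times> 'h list \<Rightarrow> 'k) set"
  where "Pf = tmap K (adj H) H e e"

sublocale Pf: mixed_map K H "adj H" H "adj H" e e
  by unfold_locales (use e_hom in simp_all)

lemma Pf_hom: "Pf p \<in> mod_hom K (W.T p) (W.T p)"
  unfolding Pf_def by (rule Pf.tmap_hom)

lemma Pf_closed [simp]: "w \<in> carrier (W.T p) \<Longrightarrow> Pf p w \<in> carrier (W.T p)"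
  by (rule mod_hom_closed[OF Pf_hom])

lemma P_cat_full:
  assumes "c \<in> carrier (T q)" "w \<in> carrier (W.T p)"
  shows "P (Suc (q + p)) (Suc p) (cat q p c w) = cat q p c (Pf p w)"
  using assms(2)
proof (induction p arbitrary: w)
  case 0
  then obtain x where x: "x \<in> carrier H" "w = W.emb x" by (auto elim: W.emb_cases)
  then show ?case using assms(1) Pf.tmap_emb by (simp add: Pf_def cat_emb P_snoc)
next
  case (Suc p)
  show ?case unfolding add_Suc_right
  proof (rule W.T_ext[where N = "T (Suc (Suc (q + p)))", OF T_module _ _ _ Suc.prems])
    fix y h assume y: "y \<in> carrier (W.T p)" and h: "h \<in> carrier H"
    then show "P (Suc (Suc (q + p))) (Suc (Suc p)) (cat q (Suc p) c (W.snoc p y h)) = cat q (Suc p) c (Pf (Suc p) (W.snoc p y h))"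
      using assms(1) Suc.IH[OF y] Pf_closed[OF y] Pf.tmap_snoc[OF y h] by (simp add: Pf_def cat_snoc P_snoc)
  qed (intro hom_P hom_cat_Suc mod_hom_id Pf_hom assms(1))+
qed

text \<open>\<open>Dl q p\<close> is \<open>1 \<otimes> \<delta>\<close> with the sign it has in the boundary of \<open>T q \<otimes> W p\<close>.\<close>

definition Dl :: "nat \<Rightarrow> nat \<Rightarrow> ('a \<times> 'h list \<Rightarrow> 'k) set \<Rightarrow> ('a \<times> 'h list \<Rightarrow> 'k) set"
  where "Dl q p x = (case p of 0 \<Rightarrow> \<zero>\<^bsub>T q\<^esub> | Suc p' \<Rightarrow> sgn_in K (Suc q) \<odot>\<^bsub>T (Suc (q + p'))\<^esub> rt q p p' (W.dd p) x)"

lemma Dl_0 [simp]: "Dl q 0 x = \<zero>\<^bsub>T q\<^esub>"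
  by (simp add: Dl_def)

lemma Dl_Suc: "Dl q (Suc p) x = sgn_in K (Suc q) \<odot>\<^bsub>T (Suc (q + p))\<^esub> rt q (Suc p) p (W.dd (Suc p)) x"
  by (simp add: Dl_def)

lemma Dl_hom: "Dl q p \<in> mod_hom K (T (Suc (q + p))) (T (q + p))"
proof (cases p)
  case 0
  then show ?thesis using mod_hom_zerof[OF T_module] by (simp add: Dl_def[abs_def])
next
  case (Suc p')
  have "(\<lambda>x. sgn_in K (Suc q) \<odot>\<^bsub>T (Suc (q + p'))\<^esub> rt q p p' (W.dd p) x) \<in> mod_hom K (T (Suc (q + p))) (T (Suc (q + p')))"
    unfolding Suc by (rule mod_hom_smultf[OF T_module rt_hom[OF W.dd_hom_Suc] K.sgn_in_closed])
  then show ?thesis using Suc by (simp add: Dl_def[abs_def])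
qed

lemma sgn_sgn: "x \<in> carrier (T k) \<Longrightarrow> sgn_in K j \<odot>\<^bsub>T k\<^esub> (sgn_in K j \<odot>\<^bsub>T k\<^esub> x) = x"
  by (induction j) (simp_all add: K.sgn_in_Suc T.smult_l_minus T.smult_r_minus)

text \<open>The boundary of c \<otimes> w has three kinds of terms. Those inside the head vanish, as
  \<open>c\<close> is a cycle. Those inside the tail give \<open>Dl\<close>, whose sign (-1)^(q+1)
  counts the \<open>q\<close> head factors and the first tail factor. In the rest a tail factor
  \<open>h\<close> acts on \<open>c\<close>, and that is up to the sign (-1)^q the boundary of c
  \<otimes> e h; \<open>Y\<close> collects these.\<close>

lemma dd_cat:
  assumes c: "c \<in> carrier (T q)" and z: "dd q c = \<zero>\<^bsub>T (q - 1)\<^esub>" and "w \<in> carrier (W.T p)"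
  shows "dd (Suc (q + p)) (cat q p c w) =
    Dl q p (cat q p c w) \<oplus>\<^bsub>T (q + p)\<^esub> ext (dd (Suc q)) (Suc q) q p (Y q (Suc p) (cat q p c w))"
  using assms(3)
proof (induction p arbitrary: w)
  case 0
  then obtain x where x: "x \<in> carrier H" "w = W.emb x" by (auto elim: W.emb_cases)
  have d: "dsn q c g = \<zero>\<^bsub>T q\<^esub>" if "g \<in> carrier H" for g
    using z that by (cases q) (simp_all add: snoc_zero1)
  show ?case
    using x c Y_snoc[of c q 0 x] by (simp add: cat_emb dd_snoc d snoc_zero1 act_e)
next
  case (Suc p)
  have d: "dsn q c g = \<zero>\<^bsub>T q\<^esub>" if "g \<in> carrier H" for g
    using z that by (cases q) (simp_all add: snoc_zero1)
  let ?dd = "ext (dd (Suc q)) (Suc q) q"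
  show ?case unfolding add_Suc_right
  proof (rule W.T_ext[where N = "T (Suc (q + p))", OF T_module _ _ _ Suc.prems])
    fix y h assume y: "y \<in> carrier (W.T p)" and h: "h \<in> carrier H"
    let ?u = "cat q p c y"
    have u: "?u \<in> carrier (T (Suc (q + p)))" using c y by simp
    have Yu: "Y q (Suc p) ?u \<in> carrier (T (Suc (q + p)))" using u by simp
    have ddYu: "?dd p (Y q (Suc p) ?u) \<in> carrier (T (q + p))" using ext_closed[OF dd_hom_Suc, of _ q p] Yu by simp
    have Dlu: "Dl q p ?u \<in> carrier (T (q + p))" by (rule mod_hom_closed[OF Dl_hom u])
    have ch: "ins q h c \<in> carrier (T (Suc q))" using c h by simp
    have cc: "cat (Suc q) p (ins q h c) y \<in> carrier (T (Suc (Suc (q + p))))" using cat_closed[OF ch y] by simp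
    have "Y q (Suc (Suc p)) (snoc (Suc (q + p)) ?u h) =
        snoc (Suc (q + p)) (Y q (Suc p) ?u) h \<oplus>\<^bsub>T (Suc (Suc (q + p)))\<^esub>
        sgn_in K (Suc p) \<odot>\<^bsub>T (Suc (Suc (q + p)))\<^esub> cat (Suc q) p (ins q h c) y"
      using Y_snoc[of ?u q "Suc p" h] u h ext_cat[OF ins_hom[OF h] c y] by simp
    moreover have "?dd (Suc p) (snoc (Suc (q + p)) (Y q (Suc p) ?u) h) = snoc (q + p) (?dd p (Y q (Suc p) ?u)) h"
      using ext_snoc[OF dd_hom_Suc, of _ q p h] Yu h by simp
    moreover have "?dd (Suc p) (cat (Suc q) p (ins q h c) y) = sgn_in K q \<odot>\<^bsub>T (Suc (q + p))\<^esub> cat q p (act q h c) y"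
      unfolding ext_cat[OF dd_hom_Suc ch y] using c h y by (simp add: dd_snoc d act_e cat_smult1)
    moreover have hd: "?dd (Suc p) \<in> mod_hom K (T (Suc (Suc (q + p)))) (T (Suc (q + p)))"
      using ext_hom_Suc[OF dd_hom_Suc, of q p] by simp
    ultimately have 1: "?dd (Suc p) (Y q (Suc (Suc p)) (snoc (Suc (q + p)) ?u h)) =
        snoc (q + p) (?dd p (Y q (Suc p) ?u)) h \<oplus>\<^bsub>T (Suc (q + p))\<^esub>
        sgn_in K (Suc p) \<odot>\<^bsub>T (Suc (q + p))\<^esub> (sgn_in K q \<odot>\<^bsub>T (Suc (q + p))\<^esub> cat q p (act q h c) y)"
      using Yu h cc by (simp add: mod_hom_add[OF hd] mod_hom_smult[OF hd])
    have "W.dd (Suc p) (W.snoc p y h) = W.dsn p y h \<oplus>\<^bsub>W.T p\<^esub> sgn_in K p \<odot>\<^bsub>W.T p\<^esub> W.act p h y"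
      by (rule W.dd_snoc[OF y h])
    then have "cat q p c (W.dd (Suc p) (W.snoc p y h)) =
        cat q p c (W.dsn p y h) \<oplus>\<^bsub>T (Suc (q + p))\<^esub> sgn_in K p \<odot>\<^bsub>T (Suc (q + p))\<^esub> cat q p c (W.act p h y)"
      using y h c by (simp add: mod_hom_add[OF cat_hom] mod_hom_smult[OF cat_hom])
    moreover have "sgn_in K (Suc q) \<odot>\<^bsub>T (Suc (q + p))\<^esub> cat q p c (W.dsn p y h) = snoc (q + p) (Dl q p ?u) h"
    proof (cases p)
      case 0
      then show ?thesis using c h by (simp add: cat_zero2 snoc_zero1)
    next
      case (Suc p')
      then show ?thesis using c h y by (simp add: Dl_Suc rt_cat[OF W.dd_hom_Suc] cat_snoc snoc_smult1)
    qed
    ultimately have 2: "Dl q (Suc p) (snoc (Suc (q + p)) ?u h) =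
        snoc (q + p) (Dl q p ?u) h \<oplus>\<^bsub>T (Suc (q + p))\<^esub>
        sgn_in K (Suc q) \<odot>\<^bsub>T (Suc (q + p))\<^esub> (sgn_in K p \<odot>\<^bsub>T (Suc (q + p))\<^esub> cat q p c (W.act p h y))"
      using rt_cat[OF W.dd_hom_Suc c, of "W.snoc p y h" p] y h c
      by (simp add: Dl_Suc cat_snoc T.smult_r_distr)
    \<comment> \<open>The sign of a move in \<open>Y\<close> times that of the head boundary, and
      the sign in \<open>Dl\<close> times that of the tail boundary, both equal the sign with which
      the last factor enters the boundary of the whole chain.\<close>
    have s1: "sgn_in K (Suc p) \<odot>\<^bsub>T (Suc (q + p))\<^esub> (sgn_in K q \<odot>\<^bsub>T (Suc (q + p))\<^esub> z) = sgn_in K (Suc (q + p)) \<odot>\<^bsub>T (Suc (q + p))\<^esub> z"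
      "sgn_in K (Suc q) \<odot>\<^bsub>T (Suc (q + p))\<^esub> (sgn_in K p \<odot>\<^bsub>T (Suc (q + p))\<^esub> z) = sgn_in K (Suc (q + p)) \<odot>\<^bsub>T (Suc (q + p))\<^esub> z"
      if "z \<in> carrier (T (Suc (q + p)))" for z
      using that K.sgn_in_add[of "Suc p" q] K.sgn_in_add[of "Suc q" p] by (simp_all add: add.commute flip: T.smult_assoc1)
    have "dd (Suc (Suc (q + p))) (snoc (Suc (q + p)) ?u h) =
        snoc (q + p) (Dl q p ?u \<oplus>\<^bsub>T (q + p)\<^esub> ?dd p (Y q (Suc p) ?u)) h \<oplus>\<^bsub>T (Suc (q + p))\<^esub>
        sgn_in K (Suc (q + p)) \<odot>\<^bsub>T (Suc (q + p))\<^esub> (cat q p (act q h c) y \<oplus>\<^bsub>T (Suc (q + p))\<^esub> cat q p c (W.act p h y))"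
      using u h by (simp add: dd_snoc Suc.IH[OF y] act_cat[OF h c y])
    also have "\<dots> = Dl q (Suc p) (snoc (Suc (q + p)) ?u h) \<oplus>\<^bsub>T (Suc (q + p))\<^esub>
        ?dd (Suc p) (Y q (Suc (Suc p)) (snoc (Suc (q + p)) ?u h))"
      unfolding 1 2 using Dlu ddYu c h y by (simp add: s1 snoc_add1 T.smult_r_distr T.a_ac)
    finally show "dd (Suc (Suc (q + p))) (cat q (Suc p) c (W.snoc p y h)) =
        Dl q (Suc p) (cat q (Suc p) c (W.snoc p y h)) \<oplus>\<^bsub>T (Suc (q + p))\<^esub>
        ?dd (Suc p) (Y q (Suc (Suc p)) (cat q (Suc p) c (W.snoc p y h)))"
      using c y h by (simp add: cat_snoc)
  next
    have Y2: "Y q (Suc (Suc p)) \<in> mod_hom K (T (Suc (Suc (q + p)))) (T (Suc (Suc (q + p))))"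
      using Y_hom_Suc[of q "Suc p"] by simp
    have hd: "?dd (Suc p) \<in> mod_hom K (T (Suc (Suc (q + p)))) (T (Suc (q + p)))"
      using ext_hom_Suc[OF dd_hom_Suc, of q p] by simp
    have D: "Dl q (Suc p) \<in> mod_hom K (T (Suc (Suc (q + p)))) (T (Suc (q + p)))" using Dl_hom[of q "Suc p"] by simp
    show "(\<lambda>w. dd (Suc (Suc (q + p))) (cat q (Suc p) c w)) \<in> mod_hom K (W.T (Suc p)) (T (Suc (q + p)))"
      by (rule mod_hom_comp[OF dd_hom_Suc cat_hom_Suc[OF c]])
    show "(\<lambda>w. Dl q (Suc p) (cat q (Suc p) c w) \<oplus>\<^bsub>T (Suc (q + p))\<^esub> ?dd (Suc p) (Y q (Suc (Suc p)) (cat q (Suc p) c w)))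
        \<in> mod_hom K (W.T (Suc p)) (T (Suc (q + p)))"
      by (intro mod_hom_addf[OF T_module] mod_hom_comp[OF hd] mod_hom_comp[OF Y2] mod_hom_comp[OF D] cat_hom_Suc[OF c])
  qed
qed

end

section \<open>Functoriality of maps between tensor products\<close>

lemma tmap_comp:
  assumes "mixed_map K H A L B f g" "mixed_map K L B M C f' g'" "x \<in> carrier (mixed_tensor K A H k)"
  shows "tmap K C M f' g' k (tmap K B L f g k x) = tmap K C M (\<lambda>v. f' (f v)) (\<lambda>h. g' (g h)) k x"
proof -
  interpret a: mixed_map K H A L B f g by fact
  interpret b: mixed_map K L B M C f' g' by fact
  interpret c: mixed_map K H A M C "\<lambda>v. f' (f v)" "\<lambda>h. g' (g h)"
    by unfold_locales (rule mod_hom_comp[OF b.f a.f] mod_hom_comp[OF b.g a.g])+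
  show ?thesis
  proof (rule a.M.T_hom_eq[OF b.N.T_module mod_hom_comp[OF b.tmap_hom a.tmap_hom] c.tmap_hom _ assms(3)])
    fix v hs assume v: "v \<in> carrier A" "hs \<in> tuples H k"
    then show "tmap K C M f' g' k (tmap K B L f g k (a.M.t k (v, hs))) =
        tmap K C M (\<lambda>v. f' (f v)) (\<lambda>h. g' (g h)) k (a.M.t k (v, hs))"
      using mod_hom_closed[OF a.f v(1)] tuples_map[OF v(2) mod_hom_closed[OF a.g]]
      by (simp add: a.tmap_t b.tmap_t c.tmap_t comp_def)
  qed
qed

lemma (in mixed_map) tmap_cong:
  assumes "\<And>v. v \<in> carrier A \<Longrightarrow> f' v = f v" "\<And>h. h \<in> carrier H \<Longrightarrow> g' h = g h" "x \<in> carrier (M.T k)"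
  shows "tmap K B L f' g' k x = tmap K B L f g k x"
proof -
  interpret c: mixed_map K H A L B f' g'
    by unfold_locales
      (use mod_hom_cong[OF M.A.module_axioms f assms(1)] mod_hom_cong[OF M.H.module_axioms g assms(2)] in auto)
  show ?thesis
  proof (rule M.T_hom_eq[OF N.T_module c.tmap_hom tmap_hom _ assms(3)])
    fix v hs assume v: "v \<in> carrier A" "hs \<in> tuples H k"
    then have "map g' hs = map g hs" using assms(2) by (auto simp: tuples_def)
    then show "tmap K B L f' g' k (M.t k (v, hs)) = tmap K B L f g k (M.t k (v, hs))"
      using v by (simp add: c.tmap_t tmap_t assms(1) del: map_eq_conv)
  qed
qed

lemma (in mixed) tmap_id:
  assumes "x \<in> carrier (T k)"
  shows "tmap K A H (\<lambda>v. v) (\<lambda>h. h) k x = x"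
proof -
  interpret i: mixed_map K H A H A "\<lambda>v. v" "\<lambda>h. h" by unfold_locales (rule mod_hom_id)+
  show ?thesis by (rule T_hom_eq[OF T_module i.tmap_hom mod_hom_id _ assms]) (simp add: i.tmap_t)
qed

text \<open>Identifies the recursively defined projection with a tensor map, so that it can be
  factored through a quotient of \<open>H\<close> by composing tensor maps.\<close>

lemma (in leibniz_ideal_complex) P_full_tmap:
  assumes "x \<in> carrier (T k)"
  shows "P k k x = tmap K A H (\<lambda>v. v) e k x"
proof -
  interpret i: mixed_map K H A H A "\<lambda>v. v" e by unfold_locales (rule mod_hom_id e_hom)+
  show ?thesis using assms
  proof (induction k arbitrary: x)
    case 0
    then show ?case by (auto elim!: emb_cases simp: i.tmap_emb)
  next
    case (Suc k)
    show ?case by (rule T_ext[OF T_module P_hom i.tmap_hom _ Suc.prems]) (simp add: P_snoc i.tmap_snoc Suc.IH)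
  qed
qed

section \<open>Compatibility of the full tail projection with the tail boundary\<close>

context adjoint_complex
begin

lemma Pf_emb: "x \<in> carrier H \<Longrightarrow> Pf 0 (W.emb x) = W.emb (e x)"
  using Pf.tmap_emb by (simp add: Pf_def)

lemma Pf_snoc: "w \<in> carrier (W.T p) \<Longrightarrow> h \<in> carrier H \<Longrightarrow> Pf (Suc p) (W.snoc p w h) = W.snoc p (Pf p w) (e h)"
  using Pf.tmap_snoc by (simp add: Pf_def)

lemma Pf_add: "x \<in> carrier (W.T p) \<Longrightarrow> y \<in> carrier (W.T p) \<Longrightarrow> Pf p (x \<oplus>\<^bsub>W.T p\<^esub> y) = Pf p x \<oplus>\<^bsub>W.T p\<^esub> Pf p y"
  by (rule mod_hom_add[OF Pf_hom])

lemma Pf_smult: "c \<in> carrier K \<Longrightarrow> y \<in> carrier (W.T p) \<Longrightarrow> Pf p (c \<odot>\<^bsub>W.T p\<^esub> y) = c \<odot>\<^bsub>W.T p\<^esub> Pf p y"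
  by (rule mod_hom_smult[OF Pf_hom])

lemma Pf_zero: "Pf p \<zero>\<^bsub>W.T p\<^esub> = \<zero>\<^bsub>W.T p\<^esub>"
  by (rule mod_hom_zero[OF W.T_module W.T_module Pf_hom])

lemma Pf_idem: "w \<in> carrier (W.T p) \<Longrightarrow> Pf p (Pf p w) = Pf p w"
  unfolding Pf_def
  using tmap_comp[OF Pf.mixed_map_axioms Pf.mixed_map_axioms, of w p] Pf.tmap_cong[of "\<lambda>x. e (e x)" "\<lambda>x. e (e x)" w p] e_e
  by simp

lemma Pf_P: "w \<in> carrier (W.T p) \<Longrightarrow> Pf p (W.P p p w) = Pf p w"
proof -
  assume w: "w \<in> carrier (W.T p)"
  interpret i: mixed_map K H "adj H" H "adj H" "\<lambda>v. v" e by unfold_locales (use mod_hom_id e_hom in auto)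
  show ?thesis
    unfolding Pf_def W.P_full_tmap[OF w]
    using tmap_comp[OF i.mixed_map_axioms Pf.mixed_map_axioms w] Pf.tmap_cong[of e "\<lambda>x. e (e x)" w p] e_e w by simp
qed

lemma Pf_act:
  assumes "h \<in> carrier H" "y \<in> carrier (W.T k)"
  shows "Pf k (W.act k h (Pf k y)) = Pf k (W.act k h y)"
  using assms(2)
proof (induction k arbitrary: y)
  case 0
  then obtain x where "x \<in> carrier H" "y = W.emb x" by (auto elim: W.emb_cases)
  then show ?case using assms(1) by (simp add: Pf_emb W.act_emb e_br)
next
  case (Suc k)
  show ?case
  proof (rule W.T_ext[OF W.T_module mod_hom_comp[OF Pf_hom mod_hom_comp[OF W.act_hom[OF assms(1)] Pf_hom]]
        mod_hom_comp[OF Pf_hom W.act_hom[OF assms(1)]] _ Suc.prems])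
    fix y x assume "y \<in> carrier (W.T k)" "x \<in> carrier H"
    then show "Pf (Suc k) (W.act (Suc k) h (Pf (Suc k) (W.snoc k y x))) = Pf (Suc k) (W.act (Suc k) h (W.snoc k y x))"
      using Suc.IH assms(1) by (simp add: Pf_snoc W.act_snoc Pf_add e_e e_br Pf_idem)
  qed
qed

lemma Pf_dd:
  assumes "x \<in> carrier (W.T (Suc m))"
  shows "Pf m (W.dd (Suc m) (Pf (Suc m) x)) = Pf m (W.dd (Suc m) x)"
  using assms
proof (induction m arbitrary: x)
  case 0
  show ?case
  proof (rule W.T_ext[OF W.T_module mod_hom_comp[OF Pf_hom mod_hom_comp[OF W.dd_hom_Suc Pf_hom]]
        mod_hom_comp[OF Pf_hom W.dd_hom_Suc] _ 0])
    fix y h assume "y \<in> carrier (W.T 0)" "h \<in> carrier H"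
    then show "Pf 0 (W.dd (Suc 0) (Pf (Suc 0) (W.snoc 0 y h))) = Pf 0 (W.dd (Suc 0) (W.snoc 0 y h))"
      by (simp add: Pf_snoc W.dd_snoc W.act_e Pf_act)
  qed
next
  case (Suc m)
  show ?case
  proof (rule W.T_ext[OF W.T_module mod_hom_comp[OF Pf_hom mod_hom_comp[OF W.dd_hom_Suc Pf_hom]]
        mod_hom_comp[OF Pf_hom W.dd_hom_Suc] _ Suc.prems])
    fix y h assume "y \<in> carrier (W.T (Suc m))" "h \<in> carrier H"
    then show "Pf (Suc m) (W.dd (Suc (Suc m)) (Pf (Suc (Suc m)) (W.snoc (Suc m) y h))) =
        Pf (Suc m) (W.dd (Suc (Suc m)) (W.snoc (Suc m) y h))"
      by (simp add: Pf_snoc W.dd_snoc W.act_e Pf_add Pf_smult Suc.IH e_e Pf_act)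
  qed
qed

lemma Pf_dd_zero: "x \<in> carrier (W.T (Suc m)) \<Longrightarrow> Pf (Suc m) x = \<zero>\<^bsub>W.T (Suc m)\<^esub> \<Longrightarrow> Pf m (W.dd (Suc m) x) = \<zero>\<^bsub>W.T m\<^esub>"
  using Pf_dd[of x m] mod_hom_zero[OF W.T_module W.T_module W.dd_hom_Suc] by (simp add: Pf_zero)

end

section \<open>The second page\<close>

text \<open>
  The parameters \<open>\<rho>, \<tau>, s, s'\<close> split the head complex in degree \<open>q\<close>, and \<open>\<kappa>, \<tau>', t, t'\<close> split the tail complex
  in degree \<open>p\<close> modulo the operators \<open>W.P\<close> and \<open>Pf\<close>.
\<close>

locale second_page = adjoint_complex K H A e
  for K :: "('k, 'r) ring_scheme" and H :: "('k, 'h, 'y) nalg_scheme" and A :: "('k, 'a, 'h, 'x) corep_scheme" and e +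
  fixes q p :: nat and C :: "('k, 'c, 'u) module_scheme" and N :: "('k, 'n, 'w) module_scheme" and \<rho> \<tau> s s' \<kappa> \<tau>' t t'
  assumes C: "module K C" and N: "module K N"
    and \<rho>: "\<rho> \<in> mod_hom K (T q) C" and \<tau>: "\<tau> \<in> mod_hom K C (T q)"
    and s: "s \<in> mod_hom K (T q) (T (Suc q))" and s': "s' \<in> mod_hom K (T (q - 1)) (T q)"
    and head: "c \<in> carrier (T q) \<Longrightarrow> c = \<tau> (\<rho> c) \<oplus>\<^bsub>T q\<^esub> dd (Suc q) (s c) \<oplus>\<^bsub>T q\<^esub> s' (dd q c)"
    and \<rho>_dd: "c \<in> carrier (T (Suc q)) \<Longrightarrow> \<rho> (dd (Suc q) c) = \<zero>\<^bsub>C\<^esub>"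
    and \<rho>_\<tau>: "a \<in> carrier C \<Longrightarrow> \<rho> (\<tau> a) = a"
    and dd_\<tau>: "a \<in> carrier C \<Longrightarrow> dd q (\<tau> a) = \<zero>\<^bsub>T (q - 1)\<^esub>"
    and \<kappa>: "\<kappa> \<in> mod_hom K (W.T p) N" and \<tau>': "\<tau>' \<in> mod_hom K N (W.T p)"
    and t: "t \<in> mod_hom K (W.T p) (W.T (Suc p))" and t': "t' \<in> mod_hom K (W.T (p - 1)) (W.T p)"
    and \<kappa>_P: "w \<in> carrier (W.T p) \<Longrightarrow> \<kappa> (W.P p p w) = \<kappa> w"
    and \<kappa>_dd: "u \<in> carrier (W.T (Suc p)) \<Longrightarrow> Pf (Suc p) u = \<zero>\<^bsub>W.T (Suc p)\<^esub> \<Longrightarrow> \<kappa> (W.dd (Suc p) u) = \<zero>\<^bsub>N\<^esub>"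
    and \<kappa>_\<tau>': "b \<in> carrier N \<Longrightarrow> \<kappa> (\<tau>' b) = b"
    and Pf_\<tau>': "b \<in> carrier N \<Longrightarrow> Pf p (\<tau>' b) = \<zero>\<^bsub>W.T p\<^esub>"
    and dd_\<tau>': "b \<in> carrier N \<Longrightarrow> W.P (p - 1) (p - 1) (W.dd p (\<tau>' b)) = \<zero>\<^bsub>W.T (p - 1)\<^esub>"
    and Pf_t: "w \<in> carrier (W.T p) \<Longrightarrow> Pf (Suc p) (t w) = \<zero>\<^bsub>W.T (Suc p)\<^esub>"
    and t'_P: "v \<in> carrier (W.T (p - 1)) \<Longrightarrow> t' (W.P (p - 1) (p - 1) v) = t' v"
    and tail: "w \<in> carrier (W.T p) \<Longrightarrow> W.P p p (w \<ominus>\<^bsub>W.T p\<^esub> Pf p w) =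
      W.P p p (\<tau>' (\<kappa> w)) \<oplus>\<^bsub>W.T p\<^esub> W.P p p (W.dd (Suc p) (t w)) \<oplus>\<^bsub>W.T p\<^esub> W.P p p (t' (W.dd p (w \<ominus>\<^bsub>W.T p\<^esub> Pf p w)))"
begin

abbreviation "CN \<equiv> tensor K C N"

lemma CN_module: "module K CN"
  by (rule tensor_is_module[OF K.field_axioms C N])

lemma pure_CN: "bilin K C N CN (pure K C N)"
  by (rule pure_bilin[OF K.field_axioms C N])

text \<open>Defined on the whole of \<open>T (Suc (q + p))\<close>, not only on cycles of the second
  page. On those it will be onto with the relations as kernel, which identifies the page in one
  step.\<close>

definition \<Theta> where "\<Theta> = clift q p CN (\<lambda>c w. pure K C N (\<rho> c) (\<kappa> w))"

lemma \<Theta>_bilin: "bilin K (T q) (W.T p) CN (\<lambda>c w. pure K C N (\<rho> c) (\<kappa> w))"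
  by (rule bilin_precomp[OF pure_CN \<rho> \<kappa>])

lemma \<Theta>_hom: "\<Theta> \<in> mod_hom K (T (Suc (q + p))) CN"
  unfolding \<Theta>_def by (rule clift_hom[OF CN_module \<Theta>_bilin])

lemma \<Theta>_cat: "c \<in> carrier (T q) \<Longrightarrow> w \<in> carrier (W.T p) \<Longrightarrow> \<Theta> (cat q p c w) = pure K C N (\<rho> c) (\<kappa> w)"
  unfolding \<Theta>_def by (rule clift_cat[OF CN_module \<Theta>_bilin])

lemma pure_zero1: "b \<in> carrier N \<Longrightarrow> pure K C N \<zero>\<^bsub>C\<^esub> b = \<zero>\<^bsub>CN\<^esub>"
  using mod_hom_zero[OF C CN_module bilinD(1)[OF pure_CN]] .

lemma pure_zero2: "a \<in> carrier C \<Longrightarrow> pure K C N a \<zero>\<^bsub>N\<^esub> = \<zero>\<^bsub>CN\<^esub>"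
  using mod_hom_zero[OF N CN_module bilinD(2)[OF pure_CN]] .

lemma \<rho>_closed [simp]: "c \<in> carrier (T q) \<Longrightarrow> \<rho> c \<in> carrier C" by (rule mod_hom_closed[OF \<rho>])
lemma \<tau>_closed [simp]: "a \<in> carrier C \<Longrightarrow> \<tau> a \<in> carrier (T q)" by (rule mod_hom_closed[OF \<tau>])
lemma \<kappa>_closed [simp]: "w \<in> carrier (W.T p) \<Longrightarrow> \<kappa> w \<in> carrier N" by (rule mod_hom_closed[OF \<kappa>])
lemma \<tau>'_closed [simp]: "b \<in> carrier N \<Longrightarrow> \<tau>' b \<in> carrier (W.T p)" by (rule mod_hom_closed[OF \<tau>'])
lemma t_closed' [simp]: "w \<in> carrier (W.T p) \<Longrightarrow> t w \<in> carrier (W.T (Suc p))" by (rule mod_hom_closed[OF t])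
lemma t'_closed [simp]: "w \<in> carrier (W.T (p - 1)) \<Longrightarrow> t' w \<in> carrier (W.T p)" by (rule mod_hom_closed[OF t'])
text \<open>\<open>\<kappa>\<close> sees a tail only through \<open>W.P p p\<close>, with all
  factors but the first projected. Consequently \<open>\<Theta>\<close> vanishes on the next lower
  filtration step.\<close>

lemma \<Theta>_P:
  assumes "x \<in> carrier (T (Suc (q + p)))"
  shows "\<Theta> (P (Suc (q + p)) p x) = \<Theta> x"
proof (rule C_ext[OF CN_module mod_hom_comp[OF \<Theta>_hom P_hom] \<Theta>_hom _ assms])
  fix c w assume "c \<in> carrier (T q)" "w \<in> carrier (W.T p)"
  then show "\<Theta> (P (Suc (q + p)) p (cat q p c w)) = \<Theta> (cat q p c w)"
    by (simp add: P_cat \<Theta>_cat \<kappa>_P)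
qed

lemma \<Theta>_filtration:
  "x \<in> carrier (T (Suc (q + p))) \<Longrightarrow> P (Suc (q + p)) p x = \<zero>\<^bsub>T (Suc (q + p))\<^esub> \<Longrightarrow> \<Theta> x = \<zero>\<^bsub>CN\<^esub>"
  using \<Theta>_P[of x] mod_hom_zero[OF T_module CN_module \<Theta>_hom] by simp

lemma ext_dd_hom: "ext (dd (Suc q)) (Suc q) q j \<in> mod_hom K (T (Suc (q + j))) (T (q + j))"
  using ext_hom[OF dd_hom_Suc, of q j] by simp

lemma ext_dd_hom_Suc: "ext (dd (Suc q)) (Suc q) q (Suc j) \<in> mod_hom K (T (Suc (Suc (q + j)))) (T (Suc (q + j)))"
  using ext_dd_hom[of "Suc j"] by simp

lemma ext_dd_closed [simp]: "x \<in> carrier (T (Suc (q + j))) \<Longrightarrow> ext (dd (Suc q)) (Suc q) q j x \<in> carrier (T (q + j))"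
  by (rule mod_hom_closed[OF ext_dd_hom])

lemma ext_dd_closed_Suc [simp]: "x \<in> carrier (T (Suc (Suc (q + j)))) \<Longrightarrow> ext (dd (Suc q)) (Suc q) q (Suc j) x \<in> carrier (T (Suc (q + j)))"
  by (rule mod_hom_closed[OF ext_dd_hom_Suc])

lemma \<Theta>_ext_dd:
  assumes "x \<in> carrier (T (Suc (Suc (q + p))))"
  shows "\<Theta> (ext (dd (Suc q)) (Suc q) q (Suc p) x) = \<zero>\<^bsub>CN\<^esub>"
proof (rule C_ext[of CN "\<lambda>x. \<Theta> (ext (dd (Suc q)) (Suc q) q (Suc p) x)" "Suc q" p, OF CN_module])
  show "(\<lambda>x. \<Theta> (ext (dd (Suc q)) (Suc q) q (Suc p) x)) \<in> mod_hom K (T (Suc (Suc q + p))) CN"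
    using mod_hom_comp[OF \<Theta>_hom ext_dd_hom_Suc] by simp
  fix c w assume "c \<in> carrier (T (Suc q))" "w \<in> carrier (W.T p)"
  then show "\<Theta> (ext (dd (Suc q)) (Suc q) q (Suc p) (cat (Suc q) p c w)) = \<zero>\<^bsub>CN\<^esub>"
    by (simp add: ext_cat[OF dd_hom_Suc] \<Theta>_cat \<rho>_dd pure_zero1)
qed (use assms mod_hom_zerof[OF CN_module] in simp_all)

text \<open>\<open>Q j\<close> projects the head to harmonic representatives and \<open>S j\<close> is the head homotopy.\<close>

definition "Q j = ext (\<lambda>c. \<tau> (\<rho> c)) q q j"
definition "S j = ext s q (Suc q) j"

lemma \<tau>\<rho>_hom: "(\<lambda>c. \<tau> (\<rho> c)) \<in> mod_hom K (T q) (T q)"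
  by (rule mod_hom_comp[OF \<tau> \<rho>])

lemma Q_hom: "Q j \<in> mod_hom K (T (q + j)) (T (q + j))"
  unfolding Q_def by (rule ext_hom[OF \<tau>\<rho>_hom])

lemma Q_hom_Suc: "Q (Suc j) \<in> mod_hom K (T (Suc (q + j))) (T (Suc (q + j)))"
  using Q_hom[of "Suc j"] by simp

lemma Q_closed_Suc [simp]: "x \<in> carrier (T (Suc (q + j))) \<Longrightarrow> Q (Suc j) x \<in> carrier (T (Suc (q + j)))"
  by (rule mod_hom_closed[OF Q_hom_Suc])

lemma S_hom_Suc: "S (Suc j) \<in> mod_hom K (T (Suc (q + j))) (T (Suc (Suc (q + j))))"
  unfolding S_def using ext_hom_Suc[OF s] by simp

lemma S_closed_Suc [simp]: "x \<in> carrier (T (Suc (q + j))) \<Longrightarrow> S (Suc j) x \<in> carrier (T (Suc (Suc (q + j))))"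
  by (rule mod_hom_closed[OF S_hom_Suc])

lemma Q_cat: "c \<in> carrier (T q) \<Longrightarrow> w \<in> carrier (W.T j) \<Longrightarrow> Q (Suc j) (cat q j c w) = cat q j (\<tau> (\<rho> c)) w"
  unfolding Q_def by (rule ext_cat[OF \<tau>\<rho>_hom])

lemma P_Q: "i \<le> j \<Longrightarrow> x \<in> carrier (T (q + j)) \<Longrightarrow> P (q + j) i (Q j x) = Q j (P (q + j) i x)"
  unfolding Q_def by (rule P_ext[OF \<tau>\<rho>_hom])

lemma P_Q_Suc: "i \<le> Suc j \<Longrightarrow> x \<in> carrier (T (Suc (q + j))) \<Longrightarrow> P (Suc (q + j)) i (Q (Suc j) x) = Q (Suc j) (P (Suc (q + j)) i x)"
  using P_Q[of i "Suc j" x] by simp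

lemma Q_zero_Suc: "Q (Suc j) \<zero>\<^bsub>T (Suc (q + j))\<^esub> = \<zero>\<^bsub>T (Suc (q + j))\<^esub>"
  by (rule mod_hom_zero[OF T_module T_module Q_hom_Suc])

lemma S_zero_Suc: "S (Suc j) \<zero>\<^bsub>T (Suc (q + j))\<^esub> = \<zero>\<^bsub>T (Suc (Suc (q + j)))\<^esub>"
  by (rule mod_hom_zero[OF T_module T_module S_hom_Suc])

lemma P_S: "i \<le> Suc j \<Longrightarrow> x \<in> carrier (T (Suc (q + j))) \<Longrightarrow>
    P (Suc (Suc (q + j))) i (S (Suc j) x) = S (Suc j) (P (Suc (q + j)) i x)"
  unfolding S_def using P_ext_Suc[OF s, of i j x] by simp

text \<open>Tensoring the splitting of the head with the identity writes \<open>x\<close> as Q x +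
  (d \<otimes> 1) (S x) + (s' d \<otimes> 1) x. By \<open>P_dd\<close> the operator d \<otimes> 1
  agrees with the full boundary modulo one filtration step, and the boundary of \<open>x\<close>
  vanishes to that order by hypothesis. So the last term disappears, and the middle one becomes a
  genuine boundary, up to the lower term \<open>w\<close>.\<close>

lemma head_contraction:
  assumes x: "x \<in> carrier (T (Suc (q + j)))" and Px: "P (Suc (q + j)) (Suc j) x = \<zero>\<^bsub>T (Suc (q + j))\<^esub>"
    and Pdx: "P (q + j) j (dd (Suc (q + j)) x) = \<zero>\<^bsub>T (q + j)\<^esub>"
  defines "w \<equiv> x \<ominus>\<^bsub>T (Suc (q + j))\<^esub> (Q (Suc j) x \<oplus>\<^bsub>T (Suc (q + j))\<^esub> dd (Suc (Suc (q + j))) (S (Suc j) x))"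
  shows "w \<in> carrier (T (Suc (q + j)))" "P (Suc (q + j)) j w = \<zero>\<^bsub>T (Suc (q + j))\<^esub>"
    "P (Suc (Suc (q + j))) (Suc j) (S (Suc j) x) = \<zero>\<^bsub>T (Suc (Suc (q + j)))\<^esub>"
    "x = (Q (Suc j) x \<oplus>\<^bsub>T (Suc (q + j))\<^esub> dd (Suc (Suc (q + j))) (S (Suc j) x)) \<oplus>\<^bsub>T (Suc (q + j))\<^esub> w"
proof -
  let ?m = "Suc (q + j)"
  have x': "x \<in> carrier (T (q + Suc j))" using x by simp
  show w: "w \<in> carrier (T ?m)" unfolding w_def using x by simp
  show PS: "P (Suc ?m) (Suc j) (S (Suc j) x) = \<zero>\<^bsub>T (Suc ?m)\<^esub>"
    using x by (simp add: P_S Px S_zero_Suc)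
  show "x = (Q (Suc j) x \<oplus>\<^bsub>T ?m\<^esub> dd (Suc ?m) (S (Suc j) x)) \<oplus>\<^bsub>T ?m\<^esub> w"
    unfolding w_def using x by (simp add: T.minus_minus_add)
  let ?ds = "\<lambda>c. dd (Suc q) (s c)"
  let ?sd = "\<lambda>c. s' (dd q c)"
  have ds: "?ds \<in> mod_hom K (T q) (T q)" by (rule mod_hom_comp[OF dd_hom_Suc s])
  have sd: "?sd \<in> mod_hom K (T q) (T q)" by (rule mod_hom_comp[OF s' dd_hom])
  note qd = mod_hom_addf[OF T_module \<tau>\<rho>_hom ds]
  let ?E = "\<lambda>f. ext f q q (Suc j) x"
  have "x = ?E (\<lambda>c. c)" using ext_id[OF x'] by simp
  also have "\<dots> = ?E (\<lambda>c. \<tau> (\<rho> c) \<oplus>\<^bsub>T q\<^esub> ?ds c \<oplus>\<^bsub>T q\<^esub> ?sd c)"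
    by (rule ext_cong[OF mod_hom_id mod_hom_addf[OF T_module qd sd] x' head])
  also have "\<dots> = Q (Suc j) x \<oplus>\<^bsub>T ?m\<^esub> ?E ?ds \<oplus>\<^bsub>T ?m\<^esub> ?E ?sd"
    using ext_add[OF qd sd x'] ext_add[OF \<tau>\<rho>_hom ds x'] by (simp add: Q_def)
  also have "?E ?ds = ext (dd (Suc q)) (Suc q) q (Suc j) (S (Suc j) x)"
    unfolding S_def by (rule ext_comp[OF s dd_hom_Suc x', symmetric])
  finally have dec: "x = Q (Suc j) x \<oplus>\<^bsub>T ?m\<^esub> ext (dd (Suc q)) (Suc q) q (Suc j) (S (Suc j) x) \<oplus>\<^bsub>T ?m\<^esub> ?E ?sd" .
  have sdc: "?E ?sd \<in> carrier (T ?m)" using ext_closed[OF sd x'] by simp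
  have P0: "P ?m j (?E ?sd) = \<zero>\<^bsub>T ?m\<^esub>"
  proof (cases q)
    case 0
    have "?E ?sd = \<zero>\<^bsub>T (q + Suc j)\<^esub>"
      by (rule ext_zero[OF _ x']) (use 0 mod_hom_zero[OF T_module T_module s'] in \<open>simp add: dd.simps(1)\<close>)
    then show ?thesis by (simp add: P_zero)
  next
    case (Suc a)
    have sa: "s' \<in> mod_hom K (T a) (T q)" using s' Suc by simp
    have da: "dd q \<in> mod_hom K (T q) (T a)" using dd_hom_Suc Suc by simp
    let ?z = "ext (dd q) q a (Suc j) x"
    have z: "?z \<in> carrier (T (a + Suc j))" by (rule ext_closed[OF da x'])
    have E: "?E ?sd = ext s' a q (Suc j) ?z" by (rule ext_comp[OF da sa x', symmetric])
    have xa: "x \<in> carrier (T (Suc (a + Suc j)))" using x Suc by simp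
    have "P (a + Suc j) j (dd (Suc (a + Suc j)) x) = P (a + Suc j) j ?z"
      using P_dd[OF xa] Px Suc by simp
    then have "P (a + Suc j) j ?z = \<zero>\<^bsub>T (a + Suc j)\<^esub>" using Pdx Suc by simp
    then show ?thesis
      unfolding E using P_ext[OF sa _ z, of j] mod_hom_zero[OF T_module T_module ext_hom[OF sa, of "Suc j"]] by simp
  qed
  have "P ?m j (dd (Suc ?m) (S (Suc j) x)) = P ?m j (ext (dd (Suc q)) (Suc q) q (Suc j) (S (Suc j) x))"
    using P_dd[of "S (Suc j) x" q "Suc j"] PS x by simp
  moreover have "P ?m j x = P ?m j (Q (Suc j) x) \<oplus>\<^bsub>T ?m\<^esub> P ?m j (ext (dd (Suc q)) (Suc q) q (Suc j) (S (Suc j) x))"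
    by (subst dec) (use x sdc in \<open>simp add: P_add P0\<close>)
  ultimately show "P ?m j w = \<zero>\<^bsub>T ?m\<^esub>"
    unfolding w_def using x by (simp add: P_minus P_add T.minus_eq_zero_iff)
qed

text \<open>Heads in the image of \<open>Q\<close> are cycles, so \<open>dd_cat\<close> extends
  linearly to such chains. A tail operator \<open>f\<close> is allowed because it does not touch the
  head.\<close>

lemma dd_harmonic:
  assumes f: "f \<in> mod_hom K (W.T j) (W.T i)" and x: "x \<in> carrier (T (Suc (q + j)))"
  defines "X \<equiv> rt q j i f (Q (Suc j) x)"
  shows "dd (Suc (q + i)) X = Dl q i X \<oplus>\<^bsub>T (q + i)\<^esub> ext (dd (Suc q)) (Suc q) q i (Y q (Suc i) X)"
  unfolding X_def
proof (rule C_ext[where N = "T (q + i)", OF T_module _ _ _ x])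
  note h = mod_hom_comp[OF rt_hom[OF f] Q_hom_Suc]
  show "(\<lambda>x. dd (Suc (q + i)) (rt q j i f (Q (Suc j) x))) \<in> mod_hom K (T (Suc (q + j))) (T (q + i))"
    by (rule mod_hom_comp[OF dd_hom_Suc h])
  show "(\<lambda>x. Dl q i (rt q j i f (Q (Suc j) x)) \<oplus>\<^bsub>T (q + i)\<^esub> ext (dd (Suc q)) (Suc q) q i (Y q (Suc i) (rt q j i f (Q (Suc j) x))))
      \<in> mod_hom K (T (Suc (q + j))) (T (q + i))"
    by (intro mod_hom_addf[OF T_module] mod_hom_comp[OF Dl_hom] mod_hom_comp[OF ext_dd_hom] mod_hom_comp[OF Y_hom_Suc] h)
  fix c w assume c: "c \<in> carrier (T q)" and w: "w \<in> carrier (W.T j)"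
  then show "dd (Suc (q + i)) (rt q j i f (Q (Suc j) (cat q j c w))) =
      Dl q i (rt q j i f (Q (Suc j) (cat q j c w))) \<oplus>\<^bsub>T (q + i)\<^esub>
      ext (dd (Suc q)) (Suc q) q i (Y q (Suc i) (rt q j i f (Q (Suc j) (cat q j c w))))"
    using dd_cat[of "\<tau> (\<rho> c)" q "f w" i] mod_hom_closed[OF f w] by (simp add: Q_cat rt_cat[OF f] dd_\<tau>)
qed

lemma rt_id: "x \<in> carrier (T (Suc (q + j))) \<Longrightarrow> rt q j j (\<lambda>w. w) x = x"
  by (rule C_ext[where N = "T (Suc (q + j))", OF T_module rt_hom[OF mod_hom_id] mod_hom_id])
    (simp_all add: rt_cat[OF mod_hom_id])

lemma dd_Q:
  assumes "x \<in> carrier (T (Suc (q + j)))"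
  shows "dd (Suc (q + j)) (Q (Suc j) x) = Dl q j (Q (Suc j) x) \<oplus>\<^bsub>T (q + j)\<^esub> ext (dd (Suc q)) (Suc q) q j (Y q (Suc j) (Q (Suc j) x))"
  using dd_harmonic[OF mod_hom_id assms] assms by (simp add: rt_id)

text \<open>The complement of \<open>Pf\<close>. A chain in the kernel of 1 \<otimes> Pf is not
  presented by generators, but 1 \<otimes> R fixes it, so claims about it can be checked on elements
  c \<otimes> R w, whose tails do lie in the kernel of \<open>Pf\<close>.\<close>

definition "R j w = w \<ominus>\<^bsub>W.T j\<^esub> Pf j w"

lemma R_hom: "R j \<in> mod_hom K (W.T j) (W.T j)"
  unfolding R_def[abs_def] by (rule mod_hom_minusf[OF W.T_module mod_hom_id Pf_hom])

lemma R_closed [simp]: "w \<in> carrier (W.T j) \<Longrightarrow> R j w \<in> carrier (W.T j)"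
  by (rule mod_hom_closed[OF R_hom])

lemma rt_R:
  assumes x: "x \<in> carrier (T (Suc (q + j)))"
  shows "rt q j j (R j) x = x \<ominus>\<^bsub>T (Suc (q + j))\<^esub> P (Suc (q + j)) (Suc j) x"
proof (rule C_ext[where N = "T (Suc (q + j))", OF T_module rt_hom[OF R_hom] mod_hom_minusf[OF T_module mod_hom_id P_hom] _ x])
  fix c w assume "c \<in> carrier (T q)" "w \<in> carrier (W.T j)"
  then show "rt q j j (R j) (cat q j c w) = cat q j c w \<ominus>\<^bsub>T (Suc (q + j))\<^esub> P (Suc (q + j)) (Suc j) (cat q j c w)"
    using mod_hom_minus[OF W.T_module T_module cat_hom] by (simp add: rt_cat[OF R_hom] P_cat_full) (simp add: R_def)
qed

lemma rt_R_fixed: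
  "x \<in> carrier (T (Suc (q + j))) \<Longrightarrow> P (Suc (q + j)) (Suc j) x = \<zero>\<^bsub>T (Suc (q + j))\<^esub> \<Longrightarrow> rt q j j (R j) x = x"
  by (simp add: rt_R a_minus_def)

lemma Pf_R: "w \<in> carrier (W.T j) \<Longrightarrow> Pf j (R j w) = \<zero>\<^bsub>W.T j\<^esub>"
  unfolding R_def using mod_hom_minus[OF W.T_module W.T_module Pf_hom] by (simp add: Pf_idem W.T.minus_eq_zero_iff)

lemma \<Theta>_rt_dd:
  assumes x: "x \<in> carrier (T (Suc (q + Suc p)))" and "P (Suc (q + Suc p)) (Suc (Suc p)) x = \<zero>\<^bsub>T (Suc (q + Suc p))\<^esub>"
  shows "\<Theta> (rt q (Suc p) p (W.dd (Suc p)) x) = \<zero>\<^bsub>CN\<^esub>"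
proof -
  have h: "(\<lambda>x. \<Theta> (rt q (Suc p) p (W.dd (Suc p)) x)) \<in> mod_hom K (T (Suc (q + Suc p))) CN"
    by (rule mod_hom_comp[OF \<Theta>_hom rt_hom[OF W.dd_hom_Suc]])
  have "\<Theta> (rt q (Suc p) p (W.dd (Suc p)) (rt q (Suc p) (Suc p) (R (Suc p)) x)) = \<zero>\<^bsub>CN\<^esub>"
  proof (rule C_ext[OF CN_module mod_hom_comp[OF h rt_hom[OF R_hom]] mod_hom_zerof[OF CN_module] _ x])
    fix c w assume "c \<in> carrier (T q)" "w \<in> carrier (W.T (Suc p))"
    then show "\<Theta> (rt q (Suc p) p (W.dd (Suc p)) (rt q (Suc p) (Suc p) (R (Suc p)) (cat q (Suc p) c w))) = \<zero>\<^bsub>CN\<^esub>"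
      by (simp add: rt_cat[OF R_hom] rt_cat[OF W.dd_hom_Suc] \<Theta>_cat \<kappa>_dd Pf_R pure_zero2)
  qed
  then show ?thesis using rt_R_fixed[OF assms] by simp
qed

text \<open>By contraction \<open>y\<close> is Q y plus a boundary plus a term \<open>w\<close> of
  lower filtration. The boundary contributes nothing; d w equals (d \<otimes> 1) w as far as
  \<open>\<Theta>\<close> can see; d (Q y) is a tail boundary plus an image of d \<otimes> 1.
  \<open>\<Theta>\<close> kills each of these, the tail boundary because \<open>\<kappa>\<close>
  vanishes on boundaries of tails in the kernel of \<open>Pf\<close>.\<close>

lemma \<Theta>_boundary:
  assumes y: "y \<in> carrier (T (Suc (Suc (q + p))))" and Py: "P (Suc (Suc (q + p))) (Suc (Suc p)) y = \<zero>\<^bsub>T (Suc (Suc (q + p)))\<^esub>"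
    and Pdy: "P (Suc (q + p)) (Suc p) (dd (Suc (Suc (q + p))) y) = \<zero>\<^bsub>T (Suc (q + p))\<^esub>"
  shows "\<Theta> (dd (Suc (Suc (q + p))) y) = \<zero>\<^bsub>CN\<^esub>"
proof -
  interpret CN: module K CN by (rule CN_module)
  let ?m = "Suc (q + p)"
  let ?y1 = "Q (Suc (Suc p)) y"
  let ?S = "S (Suc (Suc p)) y"
  let ?w = "y \<ominus>\<^bsub>T (Suc ?m)\<^esub> (?y1 \<oplus>\<^bsub>T (Suc ?m)\<^esub> dd (Suc (Suc ?m)) ?S)"
  have hc: "?w \<in> carrier (T (Suc ?m))" "P (Suc ?m) (Suc p) ?w = \<zero>\<^bsub>T (Suc ?m)\<^esub>"
    "y = (?y1 \<oplus>\<^bsub>T (Suc ?m)\<^esub> dd (Suc (Suc ?m)) ?S) \<oplus>\<^bsub>T (Suc ?m)\<^esub> ?w"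
    using head_contraction[of y "Suc p"] y Py Pdy by simp_all
  have y1: "?y1 \<in> carrier (T (Suc ?m))" and S: "?S \<in> carrier (T (Suc (Suc ?m)))"
    using Q_closed_Suc[of y "Suc p"] S_closed_Suc[of y "Suc p"] y by simp_all
  have "dd (Suc ?m) y = dd (Suc ?m) ((?y1 \<oplus>\<^bsub>T (Suc ?m)\<^esub> dd (Suc (Suc ?m)) ?S) \<oplus>\<^bsub>T (Suc ?m)\<^esub> ?w)"
    using arg_cong[OF hc(3)] .
  also have "\<dots> = dd (Suc ?m) ?y1 \<oplus>\<^bsub>T ?m\<^esub> dd (Suc ?m) ?w"
    using y1 S hc(1) by (simp add: dd_add dd_dd)
  finally have dy: "dd (Suc ?m) y = dd (Suc ?m) ?y1 \<oplus>\<^bsub>T ?m\<^esub> dd (Suc ?m) ?w" .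
  have "\<Theta> (dd (Suc ?m) ?w) = \<Theta> (P ?m p (dd (Suc ?m) ?w))" using hc(1) by (simp add: \<Theta>_P)
  also have "P ?m p (dd (Suc ?m) ?w) = P ?m p (ext (dd (Suc q)) (Suc q) q (Suc p) ?w)"
    using P_dd[of ?w q "Suc p"] hc by simp
  also have "\<Theta> \<dots> = \<zero>\<^bsub>CN\<^esub>" using hc(1) by (simp add: \<Theta>_P \<Theta>_ext_dd)
  finally have w0: "\<Theta> (dd (Suc ?m) ?w) = \<zero>\<^bsub>CN\<^esub>" .
  have Py1: "P (Suc ?m) (Suc (Suc p)) ?y1 = \<zero>\<^bsub>T (Suc ?m)\<^esub>"
    using P_Q_Suc[of "Suc (Suc p)" "Suc p" y] Q_zero_Suc[of "Suc p"] Py y by simp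
  let ?D = "rt q (Suc p) p (W.dd (Suc p)) ?y1"
  have D: "?D \<in> carrier (T ?m)" using mod_hom_closed[OF rt_hom[OF W.dd_hom_Suc], of ?y1 q p] y1 by simp
  have YY: "Y q (Suc (Suc p)) ?y1 \<in> carrier (T (Suc ?m))" using Y_closed_Suc[of ?y1 q "Suc p"] y1 by simp
  have "dd (Suc ?m) ?y1 = sgn_in K (Suc q) \<odot>\<^bsub>T ?m\<^esub> ?D \<oplus>\<^bsub>T ?m\<^esub> ext (dd (Suc q)) (Suc q) q (Suc p) (Y q (Suc (Suc p)) ?y1)"
    using dd_Q[of y "Suc p"] y by (simp add: Dl_Suc)
  moreover have "\<Theta> ?D = \<zero>\<^bsub>CN\<^esub>" using \<Theta>_rt_dd[of ?y1] Py1 y1 by simp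
  ultimately have "\<Theta> (dd (Suc ?m) ?y1) = \<zero>\<^bsub>CN\<^esub>"
    using D YY by (simp add: mod_hom_add[OF \<Theta>_hom] mod_hom_smult[OF \<Theta>_hom] \<Theta>_ext_dd)
  then show ?thesis using w0 y1 hc(1) by (simp add: dy mod_hom_add[OF \<Theta>_hom])
qed

lemma \<Psi>_exists:
  "\<exists>\<Psi>\<in>mod_hom K CN (T (Suc (q + p))). \<forall>a\<in>carrier C. \<forall>b\<in>carrier N. \<Psi> (pure K C N a b) = cat q p (\<tau> a) (\<tau>' b)"
proof -
  have b: "bilin K C N (T (Suc (q + p))) (\<lambda>a b. cat q p (\<tau> a) (\<tau>' b))"
    by (rule bilin_precomp[OF cat_bilin \<tau> \<tau>'])
  show ?thesis by (rule tensor_lift[OF K.field_axioms C N T_module b]) auto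
qed

text \<open>The evident preimage \<open>z\<close>, built from representatives of both homologies,
  may fail to be a cycle of the second page because its boundary contains (d \<otimes> 1) (Y z).
  Subtracting Y z cancels this term to the required order and is invisible to
  \<open>\<Theta>\<close>, since Y z lies in the lower filtration step.\<close>

lemma \<Theta>_surj:
  assumes \<xi>: "\<xi> \<in> carrier CN"
  obtains x where "x \<in> carrier (T (Suc (q + p)))" "P (Suc (q + p)) (Suc p) x = \<zero>\<^bsub>T (Suc (q + p))\<^esub>"
    "P (q + p) (p - 1) (dd (Suc (q + p)) x) = \<zero>\<^bsub>T (q + p)\<^esub>" "\<Theta> x = \<xi>"
proof -
  let ?m = "Suc (q + p)"
  obtain \<Psi> where \<Psi>: "\<Psi> \<in> mod_hom K CN (T ?m)"
    and \<Psi>p: "\<And>a b. a \<in> carrier C \<Longrightarrow> b \<in> carrier N \<Longrightarrow> \<Psi> (pure K C N a b) = cat q p (\<tau> a) (\<tau>' b)"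
    using \<Psi>_exists by blast
  note eqI = tensor_hom_eq[OF K.field_axioms C N _ _ _ _ \<xi>]
  interpret CN: module K CN by (rule CN_module)
  let ?z = "\<Psi> \<xi>"
  have z: "?z \<in> carrier (T ?m)" by (rule mod_hom_closed[OF \<Psi> \<xi>])
  have \<Theta>z: "\<Theta> ?z = \<xi>"
    by (rule eqI[OF CN_module mod_hom_comp[OF \<Theta>_hom \<Psi>] mod_hom_id]) (simp add: \<Psi>p \<Theta>_cat \<rho>_\<tau> \<kappa>_\<tau>')
  have Pz: "P ?m (Suc p) ?z = \<zero>\<^bsub>T ?m\<^esub>"
    by (rule eqI[where P = "T ?m", OF T_module mod_hom_comp[OF P_hom \<Psi>] mod_hom_zerof[OF T_module]])
      (simp add: \<Psi>p P_cat_full Pf_\<tau>' cat_zero2)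
  let ?Y = "Y q (Suc p) ?z"
  have Y: "?Y \<in> carrier (T ?m)" using z by simp
  have PY: "P ?m p ?Y = \<zero>\<^bsub>T ?m\<^esub>" by (rule P_Y[OF z Pz])
  have D: "Dl q p \<in> mod_hom K (T ?m) (T (q + p))" by (rule Dl_hom)
  have ddz: "dd ?m ?z = Dl q p ?z \<oplus>\<^bsub>T (q + p)\<^esub> ext (dd (Suc q)) (Suc q) q p ?Y"
    by (rule eqI[where P = "T (q + p)", OF T_module mod_hom_comp[OF dd_hom_Suc \<Psi>]
          mod_hom_addf[OF T_module mod_hom_comp[OF D \<Psi>] mod_hom_comp[OF ext_dd_hom mod_hom_comp[OF Y_hom_Suc \<Psi>]]]])
      (simp add: \<Psi>p dd_cat dd_\<tau>)
  have PD: "P (q + p) (p - 1) (Dl q p ?z) = \<zero>\<^bsub>T (q + p)\<^esub>"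
  proof (rule eqI[where P = "T (q + p)", OF T_module mod_hom_comp[OF P_hom mod_hom_comp[OF D \<Psi>]] mod_hom_zerof[OF T_module]])
    fix a b assume a: "a \<in> carrier C" and b: "b \<in> carrier N"
    show "P (q + p) (p - 1) (Dl q p (\<Psi> (pure K C N a b))) = \<zero>\<^bsub>T (q + p)\<^esub>"
    proof (cases p)
      case (Suc p')
      have "\<tau>' b \<in> carrier (W.T (Suc p'))" using \<tau>'_closed[OF b] Suc by simp
      moreover have "W.P p' p' (W.dd (Suc p') (\<tau>' b)) = \<zero>\<^bsub>W.T p'\<^esub>" using dd_\<tau>'[OF b] Suc by simp
      ultimately show ?thesis
        using a b \<Psi>p[OF a b] Suc by (simp add: Dl_Suc rt_cat[OF W.dd_hom_Suc] P_smult P_cat cat_zero2)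
    qed simp
  qed
  have Dz: "Dl q p ?z \<in> carrier (T (q + p))" by (rule mod_hom_closed[OF D z])
  let ?x = "?z \<ominus>\<^bsub>T ?m\<^esub> ?Y"
  show thesis
  proof (rule that)
    show "?x \<in> carrier (T ?m)" using z Y by simp
    show "P ?m (Suc p) ?x = \<zero>\<^bsub>T ?m\<^esub>"
      using z Y Pz P_mono[OF PY, of "Suc p"] by (simp add: P_minus T.minus_eq_zero_iff)
    have "P (q + p) (p - 1) (dd ?m ?Y) = P (q + p) (p - 1) (ext (dd (Suc q)) (Suc q) q p ?Y)"
      using P_dd[of ?Y q p] PY Y by simp
    then show "P (q + p) (p - 1) (dd ?m ?x) = \<zero>\<^bsub>T (q + p)\<^esub>"
      using z Y Dz PD by (simp add: mod_hom_minus[OF T_module T_module dd_hom_Suc] P_minus ddz P_add T.minus_eq_zero_iff)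
    have "\<Theta> ?Y = \<zero>\<^bsub>CN\<^esub>" by (rule \<Theta>_filtration[OF Y PY])
    moreover have "\<Theta> ?x = \<Theta> ?z \<ominus>\<^bsub>CN\<^esub> \<Theta> ?Y" by (rule mod_hom_minus[OF T_module CN_module \<Theta>_hom z Y])
    ultimately show "\<Theta> ?x = \<xi>" using \<xi> by (simp add: \<Theta>z a_minus_def)
  qed
qed

text \<open>Modulo the lower step \<open>x\<close> is Q x plus the boundary of S x, so Q x has to be
  bounded. The tail splitting decomposes it into a homology part, killed because
  \<open>\<Theta>\<close> vanishes on \<open>x\<close>; a homotopy applied to its tail boundary,
  which is zero to the relevant order for a cycle of the second page; and the tail boundary of 1
  \<otimes> t, which is the boundary of an actual chain after correction by
  \<open>Y\<close>.\<close>

lemma \<Theta>_kernel: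
  assumes x: "x \<in> carrier (T (Suc (q + p)))" and Px: "P (Suc (q + p)) (Suc p) x = \<zero>\<^bsub>T (Suc (q + p))\<^esub>"
    and Pdx: "P (q + p) (p - 1) (dd (Suc (q + p)) x) = \<zero>\<^bsub>T (q + p)\<^esub>" and \<Theta>x: "\<Theta> x = \<zero>\<^bsub>CN\<^esub>"
  obtains y where "y \<in> carrier (T (Suc (Suc (q + p))))" "P (Suc (Suc (q + p))) (Suc (Suc p)) y = \<zero>\<^bsub>T (Suc (Suc (q + p)))\<^esub>"
    "P (Suc (q + p)) p (x \<ominus>\<^bsub>T (Suc (q + p))\<^esub> dd (Suc (Suc (q + p))) y) = \<zero>\<^bsub>T (Suc (q + p))\<^esub>"
proof -
  let ?m = "Suc (q + p)"
  let ?x1 = "Q (Suc p) x"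
  let ?S = "S (Suc p) x"
  let ?w = "x \<ominus>\<^bsub>T ?m\<^esub> (?x1 \<oplus>\<^bsub>T ?m\<^esub> dd (Suc ?m) ?S)"
  have dx: "dd ?m x \<in> carrier (T (q + p))" using x by simp
  have Pdx': "P (q + p) p (dd ?m x) = \<zero>\<^bsub>T (q + p)\<^esub>" by (rule P_mono[OF Pdx _ dx]) simp
  note hc = head_contraction[OF x Px Pdx']
  have x1: "?x1 \<in> carrier (T ?m)" and Sx: "?S \<in> carrier (T (Suc ?m))" using x by simp_all
  have Px1: "P ?m (Suc p) ?x1 = \<zero>\<^bsub>T ?m\<^esub>" using x by (simp add: P_Q_Suc Px Q_zero_Suc)
  have PD: "P (q + p) (p - 1) (Dl q p ?x1) = \<zero>\<^bsub>T (q + p)\<^esub>"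
  proof -
    let ?Y = "Y q (Suc p) ?x1"
    have Y: "?Y \<in> carrier (T ?m)" using x1 by simp
    have D1: "Dl q p ?x1 \<in> carrier (T (q + p))" by (rule mod_hom_closed[OF Dl_hom x1])
    let ?dd = "ext (dd (Suc q)) (Suc q) q p"
    have "dd ?m x = dd ?m ((?x1 \<oplus>\<^bsub>T ?m\<^esub> dd (Suc ?m) ?S) \<oplus>\<^bsub>T ?m\<^esub> ?w)" using arg_cong[OF hc(4)] .
    also have "\<dots> = dd ?m ?x1 \<oplus>\<^bsub>T (q + p)\<^esub> dd ?m ?w" using x1 Sx hc(1) by (simp add: dd_add dd_dd)
    finally have "P (q + p) (p - 1) (dd ?m ?x1) \<oplus>\<^bsub>T (q + p)\<^esub> P (q + p) (p - 1) (dd ?m ?w) = \<zero>\<^bsub>T (q + p)\<^esub>"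
      using Pdx x1 hc(1) by (simp add: P_add)
    moreover have "P (q + p) (p - 1) (dd ?m ?w) = P (q + p) (p - 1) (?dd ?w)"
      using P_dd[of ?w q p] hc(1,2) by simp
    ultimately have "P (q + p) (p - 1) (Dl q p ?x1 \<oplus>\<^bsub>T (q + p)\<^esub> ?dd ?Y \<oplus>\<^bsub>T (q + p)\<^esub> ?dd ?w) = \<zero>\<^bsub>T (q + p)\<^esub>"
      using x1 D1 Y hc(1) by (simp add: dd_Q[OF x] P_add)
    then have "P (q + p) (p - 1) (Dl q p ?x1 \<oplus>\<^bsub>T (q + p)\<^esub> ?dd (?Y \<oplus>\<^bsub>T ?m\<^esub> ?w)) = \<zero>\<^bsub>T (q + p)\<^esub>"
      using D1 Y hc(1) by (simp add: mod_hom_add[OF ext_dd_hom] T.a_assoc)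
    \<comment> \<open>\<open>Q\<close> commutes with these projections, kills every image of d
      \<otimes> 1 and fixes the tail boundary of Q x. Applying it isolates that tail boundary from
      all other terms.\<close>
    then have "Q p (P (q + p) (p - 1) (Dl q p ?x1 \<oplus>\<^bsub>T (q + p)\<^esub> ?dd (?Y \<oplus>\<^bsub>T ?m\<^esub> ?w))) = \<zero>\<^bsub>T (q + p)\<^esub>"
      using mod_hom_zero[OF T_module T_module Q_hom] by simp
    moreover have G: "Dl q p ?x1 \<oplus>\<^bsub>T (q + p)\<^esub> ?dd (?Y \<oplus>\<^bsub>T ?m\<^esub> ?w) \<in> carrier (T (q + p))"
      using D1 Y hc(1) by simp
    ultimately have "P (q + p) (p - 1) (Q p (Dl q p ?x1 \<oplus>\<^bsub>T (q + p)\<^esub> ?dd (?Y \<oplus>\<^bsub>T ?m\<^esub> ?w))) = \<zero>\<^bsub>T (q + p)\<^esub>"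
      using P_Q[OF _ G, of "p - 1"] by simp
    moreover have "Q p (Dl q p ?x1 \<oplus>\<^bsub>T (q + p)\<^esub> ?dd (?Y \<oplus>\<^bsub>T ?m\<^esub> ?w)) =
        Q p (Dl q p ?x1) \<oplus>\<^bsub>T (q + p)\<^esub> Q p (?dd (?Y \<oplus>\<^bsub>T ?m\<^esub> ?w))"
      using D1 Y hc(1) by (intro mod_hom_add[OF Q_hom] ext_dd_closed T.a_closed)
    ultimately have "P (q + p) (p - 1) (Q p (Dl q p ?x1) \<oplus>\<^bsub>T (q + p)\<^esub> Q p (?dd (?Y \<oplus>\<^bsub>T ?m\<^esub> ?w))) = \<zero>\<^bsub>T (q + p)\<^esub>"
      by simp
    moreover have "Q p (?dd v) = \<zero>\<^bsub>T (q + p)\<^esub>" if "v \<in> carrier (T ?m)" for v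
    proof -
      have v: "v \<in> carrier (T (Suc q + p))" using that by simp
      have "Q p (?dd v) = ext (\<lambda>c. \<tau> (\<rho> (dd (Suc q) c))) (Suc q) q p v"
        unfolding Q_def by (rule ext_comp[OF dd_hom_Suc \<tau>\<rho>_hom v])
      also have "\<dots> = \<zero>\<^bsub>T (q + p)\<^esub>"
        by (rule ext_zero[OF _ v]) (simp add: \<rho>_dd mod_hom_zero[OF C T_module \<tau>])
      finally show ?thesis .
    qed
    moreover have "Q p (Dl q p ?x1) = Dl q p ?x1"
    proof (cases p)
      case 0
      then show ?thesis using mod_hom_zero[OF T_module T_module Q_hom, of p] by simp
    next
      case (Suc p')
      have x': "x \<in> carrier (T (Suc (q + Suc p')))" using x Suc by simp
      have Q2: "Q (Suc (Suc p')) \<in> mod_hom K (T (Suc (q + Suc p'))) (T (Suc (q + Suc p')))" by (rule Q_hom_Suc)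
      note h = mod_hom_comp[OF rt_hom[OF W.dd_hom_Suc[of p']] Q2]
      have "Q (Suc p') (rt q (Suc p') p' (W.dd (Suc p')) (Q (Suc (Suc p')) x)) = rt q (Suc p') p' (W.dd (Suc p')) (Q (Suc (Suc p')) x)"
      proof (rule C_ext[where N = "T (Suc (q + p'))", OF T_module mod_hom_comp[OF Q_hom_Suc h] h _ x'])
        fix c w assume "c \<in> carrier (T q)" "w \<in> carrier (W.T (Suc p'))"
        then show "Q (Suc p') (rt q (Suc p') p' (W.dd (Suc p')) (Q (Suc (Suc p')) (cat q (Suc p') c w))) =
            rt q (Suc p') p' (W.dd (Suc p')) (Q (Suc (Suc p')) (cat q (Suc p') c w))"
          by (simp add: Q_cat rt_cat[OF W.dd_hom_Suc] \<rho>_\<tau>)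
      qed
      then show ?thesis using Suc mod_hom_smult[OF Q_hom_Suc K.sgn_in_closed mod_hom_closed[OF h x']] by (simp add: Dl_Suc)
    qed
    ultimately show ?thesis using D1 Y hc(1) by simp
  qed
  \<comment> \<open>The tail homotopy applied to Q x. Subtracting its image \<open>?v\<close> under
    \<open>Y\<close> removes the term (d \<otimes> 1) (Y u) from the boundary, as in the proof of
    surjectivity.\<close>
  let ?u = "rt q p (Suc p) t ?x1"
  have u: "?u \<in> carrier (T (Suc ?m))" using mod_hom_closed[OF rt_hom[OF t] x1] by simp
  let ?v = "Y q (Suc (Suc p)) ?u"
  have v: "?v \<in> carrier (T (Suc ?m))" using Y_closed_Suc[of ?u q "Suc p"] u by simp
  have Pu: "P (Suc ?m) (Suc (Suc p)) ?u = \<zero>\<^bsub>T (Suc ?m)\<^esub>"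
  proof -
    have h: "rt q p (Suc p) t \<in> mod_hom K (T ?m) (T (Suc ?m))" using rt_hom[OF t] by simp
    show ?thesis
    proof (rule C_ext[where N = "T (Suc ?m)", OF T_module mod_hom_comp[OF P_hom h] mod_hom_zerof[OF T_module] _ x1])
      fix c w assume "c \<in> carrier (T q)" "w \<in> carrier (W.T p)"
      then show "P (Suc ?m) (Suc (Suc p)) (rt q p (Suc p) t (cat q p c w)) = \<zero>\<^bsub>T (Suc ?m)\<^esub>"
        using P_cat_full[of c q "t w" "Suc p"] cat_zero2[of c q "Suc p"] by (simp add: rt_cat[OF t] Pf_t)
    qed
  qed
  have Pv: "P (Suc ?m) (Suc p) ?v = \<zero>\<^bsub>T (Suc ?m)\<^esub>" using P_Y[of ?u q "Suc p"] Pu u by simp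
  let ?D = "rt q (Suc p) p (W.dd (Suc p)) ?u"
  have D: "?D \<in> carrier (T ?m)" using mod_hom_closed[OF rt_hom[OF W.dd_hom_Suc], of ?u q p] u by simp
  have du: "dd (Suc ?m) ?u = sgn_in K (Suc q) \<odot>\<^bsub>T ?m\<^esub> ?D \<oplus>\<^bsub>T ?m\<^esub> ext (dd (Suc q)) (Suc q) q (Suc p) ?v"
    using dd_harmonic[OF t x] by (simp add: Dl_Suc)
  have Pdv: "P ?m p (dd (Suc ?m) ?v) = P ?m p (ext (dd (Suc q)) (Suc q) q (Suc p) ?v)"
    using P_dd[of ?v q "Suc p"] Pv v by simp
  have PDu: "P ?m p (dd (Suc ?m) (?u \<ominus>\<^bsub>T (Suc ?m)\<^esub> ?v)) = sgn_in K (Suc q) \<odot>\<^bsub>T ?m\<^esub> P ?m p ?D"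
    using u v D by (simp add: mod_hom_minus[OF T_module T_module dd_hom_Suc] P_minus Pdv du P_add P_smult T.minus_minus_add)
  have x1D: "P ?m p ?x1 = P ?m p ?D"
  proof -
    have td: "(\<lambda>w. t' (W.dd p (R p w))) \<in> mod_hom K (W.T p) (W.T p)"
      by (rule mod_hom_comp[OF t' mod_hom_comp[OF W.dd_hom R_hom]])
    have tk: "(\<lambda>w. \<tau>' (\<kappa> w)) \<in> mod_hom K (W.T p) (W.T p)" by (rule mod_hom_comp[OF \<tau>' \<kappa>])
    have ht: "rt q p (Suc p) t \<in> mod_hom K (T ?m) (T (Suc (q + Suc p)))" by (rule rt_hom[OF t])
    have "P ?m p (rt q p p (R p) ?x1) = P ?m p (rt q p p (\<lambda>w. \<tau>' (\<kappa> w)) ?x1) \<oplus>\<^bsub>T ?m\<^esub> P ?m p ?D \<oplus>\<^bsub>T ?m\<^esub>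
        P ?m p (rt q p p (\<lambda>w. t' (W.dd p (R p w))) ?x1)"
    proof (rule C_ext[where N = "T ?m", OF T_module _ _ _ x1])
      show "(\<lambda>x. P ?m p (rt q p p (R p) x)) \<in> mod_hom K (T ?m) (T ?m)" by (rule mod_hom_comp[OF P_hom rt_hom[OF R_hom]])
      show "(\<lambda>x. P ?m p (rt q p p (\<lambda>w. \<tau>' (\<kappa> w)) x) \<oplus>\<^bsub>T ?m\<^esub> P ?m p (rt q (Suc p) p (W.dd (Suc p)) (rt q p (Suc p) t x)) \<oplus>\<^bsub>T ?m\<^esub>
        P ?m p (rt q p p (\<lambda>w. t' (W.dd p (R p w))) x)) \<in> mod_hom K (T ?m) (T ?m)"
        by (intro mod_hom_addf[OF T_module] mod_hom_comp[OF P_hom] rt_hom[OF tk] rt_hom[OF td] mod_hom_comp[OF rt_hom[OF W.dd_hom_Suc] ht])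
      fix c w assume c: "c \<in> carrier (T q)" and w: "w \<in> carrier (W.T p)"
      have cl: "W.dd p (R p w) \<in> carrier (W.T (p - 1))" using mod_hom_closed[OF W.dd_hom R_closed[OF w]] .
      have "cat q p c (W.P p p (R p w)) = cat q p c (W.P p p (\<tau>' (\<kappa> w)) \<oplus>\<^bsub>W.T p\<^esub> W.P p p (W.dd (Suc p) (t w)) \<oplus>\<^bsub>W.T p\<^esub> W.P p p (t' (W.dd p (R p w))))"
        unfolding R_def using tail[OF w] by simp
      also have "\<dots> = cat q p c (W.P p p (\<tau>' (\<kappa> w))) \<oplus>\<^bsub>T ?m\<^esub> cat q p c (W.P p p (W.dd (Suc p) (t w))) \<oplus>\<^bsub>T ?m\<^esub> cat q p c (W.P p p (t' (W.dd p (R p w))))"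
        using c w cl by (simp add: mod_hom_add[OF cat_hom])
      finally show "P ?m p (rt q p p (R p) (cat q p c w)) = P ?m p (rt q p p (\<lambda>w. \<tau>' (\<kappa> w)) (cat q p c w)) \<oplus>\<^bsub>T ?m\<^esub>
          P ?m p (rt q (Suc p) p (W.dd (Suc p)) (rt q p (Suc p) t (cat q p c w))) \<oplus>\<^bsub>T ?m\<^esub>
          P ?m p (rt q p p (\<lambda>w. t' (W.dd p (R p w))) (cat q p c w))"
        using c w cl by (simp add: rt_cat[OF R_hom] rt_cat[OF tk] rt_cat[OF td] rt_cat[OF t] rt_cat[OF W.dd_hom_Suc] P_cat)
    qed
    moreover have "rt q p p (R p) ?x1 = ?x1" by (rule rt_R_fixed[OF x1 Px1])
    moreover have "rt q p p (\<lambda>w. \<tau>' (\<kappa> w)) ?x1 = \<zero>\<^bsub>T ?m\<^esub>"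
    proof -
      obtain \<Psi> where \<Psi>: "\<Psi> \<in> mod_hom K CN (T ?m)"
        and \<Psi>p: "\<And>a b. a \<in> carrier C \<Longrightarrow> b \<in> carrier N \<Longrightarrow> \<Psi> (pure K C N a b) = cat q p (\<tau> a) (\<tau>' b)"
        using \<Psi>_exists by blast
      \<comment> \<open>Projecting head and tail to representatives of homology is the composite of
        \<open>\<Theta>\<close> and \<open>\<Psi>\<close>, by comparison on generators. This is
        where the vanishing of \<open>\<Theta>\<close> on \<open>x\<close> is used.\<close>
      have "rt q p p (\<lambda>w. \<tau>' (\<kappa> w)) (Q (Suc p) x) = \<Psi> (\<Theta> x)"
      proof (rule C_ext[where N = "T ?m", OF T_module mod_hom_comp[OF rt_hom[OF tk] Q_hom_Suc] mod_hom_comp[OF \<Psi> \<Theta>_hom] _ x])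
        fix c w assume "c \<in> carrier (T q)" "w \<in> carrier (W.T p)"
        then show "rt q p p (\<lambda>w. \<tau>' (\<kappa> w)) (Q (Suc p) (cat q p c w)) = \<Psi> (\<Theta> (cat q p c w))"
          by (simp add: Q_cat rt_cat[OF tk] \<Theta>_cat \<Psi>p)
      qed
      then show ?thesis using \<Theta>x mod_hom_zero[OF CN_module T_module \<Psi>] by simp
    qed
    moreover have "rt q p p (\<lambda>w. t' (W.dd p (R p w))) ?x1 = \<zero>\<^bsub>T ?m\<^esub>"
    proof (cases p)
      case 0
      have t0: "t' \<zero>\<^bsub>W.T 0\<^esub> = \<zero>\<^bsub>W.T 0\<^esub>" using mod_hom_zero[OF W.T_module W.T_module t'] 0 by simp
      show ?thesis
      proof (rule C_ext[where N = "T ?m", OF T_module rt_hom[OF td] mod_hom_zerof[OF T_module] _ x1])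
        fix c w assume cw: "c \<in> carrier (T q)" "w \<in> carrier (W.T p)"
        have "rt q p p (\<lambda>w. t' (W.dd p (R p w))) (cat q p c w) = cat q p c (t' (W.dd p (R p w)))"
          by (rule rt_cat[OF td cw])
        then show "rt q p p (\<lambda>w. t' (W.dd p (R p w))) (cat q p c w) = \<zero>\<^bsub>T ?m\<^esub>"
          using 0 t0 cat_zero2[of c q 0] cw by (simp add: W.dd.simps(1))
      qed
    next
      case (Suc p')
      have t1: "t' \<in> mod_hom K (W.T p') (W.T p)" using t' Suc by simp
      have d1: "W.dd p \<in> mod_hom K (W.T p) (W.T p')" using W.dd_hom_Suc Suc by simp
      have tP: "t' (W.P p' p' v) = t' v" if "v \<in> carrier (W.T p')" for v using t'_P[of v] that Suc by simp
      let ?E = "rt q p p' (W.dd p)"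
      have Ex: "?E ?x1 \<in> carrier (T (Suc (q + p')))" by (rule mod_hom_closed[OF rt_hom[OF d1] x1])
      have "rt q p p (\<lambda>w. t' (W.dd p (R p w))) ?x1 = rt q p' p t' (?E (rt q p p (R p) ?x1))"
      proof (rule C_ext[where N = "T ?m", OF T_module rt_hom[OF td] _ _ x1])
        show "(\<lambda>x. rt q p' p t' (?E (rt q p p (R p) x))) \<in> mod_hom K (T ?m) (T ?m)"
          by (rule mod_hom_comp[OF rt_hom[OF t1] mod_hom_comp[OF rt_hom[OF d1] rt_hom[OF R_hom]]])
        fix c w assume "c \<in> carrier (T q)" "w \<in> carrier (W.T p)"
        then show "rt q p p (\<lambda>w. t' (W.dd p (R p w))) (cat q p c w) = rt q p' p t' (?E (rt q p p (R p) (cat q p c w)))"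
          using mod_hom_closed[OF d1 R_closed] by (simp add: rt_cat[OF td] rt_cat[OF t1] rt_cat[OF d1] rt_cat[OF R_hom])
      qed
      also have "\<dots> = rt q p' p t' (?E ?x1)" by (simp add: rt_R_fixed[OF x1 Px1])
      \<comment> \<open>\<open>t'\<close> depends on its argument only through \<open>W.P\<close>,
        so the projection may be inserted, and the projected tail boundary is zero by
        \<open>PD\<close>.\<close>
      also have "\<dots> = rt q p' p t' (P (Suc (q + p')) p' (?E ?x1))"
      proof (rule C_ext[where N = "T ?m", OF T_module rt_hom[OF t1] mod_hom_comp[OF rt_hom[OF t1] P_hom] _ Ex])
        fix c w assume "c \<in> carrier (T q)" "w \<in> carrier (W.T p')"
        then show "rt q p' p t' (cat q p' c w) = rt q p' p t' (P (Suc (q + p')) p' (cat q p' c w))"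
          using tP by (simp add: rt_cat[OF t1] P_cat)
      qed
      also have "P (Suc (q + p')) p' (?E ?x1) = \<zero>\<^bsub>T (Suc (q + p'))\<^esub>"
      proof -
        have "sgn_in K (Suc q) \<odot>\<^bsub>T (Suc (q + p'))\<^esub> P (Suc (q + p')) p' (?E ?x1) = \<zero>\<^bsub>T (Suc (q + p'))\<^esub>"
          using PD Suc Ex by (simp add: Dl_Suc P_smult)
        then show ?thesis using sgn_sgn[OF P_closed[OF Ex], of "Suc q" p'] by simp
      qed
      also have "rt q p' p t' \<zero>\<^bsub>T (Suc (q + p'))\<^esub> = \<zero>\<^bsub>T ?m\<^esub>"
        by (rule mod_hom_zero[OF T_module T_module rt_hom[OF t1]])
      finally show ?thesis .
    qed
    ultimately show ?thesis using D by (simp add: P_zero)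
  qed
  \<comment> \<open>The sign undoes the one that \<open>Dl\<close> attaches to the tail
    boundary.\<close>
  let ?y = "?S \<oplus>\<^bsub>T (Suc ?m)\<^esub> sgn_in K (Suc q) \<odot>\<^bsub>T (Suc ?m)\<^esub> (?u \<ominus>\<^bsub>T (Suc ?m)\<^esub> ?v)"
  show thesis
  proof (rule that)
    show "?y \<in> carrier (T (Suc ?m))" using Sx u v by simp
    show "P (Suc ?m) (Suc (Suc p)) ?y = \<zero>\<^bsub>T (Suc ?m)\<^esub>"
      using Sx u v Pu P_mono[OF Pv, of "Suc (Suc p)"] P_mono[OF hc(3), of "Suc (Suc p)"]
        T.minus_eq_zero_iff[OF T.zero_closed T.zero_closed, of "Suc ?m"]
      by (simp add: P_add P_smult P_minus)
    have "P ?m p (dd (Suc ?m) ?y) = P ?m p (dd (Suc ?m) ?S) \<oplus>\<^bsub>T ?m\<^esub> P ?m p ?x1"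
      using Sx u v PDu D by (simp add: dd_add dd_smult P_add P_smult sgn_sgn x1D)
    moreover have "P ?m p x = P ?m p ?x1 \<oplus>\<^bsub>T ?m\<^esub> P ?m p (dd (Suc ?m) ?S)"
      using arg_cong[OF hc(4), of "P ?m p"] hc(1,2) x1 Sx by (simp add: P_add)
    ultimately show "P ?m p (x \<ominus>\<^bsub>T ?m\<^esub> dd (Suc ?m) ?y) = \<zero>\<^bsub>T ?m\<^esub>"
      using x x1 Sx u v by (simp add: P_minus T.minus_eq_zero_iff T.a_comm)
  qed
qed

end

section \<open>Chain maps induced by morphisms of coefficients\<close>

locale coefficient_map = M: coefficients K H A + N: coefficients K L B
  for K :: "('k, 'r) ring_scheme" and H :: "('k, 'h, 'y) nalg_scheme" and A :: "('k, 'a, 'h, 'x) corep_scheme"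
    and L :: "('k, 'l, 'w) nalg_scheme" and B :: "('k, 'b, 'l, 'u) corep_scheme" +
  fixes f :: "'a \<Rightarrow> 'b" and g :: "'h \<Rightarrow> 'l"
  assumes f_hom: "f \<in> mod_hom K A B" and g_hom: "g \<in> mod_hom K H L"
    and g_br: "\<lbrakk>x \<in> carrier H; y \<in> carrier H\<rbrakk> \<Longrightarrow> g (M.br x y) = N.br (g x) (g y)"
    and f_ra: "\<lbrakk>v \<in> carrier A; h \<in> carrier H\<rbrakk> \<Longrightarrow> f (M.ra v h) = N.ra (f v) (g h)"
begin

sublocale mixed_map K H A L B f g
  by unfold_locales (rule f_hom g_hom)+

abbreviation "F \<equiv> tmap K B L f g"

lemma f_closed [simp]: "v \<in> carrier A \<Longrightarrow> f v \<in> carrier B" by (rule mod_hom_closed[OF f_hom])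
lemma g_closed [simp]: "h \<in> carrier H \<Longrightarrow> g h \<in> carrier L" by (rule mod_hom_closed[OF g_hom])
lemmas [simp] = tmap_closed

lemma tmap_act:
  assumes h: "h \<in> carrier H" and "y \<in> carrier (M.T k)"
  shows "F k (M.act k h y) = N.act k (g h) (F k y)"
  using assms(2)
proof (induction k arbitrary: y)
  case 0
  then obtain v where v: "v \<in> carrier A" "y = M.emb v" by (elim M.emb_cases)
  then show ?case using h by (simp add: M.act_emb N.act_emb tmap_emb f_ra)
next
  case (Suc k)
  show ?case
  proof (rule M.T_ext[where N = "N.T (Suc k)", OF N.T_module _ _ _ Suc.prems])
    show "(\<lambda>y. F (Suc k) (M.act (Suc k) h y)) \<in> mod_hom K (M.T (Suc k)) (N.T (Suc k))"
      by (rule mod_hom_comp[OF tmap_hom M.act_hom[OF h]])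
    show "(\<lambda>y. N.act (Suc k) (g h) (F (Suc k) y)) \<in> mod_hom K (M.T (Suc k)) (N.T (Suc k))"
      by (rule mod_hom_comp[OF N.act_hom[OF g_closed[OF h]] tmap_hom])
    fix y x assume "y \<in> carrier (M.T k)" "x \<in> carrier H"
    then show "F (Suc k) (M.act (Suc k) h (M.snoc k y x)) = N.act (Suc k) (g h) (F (Suc k) (M.snoc k y x))"
      using h Suc.IH by (simp add: M.act_snoc N.act_snoc tmap_snoc mod_hom_add[OF tmap_hom] g_br)
  qed
qed

lemma tmap_dd:
  assumes "y \<in> carrier (M.T (Suc k))"
  shows "F k (M.dd (Suc k) y) = N.dd (Suc k) (F (Suc k) y)"
  using assms
proof (induction k arbitrary: y)
  case 0
  show ?case
  proof (rule M.T_ext[where N = "N.T 0", OF N.T_module mod_hom_comp[OF tmap_hom M.dd_hom_Suc] mod_hom_comp[OF N.dd_hom_Suc tmap_hom] _ 0])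
    fix y x assume "y \<in> carrier (M.T 0)" "x \<in> carrier H"
    then show "F 0 (M.dd (Suc 0) (M.snoc 0 y x)) = N.dd (Suc 0) (F (Suc 0) (M.snoc 0 y x))"
      by (simp add: M.dd_snoc N.dd_snoc tmap_snoc tmap_act)
  qed
next
  case (Suc k)
  show ?case
  proof (rule M.T_ext[where N = "N.T (Suc k)", OF N.T_module mod_hom_comp[OF tmap_hom M.dd_hom_Suc] mod_hom_comp[OF N.dd_hom_Suc tmap_hom] _ Suc.prems])
    fix y x assume "y \<in> carrier (M.T (Suc k))" "x \<in> carrier H"
    then show "F (Suc k) (M.dd (Suc (Suc k)) (M.snoc (Suc k) y x)) = N.dd (Suc (Suc k)) (F (Suc (Suc k)) (M.snoc (Suc k) y x))"
      using Suc.IH by (simp add: M.dd_snoc N.dd_snoc tmap_snoc tmap_act mod_hom_add[OF tmap_hom] mod_hom_smult[OF tmap_hom])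
  qed
qed

end

section \<open>Tensor and exterior powers\<close>

text \<open>The flag selects between tensor and exterior power, so that both Leibniz algebras, their
  actions and the projection between them are covered by one development.\<close>

definition power_rels :: "('k, 'r) ring_scheme \<Rightarrow> ('k, 'a, 'x) module_scheme \<Rightarrow> nat \<Rightarrow> bool \<Rightarrow> ('a list \<Rightarrow> 'k) set"
  where "power_rels K M k alt = tensor_power_rels K M k \<union>
    (if alt then {gen K xs | xs i j. xs \<in> tuples M k \<and> i < j \<and> j < k \<and> xs ! i = xs ! j} else {})"

definition power_space :: "('k, 'r) ring_scheme \<Rightarrow> ('k, 'a, 'x) module_scheme \<Rightarrow> nat \<Rightarrow> bool \<Rightarrow> ('k, ('a list \<Rightarrow> 'k) set) module"
  where "power_space K M k alt = presented K (tuples M k) (power_rels K M k alt)"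

definition power_gen :: "('k, 'r) ring_scheme \<Rightarrow> ('k, 'a, 'x) module_scheme \<Rightarrow> nat \<Rightarrow> bool \<Rightarrow> 'a list \<Rightarrow> ('a list \<Rightarrow> 'k) set"
  where "power_gen K M k alt = gen_class K (tuples M k) (power_rels K M k alt)"

lemma tensor_power_eq: "tensor_power K M k = power_space K M k False" "tensors K M k = power_gen K M k False"
  by (simp_all add: tensor_power_def tensors_def power_space_def power_gen_def power_rels_def fun_eq_iff)

lemma ext_power_eq: "ext_power K M k = power_space K M k True" "wedges K M k = power_gen K M k True"
  by (simp_all add: ext_power_def wedges_def power_space_def power_gen_def power_rels_def ext_power_rels_def fun_eq_iff)

definition multilinear :: "('k, 'r) ring_scheme \<Rightarrow> ('k, 'a, 'x) module_scheme \<Rightarrow> nat \<Rightarrow> ('k, 'n, 'z) module_scheme \<Rightarrow> ('a list \<Rightarrow> 'n) \<Rightarrow> bool"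
  where "multilinear K M k N \<phi> \<longleftrightarrow> (\<forall>xs\<in>tuples M k. \<phi> xs \<in> carrier N) \<and>
    (\<forall>xs\<in>tuples M k. \<forall>i<k. (\<lambda>a. \<phi> (xs[i := a])) \<in> mod_hom K M N)"

definition alternating :: "('a, 'x) partial_object_scheme \<Rightarrow> nat \<Rightarrow> ('n, 'z) ring_scheme \<Rightarrow> ('a list \<Rightarrow> 'n) \<Rightarrow> bool"
  where "alternating M k N \<phi> \<longleftrightarrow> (\<forall>xs\<in>tuples M k. \<forall>i j. i < j \<longrightarrow> j < k \<longrightarrow> xs ! i = xs ! j \<longrightarrow> \<phi> xs = \<zero>\<^bsub>N\<^esub>)"

lemma (in abelian_monoid) finsum_swap:
  assumes "finite I" "finite J" "\<And>i j. i \<in> I \<Longrightarrow> j \<in> J \<Longrightarrow> f i j \<in> carrier G"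
  shows "(\<Oplus>i\<in>I. \<Oplus>j\<in>J. f i j) = (\<Oplus>j\<in>J. \<Oplus>i\<in>I. f i j)"
  using assms(1,3)
proof (induction I)
  case empty
  then show ?case by simp
next
  case (insert a I)
  have "(\<Oplus>i\<in>insert a I. \<Oplus>j\<in>J. f i j) = (\<Oplus>j\<in>J. f a j) \<oplus> (\<Oplus>i\<in>I. \<Oplus>j\<in>J. f i j)"
    using insert by (subst finsum_insert) (auto intro!: finsum_closed)
  also have "(\<Oplus>i\<in>I. \<Oplus>j\<in>J. f i j) = (\<Oplus>j\<in>J. \<Oplus>i\<in>I. f i j)" using insert by auto
  also have "(\<Oplus>j\<in>J. f a j) \<oplus> (\<Oplus>j\<in>J. \<Oplus>i\<in>I. f i j) = (\<Oplus>j\<in>J. f a j \<oplus> (\<Oplus>i\<in>I. f i j))"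
    using insert by (intro finsum_addf[symmetric]) (auto intro!: finsum_closed)
  also have "\<dots> = (\<Oplus>j\<in>J. \<Oplus>i\<in>insert a I. f i j)"
    using insert by (intro finsum_cong') (auto intro!: finsum_closed a_closed simp: finsum_insert Pi_iff)
  finally show ?case .
qed

locale power = K: field K + M: module K M
  for K :: "('k, 'r) ring_scheme" and M :: "('k, 'a, 'x) module_scheme" +
  fixes k :: nat and alt :: bool
begin

abbreviation S where "S \<equiv> power_space K M k alt"
abbreviation \<gamma> where "\<gamma> \<equiv> power_gen K M k alt"

lemma rels_closed: "power_rels K M k alt \<subseteq> carrier (free_module K (tuples M k))"
proof -
  have "tensor_power_rels K M k \<subseteq> carrier (free_module K (tuples M k))"
    unfolding tensor_power_rels_def
    by (intro UN_least linear_rels_closed[OF K.field_axioms M.module_axioms]) (simp add: tuples_update)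
  then show ?thesis unfolding power_rels_def using gen_closed[OF K.is_cring] by auto
qed

lemma S_module: "module K S"
  unfolding power_space_def by (rule presented_is_module[OF K.field_axioms rels_closed])

sublocale S: module K S by (rule S_module)

lemma \<gamma>_closed: "xs \<in> tuples M k \<Longrightarrow> \<gamma> xs \<in> carrier S"
  unfolding power_space_def power_gen_def by (rule gen_class_closed[OF K.field_axioms rels_closed])

lemma \<gamma>_multilinear: "multilinear K M k S \<gamma>"
  unfolding multilinear_def
proof (intro conjI ballI allI impI)
  fix xs i assume xs: "xs \<in> tuples M k" and i: "i < k"
  have "linear_rels K (free_module K (tuples M k)) M (\<lambda>a. xs[i := a]) \<subseteq> power_rels K M k alt"
    unfolding power_rels_def tensor_power_rels_def using xs i by blast
  from gen_class_linear[OF K.field_axioms rels_closed M.module_axioms this]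
  show "(\<lambda>a. \<gamma> (xs[i := a])) \<in> mod_hom K M S"
    unfolding power_space_def power_gen_def using xs by (simp add: tuples_update)
qed (rule \<gamma>_closed)

lemma \<gamma>_alternating: "alt \<Longrightarrow> alternating M k S \<gamma>"
  unfolding alternating_def
proof (intro ballI allI impI)
  fix xs i j assume "alt" "xs \<in> tuples M k" "i < j" "j < k" "xs ! i = xs ! j"
  then show "\<gamma> xs = \<zero>\<^bsub>S\<^esub>"
    unfolding power_space_def power_gen_def
    by (intro gen_class_rel[OF K.field_axioms rels_closed]) (auto simp: power_rels_def)
qed

lemma S_hom_eq:
  assumes "module K N" "f \<in> mod_hom K S N" "g \<in> mod_hom K S N"
    and "\<And>xs. xs \<in> tuples M k \<Longrightarrow> f (\<gamma> xs) = g (\<gamma> xs)" and "X \<in> carrier S"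
  shows "f X = g X"
  by (rule presented_hom_eq[OF K.field_axioms rels_closed assms(1)]) (use assms in \<open>auto simp: power_space_def power_gen_def\<close>)

lemma S_induced_map_eq:
  assumes "module K N" "g \<in> mod_hom K S N"
    and "\<And>xs. xs \<in> tuples M k \<Longrightarrow> \<phi> xs = g (\<gamma> xs)" and "X \<in> carrier S"
  shows "induced_map K N \<phi> X = g X"
  by (rule induced_map_hom_eq[OF K.field_axioms rels_closed assms(1)]) (use assms in \<open>auto simp: power_space_def power_gen_def\<close>)

lemma S_lift:
  assumes "module K N" and ml: "multilinear K M k N \<phi>" and al: "alt \<Longrightarrow> alternating M k N \<phi>"
  shows "induced_map K N \<phi> \<in> mod_hom K S N" and "\<And>xs. xs \<in> tuples M k \<Longrightarrow> induced_map K N \<phi> (\<gamma> xs) = \<phi> xs"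
proof -
  have \<phi>: "\<phi> x \<in> carrier N" if "x \<in> tuples M k" for x using that ml by (simp add: multilinear_def)
  have 1: "lin_ext K N \<phi> s = \<zero>\<^bsub>N\<^esub>" if s: "s \<in> tensor_power_rels K M k" for s
  proof -
    obtain xs i where xs: "xs \<in> tuples M k" "i < k" "s \<in> linear_rels K (free_module K (tuples M k)) M (\<lambda>a. xs[i := a])"
      using s unfolding tensor_power_rels_def by auto
    show ?thesis
      by (rule lin_ext_linear_rels[OF K.field_axioms M.module_axioms assms(1) _ \<phi> _ xs(3)])
        (use xs ml in \<open>auto simp: multilinear_def tuples_update\<close>)
  qed
  have rel: "lin_ext K N \<phi> s = \<zero>\<^bsub>N\<^esub>" if s: "s \<in> power_rels K M k alt" for s
  proof (cases "s \<in> tensor_power_rels K M k")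
    case False
    then obtain xs i j where xs: "alt" "xs \<in> tuples M k" "i < j" "j < k" "xs ! i = xs ! j" "s = gen K xs"
      using s by (auto simp: power_rels_def split: if_splits)
    then show ?thesis
      using al lin_ext_gen[where \<phi> = \<phi>, OF assms(1) \<phi>[OF xs(2)] K.one_not_zero] by (auto simp: alternating_def)
  qed (rule 1)
  show "induced_map K N \<phi> \<in> mod_hom K S N"
    unfolding power_space_def by (rule presented_lift(1)[OF K.field_axioms rels_closed assms(1) \<phi> rel])
  show "induced_map K N \<phi> (\<gamma> xs) = \<phi> xs" if "xs \<in> tuples M k" for xs
    unfolding power_gen_def by (rule presented_lift(2)[OF K.field_axioms rels_closed assms(1) \<phi> rel that])
qed

section \<open>Derivations of tensor and exterior powers\<close>

definition deriv :: "('a \<Rightarrow> 'a) \<Rightarrow> ('a list \<Rightarrow> 'k) set \<Rightarrow> ('a list \<Rightarrow> 'k) set"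
  where "deriv D = induced_map K S (\<lambda>xs. \<Oplus>\<^bsub>S\<^esub>i\<in>{..<k}. \<gamma> (xs[i := D (xs ! i)]))"

lemma \<gamma>_hom: "xs \<in> tuples M k \<Longrightarrow> i < k \<Longrightarrow> (\<lambda>a. \<gamma> (xs[i := a])) \<in> mod_hom K M S"
  using \<gamma>_multilinear by (simp add: multilinear_def)

lemma deriv_multilinear:
  assumes D: "D \<in> mod_hom K M M"
  shows "multilinear K M k S (\<lambda>xs. \<Oplus>\<^bsub>S\<^esub>i\<in>{..<k}. \<gamma> (xs[i := D (xs ! i)]))"
  unfolding multilinear_def
proof (intro conjI ballI allI impI)
  have Dc: "xs[i := D (xs ! i)] \<in> tuples M k" if "xs \<in> tuples M k" "i < k" for xs i
    using that by (intro tuples_update mod_hom_closed[OF D] tuples_nth)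
  show "(\<Oplus>\<^bsub>S\<^esub>i\<in>{..<k}. \<gamma> (xs[i := D (xs ! i)])) \<in> carrier S" if "xs \<in> tuples M k" for xs
    using Dc[OF that] \<gamma>_closed by (intro S.finsum_closed) auto
  fix xs j assume xs: "xs \<in> tuples M k" and j: "j < k"
  have len: "length xs = k" using xs by (rule tuples_length)
  show "(\<lambda>a. \<Oplus>\<^bsub>S\<^esub>i\<in>{..<k}. \<gamma> (xs[j := a, i := D (xs[j := a] ! i)])) \<in> mod_hom K M S"
  proof (rule mod_hom_finsumf[OF M.module_axioms S_module])
    fix i assume "i \<in> {..<k}"
    then have i: "i < k" by simp
    show "(\<lambda>a. \<gamma> (xs[j := a, i := D (xs[j := a] ! i)])) \<in> mod_hom K M S"
    proof (cases "i = j")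
      case True
      have "(\<lambda>a. \<gamma> (xs[j := D a])) \<in> mod_hom K M S" by (rule mod_hom_comp[OF \<gamma>_hom[OF xs j] D])
      then show ?thesis using True j len by simp
    next
      case False
      have "(\<lambda>a. \<gamma> (xs[i := D (xs ! i), j := a])) \<in> mod_hom K M S" by (rule \<gamma>_hom[OF Dc[OF xs i] j])
      then show ?thesis using False by (simp add: list_update_swap)
    qed
  qed
qed

text \<open>Polarization: expand the value with a + b at both places, which is zero, and drop the
  two summands with equal entries.\<close>

lemma alternating_swap:
  assumes ml: "multilinear K M k S \<phi>" and al: "alternating M k S \<phi>" and xs: "xs \<in> tuples M k"
    and ij: "i < j" "j < k" and ab: "a \<in> carrier M" "b \<in> carrier M"
  shows "\<phi> (xs[i := a, j := b]) \<oplus>\<^bsub>S\<^esub> \<phi> (xs[i := b, j := a]) = \<zero>\<^bsub>S\<^esub>"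
proof -
  let ?f = "\<lambda>u v. \<phi> (xs[i := u, j := v])"
  have len: "length xs = k" using xs by (rule tuples_length)
  have h1: "(\<lambda>v. ?f u v) \<in> mod_hom K M S" if "u \<in> carrier M" for u
    using ml tuples_update[OF xs that, of i] ij(2) by (simp add: multilinear_def)
  have h2: "(\<lambda>u. ?f u v) \<in> mod_hom K M S" if "v \<in> carrier M" for v
  proof -
    have "(\<lambda>u. \<phi> ((xs[j := v])[i := u])) \<in> mod_hom K M S"
      using ml tuples_update[OF xs that, of j] ij by (simp add: multilinear_def)
    then show ?thesis using ij by (simp add: list_update_swap)
  qed
  have z: "?f u u = \<zero>\<^bsub>S\<^esub>" if "u \<in> carrier M" for u
  proof -
    have "xs[i := u, j := u] \<in> tuples M k" using xs that by (simp add: tuples_update)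
    moreover have "xs[i := u, j := u] ! i = xs[i := u, j := u] ! j" using ij len by simp
    ultimately show ?thesis using al ij unfolding alternating_def by blast
  qed
  have cl: "?f u v \<in> carrier S" if "u \<in> carrier M" "v \<in> carrier M" for u v using mod_hom_closed[OF h1] that by simp
  have "\<zero>\<^bsub>S\<^esub> = ?f (a \<oplus>\<^bsub>M\<^esub> b) (a \<oplus>\<^bsub>M\<^esub> b)" using z ab by simp
  also have "\<dots> = ?f a a \<oplus>\<^bsub>S\<^esub> ?f a b \<oplus>\<^bsub>S\<^esub> (?f b a \<oplus>\<^bsub>S\<^esub> ?f b b)"
    using ab cl by (simp add: mod_hom_add[OF h2] mod_hom_add[OF h1] S.a_ac)
  also have "\<dots> = ?f a b \<oplus>\<^bsub>S\<^esub> ?f b a" using ab cl z by simp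
  finally show ?thesis by simp
qed

text \<open>A summand that modifies a third place still has two equal entries and vanishes. The two
  remaining summands differ by exchanging the places and cancel by
  \<open>alternating_swap\<close>.\<close>

lemma deriv_alternating:
  assumes D: "D \<in> mod_hom K M M" and "alt"
  shows "alternating M k S (\<lambda>xs. \<Oplus>\<^bsub>S\<^esub>i\<in>{..<k}. \<gamma> (xs[i := D (xs ! i)]))"
  unfolding alternating_def
proof (intro ballI allI impI)
  fix xs a b assume xs: "xs \<in> tuples M k" and ab: "a < b" "b < k" and eq: "xs ! a = xs ! b"
  have len: "length xs = k" using xs by (rule tuples_length)
  let ?g = "\<lambda>i. \<gamma> (xs[i := D (xs ! i)])"
  have Dc: "xs[i := D (xs ! i)] \<in> tuples M k" if "i < k" for i
    using that xs by (intro tuples_update mod_hom_closed[OF D] tuples_nth)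
  have gc: "?g i \<in> carrier S" if "i < k" for i using \<gamma>_closed[OF Dc[OF that]] .
  have z: "?g i = \<zero>\<^bsub>S\<^esub>" if "i < k" "i \<noteq> a" "i \<noteq> b" for i
    using \<gamma>_alternating[OF assms(2)] Dc[OF that(1)] ab eq that by (auto simp: alternating_def)
  have split: "{..<k} = insert a (insert b ({..<k} - {a, b}))" using ab by auto
  have "(\<Oplus>\<^bsub>S\<^esub>i\<in>{..<k} - {a, b}. ?g i) = \<zero>\<^bsub>S\<^esub>"
    using z by (intro S.add.finprod_one_eqI) auto
  then have "(\<Oplus>\<^bsub>S\<^esub>i\<in>{..<k}. ?g i) = ?g a \<oplus>\<^bsub>S\<^esub> ?g b"
    using ab gc by (subst split) (simp add: Pi_iff)
  also have "?g a = \<gamma> (xs[a := D (xs ! b), b := xs ! b])" using ab len eq by (simp add: list_update_swap)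
  also have "?g b = \<gamma> (xs[a := xs ! b, b := D (xs ! b)])" using ab len eq[symmetric] by simp
  also have "\<gamma> (xs[a := D (xs ! b), b := xs ! b]) \<oplus>\<^bsub>S\<^esub> \<gamma> (xs[a := xs ! b, b := D (xs ! b)]) = \<zero>\<^bsub>S\<^esub>"
    by (rule alternating_swap[OF \<gamma>_multilinear \<gamma>_alternating[OF assms(2)] xs ab])
      (use xs ab in \<open>auto intro!: mod_hom_closed[OF D] tuples_nth\<close>)
  finally show "(\<Oplus>\<^bsub>S\<^esub>i\<in>{..<k}. ?g i) = \<zero>\<^bsub>S\<^esub>" .
qed

lemma deriv_hom: "D \<in> mod_hom K M M \<Longrightarrow> deriv D \<in> mod_hom K S S"
  unfolding deriv_def by (rule S_lift(1)[OF S_module deriv_multilinear deriv_alternating])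

lemma deriv_closed: "D \<in> mod_hom K M M \<Longrightarrow> X \<in> carrier S \<Longrightarrow> deriv D X \<in> carrier S"
  by (rule mod_hom_closed[OF deriv_hom])

lemma deriv_\<gamma>: "D \<in> mod_hom K M M \<Longrightarrow> xs \<in> tuples M k \<Longrightarrow> deriv D (\<gamma> xs) = (\<Oplus>\<^bsub>S\<^esub>i\<in>{..<k}. \<gamma> (xs[i := D (xs ! i)]))"
  unfolding deriv_def by (rule S_lift(2)[OF S_module deriv_multilinear deriv_alternating])

lemma deriv_term_closed: "D \<in> mod_hom K M M \<Longrightarrow> xs \<in> tuples M k \<Longrightarrow> i < k \<Longrightarrow> \<gamma> (xs[i := D (xs ! i)]) \<in> carrier S"
  by (intro \<gamma>_closed tuples_update mod_hom_closed[of D K M M] tuples_nth)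

lemma deriv_cong:
  assumes D: "D \<in> mod_hom K M M" and D': "D' \<in> mod_hom K M M" and eq: "\<And>a. a \<in> carrier M \<Longrightarrow> D a = D' a"
    and X: "X \<in> carrier S"
  shows "deriv D X = deriv D' X"
proof (rule S_hom_eq[OF S_module deriv_hom[OF D] deriv_hom[OF D'] _ X])
  fix xs assume xs: "xs \<in> tuples M k"
  then show "deriv D (\<gamma> xs) = deriv D' (\<gamma> xs)"
    unfolding deriv_\<gamma>[OF D xs] deriv_\<gamma>[OF D' xs]
    using eq deriv_term_closed[OF D'] tuples_nth[OF xs] by (intro S.finsum_cong') auto
qed

text \<open>Here the derivation itself varies. On a generator each summand depends on
  \<open>w\<close> through one entry only, and linearity spreads from generators to
  \<open>X\<close>.\<close>

lemma deriv_param: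
  assumes W: "module K W" and b: "bilin K M W M \<beta>" and X: "X \<in> carrier S"
  shows "(\<lambda>w. deriv (\<lambda>a. \<beta> a w) X) \<in> mod_hom K W S"
proof -
  interpret W: module K W by (rule W)
  note l = bilinD(1)[OF b]
  have tm: "(\<lambda>w. \<gamma> (xs[i := \<beta> (xs ! i) w])) \<in> mod_hom K W S" if "xs \<in> tuples M k" "i < k" for xs i
    by (rule mod_hom_comp[OF \<gamma>_hom[OF that] bilinD(2)[OF b tuples_nth[OF that]]])
  have g: "(\<lambda>w. deriv (\<lambda>a. \<beta> a w) (\<gamma> xs)) \<in> mod_hom K W S" if xs: "xs \<in> tuples M k" for xs
  proof (rule mod_hom_cong[OF W])
    show "(\<lambda>w. \<Oplus>\<^bsub>S\<^esub>i\<in>{..<k}. \<gamma> (xs[i := \<beta> (xs ! i) w])) \<in> mod_hom K W S"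
      using tm[OF xs] by (intro mod_hom_finsumf[OF W S_module]) auto
  qed (rule deriv_\<gamma>[OF l xs])
  show ?thesis
  proof (rule mod_homI)
    show "deriv (\<lambda>a. \<beta> a w) X \<in> carrier S" if "w \<in> carrier W" for w by (rule deriv_closed[OF l[OF that] X])
    show "deriv (\<lambda>a. \<beta> a (w \<oplus>\<^bsub>W\<^esub> w')) X = deriv (\<lambda>a. \<beta> a w) X \<oplus>\<^bsub>S\<^esub> deriv (\<lambda>a. \<beta> a w') X"
      if w: "w \<in> carrier W" "w' \<in> carrier W" for w w'
      by (rule S_hom_eq[OF S_module deriv_hom[OF l[OF W.a_closed[OF w]]] mod_hom_addf[OF S_module deriv_hom[OF l[OF w(1)]] deriv_hom[OF l[OF w(2)]]] _ X])
        (rule mod_hom_add[OF g w])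
    show "deriv (\<lambda>a. \<beta> a (c \<odot>\<^bsub>W\<^esub> w)) X = c \<odot>\<^bsub>S\<^esub> deriv (\<lambda>a. \<beta> a w) X"
      if c: "c \<in> carrier K" and w: "w \<in> carrier W" for c w
      by (rule S_hom_eq[OF S_module deriv_hom[OF l[OF W.smult_closed[OF c w]]] mod_hom_smultf[OF S_module deriv_hom[OF l[OF w]] c] _ X])
        (rule mod_hom_smult[OF g c w])
  qed
qed

lemma deriv_deriv_\<gamma>:
  assumes D: "D \<in> mod_hom K M M" and E: "E \<in> mod_hom K M M" and xs: "xs \<in> tuples M k"
  shows "deriv E (deriv D (\<gamma> xs)) = (\<Oplus>\<^bsub>S\<^esub>i\<in>{..<k}. \<Oplus>\<^bsub>S\<^esub>j\<in>{..<k}. \<gamma> (xs[i := D (xs ! i), j := E (xs[i := D (xs ! i)] ! j)]))"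
proof -
  have t: "xs[i := D (xs ! i)] \<in> tuples M k" if "i < k" for i
    using that xs by (intro tuples_update mod_hom_closed[OF D] tuples_nth)
  have "deriv E (deriv D (\<gamma> xs)) = (\<Oplus>\<^bsub>S\<^esub>i\<in>{..<k}. deriv E (\<gamma> (xs[i := D (xs ! i)])))"
    unfolding deriv_\<gamma>[OF D xs]
    by (rule mod_hom_finsum[OF S_module S_module deriv_hom[OF E]]) (use deriv_term_closed[OF D xs] in auto)
  also have "\<dots> = (\<Oplus>\<^bsub>S\<^esub>i\<in>{..<k}. \<Oplus>\<^bsub>S\<^esub>j\<in>{..<k}. \<gamma> (xs[i := D (xs ! i), j := E (xs[i := D (xs ! i)] ! j)]))"
    using t deriv_\<gamma>[OF E t] deriv_term_closed[OF E t] by (intro S.finsum_cong') (auto intro!: S.finsum_closed)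
  finally show ?thesis .
qed

text \<open>In the two double sums, acting at different places gives the same terms in either order
  once the summations are exchanged. On the diagonal the hypothesis on single entries contributes
  the additional term with \<open>G\<close>.\<close>

lemma deriv_commutator:
  assumes D: "D \<in> mod_hom K M M" and E: "E \<in> mod_hom K M M" and G: "G \<in> mod_hom K M M"
    and DE: "\<And>a. a \<in> carrier M \<Longrightarrow> E (D a) = D (E a) \<oplus>\<^bsub>M\<^esub> G a" and X: "X \<in> carrier S"
  shows "deriv E (deriv D X) = deriv D (deriv E X) \<oplus>\<^bsub>S\<^esub> deriv G X"
proof (rule S_hom_eq[OF S_module mod_hom_comp[OF deriv_hom[OF E] deriv_hom[OF D]]
      mod_hom_addf[OF S_module mod_hom_comp[OF deriv_hom[OF D] deriv_hom[OF E]] deriv_hom[OF G]] _ X])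
  fix xs assume xs: "xs \<in> tuples M k"
  have len: "length xs = k" using xs by (rule tuples_length)
  let ?a = "\<lambda>i j. \<gamma> (xs[i := D (xs ! i), j := E (xs[i := D (xs ! i)] ! j)])"
  let ?b = "\<lambda>i j. \<gamma> (xs[i := E (xs ! i), j := D (xs[i := E (xs ! i)] ! j)])"
  let ?c = "\<lambda>i. \<gamma> (xs[i := G (xs ! i)])"
  have tD: "xs[i := D (xs ! i)] \<in> tuples M k" if "i < k" for i
    using that xs by (intro tuples_update mod_hom_closed[OF D] tuples_nth)
  have tE: "xs[i := E (xs ! i)] \<in> tuples M k" if "i < k" for i
    using that xs by (intro tuples_update mod_hom_closed[OF E] tuples_nth)
  have ac: "?a i j \<in> carrier S" if "i < k" "j < k" for i j by (rule deriv_term_closed[OF E tD[OF that(1)] that(2)])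
  have bc: "?b i j \<in> carrier S" if "i < k" "j < k" for i j by (rule deriv_term_closed[OF D tE[OF that(1)] that(2)])
  have cc: "?c i \<in> carrier S" if "i < k" for i by (rule deriv_term_closed[OF G xs that])
  have ab: "?a i j = ?b j i" if "i < k" "j < k" "i \<noteq> j" for i j
    using that by (simp add: list_update_swap)
  have abc: "?a i i = ?b i i \<oplus>\<^bsub>S\<^esub> ?c i" if i: "i < k" for i
  proof -
    have x: "xs ! i \<in> carrier M" by (rule tuples_nth[OF xs i])
    show ?thesis
      using i len x DE[OF x] mod_hom_add[OF \<gamma>_hom[OF xs i]] mod_hom_closed[OF D] mod_hom_closed[OF E] mod_hom_closed[OF G] by simp
  qed
  have row: "(\<Oplus>\<^bsub>S\<^esub>j\<in>{..<k}. ?a i j) = (\<Oplus>\<^bsub>S\<^esub>j\<in>{..<k}. ?b j i) \<oplus>\<^bsub>S\<^esub> ?c i" if i: "i < k" for i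
  proof -
    have s: "{..<k} = insert i ({..<k} - {i})" using i by auto
    have A: "(\<Oplus>\<^bsub>S\<^esub>j\<in>{..<k}. ?a i j) = ?a i i \<oplus>\<^bsub>S\<^esub> (\<Oplus>\<^bsub>S\<^esub>j\<in>{..<k} - {i}. ?a i j)"
      using i ac by (subst s, subst S.finsum_insert) (auto simp del: list_update_overwrite)
    have B: "(\<Oplus>\<^bsub>S\<^esub>j\<in>{..<k}. ?b j i) = ?b i i \<oplus>\<^bsub>S\<^esub> (\<Oplus>\<^bsub>S\<^esub>j\<in>{..<k} - {i}. ?b j i)"
      using i bc by (subst s, subst S.finsum_insert) (auto simp del: list_update_overwrite)
    have C: "(\<Oplus>\<^bsub>S\<^esub>j\<in>{..<k} - {i}. ?a i j) = (\<Oplus>\<^bsub>S\<^esub>j\<in>{..<k} - {i}. ?b j i)"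
      using i ab bc by (intro S.finsum_cong') auto
    have Bc: "(\<Oplus>\<^bsub>S\<^esub>j\<in>{..<k} - {i}. ?b j i) \<in> carrier S" using i bc by (intro S.finsum_closed) auto
    show ?thesis unfolding A B C using abc[OF i] bc[OF i i] cc[OF i] Bc by (simp add: S.a_ac)
  qed
  have Bi: "(\<Oplus>\<^bsub>S\<^esub>j\<in>{..<k}. ?b j i) \<in> carrier S" if "i < k" for i using that bc by (intro S.finsum_closed) auto
  have "deriv E (deriv D (\<gamma> xs)) = (\<Oplus>\<^bsub>S\<^esub>i\<in>{..<k}. (\<Oplus>\<^bsub>S\<^esub>j\<in>{..<k}. ?b j i) \<oplus>\<^bsub>S\<^esub> ?c i)"
    unfolding deriv_deriv_\<gamma>[OF D E xs] using row Bi cc by (intro S.finsum_cong') auto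
  also have "\<dots> = (\<Oplus>\<^bsub>S\<^esub>i\<in>{..<k}. \<Oplus>\<^bsub>S\<^esub>j\<in>{..<k}. ?b j i) \<oplus>\<^bsub>S\<^esub> (\<Oplus>\<^bsub>S\<^esub>i\<in>{..<k}. ?c i)"
    using Bi cc by (intro S.finsum_addf) auto
  also have "(\<Oplus>\<^bsub>S\<^esub>i\<in>{..<k}. \<Oplus>\<^bsub>S\<^esub>j\<in>{..<k}. ?b j i) = (\<Oplus>\<^bsub>S\<^esub>j\<in>{..<k}. \<Oplus>\<^bsub>S\<^esub>i\<in>{..<k}. ?b j i)"
    using bc by (intro S.finsum_swap) auto
  finally show "deriv E (deriv D (\<gamma> xs)) = deriv D (deriv E (\<gamma> xs)) \<oplus>\<^bsub>S\<^esub> deriv G (\<gamma> xs)"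
    unfolding deriv_deriv_\<gamma>[OF E D xs] deriv_\<gamma>[OF G xs] .
qed

end

section \<open>The Leibniz algebras of a Filippov algebra\<close>

lemma with_bracket_simps [simp]:
  "carrier (with_bracket M b) = carrier M" "add (with_bracket M b) = add M" "zero (with_bracket M b) = zero M"
  "smult (with_bracket M b) = smult M" "bracket (with_bracket M b) = b"
  by (simp_all add: with_bracket_def)

lemma with_actions_simps [simp]:
  "carrier (with_actions M l r) = carrier M" "add (with_actions M l r) = add M" "zero (with_actions M l r) = zero M"
  "smult (with_actions M l r) = smult M" "lact (with_actions M l r) = l" "ract (with_actions M l r) = r"
  by (simp_all add: with_actions_def)

lemma a_inv_with_actions [simp]: "\<ominus>\<^bsub>with_actions M l r\<^esub> x = \<ominus>\<^bsub>M\<^esub> x"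
  by (simp add: a_inv_def m_inv_def)

lemma mod_hom_with [simp]:
  "mod_hom K (with_bracket M b) N = mod_hom K M N" "mod_hom K N (with_bracket M b) = mod_hom K N M"
  "mod_hom K (with_actions M l r) N = mod_hom K M N" "mod_hom K N (with_actions M l r) = mod_hom K N M"
  by (simp_all add: mod_hom_def)

lemma module_with:
  "module K M \<Longrightarrow> module K (with_bracket M b)" "module K M \<Longrightarrow> module K (with_actions M l r)"
  by (rule module_image[where f = "\<lambda>x. x" and M = M]; simp)+

lemma bilin_cong:
  assumes "module K M" "module K N" "bilin K M N P \<beta>"
    and "\<And>x y. x \<in> carrier M \<Longrightarrow> y \<in> carrier N \<Longrightarrow> \<beta>' x y = \<beta> x y"
  shows "bilin K M N P \<beta>'"
  using assms(4)
  by (intro bilinI mod_hom_cong[OF assms(1) bilinD(1)[OF assms(3)]] mod_hom_cong[OF assms(2) bilinD(2)[OF assms(3)]])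

locale filippov = filippov_algebra K \<gg> n + K: field K
  for K :: "('k, 'r) ring_scheme" and \<gg> :: "('k, 'g, 'x) nalg_scheme" and n :: nat +
  assumes two: "\<one>\<^bsub>K\<^esub> \<oplus>\<^bsub>K\<^esub> \<one>\<^bsub>K\<^esub> \<noteq> \<zero>\<^bsub>K\<^esub>" and n: "2 < n"
begin

declare One_nat_def [simp del]

lemma g_module: "module K \<gg>" ..

sublocale P: power K \<gg> "n - 1" alt for alt
  by unfold_locales

abbreviation "S \<equiv> power_space K \<gg> (n - 1)"
abbreviation "\<gamma> \<equiv> power_gen K \<gg> (n - 1)"

lemma tuples_Cons: "a \<in> carrier \<gg> \<Longrightarrow> bs \<in> tuples \<gg> (n - 1) \<Longrightarrow> a # bs \<in> tuples \<gg> n"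
  using n by (auto simp: tuples_def)

lemma bracket_hom:
  assumes "xs \<in> tuples \<gg> n" "i < n"
  shows "(\<lambda>a. bracket \<gg> (xs[i := a])) \<in> mod_hom K \<gg> \<gg>"
  using assms by (intro mod_homI bracket_closed tuples_update) (auto simp: bracket_add bracket_smult)

lemma bracket_hom_head:
  assumes "bs \<in> tuples \<gg> (n - 1)"
  shows "(\<lambda>a. bracket \<gg> (a # bs)) \<in> mod_hom K \<gg> \<gg>"
  using bracket_hom[OF tuples_Cons[OF M.zero_closed assms], of 0] n by simp

text \<open>Exchanging two equal entries shows that the bracket equals its own negative, so twice it
  is zero, and 2 is invertible in the field. This is what lets the bracket descend to exterior
  powers.\<close>

lemma bracket_alternating:
  assumes xs: "xs \<in> tuples \<gg> n" and ij: "i < j" "j < n" "xs ! i = xs ! j"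
  shows "bracket \<gg> xs = \<zero>\<^bsub>\<gg>\<^esub>"
proof -
  let ?b = "bracket \<gg> xs"
  let ?two = "\<one>\<^bsub>K\<^esub> \<oplus>\<^bsub>K\<^esub> \<one>\<^bsub>K\<^esub>"
  have b: "?b \<in> carrier \<gg>" by (rule bracket_closed[OF xs])
  have "xs[i := xs ! j, j := xs ! i] = xs" using ij(3) by (metis list_update_id)
  then have "?b = \<ominus>\<^bsub>\<gg>\<^esub> ?b" using antisym[OF xs ij(1,2)] by simp
  then have "?b \<oplus>\<^bsub>\<gg>\<^esub> ?b = \<zero>\<^bsub>\<gg>\<^esub>" using b M.r_neg by metis
  then have "?two \<odot>\<^bsub>\<gg>\<^esub> ?b = \<zero>\<^bsub>\<gg>\<^esub>" using b by (simp add: smult_l_distr)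
  moreover have u: "?two \<in> Units K" using two K.field_Units by simp
  moreover have "?b = (inv\<^bsub>K\<^esub> ?two \<otimes>\<^bsub>K\<^esub> ?two) \<odot>\<^bsub>\<gg>\<^esub> ?b" using u b by simp
  moreover have "\<dots> = inv\<^bsub>K\<^esub> ?two \<odot>\<^bsub>\<gg>\<^esub> (?two \<odot>\<^bsub>\<gg>\<^esub> ?b)" using u b by (intro smult_assoc1) auto
  ultimately show ?thesis using u by simp
qed

lemma ad_multilinear:
  assumes a: "a \<in> carrier \<gg>"
  shows "multilinear K \<gg> (n - 1) \<gg> (\<lambda>bs. bracket \<gg> (a # bs))"
  unfolding multilinear_def
proof (intro conjI ballI allI impI)
  show "bracket \<gg> (a # bs) \<in> carrier \<gg>" if "bs \<in> tuples \<gg> (n - 1)" for bs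
    by (rule bracket_closed[OF tuples_Cons[OF a that]])
  show "(\<lambda>b. bracket \<gg> (a # bs[i := b])) \<in> mod_hom K \<gg> \<gg>" if "bs \<in> tuples \<gg> (n - 1)" "i < n - 1" for bs i
    using bracket_hom[OF tuples_Cons[OF a that(1)], of "Suc i"] that(2) by simp
qed

lemma ad_alternating:
  assumes a: "a \<in> carrier \<gg>"
  shows "alternating \<gg> (n - 1) \<gg> (\<lambda>bs. bracket \<gg> (a # bs))"
  unfolding alternating_def
proof (intro ballI allI impI)
  fix bs i j assume bs: "bs \<in> tuples \<gg> (n - 1)" and ij: "i < j" "j < n - 1" "bs ! i = bs ! j"
  show "bracket \<gg> (a # bs) = \<zero>\<^bsub>\<gg>\<^esub>"
    by (rule bracket_alternating[OF tuples_Cons[OF a bs], of "Suc i" "Suc j"]) (use ij in auto)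
qed

text \<open>One definition covers tensor and exterior powers, because \<open>induced_map\<close>
  refers to generators and not to the relations.\<close>

definition RA :: "'g \<Rightarrow> ('g list \<Rightarrow> 'k) set \<Rightarrow> 'g"
  where "RA a = induced_map K \<gg> (\<lambda>bs. bracket \<gg> (a # bs))"

lemma RA_hom: "a \<in> carrier \<gg> \<Longrightarrow> RA a \<in> mod_hom K (S alt) \<gg>"
  unfolding RA_def by (rule P.S_lift(1)[OF g_module ad_multilinear ad_alternating])

lemma RA_\<gamma>: "a \<in> carrier \<gg> \<Longrightarrow> bs \<in> tuples \<gg> (n - 1) \<Longrightarrow> RA a (\<gamma> alt bs) = bracket \<gg> (a # bs)"
  unfolding RA_def by (rule P.S_lift(2)[OF g_module ad_multilinear ad_alternating])

lemma RA_bilin: "bilin K \<gg> (S alt) \<gg> RA"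
proof (rule bilinI)
  show "RA x \<in> mod_hom K (S alt) \<gg>" if "x \<in> carrier \<gg>" for x by (rule RA_hom[OF that])
  fix W assume W: "W \<in> carrier (S alt)"
  show "(\<lambda>a. RA a W) \<in> mod_hom K \<gg> \<gg>"
  proof (rule mod_homI)
    show "RA a W \<in> carrier \<gg>" if "a \<in> carrier \<gg>" for a by (rule mod_hom_closed[OF RA_hom[OF that] W])
    show "RA (a \<oplus>\<^bsub>\<gg>\<^esub> b) W = RA a W \<oplus>\<^bsub>\<gg>\<^esub> RA b W" if "a \<in> carrier \<gg>" "b \<in> carrier \<gg>" for a b
      by (rule P.S_hom_eq[OF g_module RA_hom mod_hom_addf[OF g_module RA_hom RA_hom] _ W])
        (use that mod_hom_add[OF bracket_hom_head] in \<open>simp_all add: RA_\<gamma>\<close>)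
    show "RA (c \<odot>\<^bsub>\<gg>\<^esub> a) W = c \<odot>\<^bsub>\<gg>\<^esub> RA a W" if "c \<in> carrier K" "a \<in> carrier \<gg>" for c a
      by (rule P.S_hom_eq[OF g_module RA_hom mod_hom_smultf[OF g_module RA_hom that(1)] _ W])
        (use that mod_hom_smult[OF bracket_hom_head] in \<open>simp_all add: RA_\<gamma>\<close>)
  qed
qed

lemma RA_closed: "a \<in> carrier \<gg> \<Longrightarrow> W \<in> carrier (S alt) \<Longrightarrow> RA a W \<in> carrier \<gg>"
  using bilin_closed[OF RA_bilin] .

lemma RA_hom1: "W \<in> carrier (S alt) \<Longrightarrow> (\<lambda>a. RA a W) \<in> mod_hom K \<gg> \<gg>"
  by (rule bilinD(1)[OF RA_bilin])

text \<open>The first argument lies in the power selected by \<open>alt\<close>, the second in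
  either power. The brackets of \<open>D_alg\<close> and \<open>L_alg\<close> and the action in
  \<open>D_corep\<close> are all instances.\<close>

definition DA :: "bool \<Rightarrow> ('g list \<Rightarrow> 'k) set \<Rightarrow> ('g list \<Rightarrow> 'k) set \<Rightarrow> ('g list \<Rightarrow> 'k) set"
  where "DA alt X W = P.deriv alt (\<lambda>a. RA a W) X"

lemma DA_bilin: "bilin K (S alt) (S alt') (S alt) (DA alt)"
  unfolding DA_def
  by (intro bilinI P.deriv_hom RA_hom1 P.deriv_param[OF P.S_module RA_bilin])

lemma DA_closed: "X \<in> carrier (S alt) \<Longrightarrow> W \<in> carrier (S alt') \<Longrightarrow> DA alt X W \<in> carrier (S alt)"
  using bilin_closed[OF DA_bilin] .

lemma derivation_action_eq:
  assumes X: "X \<in> carrier (S alt)" and W: "W \<in> carrier (S alt')"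
  shows "derivation_action K n \<gg> (S alt) (\<gamma> alt) X W = DA alt X W"
  unfolding derivation_action_def
proof (rule P.S_induced_map_eq[OF P.S_module bilinD(2)[OF DA_bilin X] _ W])
  fix bs assume bs: "bs \<in> tuples \<gg> (n - 1)"
  have "P.deriv alt (\<lambda>a. bracket \<gg> (a # bs)) X = P.deriv alt (\<lambda>a. RA a (\<gamma> alt' bs)) X"
    by (rule P.deriv_cong[OF bracket_hom_head[OF bs] RA_hom1[OF P.\<gamma>_closed[OF bs]] _ X]) (simp add: RA_\<gamma> bs)
  then show "induced_map K (S alt) (\<lambda>as. \<Oplus>\<^bsub>S alt\<^esub>i\<in>{..<n - 1}. \<gamma> alt (as[i := bracket \<gg> (as ! i # bs)])) X = DA alt X (\<gamma> alt' bs)"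
    by (simp add: DA_def P.deriv_def)
qed

text \<open>On generators this is the defining identity of a Leibniz n-algebra: the summand with
  index 0 lets \<open>Y\<close> act on \<open>a\<close>, the others let it act on the entries of
  \<open>X\<close>. Linearity extends it to all \<open>Y\<close> and then to all
  \<open>X\<close>.\<close>

lemma RA_RA:
  assumes a: "a \<in> carrier \<gg>" and X: "X \<in> carrier (S alt)" and Y: "Y \<in> carrier (S alt)"
  shows "RA (RA a X) Y = RA (RA a Y) X \<oplus>\<^bsub>\<gg>\<^esub> RA a (DA alt X Y)"
proof -
  have Xgen: "RA (RA a (\<gamma> alt bs)) (\<gamma> alt cs) = RA (RA a (\<gamma> alt cs)) (\<gamma> alt bs) \<oplus>\<^bsub>\<gg>\<^esub> RA a (DA alt (\<gamma> alt bs) (\<gamma> alt cs))"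
    if bs: "bs \<in> tuples \<gg> (n - 1)" and cs: "cs \<in> tuples \<gg> (n - 1)" for bs cs
  proof -
    let ?t = "\<lambda>i. bracket \<gg> ((a # bs)[i := bracket \<gg> ((a # bs) ! i # cs)])"
    have ab: "a # bs \<in> tuples \<gg> n" by (rule tuples_Cons[OF a bs])
    have tc: "?t i \<in> carrier \<gg>" if "i < n" for i
      by (intro bracket_closed tuples_update[OF ab] tuples_Cons[OF tuples_nth[OF ab that] cs])
    have ac: "bracket \<gg> (a # cs) \<in> carrier \<gg>" by (intro bracket_closed tuples_Cons a cs)
    have gc: "\<gamma> alt cs \<in> carrier (S alt)" by (rule P.\<gamma>_closed[OF cs])
    have "RA (RA a (\<gamma> alt bs)) (\<gamma> alt cs) = bracket \<gg> (bracket \<gg> (a # bs) # cs)"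
      using RA_\<gamma>[OF a bs] RA_\<gamma>[OF bracket_closed[OF ab] cs] by simp
    also have "\<dots> = (\<Oplus>\<^bsub>\<gg>\<^esub>i\<in>{..<n}. ?t i)" by (rule leibniz_identity[OF ab cs])
    \<comment> \<open>Index 0 is the place of \<open>a\<close>; the shifted indices are the n - 1
      places of \<open>bs\<close>.\<close>
    also have "{..<n} = insert 0 (Suc ` {..<n - 1})"
      using lessThan_Suc_eq_insert_0[of "n - 1"] n by simp
    also have "(\<Oplus>\<^bsub>\<gg>\<^esub>i\<in>insert 0 (Suc ` {..<n - 1}). ?t i) = ?t 0 \<oplus>\<^bsub>\<gg>\<^esub> (\<Oplus>\<^bsub>\<gg>\<^esub>i\<in>Suc ` {..<n - 1}. ?t i)"
      
proof (rule M.finsum_insert)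
      show "?t 0 \<in> carrier \<gg>" by (rule tc) (use n in simp)
      show "(\<lambda>i. ?t i) \<in> Suc ` {..<n - 1} \<rightarrow> carrier \<gg>" by (rule Pi_I, rule tc) auto
    qed auto
    also have "(\<Oplus>\<^bsub>\<gg>\<^esub>i\<in>Suc ` {..<n - 1}. ?t i) = (\<Oplus>\<^bsub>\<gg>\<^esub>i\<in>{..<n - 1}. ?t (Suc i))"
      by (rule M.finsum_reindex, rule Pi_I, rule tc) auto
    also have "?t 0 = RA (RA a (\<gamma> alt cs)) (\<gamma> alt bs)"
      using RA_\<gamma>[OF a cs] RA_\<gamma>[OF ac bs] by simp
    also have "(\<Oplus>\<^bsub>\<gg>\<^esub>i\<in>{..<n - 1}. ?t (Suc i)) = RA a (DA alt (\<gamma> alt bs) (\<gamma> alt cs))"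
    proof -
      let ?u = "\<lambda>i. \<gamma> alt (bs[i := RA (bs ! i) (\<gamma> alt cs)])"
      have uc: "?u i \<in> carrier (S alt)" if "i < n - 1" for i
        by (rule P.deriv_term_closed[OF RA_hom1[OF gc] bs that])
      have "RA a (DA alt (\<gamma> alt bs) (\<gamma> alt cs)) = RA a (\<Oplus>\<^bsub>S alt\<^esub>i\<in>{..<n - 1}. ?u i)"
        unfolding DA_def P.deriv_\<gamma>[OF RA_hom1[OF gc] bs] ..
      also have "\<dots> = (\<Oplus>\<^bsub>\<gg>\<^esub>i\<in>{..<n - 1}. RA a (?u i))"
        by (rule mod_hom_finsum[OF P.S_module g_module RA_hom[OF a]]) (use uc in auto)
      also have "\<dots> = (\<Oplus>\<^bsub>\<gg>\<^esub>i\<in>{..<n - 1}. ?t (Suc i))"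
      proof (rule M.finsum_cong')
        show "(\<lambda>i. ?t (Suc i)) \<in> {..<n - 1} \<rightarrow> carrier \<gg>" by (rule Pi_I, rule tc) auto
        fix i assume "i \<in> {..<n - 1}"
        then have i: "i < n - 1" by simp
        have bi: "bs ! i \<in> carrier \<gg>" by (rule tuples_nth[OF bs i])
        have "bs[i := bracket \<gg> (bs ! i # cs)] \<in> tuples \<gg> (n - 1)"
          by (intro tuples_update bs bracket_closed tuples_Cons bi cs)
        then show "RA a (?u i) = ?t (Suc i)" using RA_\<gamma>[OF a] RA_\<gamma>[OF bi cs] by simp
      qed simp
      finally show ?thesis by simp
    qed
    finally show ?thesis .
  qed
  have h1: "(\<lambda>X. RA (RA a X) Y) \<in> mod_hom K (S alt) \<gg>" if "Y \<in> carrier (S alt)" for Y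
    by (rule mod_hom_comp[OF RA_hom1[OF that] RA_hom[OF a]])
  have h2: "(\<lambda>Y. RA (RA a X) Y) \<in> mod_hom K (S alt) \<gg>" if "X \<in> carrier (S alt)" for X
    by (rule RA_hom[OF RA_closed[OF a that]])
  have h3: "(\<lambda>X. RA a (DA alt X Y)) \<in> mod_hom K (S alt) \<gg>" if "Y \<in> carrier (S alt)" for Y
    by (rule mod_hom_comp[OF RA_hom[OF a] bilinD(1)[OF DA_bilin that]])
  have h4: "(\<lambda>Y. RA a (DA alt X Y)) \<in> mod_hom K (S alt) \<gg>" if "X \<in> carrier (S alt)" for X
    by (rule mod_hom_comp[OF RA_hom[OF a] bilinD(2)[OF DA_bilin that]])
  show ?thesis
  proof (rule P.S_hom_eq[OF g_module h1[OF Y] mod_hom_addf[OF g_module h2[OF Y] h3[OF Y]] _ X])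
    fix bs assume bs: "bs \<in> tuples \<gg> (n - 1)"
    note gb = P.\<gamma>_closed[OF bs, of alt]
    show "RA (RA a (\<gamma> alt bs)) Y = RA (RA a Y) (\<gamma> alt bs) \<oplus>\<^bsub>\<gg>\<^esub> RA a (DA alt (\<gamma> alt bs) Y)"
      by (rule P.S_hom_eq[OF g_module h2[OF gb] mod_hom_addf[OF g_module h1[OF gb] h4[OF gb]] Xgen[OF bs] Y])
  qed
qed

text \<open>\<open>RA_RA\<close> is the commutation hypothesis of \<open>deriv_commutator\<close>
  for a single entry. With \<open>alt = alt'\<close> the result is the Leibniz identity.\<close>

lemma DA_DA:
  assumes X: "X \<in> carrier (S alt)" and Y: "Y \<in> carrier (S alt')" and Z: "Z \<in> carrier (S alt')"
  shows "DA alt (DA alt X Y) Z = DA alt (DA alt X Z) Y \<oplus>\<^bsub>S alt\<^esub> DA alt X (DA alt' Y Z)"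
  unfolding DA_def[of alt]
  by (rule P.deriv_commutator[OF RA_hom1[OF Y] RA_hom1[OF Z] RA_hom1[OF DA_closed[OF Y Z]] RA_RA[OF _ Y Z] X])

abbreviation "D \<equiv> D_alg K n \<gg>"
abbreviation "L \<equiv> L_alg K n \<gg>"
abbreviation "gc \<equiv> g_corep K \<gg>"
abbreviation "Dc \<equiv> D_corep K n \<gg>"
abbreviation "\<pi> \<equiv> D_to_L K n \<gg>"

lemma D_simps [simp]:
  "carrier D = carrier (S False)" "add D = add (S False)" "zero D = zero (S False)" "smult D = smult (S False)"
  "mod_hom K D N = mod_hom K (S False) N" "mod_hom K N' D = mod_hom K N' (S False)"
  by (simp_all add: D_alg_def Let_def tensor_power_eq)

lemma L_simps [simp]:
  "carrier L = carrier (S True)" "add L = add (S True)" "zero L = zero (S True)" "smult L = smult (S True)"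
  "mod_hom K L N = mod_hom K (S True) N" "mod_hom K N' L = mod_hom K N' (S True)"
  by (simp_all add: L_alg_def Let_def ext_power_eq)

lemma gc_simps [simp]:
  "carrier gc = carrier \<gg>" "add gc = add \<gg>" "zero gc = zero \<gg>" "smult gc = smult \<gg>"
  "mod_hom K gc N = mod_hom K \<gg> N" "mod_hom K N' gc = mod_hom K N' \<gg>"
  "lact gc = (\<lambda>Y x. \<ominus>\<^bsub>\<gg>\<^esub> RA x Y)" "\<ominus>\<^bsub>gc\<^esub> x = \<ominus>\<^bsub>\<gg>\<^esub> x"
  by (simp_all add: g_corep_def Let_def RA_def)

lemma Dc_simps [simp]:
  "carrier Dc = carrier (S False)" "add Dc = add (S False)" "zero Dc = zero (S False)" "smult Dc = smult (S False)"
  "mod_hom K Dc N = mod_hom K (S False) N" "mod_hom K N' Dc = mod_hom K N' (S False)"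
  "\<ominus>\<^bsub>Dc\<^esub> X = \<ominus>\<^bsub>S False\<^esub> X"
  by (simp_all add: D_corep_def Let_def tensor_power_eq)

lemma D_module: "module K D" and L_module: "module K L" and gc_module: "module K gc" and Dc_module: "module K Dc"
  using module_with(1)[OF P.S_module] module_with(2)[OF P.S_module] module_with(2)[OF g_module]
  by (simp_all add: D_alg_def L_alg_def g_corep_def D_corep_def Let_def tensor_power_eq ext_power_eq)

lemma bracket_D: "X \<in> carrier (S False) \<Longrightarrow> Y \<in> carrier (S False) \<Longrightarrow> bracket D [X, Y] = DA False X Y"
  using derivation_action_eq[of X False Y False] by (simp add: D_alg_def Let_def tensor_power_eq)

lemma bracket_L: "X \<in> carrier (S True) \<Longrightarrow> Y \<in> carrier (S True) \<Longrightarrow> bracket L [X, Y] = DA True X Y"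
  using derivation_action_eq[of X True Y True] by (simp add: L_alg_def Let_def ext_power_eq)

lemma lact_Dc: "X \<in> carrier (S False) \<Longrightarrow> Y \<in> carrier (S True) \<Longrightarrow> lact Dc Y X = \<ominus>\<^bsub>S False\<^esub> DA False X Y"
  using derivation_action_eq[of X False Y True] by (simp add: D_corep_def Let_def tensor_power_eq)

lemma \<pi>_hom: "\<pi> \<in> mod_hom K (S False) (S True)"
  and \<pi>_\<gamma>: "xs \<in> tuples \<gg> (n - 1) \<Longrightarrow> \<pi> (\<gamma> False xs) = \<gamma> True xs"
proof -
  have m: "multilinear K \<gg> (n - 1) L (\<gamma> True)"
    using P.\<gamma>_multilinear[of True] by (simp add: multilinear_def)
  note l = P.S_lift[where alt = False, OF L_module m]
  show "\<pi> \<in> mod_hom K (S False) (S True)" using l(1) by (simp add: D_to_L_def ext_power_eq)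
  show "\<pi> (\<gamma> False xs) = \<gamma> True xs" if "xs \<in> tuples \<gg> (n - 1)"
    using l(2) that by (simp add: D_to_L_def ext_power_eq)
qed

lemma \<pi>_closed [simp]: "X \<in> carrier (S False) \<Longrightarrow> \<pi> X \<in> carrier (S True)"
  by (rule mod_hom_closed[OF \<pi>_hom])

text \<open>Both spaces are quotients of the same free module, and \<open>\<pi>\<close> sends the
  coset of an element to the coset of the same element, since it does so on generators.\<close>

lemma \<pi>_surj: "\<pi> ` carrier (S False) = carrier (S True)"
proof
  show "\<pi> ` carrier (S False) \<subseteq> carrier (S True)" by auto
  show "carrier (S True) \<subseteq> \<pi> ` carrier (S False)"
  proof
    let ?F = "free_module K (tuples \<gg> (n - 1))"
    let ?q = "\<lambda>alt f. mod_span K ?F (power_rels K \<gg> (n - 1) alt) +>\<^bsub>?F\<^esub> f"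
    have q: "?q alt \<in> mod_hom K ?F (S alt)" for alt
      unfolding power_space_def by (rule coset_presented_hom[OF K.field_axioms P.rels_closed])
    fix Y assume "Y \<in> carrier (S True)"
    then obtain c where c: "c \<in> carrier ?F" "Y = ?q True c"
      unfolding power_space_def presented_def by (rule quot_module_cases)
    have "\<pi> (?q False c) = lin_ext K (S True) (\<lambda>x. \<pi> (?q False (gen K x))) c"
      by (rule free_module_hom_eq[OF P.S_module mod_hom_comp[OF \<pi>_hom q] c(1)])
    also have "\<dots> = lin_ext K (S True) (\<lambda>x. ?q True (gen K x)) c"
    proof (rule lin_ext_cong[OF P.S_module _ _ c(1)])
      fix x assume x: "x \<in> tuples \<gg> (n - 1)"
      show "\<pi> (?q False (gen K x)) = ?q True (gen K x)"
        using \<pi>_\<gamma>[OF x] by (simp add: power_gen_def gen_class_def)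
      show "?q True (gen K x) \<in> carrier (S True)"
        by (rule mod_hom_closed[OF q gen_closed[OF R.is_cring x]])
    qed
    also have "\<dots> = ?q True c" by (rule free_module_hom_eq[OF P.S_module q c(1), symmetric])
    finally show "Y \<in> \<pi> ` carrier (S False)" using c mod_hom_closed[OF q c(1)] by (metis imageI)
  qed
qed

text \<open>On generators both sides are the same bracket. Hence the kernel of \<open>\<pi>\<close>
  acts trivially from the right, as the filtration requires.\<close>

lemma RA_\<pi>: "a \<in> carrier \<gg> \<Longrightarrow> X \<in> carrier (S False) \<Longrightarrow> RA a (\<pi> X) = RA a X"
  by (rule P.S_hom_eq[OF g_module mod_hom_comp[OF RA_hom \<pi>_hom] RA_hom]) (simp_all add: \<pi>_\<gamma> RA_\<gamma>)

lemma DA_\<pi>: "X \<in> carrier (S alt) \<Longrightarrow> Y \<in> carrier (S False) \<Longrightarrow> DA alt X (\<pi> Y) = DA alt X Y"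
  unfolding DA_def by (rule P.deriv_cong[OF RA_hom1[OF \<pi>_closed] RA_hom1]) (simp_all add: RA_\<pi>)

lemma \<pi>_deriv:
  assumes E: "E \<in> mod_hom K \<gg> \<gg>" and X: "X \<in> carrier (S False)"
  shows "\<pi> (P.deriv False E X) = P.deriv True E (\<pi> X)"
proof (rule P.S_hom_eq[OF P.S_module mod_hom_comp[OF \<pi>_hom P.deriv_hom[OF E]] mod_hom_comp[OF P.deriv_hom[OF E] \<pi>_hom] _ X])
  fix xs assume xs: "xs \<in> tuples \<gg> (n - 1)"
  have t: "xs[i := E (xs ! i)] \<in> tuples \<gg> (n - 1)" if "i < n - 1" for i
    using that xs by (intro tuples_update mod_hom_closed[OF E] tuples_nth)
  have "\<pi> (P.deriv False E (\<gamma> False xs)) = (\<Oplus>\<^bsub>S True\<^esub>i\<in>{..<n - 1}. \<pi> (\<gamma> False (xs[i := E (xs ! i)])))"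
    unfolding P.deriv_\<gamma>[OF E xs]
    by (rule mod_hom_finsum[OF P.S_module P.S_module \<pi>_hom]) (use P.deriv_term_closed[OF E xs] in auto)
  also have "\<dots> = P.deriv True E (\<gamma> True xs)"
    unfolding P.deriv_\<gamma>[OF E xs] using t \<pi>_\<gamma>[OF t] P.deriv_term_closed[OF E xs, of _ True]
    by (intro M.finsum_cong' P.S.finsum_cong') auto
  finally show "\<pi> (P.deriv False E (\<gamma> False xs)) = P.deriv True E (\<pi> (\<gamma> False xs))" using \<pi>_\<gamma>[OF xs] by simp
qed

lemma \<pi>_DA: "X \<in> carrier (S False) \<Longrightarrow> Y \<in> carrier (S False) \<Longrightarrow> \<pi> (DA False X Y) = DA True (\<pi> X) (\<pi> Y)"
  using DA_\<pi>[of "\<pi> X" True Y] by (simp add: DA_def \<pi>_deriv[OF RA_hom1])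

lemma bracket_D_bilin: "bilin K D D D (\<lambda>x y. bracket D [x, y])"
  by (rule bilin_cong[OF D_module D_module, where \<beta> = "DA False"])
    (use DA_bilin[of False False] in \<open>auto simp: bracket_D bilin_def\<close>)

lemma bracket_L_bilin: "bilin K L L L (\<lambda>x y. bracket L [x, y])"
  by (rule bilin_cong[OF L_module L_module, where \<beta> = "DA True"])
    (use DA_bilin[of True True] in \<open>auto simp: bracket_L bilin_def\<close>)

lemma lact_gc_bilin: "bilin K D gc gc (lact gc)"
  unfolding gc_simps
  using bilinD[OF RA_bilin[of False]] by (intro bilinI) (simp_all add: mod_hom_negf[OF g_module])

lemma lact_Dc_bilin: "bilin K L Dc Dc (lact Dc)"
proof (rule bilin_cong[OF L_module Dc_module, where \<beta> = "\<lambda>Y X. \<ominus>\<^bsub>S False\<^esub> DA False X Y"])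
  show "bilin K L Dc Dc (\<lambda>Y X. \<ominus>\<^bsub>S False\<^esub> DA False X Y)"
    using bilinD[OF DA_bilin[of False True]] by (intro bilinI) (simp_all add: mod_hom_negf[OF P.S_module])
qed (simp add: lact_Dc)

lemma coefficients_D_gc: "coefficients K D gc"
  by (intro coefficients.intro mixed.intro coefficients_axioms.intro K.field_axioms D_module gc_module bracket_D_bilin lact_gc_bilin)

lemma coefficients_L_Dc: "coefficients K L Dc"
  by (intro coefficients.intro mixed.intro coefficients_axioms.intro K.field_axioms L_module Dc_module bracket_L_bilin lact_Dc_bilin)

end

section \<open>A linear section of the projection and the complexes of head and tail\<close>

context filippov
begin

lemma \<sigma>_exists: "\<exists>s. s \<in> mod_hom K (S True) (S False) \<and> (\<forall>Y\<in>carrier (S True). \<pi> (s Y) = Y)"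
  by (rule surjection_section[OF K.field_axioms P.S_module P.S_module \<pi>_hom \<pi>_surj]) blast

definition \<sigma> where "\<sigma> = (SOME s. s \<in> mod_hom K (S True) (S False) \<and> (\<forall>Y\<in>carrier (S True). \<pi> (s Y) = Y))"

lemma \<sigma>_hom: "\<sigma> \<in> mod_hom K (S True) (S False)" and \<pi>_\<sigma> [simp]: "Y \<in> carrier (S True) \<Longrightarrow> \<pi> (\<sigma> Y) = Y"
  using someI_ex[OF \<sigma>_exists] unfolding \<sigma>_def by auto

lemma \<sigma>_closed [simp]: "Y \<in> carrier (S True) \<Longrightarrow> \<sigma> Y \<in> carrier (S False)"
  by (rule mod_hom_closed[OF \<sigma>_hom])

abbreviation "e X \<equiv> \<sigma> (\<pi> X)"

end

text \<open>All conditions on the idempotent come from \<open>\<pi>\<close>: right actions depend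
  only on the projection, and \<open>\<pi>\<close> respects brackets. Of \<open>\<sigma>\<close>
  only linearity and the section property enter.\<close>

sublocale filippov \<subseteq> C: adjoint_complex K D gc "\<lambda>X. \<sigma> (\<pi> X)"
proof -
  interpret c: coefficients K D gc by (rule coefficients_D_gc)
  have ra: "c.ra v X = RA v X" if "v \<in> carrier \<gg>" "X \<in> carrier (S False)" for v X
    using that by (simp add: c.ra_def RA_closed)
  have e: "(\<lambda>X. \<sigma> (\<pi> X)) \<in> mod_hom K (S False) (S False)" by (rule mod_hom_comp[OF \<sigma>_hom \<pi>_hom])
  show "adjoint_complex K D gc (\<lambda>X. \<sigma> (\<pi> X))"
  proof (intro adjoint_complex.intro leibniz_ideal_complex.intro leibniz_complex.intro coefficients_D_gc
      leibniz_complex_axioms.intro leibniz_ideal_complex_axioms.intro)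
    fix x y z assume "x \<in> carrier D" "y \<in> carrier D" "z \<in> carrier D"
    then show "bracket D [bracket D [x, y], z] = bracket D [bracket D [x, z], y] \<oplus>\<^bsub>D\<^esub> bracket D [x, bracket D [y, z]]"
      using DA_DA[of x False y False z] by (simp add: bracket_D DA_closed[where alt' = False])
  next
    fix v x y assume "v \<in> carrier gc" "x \<in> carrier D" "y \<in> carrier D"
    then show "c.ra (c.ra v x) y = c.ra (c.ra v y) x \<oplus>\<^bsub>gc\<^esub> c.ra v (bracket D [x, y])"
      using RA_RA[of v x False y] by (simp add: ra bracket_D RA_closed DA_closed[where alt' = False])
  next
    show "(\<lambda>X. \<sigma> (\<pi> X)) \<in> mod_hom K D D" using e by simp
  next
    fix x assume "x \<in> carrier D"
    then show "\<sigma> (\<pi> (\<sigma> (\<pi> x))) = \<sigma> (\<pi> x)" by simp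
  next
    fix x y assume "x \<in> carrier D" "y \<in> carrier D"
    then show "bracket D [x, \<sigma> (\<pi> y)] = bracket D [x, y]"
      using DA_\<pi>[of x False "\<sigma> (\<pi> y)"] DA_\<pi>[of x False y] by (simp add: bracket_D)
    show "\<sigma> (\<pi> (bracket D [\<sigma> (\<pi> x), y])) = \<sigma> (\<pi> (bracket D [x, y]))"
      using \<open>x \<in> carrier D\<close> \<open>y \<in> carrier D\<close> by (simp add: bracket_D \<pi>_DA)
  next
    fix v x assume "v \<in> carrier gc" "x \<in> carrier D"
    then show "c.ra v (\<sigma> (\<pi> x)) = c.ra v x"
      using RA_\<pi>[of v "\<sigma> (\<pi> x)"] RA_\<pi>[of v x] by (simp add: ra)
  qed
qed

context filippov
begin

sublocale R: coefficients K L Dc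
  by (rule coefficients_L_Dc)

sublocale al: coefficient_map K D "adj D" L Dc "\<lambda>X. X" \<pi>
proof (intro coefficient_map.intro coefficient_map_axioms.intro C.W.coefficients_axioms coefficients_L_Dc)
  show "(\<lambda>X. X) \<in> mod_hom K (adj D) Dc" using mod_hom_id by simp
  show "\<pi> \<in> mod_hom K D L" using \<pi>_hom by simp
  show "\<pi> (bracket D [x, y]) = bracket L [\<pi> x, \<pi> y]" if "x \<in> carrier D" "y \<in> carrier D" for x y
    using that by (simp add: bracket_D bracket_L \<pi>_DA)
  show "C.W.ra v h = R.ra v (\<pi> h)" if "v \<in> carrier (adj D)" "h \<in> carrier D" for v h
    using that DA_\<pi>[of v False h] by (simp add: bracket_D R.ra_def lact_Dc DA_closed)
qed

text \<open>Merely a map of tensor products: \<open>\<sigma>\<close> is not known to respect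
  brackets, so the map it induces is not claimed to be a chain map. A boundary taken after it is
  therefore compared only up to \<open>W.P\<close>, in \<open>P_dd_\<beta>\<close>.\<close>

sublocale be: mixed_map K L Dc D "adj D" "\<lambda>X. X" \<sigma>
  by unfold_locales (use mod_hom_id \<sigma>_hom in simp_all)

abbreviation "\<alpha> \<equiv> tmap K Dc L (\<lambda>X. X) \<pi>"
abbreviation "\<beta> \<equiv> tmap K (adj D) D (\<lambda>X. X) \<sigma>"

lemma \<alpha>_\<beta> [simp]: "r \<in> carrier (R.T p) \<Longrightarrow> \<alpha> p (\<beta> p r) = r"
proof -
  assume r: "r \<in> carrier (R.T p)"
  interpret i: mixed_map K L Dc L Dc "\<lambda>X. X" "\<lambda>X. X" by unfold_locales (rule mod_hom_id)+
  show ?thesis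
    using tmap_comp[OF be.mixed_map_axioms al.mixed_map_axioms r] i.tmap_cong[of "\<lambda>X. X" "\<lambda>X. \<pi> (\<sigma> X)" r p]
      R.tmap_id[OF r] r by simp
qed

lemma \<beta>_\<alpha>: "w \<in> carrier (C.W.T p) \<Longrightarrow> \<beta> p (\<alpha> p w) = C.W.P p p w"
  using tmap_comp[OF al.mixed_map_axioms be.mixed_map_axioms, of w p] C.W.P_full_tmap[of w p] by simp

lemma \<beta>_closed [simp]: "r \<in> carrier (R.T p) \<Longrightarrow> \<beta> p r \<in> carrier (C.W.T p)"
  by (rule be.tmap_closed)

lemma P_\<beta>: "r \<in> carrier (R.T p) \<Longrightarrow> C.W.P p p (\<beta> p r) = \<beta> p r"
  by (simp flip: \<beta>_\<alpha>)

lemma \<alpha>_P: "w \<in> carrier (C.W.T p) \<Longrightarrow> \<alpha> p (C.W.P p p w) = \<alpha> p w"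
  by (simp flip: \<beta>_\<alpha>)

subsection \<open>The kernels of the projections\<close>

sublocale PL: power K L "p + 1" False for p
  by (intro power.intro K.field_axioms L_module)

abbreviation "TL p \<equiv> power_space K L (p + 1) False"

lemma pi2_hom: "pi2 K n \<gg> p \<in> mod_hom K (R.T p) (TL p)"
  and pi2_t: "X \<in> carrier (S False) \<Longrightarrow> hs \<in> tuples L p \<Longrightarrow> pi2 K n \<gg> p (R.t p (X, hs)) = power_gen K L (p + 1) False (\<pi> X # hs)"
proof -
  let ?g = "power_gen K L (p + 1) False"
  let ?\<phi> = "\<lambda>(X, hs). ?g (\<pi> X # hs)"
  have c: "\<pi> X # hs \<in> tuples L (p + 1)" if "X \<in> carrier (S False)" "hs \<in> tuples L p" for X hs
    using that by (auto simp: tuples_def)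
  have 1: "?\<phi> (X, hs) \<in> carrier (TL p)" if "X \<in> carrier Dc" "hs \<in> tuples L p" for X hs
    using PL.\<gamma>_closed[OF c] that by simp
  have 2: "(\<lambda>X. ?\<phi> (X, hs)) \<in> mod_hom K Dc (TL p)" if "hs \<in> tuples L p" for hs
  proof -
    have z: "\<zero>\<^bsub>S False\<^esub> \<in> carrier (S False)" by simp
    have "(\<lambda>Y. ?g ((\<pi> \<zero>\<^bsub>S False\<^esub> # hs)[0 := Y])) \<in> mod_hom K L (TL p)" by (rule PL.\<gamma>_hom[OF c[OF z that]]) simp
    then have "(\<lambda>Y. ?g (Y # hs)) \<in> mod_hom K (S True) (TL p)" by simp
    from mod_hom_comp[OF this \<pi>_hom] show ?thesis by simp
  qed
  have 3: "(\<lambda>h. ?\<phi> (X, hs[i := h])) \<in> mod_hom K L (TL p)" if "X \<in> carrier Dc" "hs \<in> tuples L p" "i < p" for X hs i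
    using PL.\<gamma>_hom[where i = "Suc i", OF c[OF _ that(2), of X]] that by simp
  show "pi2 K n \<gg> p \<in> mod_hom K (R.T p) (TL p)"
    unfolding pi2_def tensor_power_eq by (rule R.T_induced_map(1)[where \<phi> = ?\<phi>, OF PL.S_module 1 2 3])
  show "pi2 K n \<gg> p (R.t p (X, hs)) = ?g (\<pi> X # hs)" if "X \<in> carrier (S False)" "hs \<in> tuples L p"
    using R.T_induced_map(2)[where \<phi> = ?\<phi> and k = p and v = X and hs = hs, OF PL.S_module] 1 2 3 that
    by (simp add: pi2_def tensor_power_eq)
qed

text \<open>Each of the two maps determines the other: a lift by \<open>\<sigma>\<close> turns
  \<open>pi2\<close> after \<open>\<alpha>\<close> into \<open>Pf\<close>, and applying
  \<open>Pf\<close> first does not change \<open>pi2\<close> after \<open>\<alpha>\<close>. So their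
  kernels coincide.\<close>

lemma pi2_\<alpha>_zero_iff:
  assumes w: "w \<in> carrier (C.W.T p)"
  shows "pi2 K n \<gg> p (\<alpha> p w) = \<zero>\<^bsub>TL p\<^esub> \<longleftrightarrow> C.Pf p w = \<zero>\<^bsub>C.W.T p\<^esub>"
proof -
  let ?g = "power_gen K L (p + 1) False"
  let ?\<phi> = "\<lambda>ls. C.W.t p (\<sigma> (hd ls), map \<sigma> (tl ls))"
  have hd: "hd ls \<in> carrier L" and tl: "tl ls \<in> tuples L p" if "ls \<in> tuples L (p + 1)" for ls
    using that by (cases ls; auto simp: tuples_def)+
  have ms: "map \<sigma> hs \<in> tuples D p" if "hs \<in> tuples L p" for hs
    using that by (rule tuples_map) simp
  have ml: "multilinear K L (p + 1) (C.W.T p) ?\<phi>"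
    unfolding multilinear_def
  proof (intro conjI ballI allI impI)
    show "?\<phi> ls \<in> carrier (C.W.T p)" if "ls \<in> tuples L (p + 1)" for ls
      using hd[OF that] ms[OF tl[OF that]] by (intro C.W.t_closed) simp_all
    fix ls i assume ls: "ls \<in> tuples L (p + 1)" and i: "i < p + 1"
    have ne: "ls \<noteq> []" using ls by (auto simp: tuples_def)
    show "(\<lambda>a. ?\<phi> (ls[i := a])) \<in> mod_hom K L (C.W.T p)"
    proof (cases i)
      case 0
      have "(\<lambda>v. C.W.t p (v, map \<sigma> (tl ls))) \<in> mod_hom K (S False) (C.W.T p)"
        using C.W.t_linear_coeff[OF ms[OF tl[OF ls]]] by simp
      from mod_hom_comp[OF this \<sigma>_hom] show ?thesis using 0 ne by (cases ls) auto
    next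
      case (Suc j)
      have "(\<lambda>h. C.W.t p (\<sigma> (hd ls), (map \<sigma> (tl ls))[j := h])) \<in> mod_hom K (S False) (C.W.T p)"
        using C.W.t_linear_nth[OF _ ms[OF tl[OF ls]], of "\<sigma> (hd ls)" j] hd[OF ls] i Suc by simp
      from mod_hom_comp[OF this \<sigma>_hom] show ?thesis using Suc ne by (cases ls) (auto simp: map_update)
    qed
  qed
  let ?f = "induced_map K (C.W.T p) ?\<phi>"
  have f: "?f \<in> mod_hom K (TL p) (C.W.T p)" by (rule PL.S_lift(1)[OF C.W.T_module ml]) simp
  have fg: "?f (?g ls) = ?\<phi> ls" if "ls \<in> tuples L (p + 1)" for ls by (rule PL.S_lift(2)[OF C.W.T_module ml _ that]) simp
  note pa = mod_hom_comp[OF pi2_hom al.tmap_hom]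
  have c: "\<pi> X # map \<pi> hs \<in> tuples L (p + 1)" if "X \<in> carrier (S False)" "hs \<in> tuples D p" for X hs
    using that by (auto simp: tuples_def)
  have mp: "map \<pi> hs \<in> tuples L p" if "hs \<in> tuples D p" for hs using that by (rule tuples_map) simp
  have me: "map (\<lambda>X. \<sigma> (\<pi> X)) hs \<in> tuples D p" if "hs \<in> tuples D p" for hs using that by (rule tuples_map) simp
  have t1: "pi2 K n \<gg> p (\<alpha> p (C.W.t p (X, hs))) = ?g (\<pi> X # map \<pi> hs)" if "X \<in> carrier (S False)" "hs \<in> tuples D p" for X hs
    using that mp[OF that(2)] by (simp add: al.tmap_t pi2_t)
  have t2: "C.Pf p (C.W.t p (X, hs)) = C.W.t p (\<sigma> (\<pi> X), map (\<lambda>X. \<sigma> (\<pi> X)) hs)"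
    if "X \<in> carrier (S False)" "hs \<in> tuples D p" for X hs
    using that C.Pf.tmap_t[of X hs p] by (simp add: C.Pf_def)
  have A: "?f (pi2 K n \<gg> p (\<alpha> p w)) = C.Pf p w"
  proof (rule C.W.T_hom_eq[OF C.W.T_module mod_hom_comp[OF f pa] C.Pf_hom _ w])
    fix X hs assume "X \<in> carrier (adj D)" "hs \<in> tuples D p"
    then show "?f (pi2 K n \<gg> p (\<alpha> p (C.W.t p (X, hs)))) = C.Pf p (C.W.t p (X, hs))"
      using c by (simp add: t1 t2 fg comp_def)
  qed
  have B: "pi2 K n \<gg> p (\<alpha> p (C.Pf p w)) = pi2 K n \<gg> p (\<alpha> p w)"
  proof (rule C.W.T_hom_eq[OF PL.S_module mod_hom_comp[OF pa C.Pf_hom] pa _ w])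
    fix X hs assume X: "X \<in> carrier (adj D)" and hs: "hs \<in> tuples D p"
    have "map \<pi> (map (\<lambda>X. \<sigma> (\<pi> X)) hs) = map \<pi> hs" using hs by (auto simp: tuples_def)
    then show "pi2 K n \<gg> p (\<alpha> p (C.Pf p (C.W.t p (X, hs)))) = pi2 K n \<gg> p (\<alpha> p (C.W.t p (X, hs)))"
      using X hs me[OF hs] by (simp add: t1 t2 del: map_map)
  qed
  show ?thesis
  proof
    assume "pi2 K n \<gg> p (\<alpha> p w) = \<zero>\<^bsub>TL p\<^esub>"
    then show "C.Pf p w = \<zero>\<^bsub>C.W.T p\<^esub>" using A mod_hom_zero[OF PL.S_module C.W.T_module f] by simp
  next
    assume "C.Pf p w = \<zero>\<^bsub>C.W.T p\<^esub>"
    then show "pi2 K n \<gg> p (\<alpha> p w) = \<zero>\<^bsub>TL p\<^esub>" using B mod_hom_zero[OF C.W.T_module PL.S_module pa] by simp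
  qed
qed

text \<open>The projection and \<open>P m m\<close> determine each other through the map induced by
  \<open>\<sigma>\<close>. This translates the relative complex into the operators of the
  filtration.\<close>

lemma proj_gD_zero_iff:
  assumes x: "x \<in> carrier (C.T m)"
  shows "proj_gD K n \<gg> m x = \<zero>\<^bsub>mixed_tensor K \<gg> L m\<^esub> \<longleftrightarrow> C.P m m x = \<zero>\<^bsub>C.T m\<^esub>"
proof -
  interpret gL: mixed K L \<gg> by (intro mixed.intro K.field_axioms L_module g_module)
  interpret a: mixed_map K D gc L \<gg> "\<lambda>X. X" \<pi> by unfold_locales (use mod_hom_id \<pi>_hom in simp_all)
  interpret b: mixed_map K L \<gg> D gc "\<lambda>X. X" \<sigma> by unfold_locales (use mod_hom_id \<sigma>_hom in simp_all)
  interpret c: mixed_map K D gc D gc "\<lambda>X. X" "\<lambda>X. \<sigma> (\<pi> X)" by unfold_locales (use mod_hom_id C.e_hom in simp_all)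
  have p: "proj_gD K n \<gg> m = tmap K \<gg> L (\<lambda>X. X) \<pi> m" by (simp add: proj_gD_def tmap_def)
  have A: "tmap K gc D (\<lambda>X. X) \<sigma> m (tmap K \<gg> L (\<lambda>X. X) \<pi> m x) = C.P m m x"
    using tmap_comp[OF a.mixed_map_axioms b.mixed_map_axioms x] C.P_full_tmap[OF x] by simp
  have B: "tmap K \<gg> L (\<lambda>X. X) \<pi> m (C.P m m x) = tmap K \<gg> L (\<lambda>X. X) \<pi> m x"
    using tmap_comp[OF c.mixed_map_axioms a.mixed_map_axioms x] C.P_full_tmap[OF x]
      a.tmap_cong[of "\<lambda>X. X" "\<lambda>X. \<pi> (\<sigma> (\<pi> X))" x m] x by simp
  show ?thesis unfolding p
    using A B mod_hom_zero[OF gL.T_module C.T_module b.tmap_hom] mod_hom_zero[OF C.T_module gL.T_module a.tmap_hom] by metis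
qed

end

context filippov
begin

section \<open>The complex of the tails\<close>

lemma DR_eq: "DR K n \<gg> p = (R.T p)\<lparr>carrier := {r \<in> carrier (R.T p). pi2 K n \<gg> p r = \<zero>\<^bsub>TL p\<^esub>}\<rparr>"
  by (simp add: DR_def Let_def tensor_power_eq)

lemma DR_simps [simp]: "add (DR K n \<gg> p) = add (R.T p)" "zero (DR K n \<gg> p) = zero (R.T p)" "smult (DR K n \<gg> p) = smult (R.T p)"
  by (simp_all add: DR_eq)

lemma DR_submodule: "submodule (carrier (DR K n \<gg> p)) K (R.T p)"
  using kernel_submodule[OF R.T_module PL.S_module pi2_hom] by (simp add: DR_eq)

lemma DR_module: "module K (DR K n \<gg> p)"
  using submodule.submodule_is_module[OF DR_submodule R.T_module] by (simp add: DR_eq)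

lemma DR_carrier: "r \<in> carrier (DR K n \<gg> p) \<Longrightarrow> r \<in> carrier (R.T p)"
  by (simp add: DR_eq)

lemma \<alpha>_DR_iff: "w \<in> carrier (C.W.T p) \<Longrightarrow> \<alpha> p w \<in> carrier (DR K n \<gg> p) \<longleftrightarrow> C.Pf p w = \<zero>\<^bsub>C.W.T p\<^esub>"
  by (simp add: DR_eq pi2_\<alpha>_zero_iff)

lemma Pf_\<beta>: "r \<in> carrier (DR K n \<gg> p) \<Longrightarrow> C.Pf p (\<beta> p r) = \<zero>\<^bsub>C.W.T p\<^esub>"
  using \<alpha>_DR_iff[of "\<beta> p r" p] by (simp add: DR_carrier)

lemma \<alpha>_dd: "w \<in> carrier (C.W.T p) \<Longrightarrow> \<alpha> (p - 1) (C.W.dd p w) = R.dd p (\<alpha> p w)"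
  using mod_hom_zero[OF C.W.T_module R.T_module al.tmap_hom] by (cases p) (simp_all add: al.tmap_dd C.W.dd.simps(1) R.dd.simps(1))

lemma Pf_dd_zero: "w \<in> carrier (C.W.T p) \<Longrightarrow> C.Pf p w = \<zero>\<^bsub>C.W.T p\<^esub> \<Longrightarrow> C.Pf (p - 1) (C.W.dd p w) = \<zero>\<^bsub>C.W.T (p - 1)\<^esub>"
  by (cases p) (simp_all add: C.Pf_dd_zero C.W.dd.simps(1) C.Pf_zero)

lemma Wdd_closed: "w \<in> carrier (C.W.T p) \<Longrightarrow> C.W.dd p w \<in> carrier (C.W.T (p - 1))"
  by (rule mod_hom_closed[OF C.W.dd_hom])

text \<open>Seen through \<open>\<alpha>\<close>, membership in \<open>DR\<close> is the kernel
  condition for \<open>Pf\<close>, and the kernels of \<open>Pf\<close> are stable under the tail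
  boundary.\<close>

lemma dd_DR: "r \<in> carrier (DR K n \<gg> p) \<Longrightarrow> R.dd p r \<in> carrier (DR K n \<gg> (p - 1))"
  using \<alpha>_dd[of "\<beta> p r" p] \<alpha>_DR_iff[OF Wdd_closed, of "\<beta> p r" p] Pf_dd_zero[of "\<beta> p r" p] Pf_\<beta>[of r p]
  by (simp add: DR_carrier)

lemma dd_DR_hom: "R.dd p \<in> mod_hom K (DR K n \<gg> p) (DR K n \<gg> (p - 1))"
proof (rule mod_homI)
  show "R.dd p r \<in> carrier (DR K n \<gg> (p - 1))" if "r \<in> carrier (DR K n \<gg> p)" for r by (rule dd_DR[OF that])
qed (simp_all add: DR_carrier mod_hom_add[OF R.dd_hom] mod_hom_smult[OF R.dd_hom])

text \<open>Inherited from the adjoint complex: \<open>\<alpha>\<close> is a chain map, and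
  \<open>\<beta>\<close> supplies preimages.\<close>

lemma dd_dd_R:
  assumes "r \<in> carrier (R.T (Suc (Suc p)))"
  shows "R.dd (Suc p) (R.dd (Suc (Suc p)) r) = \<zero>\<^bsub>R.T p\<^esub>"
proof -
  let ?w = "\<beta> (Suc (Suc p)) r"
  have w: "?w \<in> carrier (C.W.T (Suc (Suc p)))" using assms by simp
  have "R.dd (Suc p) (R.dd (Suc (Suc p)) r) = \<alpha> p (C.W.dd (Suc p) (C.W.dd (Suc (Suc p)) ?w))"
    using w assms by (simp add: al.tmap_dd)
  then show ?thesis using mod_hom_zero[OF C.W.T_module R.T_module al.tmap_hom] by (simp add: C.W.dd_dd[OF w])
qed

text \<open>A retraction onto \<open>DR\<close>, with \<open>\<beta>\<close> as a right inverse
  there. The argument is first moved into the kernel of \<open>Pf\<close>, since otherwise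
  \<open>\<alpha>\<close> need not land in \<open>DR\<close>. It extends maps defined on
  \<open>DR\<close> to all of \<open>C.W.T p\<close>.\<close>

definition \<alpha>Q where "\<alpha>Q p w = \<alpha> p (w \<ominus>\<^bsub>C.W.T p\<^esub> C.Pf p w)"

lemma Pf_minus_Pf: "w \<in> carrier (C.W.T p) \<Longrightarrow> C.Pf p (w \<ominus>\<^bsub>C.W.T p\<^esub> C.Pf p w) = \<zero>\<^bsub>C.W.T p\<^esub>"
  using mod_hom_minus[OF C.W.T_module C.W.T_module C.Pf_hom] by (simp add: C.Pf_idem C.W.T.minus_eq_zero_iff)

lemma \<alpha>Q_closed: "w \<in> carrier (C.W.T p) \<Longrightarrow> \<alpha>Q p w \<in> carrier (DR K n \<gg> p)"
  by (simp add: \<alpha>Q_def \<alpha>_DR_iff Pf_minus_Pf)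

lemma \<alpha>Q_hom: "\<alpha>Q p \<in> mod_hom K (C.W.T p) (DR K n \<gg> p)"
proof -
  have h: "\<alpha>Q p \<in> mod_hom K (C.W.T p) (R.T p)"
    unfolding \<alpha>Q_def[abs_def]
    by (rule mod_hom_comp[OF al.tmap_hom mod_hom_minusf[OF C.W.T_module mod_hom_id C.Pf_hom]])
  show ?thesis
    by (rule mod_homI) (simp_all add: \<alpha>Q_closed mod_hom_add[OF h] mod_hom_smult[OF h])
qed

lemma \<alpha>Q_P: "w \<in> carrier (C.W.T p) \<Longrightarrow> \<alpha>Q p (C.W.P p p w) = \<alpha>Q p w"
  using mod_hom_minus[OF C.W.T_module R.T_module al.tmap_hom] by (simp add: \<alpha>Q_def C.Pf_P \<alpha>_P)

lemma \<alpha>Q_Pf_zero: "w \<in> carrier (C.W.T p) \<Longrightarrow> C.Pf p w = \<zero>\<^bsub>C.W.T p\<^esub> \<Longrightarrow> \<alpha>Q p w = \<alpha> p w"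
  by (simp add: \<alpha>Q_def C.W.T.minus_zero_right)

lemma \<alpha>Q_\<beta>: "r \<in> carrier (DR K n \<gg> p) \<Longrightarrow> \<alpha>Q p (\<beta> p r) = r"
  by (simp add: \<alpha>Q_Pf_zero Pf_\<beta> DR_carrier)

lemma \<beta>_hom: "\<beta> p \<in> mod_hom K (DR K n \<gg> p) (C.W.T p)"
  by (rule mod_homI) (simp_all add: DR_carrier mod_hom_add[OF be.tmap_hom] mod_hom_smult[OF be.tmap_hom])

lemma P_dd_\<beta>:
  assumes "r \<in> carrier (R.T p)"
  shows "C.W.P (p - 1) (p - 1) (C.W.dd p (\<beta> p r)) = \<beta> (p - 1) (R.dd p r)"
  using \<beta>_\<alpha>[OF Wdd_closed, of "\<beta> p r" p] assms by (simp add: \<alpha>_dd)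

text \<open>The head splitting is that of the Loday complex of \<open>D\<close> with coefficients in
  \<open>\<gg>\<close>. The splitting of \<open>DR\<close> is carried to the tails by
  \<open>\<alpha>Q\<close> on the way in and \<open>\<beta>\<close> on the way out. Boundaries taken
  after \<open>\<beta>\<close> are controlled only up to \<open>W.P\<close>, which is why the
  identities in \<open>second_page\<close> are stated under that projection.\<close>

lemma second_page_exists:
  shows "\<exists>\<rho> \<tau> s s' \<kappa> \<tau>' t t'.
    second_page K D gc (\<lambda>X. \<sigma> (\<pi> X)) q p (nHL K n \<gg> q) (HD K n \<gg> p) \<rho> \<tau> s s' \<kappa> \<tau>' t t'"
proof -
  let ?C = "nHL K n \<gg> q" and ?N = "HD K n \<gg> p"
  have Ceq: "?C = homology C.T (loday_boundary K D gc) q"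
    by (simp add: nHL_def HL_def)
  obtain \<rho> \<tau> s s' where head: "module K ?C" "\<rho> \<in> mod_hom K (C.T q) ?C" "\<tau> \<in> mod_hom K ?C (C.T q)"
    "s \<in> mod_hom K (C.T q) (C.T (Suc q))" "s' \<in> mod_hom K (C.T (q - 1)) (C.T q)"
    "\<And>x. x \<in> carrier (C.T q) \<Longrightarrow> x = \<tau> (\<rho> x) \<oplus>\<^bsub>C.T q\<^esub> C.dd (Suc q) (s x) \<oplus>\<^bsub>C.T q\<^esub> s' (C.dd q x)"
    "\<And>x. x \<in> carrier (C.T (Suc q)) \<Longrightarrow> \<rho> (C.dd (Suc q) x) = \<zero>\<^bsub>?C\<^esub>"
    "\<And>a. a \<in> carrier ?C \<Longrightarrow> \<rho> (\<tau> a) = a" "\<And>a. a \<in> carrier ?C \<Longrightarrow> C.dd q (\<tau> a) = \<zero>\<^bsub>C.T (q - 1)\<^esub>"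
    unfolding Ceq
    by (rule homology_splitting[where M = C.T and d = C.dd and d' = "loday_boundary K D gc" and q = q,
          OF K.field_axioms C.T_module C.dd_hom _ C.dd_dd C.loday_boundary_eq]) (simp_all add: C.dd.simps(1))
  let ?dr = "DR K n \<gg>"
  have Neq: "?N = homology ?dr (loday_boundary K L Dc) p" by (simp add: HD_def)
  have R0: "R.dd 0 r = \<zero>\<^bsub>?dr 0\<^esub>" for r by (simp add: R.dd.simps(1))
  have R2: "R.dd (Suc k) (R.dd (Suc (Suc k)) r) = \<zero>\<^bsub>?dr k\<^esub>" if "r \<in> carrier (?dr (Suc (Suc k)))" for k r
    using dd_dd_R[OF DR_carrier[OF that]] by simp
  have Rl: "loday_boundary K L Dc (Suc k) r = R.dd (Suc k) r" if "r \<in> carrier (?dr (Suc k))" for k r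
    by (rule R.loday_boundary_eq[OF DR_carrier[OF that]])
  obtain \<kappa>0 \<tau>0 t0 t0' where tail: "module K ?N" "\<kappa>0 \<in> mod_hom K (?dr p) ?N" "\<tau>0 \<in> mod_hom K ?N (?dr p)"
    "t0 \<in> mod_hom K (?dr p) (?dr (Suc p))" "t0' \<in> mod_hom K (?dr (p - 1)) (?dr p)"
    "\<And>x. x \<in> carrier (?dr p) \<Longrightarrow> x = \<tau>0 (\<kappa>0 x) \<oplus>\<^bsub>?dr p\<^esub> R.dd (Suc p) (t0 x) \<oplus>\<^bsub>?dr p\<^esub> t0' (R.dd p x)"
    "\<And>x. x \<in> carrier (?dr (Suc p)) \<Longrightarrow> \<kappa>0 (R.dd (Suc p) x) = \<zero>\<^bsub>?N\<^esub>"
    "\<And>a. a \<in> carrier ?N \<Longrightarrow> \<kappa>0 (\<tau>0 a) = a" "\<And>a. a \<in> carrier ?N \<Longrightarrow> R.dd p (\<tau>0 a) = \<zero>\<^bsub>?dr (p - 1)\<^esub>"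
    unfolding Neq
    by (rule homology_splitting[where M = ?dr and d = R.dd and d' = "loday_boundary K L Dc" and q = p,
          OF K.field_axioms DR_module dd_DR_hom R0 R2 Rl]) simp_all
  note c = mod_hom_closed[OF tail(2)] mod_hom_closed[OF tail(3)] mod_hom_closed[OF tail(4)] mod_hom_closed[OF tail(5)]
  let ?\<kappa> = "\<lambda>w. \<kappa>0 (\<alpha>Q p w)" and ?\<tau> = "\<lambda>b. \<beta> p (\<tau>0 b)"
  let ?t = "\<lambda>w. \<beta> (Suc p) (t0 (\<alpha>Q p w))" and ?t' = "\<lambda>v. \<beta> p (t0' (\<alpha>Q (p - 1) v))"
  have "second_page K D gc (\<lambda>X. \<sigma> (\<pi> X)) q p ?C ?N \<rho> \<tau> s s' ?\<kappa> ?\<tau> ?t ?t'"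
  proof (intro second_page.intro second_page_axioms.intro C.adjoint_complex_axioms head tail(1))
    show "?\<kappa> \<in> mod_hom K (C.W.T p) ?N" by (rule mod_hom_comp[OF tail(2) \<alpha>Q_hom])
    show "?\<tau> \<in> mod_hom K ?N (C.W.T p)" by (rule mod_hom_comp[OF \<beta>_hom tail(3)])
    show "?t \<in> mod_hom K (C.W.T p) (C.W.T (Suc p))" by (rule mod_hom_comp[OF \<beta>_hom mod_hom_comp[OF tail(4) \<alpha>Q_hom]])
    show "?t' \<in> mod_hom K (C.W.T (p - 1)) (C.W.T p)" by (rule mod_hom_comp[OF \<beta>_hom mod_hom_comp[OF tail(5) \<alpha>Q_hom]])
    show "?\<kappa> (C.W.P p p w) = ?\<kappa> w" if "w \<in> carrier (C.W.T p)" for w using that by (simp add: \<alpha>Q_P)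
    show "?t' (C.W.P (p - 1) (p - 1) v) = ?t' v" if "v \<in> carrier (C.W.T (p - 1))" for v using that by (simp add: \<alpha>Q_P)
    show "?\<kappa> (?\<tau> b) = b" if "b \<in> carrier ?N" for b using that by (simp add: \<alpha>Q_\<beta> c tail(8))
    show "C.Pf p (?\<tau> b) = \<zero>\<^bsub>C.W.T p\<^esub>" if "b \<in> carrier ?N" for b by (rule Pf_\<beta>[OF c(2)[OF that]])
    show "C.Pf (Suc p) (?t w) = \<zero>\<^bsub>C.W.T (Suc p)\<^esub>" if "w \<in> carrier (C.W.T p)" for w
      by (rule Pf_\<beta>[OF c(3)[OF \<alpha>Q_closed[OF that]]])
    show "C.W.P (p - 1) (p - 1) (C.W.dd p (?\<tau> b)) = \<zero>\<^bsub>C.W.T (p - 1)\<^esub>" if "b \<in> carrier ?N" for b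
      using P_dd_\<beta>[OF DR_carrier[OF c(2)[OF that]]] tail(9)[OF that] mod_hom_zero[OF R.T_module C.W.T_module be.tmap_hom] by simp
  next
    fix u assume u: "u \<in> carrier (C.W.T (Suc p))" "C.Pf (Suc p) u = \<zero>\<^bsub>C.W.T (Suc p)\<^esub>"
    have "\<alpha>Q p (C.W.dd (Suc p) u) = R.dd (Suc p) (\<alpha> (Suc p) u)"
      using u \<alpha>_dd[of u "Suc p"] by (simp add: \<alpha>Q_Pf_zero C.Pf_dd_zero)
    then show "?\<kappa> (C.W.dd (Suc p) u) = \<zero>\<^bsub>?N\<^esub>" using u by (simp add: tail(7) \<alpha>_DR_iff)
  next
    fix w assume w: "w \<in> carrier (C.W.T p)"
    let ?Qw = "w \<ominus>\<^bsub>C.W.T p\<^esub> C.Pf p w" and ?r = "\<alpha>Q p w"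
    have Qw: "?Qw \<in> carrier (C.W.T p)" using w by simp
    have r: "?r \<in> carrier (?dr p)" by (rule \<alpha>Q_closed[OF w])
    have cs: "\<tau>0 (\<kappa>0 ?r) \<in> carrier (?dr p)" "R.dd (Suc p) (t0 ?r) \<in> carrier (?dr p)" "t0' (R.dd p ?r) \<in> carrier (?dr p)"
      using r c dd_DR[OF c(3)[OF r]] dd_DR[OF r] by simp_all
    have "C.W.P p p ?Qw = \<beta> p ?r" using \<beta>_\<alpha>[OF Qw] by (simp add: \<alpha>Q_def)
    also have "\<dots> = \<beta> p (\<tau>0 (\<kappa>0 ?r) \<oplus>\<^bsub>R.T p\<^esub> R.dd (Suc p) (t0 ?r) \<oplus>\<^bsub>R.T p\<^esub> t0' (R.dd p ?r))"
      using arg_cong[OF tail(6)[OF r], of "\<beta> p"] by simp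
    also have "\<dots> = \<beta> p (\<tau>0 (\<kappa>0 ?r)) \<oplus>\<^bsub>C.W.T p\<^esub> \<beta> p (R.dd (Suc p) (t0 ?r)) \<oplus>\<^bsub>C.W.T p\<^esub> \<beta> p (t0' (R.dd p ?r))"
      using cs[THEN DR_carrier] by (simp add: mod_hom_add[OF be.tmap_hom])
    also have "\<beta> p (\<tau>0 (\<kappa>0 ?r)) = C.W.P p p (?\<tau> (?\<kappa> w))"
      using P_\<beta>[OF DR_carrier[OF cs(1)]] by simp
    also have "\<beta> p (R.dd (Suc p) (t0 ?r)) = C.W.P p p (C.W.dd (Suc p) (?t w))"
      using P_dd_\<beta>[OF DR_carrier[OF c(3)[OF r]]] by simp
    also have "R.dd p ?r = \<alpha>Q (p - 1) (C.W.dd p ?Qw)"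
      using \<alpha>_dd[OF Qw] \<alpha>Q_Pf_zero[OF Wdd_closed[OF Qw] Pf_dd_zero[OF Qw Pf_minus_Pf[OF w]]] by (simp add: \<alpha>Q_def)
    also have "\<beta> p (t0' (\<alpha>Q (p - 1) (C.W.dd p ?Qw))) = C.W.P p p (?t' (C.W.dd p ?Qw))"
      using P_\<beta>[OF DR_carrier[OF c(4)[OF \<alpha>Q_closed[OF Wdd_closed[OF Qw]]]]] by simp
    finally show "C.W.P p p ?Qw = C.W.P p p (?\<tau> (?\<kappa> w)) \<oplus>\<^bsub>C.W.T p\<^esub> C.W.P p p (C.W.dd (Suc p) (?t w))
      \<oplus>\<^bsub>C.W.T p\<^esub> C.W.P p p (?t' (C.W.dd p ?Qw))" .
  qed
  then show ?thesis by blast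
qed

section \<open>The filtered relative complex\<close>

definition G where "G k j = {x \<in> carrier (C.T k). C.P k j x = \<zero>\<^bsub>C.T k\<^esub>}"

lemma G_submodule: "submodule (G k j) K (C.T k)"
  unfolding G_def by (rule kernel_submodule[OF C.T_module C.T_module C.P_hom])

lemma G_0: "G k 0 = {\<zero>\<^bsub>C.T k\<^esub>}"
  by (auto simp: G_def)

lemma G_mono: "i \<le> j \<Longrightarrow> G k i \<subseteq> G k j"
  unfolding G_def using C.P_mono by blast

text \<open>If all factors are projected, one of them is deleted, and the minimum records the loss
  (\<open>P_dd_full\<close>). For j = 0 the chain is zero. Otherwise some factor is unprojected, and
  the number of projected ones is kept (\<open>P_dd_mono\<close>).\<close>

lemma dd_G:
  assumes x: "x \<in> G (Suc k) j" and j: "j \<le> Suc k"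
  shows "C.dd (Suc k) x \<in> G k (min j k)"
proof -
  have c: "x \<in> carrier (C.T (Suc k))" "C.P (Suc k) j x = \<zero>\<^bsub>C.T (Suc k)\<^esub>" using x by (auto simp: G_def)
  consider "j = Suc k" | "j = 0" | i a where "j = Suc i" "k = a + Suc i"
    using j by (metis le_SucE less_eqE add.commute not0_implies_Suc)
  then have "C.P k (min j k) (C.dd (Suc k) x) = \<zero>\<^bsub>C.T k\<^esub>"
  proof cases
    case 1
    then show ?thesis using C.P_dd_full[of x k] c mod_hom_zero[OF C.T_module C.T_module C.dd_hom_Suc] by (simp add: C.P_zero)
  next
    case 2
    then show ?thesis using x mod_hom_zero[OF C.T_module C.T_module C.dd_hom_Suc] by (simp add: G_0)
  next
    case 3
    then show ?thesis using C.P_dd_mono[of x a i] c by simp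
  qed
  then show ?thesis using c by (simp add: G_def)
qed

text \<open>Degree \<open>m\<close> sits in \<open>C.T (Suc (nat m))\<close>, which has m + 1
  factors, and filtration degree \<open>p\<close> projects the last p + 1 of them. The minimum caps
  this at the number of factors, and \<open>nat\<close> turns negative \<open>p\<close> into 0
  projections, whose kernel is zero. Negative degrees are represented by the zero space of
  \<open>C.T 1\<close>, because \<open>nat m\<close> is 0 there.\<close>

definition Fi :: "int \<Rightarrow> int \<Rightarrow> _"
  where "Fi p m = (if m < 0 then {\<zero>\<^bsub>C.T 1\<^esub>} else G (Suc (nat m)) (nat (min p m + 1)))"

definition V :: "int \<Rightarrow> _"
  where "V m = (C.T (Suc (nat m)))\<lparr>carrier := Fi m m\<rparr>"

text \<open>Degree 0 of the relative complex lies in \<open>C.T 1\<close>; its boundary would land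
  in \<open>C.T 0\<close>, outside the complex, and is set to zero.\<close>

definition d :: "int \<Rightarrow> _"
  where "d m = (if m \<le> 0 then (\<lambda>x. \<zero>\<^bsub>C.T 1\<^esub>) else C.dd (Suc (nat m)))"

lemma V_simps [simp]:
  "carrier (V m) = Fi m m" "add (V m) = add (C.T (Suc (nat m)))" "zero (V m) = zero (C.T (Suc (nat m)))"
  "smult (V m) = smult (C.T (Suc (nat m)))"
  by (simp_all add: V_def)

lemma Fi_neg: "m < 0 \<Longrightarrow> Fi p m = {\<zero>\<^bsub>C.T 1\<^esub>}"
  by (simp add: Fi_def)

lemma Fi_nat: "j \<le> Suc k \<Longrightarrow> Fi (int j - 1) (int k) = G (Suc k) j"
  by (simp add: Fi_def)

lemma Fi_submodule_T: "submodule (Fi p m) K (C.T (Suc (nat m)))"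
  using zero_submodule[OF C.T_module] by (simp add: Fi_def G_submodule One_nat_def)

lemma Fi_mono: "p \<le> p' \<Longrightarrow> Fi p m \<subseteq> Fi p' m"
  using G_mono[of "nat (min p m + 1)" "nat (min p' m + 1)" "Suc (nat m)"] by (simp add: Fi_def nat_mono)

lemma Fi_top: "Fi p m \<subseteq> Fi m m"
  using G_mono[of "nat (min p m + 1)" "nat (m + 1)" "Suc (nat m)"] by (simp add: Fi_def nat_mono)

lemma Fi_carrier: "x \<in> Fi p m \<Longrightarrow> x \<in> carrier (C.T (Suc (nat m)))"
  using C.T.submoduleE(1)[OF Fi_submodule_T] by blast

lemma d_Fi:
  assumes "x \<in> Fi p m"
  shows "d m x \<in> Fi p (m - 1)"
proof (cases "m \<le> 0")
  case False
  then obtain k where m: "m = int (Suc k)" by (metis gr0_implies_Suc linorder_not_le pos_int_cases)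
  have nm: "nat m = Suc k" "nat (m - 1) = k" "\<not> m < 0" "\<not> m - 1 < 0" "\<not> m \<le> 0" using m by simp_all
  let ?j = "nat (min p m + 1)"
  have "?j \<le> Suc (Suc k)" using m by simp
  then have "C.dd (Suc (Suc k)) x \<in> G (Suc k) (min ?j (Suc k))" using assms nm by (intro dd_G) (simp_all add: Fi_def)
  moreover have "min ?j (Suc k) = nat (min p (m - 1) + 1)" unfolding m by simp
  ultimately show ?thesis using nm by (simp add: d_def Fi_def)
qed (simp add: d_def Fi_def)

lemma d_nat: "d (int (Suc k)) = C.dd (Suc (Suc k))"
  by (simp add: d_def nat_add_distrib)

lemma d_hom_T: "d m \<in> mod_hom K (C.T (Suc (nat m))) (C.T (Suc (nat (m - 1))))"
proof (cases "m \<le> 0")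
  case False
  then obtain k where m: "m = int (Suc k)" by (metis gr0_implies_Suc linorder_not_le pos_int_cases)
  show ?thesis using C.dd_hom_Suc[of "Suc k"] unfolding d_nat m by (simp add: nat_add_distrib)
qed (use mod_hom_zerof[OF C.T_module] in \<open>simp add: d_def One_nat_def\<close>)

end

sublocale filippov \<subseteq> rel: filtered_complex K V d Fi
proof (rule filtered_complex.intro)
  show V: "module K (V m)" for m
    unfolding V_def by (rule submodule.submodule_is_module[OF Fi_submodule_T C.T_module])
  show "d m \<in> mod_hom K (V m) (V (m - 1))" for m
    unfolding V_def
    by (rule mod_hom_restrict[OF d_hom_T]) (use C.T.submoduleE(1)[OF Fi_submodule_T] d_Fi Fi_top in blast)+
  show "submodule (Fi p m) K (V m)" for p m
    unfolding V_def by (rule submodule_restrict[OF C.T_module Fi_submodule_T Fi_submodule_T Fi_top])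
  show "Fi (p - 1) m \<subseteq> Fi p m" for p m by (rule Fi_mono) simp
  show "p < 0 \<Longrightarrow> Fi p m = {\<zero>\<^bsub>V m\<^esub>}" for p m by (simp add: Fi_def G_0 One_nat_def)
  show "m \<le> p \<Longrightarrow> Fi p m = carrier (V m)" for p m by (simp add: Fi_def)
  show "x \<in> Fi p m \<Longrightarrow> d m x \<in> Fi p (m - 1)" for x p m by (rule d_Fi)
  fix m x assume x: "x \<in> carrier (V m)"
  show "d (m - 1) (d m x) = \<zero>\<^bsub>V (m - 2)\<^esub>"
  proof (cases "m \<le> 1")
    case False
    then obtain k where m: "m = int (Suc (Suc k))"
      by (metis One_nat_def int_eq_iff linorder_not_le nat_le_eq_zle nat_one_as_int not_less_eq_eq order_less_imp_le zero_le_one Suc_le_D zle_iff_zadd int_one_le_iff_zero_less)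
    have e: "m - 1 = int (Suc k)" "nat (m - 2) = k" "nat m = Suc (Suc k)" using m by simp_all
    have "x \<in> carrier (C.T (Suc (Suc (Suc k))))" using Fi_carrier[of x m m] x e by simp
    moreover have "d m = C.dd (Suc (Suc (Suc k)))" "d (m - 1) = C.dd (Suc (Suc k))" unfolding e(1) unfolding m by (rule d_nat)+
    ultimately show ?thesis using C.dd_dd e(2) by simp
  qed (simp add: d_def One_nat_def)
qed

section \<open>Identification of the second page and of the limit\<close>

context filippov
begin

lemma Z_nat:
  "rel.Z 2 (int p) (int (q + p)) = {x \<in> carrier (C.T (Suc (q + p))). C.P (Suc (q + p)) (Suc p) x = \<zero>\<^bsub>C.T (Suc (q + p))\<^esub> \<and>
     C.P (q + p) (p - 1) (C.dd (Suc (q + p)) x) = \<zero>\<^bsub>C.T (q + p)\<^esub>}" (is "?L = ?R")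
proof -
  have F: "Fi (int p) (int (q + p)) = G (Suc (q + p)) (Suc p)" using Fi_nat[of "Suc p" "q + p"] by simp
  show ?thesis
  proof (cases "q + p")
    case 0
    \<comment> \<open>In total degree 0 the complex has zero boundary by definition, while the
      right-hand side mentions the Loday boundary; that one vanishes on the kernel as well.\<close>
    have "C.P 0 0 (C.dd (Suc 0) x) = \<zero>\<^bsub>C.T 0\<^esub>" if "x \<in> G (Suc 0) (Suc 0)" for x
      using dd_G[OF that] by (simp add: G_def)
    then show ?thesis using 0 F by (auto simp: rel.Z_def d_def Fi_neg G_def)
  next
    case (Suc k)
    \<comment> \<open>For p = 0 the integer index is negative and the truncated p - 1 is 0; both
      describe the zero space.\<close>
    have "Fi (int p - int 2) (int (q + p) - 1) = G (Suc k) (p - 1)"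
      using Suc by (auto simp: Fi_def intro!: arg_cong[of _ _ "G (Suc k)"])
    then show ?thesis using F Suc unfolding rel.Z_def by (auto simp: d_nat[unfolded of_nat_Suc] G_def)
  qed
qed

text \<open>\<open>\<Theta>\<close> and the class map of the page are two surjections out of the
  cycles of the second page, so it remains to compare their kernels:
  \<open>\<Theta>_filtration\<close> and \<open>\<Theta>_boundary\<close> give one inclusion,
  \<open>\<Theta>_kernel\<close> the other.\<close>

lemma rel_E_iso: "mod_isomorphic K (rel.E 2 (int p) (int q)) (tensor K (nHL K n \<gg> q) (HD K n \<gg> p))"
proof -
  obtain \<rho> \<tau> s s' \<kappa> \<tau>' t t' where
    "second_page K D gc (\<lambda>X. \<sigma> (\<pi> X)) q p (nHL K n \<gg> q) (HD K n \<gg> p) \<rho> \<tau> s s' \<kappa> \<tau>' t t'"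
    using second_page_exists by blast
  then interpret S: second_page K D gc "\<lambda>X. \<sigma> (\<pi> X)" q p "nHL K n \<gg> q" "HD K n \<gg> p" \<rho> \<tau> s s' \<kappa> \<tau>' t t' .
  let ?k = "q + p"
  let ?m = "int ?k"
  let ?Z = "rel.Z 2 (int p) ?m"
  let ?M = "(V ?m)\<lparr>carrier := ?Z\<rparr>"
  let ?CN = "tensor K (nHL K n \<gg> q) (HD K n \<gg> p)"
  have nm: "nat ?m = ?k" "nat (?m + 1) = Suc ?k" by simp_all
  have d1: "d (?m + 1) = C.dd (Suc (Suc ?k))" using d_nat[of ?k] by (simp add: ac_simps)
  have F: "Fi (int p) ?m = G (Suc ?k) (Suc p)" "Fi (int p - 1) ?m = G (Suc ?k) p" "Fi (int p + 1) (?m + 1) = G (Suc (Suc ?k)) (Suc (Suc p))"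
    using Fi_nat[of "Suc p" ?k] Fi_nat[of p ?k] Fi_nat[of "Suc (Suc p)" "Suc ?k"] by (simp_all add: ac_simps)
  have E: "rel.E 2 (int p) (int q) = rel.page 1 (int p) ?m" by (simp add: rel.E_def ac_simps One_nat_def)
  have Zs: "?Z \<subseteq> carrier (C.T (Suc ?k))" unfolding Z_nat by blast
  have \<Theta>: "S.\<Theta> \<in> mod_hom K ?M ?CN"
    using mod_hom_restrict_dom[OF S.\<Theta>_hom Zs] nm unfolding mod_hom_def by (simp del: of_nat_add)
  have \<Theta>Z: "S.\<Theta> ` carrier ?M = carrier ?CN"
  proof
    show "S.\<Theta> ` carrier ?M \<subseteq> carrier ?CN" using mod_hom_closed[OF \<Theta>] by blast
    show "carrier ?CN \<subseteq> S.\<Theta> ` carrier ?M"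
    proof
      fix \<xi> assume "\<xi> \<in> carrier ?CN"
      from S.\<Theta>_surj[OF this] obtain x where "x \<in> carrier (C.T (Suc ?k))" "C.P (Suc ?k) (Suc p) x = \<zero>\<^bsub>C.T (Suc ?k)\<^esub>"
        "C.P ?k (p - 1) (C.dd (Suc ?k) x) = \<zero>\<^bsub>C.T ?k\<^esub>" "S.\<Theta> x = \<xi>" by blast
      then show "\<xi> \<in> S.\<Theta> ` carrier ?M" unfolding Z_nat by auto
    qed
  qed
  have ker: "x \<in> rel.B 1 (int p) ?m \<longleftrightarrow> S.\<Theta> x = \<zero>\<^bsub>?CN\<^esub>" if x: "x \<in> ?Z" for x
  proof
    assume "x \<in> rel.B 1 (int p) ?m"
    then obtain w v where w: "w \<in> rel.Z 1 (int p - 1) ?m" and v: "v \<in> rel.Z 1 (int p + int 1) (?m + 1)"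
      and xe: "x = w \<oplus>\<^bsub>V ?m\<^esub> d (?m + 1) v" unfolding rel.mem_B by blast
    have w': "w \<in> G (Suc ?k) p" using w F by (simp add: rel.Z_def)
    have v': "v \<in> G (Suc (Suc ?k)) (Suc (Suc p))" "C.dd (Suc (Suc ?k)) v \<in> G (Suc ?k) (Suc p)"
      using v F by (simp_all add: rel.Z_def d1 del: of_nat_add)
    interpret CN: module K ?CN by (rule S.CN_module)
    have "S.\<Theta> w = \<zero>\<^bsub>?CN\<^esub>" using S.\<Theta>_filtration[of w] w' by (simp add: G_def)
    moreover have "S.\<Theta> (C.dd (Suc (Suc ?k)) v) = \<zero>\<^bsub>?CN\<^esub>" using S.\<Theta>_boundary[of v] v' by (simp add: G_def)
    moreover have "x = w \<oplus>\<^bsub>C.T (Suc ?k)\<^esub> C.dd (Suc (Suc ?k)) v" using xe nm d1 by (simp del: of_nat_add)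
    ultimately show "S.\<Theta> x = \<zero>\<^bsub>?CN\<^esub>" using w' v' by (simp add: G_def mod_hom_add[OF S.\<Theta>_hom])
  next
    \<comment> \<open>The chain \<open>y\<close> from \<open>\<Theta>_kernel\<close> splits
      \<open>x\<close> into d y and a difference of lower filtration. The difference has the same
      boundary as \<open>x\<close>, which is exactly the condition on the first summand of the
      relations.\<close>
    assume z: "S.\<Theta> x = \<zero>\<^bsub>?CN\<^esub>"
    have xR: "x \<in> carrier (C.T (Suc ?k))" "C.P (Suc ?k) (Suc p) x = \<zero>\<^bsub>C.T (Suc ?k)\<^esub>"
      "C.P ?k (p - 1) (C.dd (Suc ?k) x) = \<zero>\<^bsub>C.T ?k\<^esub>" using x unfolding Z_nat by auto
    from S.\<Theta>_kernel[OF xR z] obtain y where y: "y \<in> carrier (C.T (Suc (Suc ?k)))" "C.P (Suc (Suc ?k)) (Suc (Suc p)) y = \<zero>\<^bsub>C.T (Suc (Suc ?k))\<^esub>"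
      "C.P (Suc ?k) p (x \<ominus>\<^bsub>C.T (Suc ?k)\<^esub> C.dd (Suc (Suc ?k)) y) = \<zero>\<^bsub>C.T (Suc ?k)\<^esub>" by blast
    let ?y = "C.dd (Suc (Suc ?k)) y"
    let ?w = "x \<ominus>\<^bsub>C.T (Suc ?k)\<^esub> ?y"
    have yc: "?y \<in> carrier (C.T (Suc ?k))" using y(1) by simp
    have wG: "?w \<in> G (Suc ?k) p" using y(3) xR(1) yc by (simp add: G_def)
    have "?w \<in> G (Suc ?k) (Suc p)" using wG G_mono[of p "Suc p" "Suc ?k"] by auto
    then have "C.P (Suc ?k) (Suc p) ?y = \<zero>\<^bsub>C.T (Suc ?k)\<^esub>"
      using xR yc C.T.minus_eq_zero_iff C.P_minus[OF xR(1) yc, of "Suc p"] by (simp add: G_def)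
    then have yZ: "y \<in> rel.Z 1 (int p + int 1) (?m + 1)"
      using y yc F by (simp add: rel.Z_def d1 G_def del: of_nat_add)
    have dV: "d (?m + 1) y = ?y" by (rule fun_cong[OF d1])
    have yV: "y \<in> carrier (V (?m + 1))" by (rule rel.Z_carrier[OF yZ])
    have "x \<in> carrier (V ?m)" by (rule rel.Z_carrier[OF x])
    moreover have yV': "?y \<in> carrier (V ?m)" using mod_hom_closed[OF rel.d_hom yV] unfolding dV by simp
    ultimately have "d ?m (x \<ominus>\<^bsub>V ?m\<^esub> ?y) = d ?m x \<ominus>\<^bsub>V (?m - 1)\<^esub> d ?m ?y"
      by (rule mod_hom_minus[OF rel.V_module rel.V_module rel.d_hom])
    also have "d ?m ?y = \<zero>\<^bsub>V (?m - 1)\<^esub>" using rel.d_d[OF yV] unfolding dV by simp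
    also have "d ?m x \<ominus>\<^bsub>V (?m - 1)\<^esub> \<zero>\<^bsub>V (?m - 1)\<^esub> = d ?m x"
      by (rule rel.V.minus_zero_right[OF mod_hom_closed[OF rel.d_hom \<open>x \<in> carrier (V ?m)\<close>]])
    finally have dw: "d ?m (x \<ominus>\<^bsub>V ?m\<^esub> ?y) = d ?m x" .
    \<comment> \<open>Negatives are defined relative to a carrier, so differences in the subspace
      and in the ambient space are different terms; both are determined by adding \<open>?y\<close>
      back.\<close>
    have "x \<ominus>\<^bsub>V ?m\<^esub> ?y = ?w"
    proof -
      have "(x \<ominus>\<^bsub>V ?m\<^esub> ?y) \<oplus>\<^bsub>C.T (Suc ?k)\<^esub> ?y = x"
        using rel.V.minus_minus_add(2)[OF \<open>x \<in> carrier (V ?m)\<close> yV'] nm by (simp del: of_nat_add)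
      moreover have "x \<ominus>\<^bsub>V ?m\<^esub> ?y \<in> Fi ?m ?m"
        using rel.V.minus_closed[OF \<open>x \<in> carrier (V ?m)\<close> yV'] unfolding V_simps .
      then have "x \<ominus>\<^bsub>V ?m\<^esub> ?y \<in> carrier (C.T (Suc ?k))" by (rule Fi_carrier[of _ ?m ?m, unfolded nm])
      from C.T.minus_minus_add(3)[OF this yc] show ?thesis unfolding calculation by (rule sym)
    qed
    then have "?w \<in> rel.Z 1 (int p - 1) ?m"
      using wG F dw x by (simp add: rel.Z_def)
    moreover have "x = ?w \<oplus>\<^bsub>V ?m\<^esub> d (?m + 1) y" using C.T.minus_minus_add(2)[OF yc xR(1)] C.T.minus_minus_add(2)[OF xR(1) yc] nm unfolding dV by (simp del: of_nat_add)
    ultimately show "x \<in> rel.B 1 (int p) ?m" unfolding rel.mem_B using yZ by blast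
  qed
  show ?thesis
    unfolding E
  proof (rule mod_isomorphicI_surj[OF rel.Z_module rel.page_module S.CN_module])
    show "rel.cls 1 (int p) ?m \<in> mod_hom K ?M (rel.page 1 (int p) ?m)"
      using rel.cls_hom[where s = 1 and p = "int p" and m = ?m] by (simp add: numeral_2_eq_2 One_nat_def)
    show "rel.cls 1 (int p) ?m ` carrier ?M = carrier (rel.page 1 (int p) ?m)"
      using rel.cls_image[where s = 1 and p = "int p" and m = ?m] by (simp add: numeral_2_eq_2 One_nat_def)
    show "S.\<Theta> \<in> mod_hom K ?M ?CN" by (rule \<Theta>)
    show "S.\<Theta> ` carrier ?M = carrier ?CN" by (rule \<Theta>Z)
    fix x assume "x \<in> carrier ?M"
    then have x: "x \<in> ?Z" by simp
    show "rel.cls 1 (int p) ?m x = \<zero>\<^bsub>rel.page 1 (int p) ?m\<^esub> \<longleftrightarrow> S.\<Theta> x = \<zero>\<^bsub>?CN\<^esub>"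
      unfolding rel.page_zero rel.cls_zero_iff[OF rel.Z_carrier[OF x]] by (rule ker[OF x])
  qed
qed

lemma C_rel_eq: "C_rel K n \<gg> k = V (int k)"
proof -
  have "{c \<in> carrier (C.T (Suc k)). proj_gD K n \<gg> (Suc k) c = \<zero>\<^bsub>mixed_tensor K \<gg> L (Suc k)\<^esub>} = Fi (int k) (int k)"
    using Fi_nat[of "Suc k" k] by (simp add: G_def proj_gD_zero_iff cong: conj_cong)
  then show ?thesis by (simp add: C_rel_def Let_def V_def One_nat_def)
qed

text \<open>Both complexes have the same chains, and their boundaries agree on these in positive
  degrees; in degree 0 every chain is a cycle on either side.\<close>

lemma H_rel_eq: "H_rel K n \<gg> m = rel.hom_V (int m)"
proof -
  let ?b = "\<lambda>k. loday_boundary K D gc (k + 1)"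
  have b: "?b (Suc k) x = d (int (Suc k)) x" if "x \<in> carrier (V (int (Suc k)))" for k x
  proof -
    have "x \<in> carrier (C.T (Suc (Suc k)))" using Fi_carrier[of x "int (Suc k)" "int (Suc k)"] that by (simp add: nat_add_distrib)
    then show ?thesis unfolding d_nat using C.loday_boundary_eq[of x "Suc (Suc k)"] by (simp add: One_nat_def)
  qed
  have "cycles (\<lambda>k. V (int k)) ?b m = rel.zyc (int m)"
  proof (cases m)
    case 0
    then show ?thesis by (auto simp: cycles_def rel.zyc_def d_def One_nat_def)
  next
    case (Suc k)
    then show ?thesis using b[of _ k] by (auto simp: cycles_def rel.zyc_def)
  qed
  moreover have "?b (Suc m) ` carrier (V (int (Suc m))) = d (int m + 1) ` carrier (V (int m + 1))"
    using b[of _ m] by (intro image_cong) (simp_all add: ac_simps)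
  ultimately show ?thesis by (simp add: H_rel_def homology_def rel.hom_V_def C_rel_eq[abs_def])
qed

lemma rel_converges: "ss_converges K rel.E (H_rel K n \<gg>)"
  unfolding ss_converges_def H_rel_eq
  by (rule exI[of _ "\<lambda>m. rel.FH (int m)"]) (use rel.convergence in auto)

end

theorem theorem3p4:
  fixes K :: "('k, 'r) ring_scheme"
    and \<gg> :: "('k, 'g, 'x) nalg_scheme"
    and n :: nat
  assumes "field K"
    and "\<one>\<^bsub>K\<^esub> \<oplus>\<^bsub>K\<^esub> \<one>\<^bsub>K\<^esub> \<noteq> \<zero>\<^bsub>K\<^esub>"
    and "n > 2"
    and "filippov_algebra K \<gg> n"
    and "dim_at_least K \<gg> n"
  shows "\<exists>(E :: nat \<Rightarrow> int \<Rightarrow> int \<Rightarrow> ('k, ('g \<times> ('g list \<Rightarrow> 'k) set list \<Rightarrow> 'k) set set) module) d.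
           spectral_sequence K E d \<and>
           ss_converges K E (H_rel K n \<gg>) \<and>
           (\<forall>r s. mod_isomorphic K (E 2 (int r) (int s)) (tensor K (nHL K n \<gg> s) (HD K n \<gg> r)))"
proof -
  interpret filippov K \<gg> n
    by (intro filippov.intro filippov_axioms.intro assms)
  show ?thesis
    using rel.is_spectral_sequence rel_converges rel_E_iso by blast
qed

end
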